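(* Fix a finite set $AP$ of atomic propositions and an operator precedence matrix $M$ on $2^{AP}$. POTL is equivalent to first-order logic with one free variable on finite OP words: (i) for every POTL formula $\varphi$ over $AP$ there is a first-order formula $\nu_\varphi(x)$ with exactly one free variable such that for every OP word $w$ (with matrix $M$) and every position $i$ of $w$, $(w,i)\models\varphi$ iff $w\models\nu_\varphi(i)$; and (ii) for every first-order formula $\psi(x)$ with exactly one free variable there is a POTL formula $\varphi$ over $AP$ such that for every OP word $w$ and position $i$, $w\models\psi(i)$ iff $(w,i)\models\varphi$.
   Context: Let $AP$ be partitioned into normal propositions and structural labels, and let $\#\notin AP$ be an end marker; $\Sigma=2^{AP}$. An operator precedence matrix (OPM) $M$ on $\Sigma$ is a partial function $M:(\Sigma\cup\{\#\})^2\to\{\lessdot,\doteq,\gtrdot\}$ (yields precedence, equal in precedence, takes precedence), defined only on sets containing exactly one structural label, with $M(a,b)$ depending only on the structural labels in $a$ and $b$. Write $a\,\pi\,b$ for $M(a,b)=\pi$; by convention $\#\lessdot b$ for every $b$ and $a\gtrdot\#$ for every $a\in\Sigma$. A simple chain is a string $c_0c_1\dots c_\ell c_{\ell+1}$ with $\ell\ge1$, $c_0,c_{\ell+1}\in\Sigma\cup\{\#\}$, $c_1,\dots,c_\ell\in\Sigma$ and $c_0\lessdot c_1\doteq c_2\doteq\dots\doteq c_\ell\gtrdot c_{\ell+1}$. A composed chain is a string $c_0s_0c_1s_1\dots c_\ell s_\ell c_{\ell+1}$ such that $c_0c_1\dots c_\ell c_{\ell+1}$ is a simple chain and each $s_k\in\Sigma^*$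 is either empty or such that $c_ks_kc_{k+1}$ is a (simple or composed) chain. The pair $(c_0,c_{\ell+1})$ is the context of the chain. A word $x\in\Sigma^*$ is compatible with $M$ if $M(c,d)$ is defined for any two consecutive letters $c,d$ of $x$ and $M(a,b)$ is defined for each substring of $\#x\#$ that is a chain with context $(a,b)$. An OP word is a structure $w=\langle U,M,P\rangle$ with $U=\{0,1,\dots,n+1\}$, $P(0)=P(n+1)=\#$ and $P(1)\cdots P(n)\in\Sigma^*$ compatible with $M$. For positions write $i\,\pi\,j$ if $P(i)\,\pi\,P(j)$. The chain relation: $\chi(i,j)$ holds iff $i<j-1$ and $P(i)P(i+1)\cdots P(j)$ is a chain. POTL formulas over $AP$: $\varphi::=a\mid\neg\varphi\mid\varphi\lor\varphi\mid\bigcirc^{\Pi}\varphi\mid\ominus^{\Pi}\varphi\mid\chi_F^{\Pi}\varphi\mid\chi_P^{\Pi}\varphi\mid\varphi\,\mathcal U_\chi^{\Pi}\,\varphi\mid\varphi\,\mathcal S_\chi^{\Pi}\,\varphi\mid\bigcirc_H^{\mu}\varphi\mid\ominus_H^{\mu}\varphi\mid\varphi\,\mathcal U_H^{\mu}\,\varphi\mid\varphi\,\mathcal S_H^{\mu}\,\varphi$, with $a\in AP$, $\Pi$ a nonempty subset of $\{\lessdot,\doteq,\gtrdot\}$ (written as a list, e.g. $\bigcirc^{\lessdot\doteq}$), $\mu\in\{\lessdot,\gtrdot\}$; $\top,\land,\to$ are the usual abbreviations. Semantics at position $i$ of $w$: $(w,i)\models a$ iff $a\in P(i)$; Boolean connectives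 as usual. $\bigcirc^\Pi\varphi$: $i\,\pi\,(i+1)$ for some $\pi\in\Pi$ and $\varphi$ holds at $i+1$. $\ominus^\Pi\varphi$: $(i-1)\,\pi\,i$ for some $\pi\in\Pi$ and $\varphi$ holds at $i-1$. $\chi_F^\Pi\varphi$: some $j>i$ has $\chi(i,j)$, $i\,\pi\,j$ for some $\pi\in\Pi$, and $\varphi$ at $j$. $\chi_P^\Pi\varphi$: some $j<i$ has $\chi(j,i)$, $j\,\pi\,i$ for some $\pi\in\Pi$, and $\varphi$ at $j$. $\bigcirc_H^\lessdot\varphi$: there is $h<i$ with $\chi(h,i)$, $h\lessdot i$, such that $\{k>i:\chi(h,k),h\lessdot k\}$ is nonempty and $\varphi$ holds at its minimum; $\ominus_H^\lessdot\varphi$: same with $\{k<i:\chi(h,k),h\lessdot k\}$ and its maximum. $\bigcirc_H^\gtrdot\varphi$: there is $h>i$ with $\chi(i,h)$, $i\gtrdot h$, such that $\{k>i:\chi(k,h),k\gtrdot h\}$ is nonempty and $\varphi$ holds at its minimum; $\ominus_H^\gtrdot\varphi$: same with $\{k<i:\chi(k,h),k\gtrdot h\}$ and its maximum. A path from $i$ to $j$ is $i=i_1<\dots<i_n=j$ ($n\ge1$). For a set $\Gamma$ of paths: $(w,i)\models\varphi\,\mathcal U_\Gamma\,\psi$ iff for some $j\ge i$ there is a path in $\Gamma$ from $i$ to $j$ with $\varphi$ at $i_1,\dots,i_{n-1}$ and $\psi$ at $i_n$; $(w,i)\models\varphi\,\mathcal S_\Gamma\,\psi$ iff for some $j\le i$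 there is a path $j=i_1<\dots<i_n=i$ in $\Gamma$ with $\psi$ at $i_1$ and $\varphi$ at $i_2,\dots,i_n$. A summary path for $\Pi$ from $i$ to $j$ is a path $i=i_1<\dots<i_n=j$ such that for each $p<n$: if $K_p=\{h\le j:\chi(i_p,h),\ i_p\,\pi\,h\text{ for some }\pi\in\Pi\}\neq\emptyset$ then $i_{p+1}=\max K_p$, otherwise $i_{p+1}=i_p+1$ and $i_p\,\pi\,(i_p+1)$ for some $\pi\in\Pi$; $\mathcal U_\chi^\Pi,\mathcal S_\chi^\Pi$ use these paths. A yield-precedence hierarchical path from $i$ to $j$ is a path $i=i_1<\dots<i_n=j$ for which some $h<i$ has $\chi(h,i_p)$ and $h\lessdot i_p$ for all $p$, and there is no $k$ with $i_q<k<i_{q+1}$ and $\chi(h,k)$ for $q<n$; $\mathcal U_H^\lessdot,\mathcal S_H^\lessdot$ use these paths. A take-precedence hierarchical path from $i$ to $j$: some $h>j$ has $\chi(i_p,h)$ and $i_p\gtrdot h$ for all $p$, and there is no $k$ with $i_q<k<i_{q+1}$ and $\chi(k,h)$; $\mathcal U_H^\gtrdot,\mathcal S_H^\gtrdot$ use these paths. First-order logic on OP words: variables range over $U$; the signature consists of equality, the linear order $<$ on $U$, the binary relation $\chi$, and a unary predicate for each $a\in AP$ (true at $i$ iff $a\in P(i)$). *)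

theory Defs
  imports Main "HOL-Library.Sublist"
begin

datatype prec = Yields | Equals | Takes

text \<open>Letters are arbitrary subsets of \<open>AP\<close>, the universe of the type \<open>'ap\<close>;
  \<open>Hash\<close> is the end marker.\<close>

datatype 'ap symb = Hash | Letter "'ap set"

type_synonym 'ap opm = "'ap symb \<Rightarrow> 'ap symb \<Rightarrow> prec option"

text \<open>\<open>SL\<close> is the set of structural labels, its complement the set of normal propositions.
  The conventions for the end marker cover all symbols. In particular \<open>#\<close> yields precedence
  to itself: for every nonempty compatible word \<open>x\<close> the string \<open>#x#\<close> is a chain with context
  \<open>(#,#)\<close>, so no such word could exist otherwise.\<close>

definition is_opm :: "'ap set \<Rightarrow> 'ap opm \<Rightarrow> bool" where
  "is_opm SL M \<longleftrightarrow>
     (\<forall>a b. M (Letter a) (Letter b) \<noteq> None \<longrightarrow> (\<exists>!l. l \<in> a \<inter> SL) \<and> (\<exists>!l. l \<in> b \<inter> SL)) \<and>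
     (\<forall>a a' b b'. a \<inter> SL = a' \<inter> SL \<longrightarrow> b \<inter> SL = b' \<inter> SL \<longrightarrow>
        M (Letter a) (Letter b) = M (Letter a') (Letter b')) \<and>
     (\<forall>b. M Hash b = Some Yields) \<and>
     (\<forall>a. M (Letter a) Hash = Some Takes)"

definition simple_chain :: "'ap opm \<Rightarrow> nat \<Rightarrow> (nat \<Rightarrow> 'ap symb) \<Rightarrow> bool" where
  "simple_chain M l c \<longleftrightarrow> 1 \<le> l \<and> (\<forall>k\<in>{1..l}. c k \<in> range Letter) \<and>
     M (c 0) (c 1) = Some Yields \<and>
     (\<forall>k\<in>{1..<l}. M (c k) (c (k + 1)) = Some Equals) \<and>
     M (c l) (c (l + 1)) = Some Takes"

inductive chain :: "'ap opm \<Rightarrow> 'ap symb list \<Rightarrow> bool" for M where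
  simple: "simple_chain M l c \<Longrightarrow> chain M (map c [0..<l + 2])"
| composed: "simple_chain M l c \<Longrightarrow>
    \<forall>k\<le>l. s k = [] \<or> chain M (c k # map Letter (s k) @ [c (k + 1)]) \<Longrightarrow>
    chain M (concat (map (\<lambda>k. c k # map Letter (s k)) [0..<l + 1]) @ [c (l + 1)])"

definition compatible :: "'ap opm \<Rightarrow> 'ap set list \<Rightarrow> bool" where
  "compatible M x \<longleftrightarrow>
     (\<forall>k. k + 1 < length x \<longrightarrow> M (Letter (x ! k)) (Letter (x ! (k + 1))) \<noteq> None) \<and>
     (\<forall>y. sublist y (Hash # map Letter x @ [Hash]) \<longrightarrow> chain M y \<longrightarrow> M (hd y) (last y) \<noteq> None)"

text \<open>An OP word with matrix \<open>M\<close> is given by the list \<open>w\<close> of the letters at the positions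
  \<open>1, \<dots>, n\<close>; the positions \<open>0\<close> and \<open>n + 1\<close> carry the end marker. The value of
  \<open>symb_at\<close> beyond position \<open>n + 1\<close> is irrelevant.\<close>

abbreviation op_word :: "'ap opm \<Rightarrow> 'ap set list \<Rightarrow> bool" where
  "op_word M w \<equiv> compatible M w"

definition positions :: "'ap set list \<Rightarrow> nat set" where
  "positions w = {0..length w + 1}"

definition symb_at :: "'ap set list \<Rightarrow> nat \<Rightarrow> 'ap symb" where
  "symb_at w i = (if 1 \<le> i \<and> i \<le> length w then Letter (w ! (i - 1)) else Hash)"

definition prop_at :: "'ap set list \<Rightarrow> 'ap \<Rightarrow> nat \<Rightarrow> bool" where
  "prop_at w a i \<longleftrightarrow> (\<exists>b. symb_at w i = Letter b \<and> a \<in> b)"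

definition rel :: "'ap opm \<Rightarrow> 'ap set list \<Rightarrow> prec set \<Rightarrow> nat \<Rightarrow> nat \<Rightarrow> bool" where
  "rel M w \<Pi> i j \<longleftrightarrow> (\<exists>\<pi>\<in>\<Pi>. M (symb_at w i) (symb_at w j) = Some \<pi>)"

definition chi :: "'ap opm \<Rightarrow> 'ap set list \<Rightarrow> nat \<Rightarrow> nat \<Rightarrow> bool" where
  "chi M w i j \<longleftrightarrow> i \<in> positions w \<and> j \<in> positions w \<and> i + 1 < j \<and>
     chain M (map (symb_at w) [i..<j + 1])"

subsection \<open>POTL\<close>

text \<open>The values of the parameter \<open>\<mu>\<close> of the hierarchical operators.\<close>

datatype hprec = HYields | HTakes

datatype 'ap potl =
    Atom 'ap
  | Neg "'ap potl"
  | Or "'ap potl" "'ap potl"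
  | Next "prec set" "'ap potl"
  | Back "prec set" "'ap potl"
  | ChainNext "prec set" "'ap potl"
  | ChainBack "prec set" "'ap potl"
  | ChainUntil "prec set" "'ap potl" "'ap potl"
  | ChainSince "prec set" "'ap potl" "'ap potl"
  | HNext hprec "'ap potl"
  | HBack hprec "'ap potl"
  | HUntil hprec "'ap potl" "'ap potl"
  | HSince hprec "'ap potl" "'ap potl"

text \<open>The sets \<open>\<Pi>\<close> of precedence relations have to be nonempty.\<close>

primrec potl_wf :: "'ap potl \<Rightarrow> bool" where
  "potl_wf (Atom a) \<longleftrightarrow> True"
| "potl_wf (Neg \<phi>) \<longleftrightarrow> potl_wf \<phi>"
| "potl_wf (Or \<phi> \<psi>) \<longleftrightarrow> potl_wf \<phi> \<and> potl_wf \<psi>"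
| "potl_wf (Next \<Pi> \<phi>) \<longleftrightarrow> \<Pi> \<noteq> {} \<and> potl_wf \<phi>"
| "potl_wf (Back \<Pi> \<phi>) \<longleftrightarrow> \<Pi> \<noteq> {} \<and> potl_wf \<phi>"
| "potl_wf (ChainNext \<Pi> \<phi>) \<longleftrightarrow> \<Pi> \<noteq> {} \<and> potl_wf \<phi>"
| "potl_wf (ChainBack \<Pi> \<phi>) \<longleftrightarrow> \<Pi> \<noteq> {} \<and> potl_wf \<phi>"
| "potl_wf (ChainUntil \<Pi> \<phi> \<psi>) \<longleftrightarrow> \<Pi> \<noteq> {} \<and> potl_wf \<phi> \<and> potl_wf \<psi>"
| "potl_wf (ChainSince \<Pi> \<phi> \<psi>) \<longleftrightarrow> \<Pi> \<noteq> {} \<and> potl_wf \<phi> \<and> potl_wf \<psi>"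
| "potl_wf (HNext \<mu> \<phi>) \<longleftrightarrow> potl_wf \<phi>"
| "potl_wf (HBack \<mu> \<phi>) \<longleftrightarrow> potl_wf \<phi>"
| "potl_wf (HUntil \<mu> \<phi> \<psi>) \<longleftrightarrow> potl_wf \<phi> \<and> potl_wf \<psi>"
| "potl_wf (HSince \<mu> \<phi> \<psi>) \<longleftrightarrow> potl_wf \<phi> \<and> potl_wf \<psi>"

definition path :: "'ap set list \<Rightarrow> nat \<Rightarrow> nat \<Rightarrow> nat list \<Rightarrow> bool" where
  "path w i j p \<longleftrightarrow> p \<noteq> [] \<and> hd p = i \<and> last p = j \<and> sorted_wrt (<) p \<and> set p \<subseteq> positions w"

definition summary_path ::
    "'ap opm \<Rightarrow> 'ap set list \<Rightarrow> prec set \<Rightarrow> nat \<Rightarrow> nat \<Rightarrow> nat list \<Rightarrow> bool" where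
  "summary_path M w \<Pi> i j p \<longleftrightarrow> path w i j p \<and>
     (\<forall>q. q + 1 < length p \<longrightarrow>
        (let K = {h. h \<le> j \<and> chi M w (p ! q) h \<and> rel M w \<Pi> (p ! q) h}
         in if K \<noteq> {} then p ! (q + 1) = Max K
            else p ! (q + 1) = p ! q + 1 \<and> rel M w \<Pi> (p ! q) (p ! q + 1)))"

fun hier_path ::
    "'ap opm \<Rightarrow> 'ap set list \<Rightarrow> hprec \<Rightarrow> nat \<Rightarrow> nat \<Rightarrow> nat list \<Rightarrow> bool" where
  "hier_path M w HYields i j p \<longleftrightarrow> path w i j p \<and>
     (\<exists>h<i. (\<forall>k\<in>set p. chi M w h k \<and> rel M w {Yields} h k) \<and>
        (\<forall>q. q + 1 < length p \<longrightarrow> \<not> (\<exists>k. p ! q < k \<and> k < p ! (q + 1) \<and> chi M w h k)))"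
| "hier_path M w HTakes i j p \<longleftrightarrow> path w i j p \<and>
     (\<exists>h>j. (\<forall>k\<in>set p. chi M w k h \<and> rel M w {Takes} k h) \<and>
        (\<forall>q. q + 1 < length p \<longrightarrow> \<not> (\<exists>k. p ! q < k \<and> k < p ! (q + 1) \<and> chi M w k h)))"

text \<open>Until and since with respect to a set \<open>\<Gamma>\<close> of paths, where \<open>\<Gamma> i j p\<close> means that
  \<open>p\<close> is a path of the set leading from \<open>i\<close> to \<open>j\<close>.\<close>

definition until_sat ::
    "(nat \<Rightarrow> nat \<Rightarrow> nat list \<Rightarrow> bool) \<Rightarrow> (nat \<Rightarrow> bool) \<Rightarrow> (nat \<Rightarrow> bool) \<Rightarrow> nat \<Rightarrow> bool" where
  "until_sat \<Gamma> F G i \<longleftrightarrow>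
     (\<exists>j\<ge>i. \<exists>p. \<Gamma> i j p \<and> (\<forall>k\<in>set (butlast p). F k) \<and> G (last p))"

definition since_sat ::
    "(nat \<Rightarrow> nat \<Rightarrow> nat list \<Rightarrow> bool) \<Rightarrow> (nat \<Rightarrow> bool) \<Rightarrow> (nat \<Rightarrow> bool) \<Rightarrow> nat \<Rightarrow> bool" where
  "since_sat \<Gamma> F G i \<longleftrightarrow>
     (\<exists>j\<le>i. \<exists>p. \<Gamma> j i p \<and> G (hd p) \<and> (\<forall>k\<in>set (tl p). F k))"

fun hnext_sat :: "'ap opm \<Rightarrow> 'ap set list \<Rightarrow> hprec \<Rightarrow> (nat \<Rightarrow> bool) \<Rightarrow> nat \<Rightarrow> bool" where
  "hnext_sat M w HYields F i \<longleftrightarrow>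
     (\<exists>h<i. chi M w h i \<and> rel M w {Yields} h i \<and>
        (let K = {k. k > i \<and> chi M w h k \<and> rel M w {Yields} h k} in K \<noteq> {} \<and> F (Min K)))"
| "hnext_sat M w HTakes F i \<longleftrightarrow>
     (\<exists>h>i. chi M w i h \<and> rel M w {Takes} i h \<and>
        (let K = {k. k > i \<and> chi M w k h \<and> rel M w {Takes} k h} in K \<noteq> {} \<and> F (Min K)))"

fun hback_sat :: "'ap opm \<Rightarrow> 'ap set list \<Rightarrow> hprec \<Rightarrow> (nat \<Rightarrow> bool) \<Rightarrow> nat \<Rightarrow> bool" where
  "hback_sat M w HYields F i \<longleftrightarrow>
     (\<exists>h<i. chi M w h i \<and> rel M w {Yields} h i \<and>
        (let K = {k. k < i \<and> chi M w h k \<and> rel M w {Yields} h k} in K \<noteq> {} \<and> F (Max K)))"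
| "hback_sat M w HTakes F i \<longleftrightarrow>
     (\<exists>h>i. chi M w i h \<and> rel M w {Takes} i h \<and>
        (let K = {k. k < i \<and> chi M w k h \<and> rel M w {Takes} k h} in K \<noteq> {} \<and> F (Max K)))"

primrec potl_sat :: "'ap opm \<Rightarrow> 'ap set list \<Rightarrow> 'ap potl \<Rightarrow> nat \<Rightarrow> bool" where
  "potl_sat M w (Atom a) = (\<lambda>i. prop_at w a i)"
| "potl_sat M w (Neg \<phi>) = (\<lambda>i. \<not> potl_sat M w \<phi> i)"
| "potl_sat M w (Or \<phi> \<psi>) = (\<lambda>i. potl_sat M w \<phi> i \<or> potl_sat M w \<psi> i)"
| "potl_sat M w (Next \<Pi> \<phi>) =
     (\<lambda>i. i + 1 \<in> positions w \<and> rel M w \<Pi> i (i + 1) \<and> potl_sat M w \<phi> (i + 1))"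
| "potl_sat M w (Back \<Pi> \<phi>) =
     (\<lambda>i. 1 \<le> i \<and> rel M w \<Pi> (i - 1) i \<and> potl_sat M w \<phi> (i - 1))"
| "potl_sat M w (ChainNext \<Pi> \<phi>) =
     (\<lambda>i. \<exists>j>i. chi M w i j \<and> rel M w \<Pi> i j \<and> potl_sat M w \<phi> j)"
| "potl_sat M w (ChainBack \<Pi> \<phi>) =
     (\<lambda>i. \<exists>j<i. chi M w j i \<and> rel M w \<Pi> j i \<and> potl_sat M w \<phi> j)"
| "potl_sat M w (ChainUntil \<Pi> \<phi> \<psi>) =
     until_sat (summary_path M w \<Pi>) (potl_sat M w \<phi>) (potl_sat M w \<psi>)"
| "potl_sat M w (ChainSince \<Pi> \<phi> \<psi>) =
     since_sat (summary_path M w \<Pi>) (potl_sat M w \<phi>) (potl_sat M w \<psi>)"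
| "potl_sat M w (HNext \<mu> \<phi>) = hnext_sat M w \<mu> (potl_sat M w \<phi>)"
| "potl_sat M w (HBack \<mu> \<phi>) = hback_sat M w \<mu> (potl_sat M w \<phi>)"
| "potl_sat M w (HUntil \<mu> \<phi> \<psi>) =
     until_sat (hier_path M w \<mu>) (potl_sat M w \<phi>) (potl_sat M w \<psi>)"
| "potl_sat M w (HSince \<mu> \<phi> \<psi>) =
     since_sat (hier_path M w \<mu>) (potl_sat M w \<phi>) (potl_sat M w \<psi>)"

subsection \<open>First-order logic\<close>

datatype 'ap fo =
    FEq nat nat
  | FLess nat nat
  | FChi nat nat
  | FProp 'ap nat
  | FNeg "'ap fo"
  | FOr "'ap fo" "'ap fo"
  | FEx nat "'ap fo"

primrec fo_fv :: "'ap fo \<Rightarrow> nat set" where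
  "fo_fv (FEq x y) = {x, y}"
| "fo_fv (FLess x y) = {x, y}"
| "fo_fv (FChi x y) = {x, y}"
| "fo_fv (FProp a x) = {x}"
| "fo_fv (FNeg \<psi>) = fo_fv \<psi>"
| "fo_fv (FOr \<psi> \<theta>) = fo_fv \<psi> \<union> fo_fv \<theta>"
| "fo_fv (FEx x \<psi>) = fo_fv \<psi> - {x}"

primrec fo_sat :: "'ap opm \<Rightarrow> 'ap set list \<Rightarrow> 'ap fo \<Rightarrow> (nat \<Rightarrow> nat) \<Rightarrow> bool" where
  "fo_sat M w (FEq x y) = (\<lambda>v. v x = v y)"
| "fo_sat M w (FLess x y) = (\<lambda>v. v x < v y)"
| "fo_sat M w (FChi x y) = (\<lambda>v. chi M w (v x) (v y))"
| "fo_sat M w (FProp a x) = (\<lambda>v. prop_at w a (v x))"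
| "fo_sat M w (FNeg \<psi>) = (\<lambda>v. \<not> fo_sat M w \<psi> v)"
| "fo_sat M w (FOr \<psi> \<theta>) = (\<lambda>v. fo_sat M w \<psi> v \<or> fo_sat M w \<theta> v)"
| "fo_sat M w (FEx x \<psi>) = (\<lambda>v. \<exists>k\<in>positions w. fo_sat M w \<psi> (v(x := k)))"

end

theory Submission
  imports Defs
begin

text \<open>An OP word is the preorder traversal of an ordered tree: the parent of \<open>j\<close> is the position \<open>i\<close> that is
  adjacent to \<open>j\<close> or linked to it by a chain and satisfies \<open>i \<lessdot> j\<close> or \<open>i \<doteq> j\<close>. The chain relation is first-order
  definable from the order and the ancestor relation of this tree, so the truth of a first-order formula at a
  position depends only on the Ehrenfeucht-Fraisse class of the tree marked at this position. That class is the
  composition of context classes along the path from the root to the position, each of which is determined by the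
  classes of the subtrees to the left and to the right of the path. Contexts modulo equivalence form finite
  aperiodic monoids, and products in such monoids along a discrete linear order are definable by until and since
  (induction by local divisors). It remains to express in POTL the until and since operators along the branches
  of the tree and along the siblings of a node. Conversely, summary paths are first-order definable since chains
  do not cross: the path from \<open>i\<close> to \<open>j\<close> visits the positions that are not strictly inside a jump.\<close>

section \<open>The tree of an OP word\<close>

text \<open>The class of a marked tree depends on the whole word; what makes it definable step by
  step is an induction on the number of rounds. The class of rank k + 1 of a child forest is its
  class of rank k together with the classes of rank k of all its versions with one more pebble. Each
  such version is a product of contexts leading down to the pebble, and their labels use only
  classes of rank k. Aperiodicity is the Ehrenfeucht-Fraisse fact that k rounds cannot tell
  \<open>n\<close> copies of a context from \<open>m\<close> copies once both numbers reach 2^k - 1.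
  All this is done for an abstract set of predicates on pairs of a word and a position, so the
  formulas are uniform in the word. Two features of POTL have to be worked around. A chain may also
  link a node to the end of its subtree, which is no tree edge. And no operator walks along all
  siblings: the children of \<open>h\<close> are the adjacent one \<open>Suc h\<close>, those linked
  by a chain with \<open>Yields\<close>, and at most one, the last, linked by a chain with
  \<open>Equals\<close>; the hierarchical operators for \<open>Yields\<close> see only the middle
  group.\<close>

definition prel :: "'ap opm \<Rightarrow> 'ap set list \<Rightarrow> prec \<Rightarrow> nat \<Rightarrow> nat \<Rightarrow> bool" where
  "prel M w \<pi> i j \<longleftrightarrow> M (symb_at w i) (symb_at w j) = Some \<pi>"

text \<open>Position-based counterpart of \<open>chain\<close>: \<open>f\<close> lists the positions
  of the letters \<open>c 0\<close>, ..., \<open>c (l + 1)\<close>, and the rule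
  \<open>adjacent\<close> stands for an empty \<open>s k\<close>, so that simple and composed chains
  are covered by one rule. \<open>chi_iff_link\<close> states the agreement with
  \<open>chi\<close>.\<close>

inductive link :: "'ap opm \<Rightarrow> 'ap set list \<Rightarrow> nat \<Rightarrow> nat \<Rightarrow> bool" for M w where
  adjacent: "i \<le> length w \<Longrightarrow> link M w i (Suc i)"
| body: "1 \<le> l \<Longrightarrow> \<forall>k\<le>l. link M w (f k) (f (Suc k)) \<Longrightarrow> prel M w Yields (f 0) (f 1) \<Longrightarrow>
    \<forall>k. 1 \<le> k \<and> k < l \<longrightarrow> prel M w Equals (f k) (f (Suc k)) \<Longrightarrow>
    prel M w Takes (f l) (f (Suc l)) \<Longrightarrow> link M w (f 0) (f (Suc l))"

lemma increasing_from: 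
  fixes f :: "nat \<Rightarrow> nat"
  assumes "\<forall>k\<le>l. f k < f (Suc k)" "i < j" "j \<le> Suc l"
  shows "f i < f j"
  using assms(2,3)
proof (induction j)
  case (Suc j)
  then show ?case using assms(1) by (cases "i = j") (auto intro: less_trans)
qed simp

lemma link_bounds: "link M w i j \<Longrightarrow> i < j \<and> j \<le> length w + 1"
proof (induction rule: link.induct)
  case (body l f)
  then have "f 0 < f (Suc l)" using increasing_from[of l f 0 "Suc l"] by auto
  then show ?case using body by auto
qed simp

lemma upt_split: "i \<le> j \<Longrightarrow> j \<le> k \<Longrightarrow> [i..<k] = [i..<j] @ [j..<k]"
  using upt_add_eq_append[of i j "k - j"] by simp

lemma map_upt_append:
  assumes "map g [i..<m] = A @ B"
  shows "A = map g [i..<i + length A]" "B = map g [i + length A..<m]"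
proof -
  have "length A \<le> m - i" using arg_cong[OF assms, of length] by simp
  then have "take (length A) (map g [i..<m]) = map g [i..<i + length A]"
    "drop (length A) (map g [i..<m]) = map g [i + length A..<m]"
    by (cases "i \<le> m"; simp add: take_map drop_map take_upt)+
  then show "A = map g [i..<i + length A]" "B = map g [i + length A..<m]"
    unfolding assms by simp_all
qed

lemma concat_split:
  assumes "k \<le> l"
  shows "\<exists>rest. concat (map (\<lambda>k. c k # h k) [0..<l + 1]) @ [c (l + 1)] =
    concat (map (\<lambda>k. c k # h k) [0..<k]) @ (c k # h k) @ c (k + 1) # rest"
  using assms
proof (induction l)
  case (Suc l)
  show ?case
  proof (cases "k = Suc l")
    case False
    then obtain rest where "concat (map (\<lambda>k. c k # h k) [0..<l + 1]) @ [c (l + 1)] =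
      concat (map (\<lambda>k. c k # h k) [0..<k]) @ (c k # h k) @ c (k + 1) # rest"
      using Suc by auto
    then have "(concat (map (\<lambda>k. c k # h k) [0..<l + 1]) @ [c (l + 1)]) @ h (l + 1) @ [c (l + 2)] =
      concat (map (\<lambda>k. c k # h k) [0..<k]) @ (c k # h k) @ c (k + 1) # rest @ h (l + 1) @ [c (l + 2)]"
      by simp
    then show ?thesis
      by (intro exI[of _ "rest @ h (l + 1) @ [c (l + 2)]"]) simp
  qed auto
qed simp

text \<open>Common step of the simple and the composed case, the former with all \<open>s k\<close>
  empty. The equation of strings fixes the position of every \<open>c k\<close>, and the induction
  hypothesis turns each nonempty block into a link.\<close>

lemma composed_link:
  assumes sc: "simple_chain M l c"
    and ys: "concat (map (\<lambda>k. c k # map Letter (s k)) [0..<l + 1]) @ [c (l + 1)] = map (symb_at w) [i..<j + 1]"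
    and j: "j \<le> length w + 1"
    and IH: "\<forall>k\<le>l. s k = [] \<or> (\<forall>i j. c k # map Letter (s k) @ [c (k + 1)] = map (symb_at w) [i..<j + 1] \<longrightarrow>
      j \<le> length w + 1 \<longrightarrow> link M w i j)"
  shows "link M w i j"
proof -
  define g where "g = (\<lambda>k. c k # map Letter (s k))"
  \<comment> \<open>Position of \<open>c k\<close>: the first \<open>k\<close> blocks are laid out
    from \<open>i\<close> on.\<close>
  define f where "f k = i + length (concat (map g [0..<k]))" for k
  have fS: "f (Suc k) = f k + 1 + length (s k)" for k by (simp add: f_def g_def)
  have f0: "f 0 = i" by (simp add: f_def)
  have "length (concat (map g [0..<l + 1]) @ [c (l + 1)]) = j + 1 - i"
    using arg_cong[OF ys, of length] unfolding g_def by (simp del: upt_Suc)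
  then have fl: "f (Suc l) = j" by (simp add: f_def g_def)
  have step: "f k + 1 \<le> length w + 1 \<and> symb_at w (f k) = c k \<and> symb_at w (f (Suc k)) = c (Suc k) \<and>
      map (symb_at w) [f k..<f (Suc k) + 1] = c k # map Letter (s k) @ [c (k + 1)] \<and> f (Suc k) \<le> j"
    if k: "k \<le> l" for k
  proof -
    obtain rest where r: "concat (map g [0..<l + 1]) @ [c (l + 1)] =
      concat (map g [0..<k]) @ g k @ c (k + 1) # rest"
      using concat_split[OF k, of c "\<lambda>k. map Letter (s k)"] unfolding g_def by auto
    have "map (symb_at w) [i..<j + 1] = concat (map g [0..<k]) @ (g k @ c (k + 1) # rest)"
      using ys r unfolding g_def by simp
    from map_upt_append(2)[OF this] have sp: "map (symb_at w) [f k..<j + 1] = (g k @ [c (k + 1)]) @ rest"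
      by (simp add: f_def)
    note e = map_upt_append(1)[OF sp]
    have len: "length (g k @ [c (k + 1)]) = f (Suc k) + 1 - f k" by (simp add: fS g_def)
    have e2: "map (symb_at w) [f k..<f (Suc k) + 1] = g k @ [c (k + 1)]"
      using e unfolding len using fS[of k] by simp
    have "length (g k @ [c (k + 1)]) \<le> j + 1 - f k"
      using arg_cong[OF sp, of length] by (simp del: upt_Suc)
    then have fj: "f (Suc k) \<le> j" using fS[of k] by (simp add: g_def)
    have "map (symb_at w) [f k..<f (Suc k) + 1] ! 0 = c k" unfolding e2 by (simp add: g_def)
    then have 1: "symb_at w (f k) = c k" using fS[of k] by (simp del: upt_Suc)
    have "last (map (symb_at w) [f k..<f (Suc k) + 1]) = c (k + 1)" unfolding e2 by simp
    then have 2: "symb_at w (f (Suc k)) = c (Suc k)" using fS[of k] by simp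
    show ?thesis using 1 2 e2 fj j fS[of k] by (simp add: g_def)
  qed
  have lk: "link M w (f k) (f (Suc k))" if k: "k \<le> l" for k
  proof (cases "s k = []")
    case True
    then show ?thesis using fS[of k] step[OF k] adjacent[of "f k" w M] by simp
  next
    case False
    from IH[THEN spec, THEN mp, OF k] show ?thesis
    proof
      assume *: "\<forall>i j. c k # map Letter (s k) @ [c (k + 1)] = map (symb_at w) [i..<j + 1] \<longrightarrow>
        j \<le> length w + 1 \<longrightarrow> link M w i j"
      show ?thesis by (rule *[rule_format]) (use step[OF k] j in auto)
    qed (use False in simp)
  qed
  have "prel M w Yields (f 0) (f 1)" using sc step[of 0] unfolding simple_chain_def prel_def by simp
  moreover have "\<forall>k. 1 \<le> k \<and> k < l \<longrightarrow> prel M w Equals (f k) (f (Suc k))"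
    using sc step unfolding simple_chain_def prel_def by simp
  moreover have "prel M w Takes (f l) (f (Suc l))"
    using sc step[of l] unfolding simple_chain_def prel_def by simp
  moreover have "1 \<le> l" using sc by (simp add: simple_chain_def)
  ultimately have "link M w (f 0) (f (Suc l))" using link.body[of l M w f] lk by blast
  then show ?thesis using f0 fl by simp
qed

lemma chain_link:
  "chain M y \<Longrightarrow> \<forall>i j. y = map (symb_at w) [i..<j + 1] \<longrightarrow> j \<le> length w + 1 \<longrightarrow> link M w i j"
proof (induction rule: chain.induct)
  case (simple l c)
  have "concat (map (\<lambda>k. c k # map Letter ((\<lambda>k. []) k)) [0..<l + 1]) @ [c (l + 1)] = map c [0..<l + 2]"
    by simp
  then show ?case
    using composed_link[OF simple, of "\<lambda>k. []" w]
    by (intro allI impI) (simp only: simp_thms list.map)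
next
  case (composed l c s)
  have "\<forall>k\<le>l. s k = [] \<or> (\<forall>i j. c k # map Letter (s k) @ [c (k + 1)] = map (symb_at w) [i..<j + 1] \<longrightarrow>
      j \<le> length w + 1 \<longrightarrow> link M w i j)"
  proof (intro allI impI)
    fix k assume "k \<le> l"
    from composed.IH[THEN spec, THEN mp, OF this]
    show "s k = [] \<or> (\<forall>i j. c k # map Letter (s k) @ [c (k + 1)] = map (symb_at w) [i..<j + 1] \<longrightarrow>
      j \<le> length w + 1 \<longrightarrow> link M w i j)"
      by (elim disjE conjE) (rule disjI1, assumption, rule disjI2, assumption)
  qed
  then show ?case by (intro allI impI) (rule composed_link[OF composed.hyps])
qed

lemma link_chain: "link M w i j \<Longrightarrow> Suc i < j \<Longrightarrow> chain M (map (symb_at w) [i..<j + 1])"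
proof (induction rule: link.induct)
  case (body l f)
  have inc: "\<forall>k\<le>l. f k < f (Suc k)" and bd: "\<forall>k\<le>l. f (Suc k) \<le> length w + 1"
    using body link_bounds by blast+
  define c where "c k = symb_at w (f k)" for k
  \<comment> \<open>Position \<open>p\<close> carries the letter with index \<open>p - 1\<close>;
    strictly between two linked positions there is no end marker.\<close>
  define s where "s k = map (\<lambda>p. w ! (p - 1)) [Suc (f k)..<f (Suc k)]" for k
  have let_eq: "map Letter (s k) = map (symb_at w) [Suc (f k)..<f (Suc k)]" if "k \<le> l" for k
    using bd[rule_format, OF that] unfolding s_def by (auto simp: symb_at_def)
  have up: "[f k..<f (Suc k)] = f k # [Suc (f k)..<f (Suc k)]" if "k \<le> l" for k
    using inc that by (simp add: upt_conv_Cons)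
  have seg: "c k # map Letter (s k) = map (symb_at w) [f k..<f (Suc k)]" if "k \<le> l" for k
    using let_eq[OF that] up[OF that] by (simp add: c_def)
  have cat: "k \<le> Suc l \<Longrightarrow> concat (map (\<lambda>k. c k # map Letter (s k)) [0..<k]) = map (symb_at w) [f 0..<f k]" for k
  proof (induction k)
    case (Suc k)
    have "f 0 \<le> f k" using increasing_from[OF inc, of 0 k] Suc by (cases k) auto
    moreover have "f k \<le> f (Suc k)" using inc Suc by auto
    ultimately have "[f 0..<f (Suc k)] = [f 0..<f k] @ [f k..<f (Suc k)]"
      by (rule upt_split)
    then show ?case using Suc seg[of k] by simp
  qed simp
  have "simple_chain M l c" unfolding simple_chain_def
  proof (intro conjI ballI)
    show "1 \<le> l" using body by simp
    show "c k \<in> range Letter" if "k \<in> {1..l}" for k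
    proof -
      have "f 0 < f k" "f k < f (Suc k)" "f (Suc k) \<le> length w + 1"
        using increasing_from[OF inc, of 0 k] inc bd that by auto
      then show ?thesis by (auto simp: c_def symb_at_def)
    qed
  qed (use body in \<open>auto simp: prel_def c_def\<close>)
  moreover have "\<forall>k\<le>l. s k = [] \<or> chain M (c k # map Letter (s k) @ [c (k + 1)])"
  proof (intro allI impI)
    fix k assume k: "k \<le> l"
    show "s k = [] \<or> chain M (c k # map Letter (s k) @ [c (k + 1)])"
    proof (cases "Suc (f k) < f (Suc k)")
      case True
      have "c k # map Letter (s k) @ [c (k + 1)] = map (symb_at w) [f k..<f (Suc k) + 1]"
        using seg[OF k] inc k by (simp add: c_def less_imp_le)
      moreover have "chain M (map (symb_at w) [f k..<f (Suc k) + 1])" using body.IH k True by blast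
      ultimately show ?thesis by simp
    qed (simp add: s_def)
  qed
  ultimately have "chain M (concat (map (\<lambda>k. c k # map Letter (s k)) [0..<l + 1]) @ [c (l + 1)])"
    by (rule chain.composed)
  moreover have "f 0 \<le> f (Suc l)" using increasing_from[OF inc, of 0 "Suc l"] by simp
  moreover have "concat (map (\<lambda>k. c k # map Letter (s k)) [0..<l + 1]) = map (symb_at w) [f 0..<f (Suc l)]"
    using cat[OF order_refl] by (simp only: Suc_eq_plus1)
  ultimately have "chain M (map (symb_at w) [f 0..<f (Suc l)] @ [c (l + 1)])" by (simp only:)
  then show ?case using \<open>f 0 \<le> f (Suc l)\<close> by (simp add: c_def)
qed simp

lemma chi_iff_link: "chi M w i j \<longleftrightarrow> link M w i j \<and> Suc i < j"
proof
  assume "chi M w i j"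
  then show "link M w i j \<and> Suc i < j"
    unfolding chi_def positions_def using chain_link[of M "map (symb_at w) [i..<j + 1]" w] by auto
next
  assume "link M w i j \<and> Suc i < j"
  then show "chi M w i j"
    unfolding chi_def positions_def using link_chain[of M w i j] link_bounds[of M w i j] by auto
qed

section \<open>Parents, subtree ends and reductions of handles\<close>

definition parent :: "'ap opm \<Rightarrow> 'ap set list \<Rightarrow> nat \<Rightarrow> nat \<Rightarrow> bool" where
  "parent M w i j \<longleftrightarrow> link M w i j \<and> (prel M w Yields i j \<or> prel M w Equals i j)"

text \<open>Exclusive right end of the subtree of \<open>i\<close>: by \<open>ancestor_iff\<close>
  the subtree is the interval from \<open>i\<close> up to this value. For the root the value is
  \<open>length w + 2\<close>, one past the last position.\<close>

definition sub_end :: "'ap opm \<Rightarrow> 'ap set list \<Rightarrow> nat \<Rightarrow> nat" where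
  "sub_end M w i = (LEAST k. i < k \<and> \<not> (parent M w)\<^sup>*\<^sup>* i k)"

definition eq_run :: "'ap opm \<Rightarrow> 'ap set list \<Rightarrow> nat \<Rightarrow> nat \<Rightarrow> bool" where
  "eq_run M w = (\<lambda>x y. link M w x y \<and> prel M w Equals x y)\<^sup>*\<^sup>*"

text \<open>One reduction of an operator precedence parser: the handle is an \<open>Equals\<close>
  run ending in \<open>b\<close>, and reducing it exposes its left context \<open>a\<close> on the
  stack.\<close>

definition pops :: "'ap opm \<Rightarrow> 'ap set list \<Rightarrow> nat \<Rightarrow> nat \<Rightarrow> bool" where
  "pops M w b a \<longleftrightarrow> (\<exists>c. eq_run M w c b \<and> link M w a c \<and> prel M w Yields a c)"

lemma eq_run_parent: "eq_run M w x y \<Longrightarrow> (parent M w)\<^sup>*\<^sup>* x y"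
  unfolding eq_run_def by (rule rtranclp_mono[THEN predicate2D, rotated]) (auto simp: parent_def)

lemma parent_less: "parent M w i j \<Longrightarrow> i < j \<and> j \<le> length w + 1"
  unfolding parent_def using link_bounds by blast

lemma ancestor_le: "(parent M w)\<^sup>*\<^sup>* i j \<Longrightarrow> i \<le> j"
  by (induction rule: rtranclp_induct) (auto dest: parent_less)

lemma ancestor_bound: "(parent M w)\<^sup>*\<^sup>* i j \<Longrightarrow> i = j \<or> j \<le> length w + 1"
  by (induction rule: rtranclp_induct) (auto dest: parent_less)

lemma pops_parent: "pops M w b a \<Longrightarrow> (parent M w)\<^sup>*\<^sup>* a b \<and> a < b"
proof -
  assume "pops M w b a"
  then obtain c where c: "eq_run M w c b" "parent M w a c" by (auto simp: pops_def parent_def)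
  then show ?thesis using eq_run_parent[OF c(1)] parent_less[OF c(2)] ancestor_le[of M w c b]
    converse_rtranclp_into_rtranclp[of "parent M w" a c b] by auto
qed

text \<open>The context \<open>a\<close>, the run ending in \<open>b\<close>, and \<open>j\<close>
  make up an instance of the rule \<open>body\<close>. Together with \<open>link_nonadjacent\<close>
  this says that links into \<open>j\<close> propagate exactly along reductions.\<close>

lemma link_pops:
  assumes "pops M w b a" "link M w b j" "prel M w Takes b j"
  shows "link M w a j"
proof -
  obtain c where c: "eq_run M w c b" "link M w a c" "prel M w Yields a c"
    using assms(1) by (auto simp: pops_def)
  obtain r where "((\<lambda>x y. link M w x y \<and> prel M w Equals x y) ^^ r) c b"
    using c(1) unfolding eq_run_def by (meson rtranclp_imp_relpowp)
  then obtain g where g: "g 0 = c" "g r = b" "\<forall>i<r. link M w (g i) (g (Suc i)) \<and> prel M w Equals (g i) (g (Suc i))"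
    unfolding relpowp_fun_conv by blast
  define f where "f k = (if k = 0 then a else if k = r + 2 then j else g (k - 1))" for k
  have "link M w (f k) (f (Suc k))" if "k \<le> Suc r" for k
    using that g c assms unfolding f_def by (cases k) auto
  moreover have "prel M w Yields (f 0) (f 1)" using g c by (simp add: f_def)
  moreover have "\<forall>k. 1 \<le> k \<and> k < Suc r \<longrightarrow> prel M w Equals (f k) (f (Suc k))"
  proof (intro allI impI)
    fix k assume k: "1 \<le> k \<and> k < Suc r"
    then have "prel M w Equals (g (k - 1)) (g (Suc (k - 1)))" using g(3) by (cases k) auto
    then show "prel M w Equals (f k) (f (Suc k))" using k by (simp add: f_def)
  qed
  moreover have "prel M w Takes (f (Suc r)) (f (Suc (Suc r)))" using g assms by (simp add: f_def)
  ultimately have "link M w (f 0) (f (Suc (Suc r)))" using link.body[of "Suc r" M w f] by auto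
  then show ?thesis by (simp add: f_def)
qed

lemma link_nonadjacent:
  assumes "link M w a j" "Suc a < j"
  shows "\<exists>b. pops M w b a \<and> link M w b j \<and> prel M w Takes b j"
  using assms
proof (cases rule: link.cases)
  case (body l f)
  have "Suc 0 \<le> k \<Longrightarrow> k \<le> l \<Longrightarrow> eq_run M w (f 1) (f k)" for k
  proof (induction k)
    case (Suc k)
    show ?case
    proof (cases "k = 0")
      case False
      then have "eq_run M w (f 1) (f k)" "link M w (f k) (f (Suc k)) \<and> prel M w Equals (f k) (f (Suc k))"
        using Suc body by auto
      then show ?thesis unfolding eq_run_def by (rule rtranclp.rtrancl_into_rtrancl)
    qed (simp add: eq_run_def)
  qed simp
  then have "eq_run M w (f 1) (f l)" using body by simp
  then have "pops M w (f l) a" unfolding pops_def using body by auto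
  then show ?thesis using body by auto
qed simp

text \<open>Iterating \<open>link_nonadjacent\<close>, every left end of a link into
  \<open>j\<close> is reached from the adjacent position \<open>j - 1\<close> by reductions. As soon
  as reductions are known to be deterministic, the left ends are therefore linearly ordered along
  the stack.\<close>

lemma link_by_pops:
  "link M w a j \<Longrightarrow> (\<lambda>b a. link M w b j \<and> prel M w Takes b j \<and> pops M w b a)\<^sup>*\<^sup>* (j - 1) a"
proof (induction "j - a" arbitrary: a rule: less_induct)
  case less
  show ?case
  proof (cases "Suc a < j")
    case True
    then obtain b where b: "pops M w b a" "link M w b j" "prel M w Takes b j"
      using link_nonadjacent[OF less.prems] by blast
    have "j - b < j - a" using pops_parent[OF b(1)] True by auto
    then show ?thesis using less.hyps[OF _ b(2)] b by (auto intro: rtranclp.rtrancl_into_rtrancl)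
  next
    case False
    then have "a = j - 1" using link_bounds[OF less.prems] by auto
    then show ?thesis by simp
  qed
qed

lemma deterministic_rtranclp:
  assumes det: "\<And>x y z. r x y \<Longrightarrow> r x z \<Longrightarrow> y = z" and "r\<^sup>*\<^sup>* x a" "r\<^sup>*\<^sup>* x b"
  shows "r\<^sup>*\<^sup>* a b \<or> r\<^sup>*\<^sup>* b a"
  using assms(2)
proof induction
  case (step y z)
  from step.IH show ?case
  proof
    assume "r\<^sup>*\<^sup>* y b"
    then show ?thesis
      by (cases rule: converse_rtranclpE) (use step det in \<open>auto intro: rtranclp.rtrancl_into_rtrancl\<close>)
  qed (use step in \<open>auto intro: rtranclp.rtrancl_into_rtrancl\<close>)
qed (use assms(3) in simp)

section \<open>Existence and uniqueness of parents\<close>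

locale opword =
  fixes M :: "'ap opm" and SL :: "'ap set" and w :: "'ap set list"
  assumes opm: "is_opm SL M" and compat: "compatible M w"
begin

abbreviation "n \<equiv> length w"
abbreviation "L \<equiv> link M w"
abbreviation "Y \<equiv> prel M w Yields"
abbreviation "E \<equiv> prel M w Equals"
abbreviation "T \<equiv> prel M w Takes"
abbreviation "pr \<equiv> parent M w"
abbreviation "en \<equiv> sub_end M w"

lemma Y_zero: "Y 0 j"
  using opm by (simp add: prel_def symb_at_def is_opm_def)

text \<open>Compatibility speaks of chains and of consecutive letters; the remaining adjacent pairs
  involve an end marker and are covered by the conventions for \<open>Hash\<close>.\<close>

lemma link_defined: "L i j \<Longrightarrow> Y i j \<or> E i j \<or> T i j"
proof -
  assume l: "L i j"
  note b = link_bounds[OF l]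
  have "M (symb_at w i) (symb_at w j) \<noteq> None"
  proof (cases "Suc i < j")
    case True
    have "[0..<n + 2] = [0..<i] @ [i..<j + 1] @ [j + 1..<n + 2]"
      using b upt_split[of 0 i "n + 2"] upt_split[of i "j + 1" "n + 2"] by (simp del: upt_Suc)
    then have "sublist (map (symb_at w) [i..<j + 1]) (map (symb_at w) [0..<n + 2])"
      unfolding sublist_def map_append[symmetric] by (intro exI) simp
    moreover have "map (symb_at w) [0..<n + 2] = Hash # map Letter w @ [Hash]"
      by (rule nth_equalityI) (auto simp: symb_at_def nth_append nth_Cons' simp del: upt_Suc)
    ultimately have "sublist (map (symb_at w) [i..<j + 1]) (Hash # map Letter w @ [Hash])" by (simp only:)
    then have "M (hd (map (symb_at w) [i..<j + 1])) (last (map (symb_at w) [i..<j + 1])) \<noteq> None"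
      using compat link_chain[OF l True] unfolding compatible_def by blast
    moreover have "hd (map (symb_at w) [i..<j + 1]) = symb_at w i" using b by (simp add: hd_map del: upt_Suc)
    moreover have "last (map (symb_at w) [i..<j + 1]) = symb_at w j" using b by simp
    ultimately show ?thesis by simp
  next
    case False
    then have j: "j = Suc i" using b by simp
    consider "i = 0" | "i = n" "i \<noteq> 0" | "0 < i" "i < n" using b j by linarith
    then show ?thesis
    proof cases
      case 3
      then have "i - 1 + 1 < n" by simp
      then have "M (Letter (w ! (i - 1))) (Letter (w ! (i - 1 + 1))) \<noteq> None"
        using compat unfolding compatible_def by blast
      then show ?thesis using 3 j by (simp add: symb_at_def)
    qed (use opm j in \<open>auto simp: symb_at_def is_opm_def\<close>)
  qed
  then obtain p where "M (symb_at w i) (symb_at w j) = Some p" by blast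
  then show ?thesis by (cases p) (auto simp: prel_def)
qed

lemma prel_excl: "\<not> (Y i j \<and> E i j)" "\<not> (Y i j \<and> T i j)" "\<not> (E i j \<and> T i j)"
  by (auto simp: prel_def)

lemma not_zero: "E i j \<Longrightarrow> 0 < i" "T i j \<Longrightarrow> 0 < i"
  using Y_zero[of j] by (auto simp: prel_def intro: gr0I)

text \<open>Climb from \<open>a\<close> through parents: an \<open>Equals\<close> edge extends the
  run, and the first \<open>Yields\<close> edge supplies the left context. The climb ends because an
  \<open>Equals\<close> edge never starts at position 0.\<close>

lemma pops_exists:
  assumes "\<And>j. 0 < j \<Longrightarrow> j \<le> a \<Longrightarrow> \<exists>i. pr i j" "0 < a"
  shows "\<exists>c. pops M w a c"
  using assms
proof (induction a rule: less_induct)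
  case (less a)
  obtain p where p: "pr p a" using less.prems by blast
  show ?case
  proof (cases "Y p a")
    case True
    then show ?thesis using p unfolding pops_def parent_def eq_run_def by blast
  next
    case False
    then have E: "E p a" "L p a" using p by (auto simp: parent_def)
    then obtain c d where "eq_run M w d p" "L c d" "Y c d"
      using less.IH[of p] less.prems not_zero(1) parent_less[OF p] by (fastforce simp: pops_def)
    then have "eq_run M w d a" using E unfolding eq_run_def by (simp add: rtranclp.rtrancl_into_rtrancl)
    then show ?thesis using \<open>L c d\<close> \<open>Y c d\<close> unfolding pops_def by blast
  qed
qed

text \<open>The leftmost link into \<open>j\<close> cannot be a \<open>Takes\<close> link, for a
  reduction would then produce a link starting further to the left.\<close>

lemma parent_exists: "0 < j \<Longrightarrow> j \<le> n + 1 \<Longrightarrow> \<exists>i. pr i j"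
proof (induction j rule: less_induct)
  case (less j)
  define a where "a = (LEAST a. L a j)"
  have "L (j - 1) j" using less adjacent[of "j - 1" w M] by auto
  then have a: "L a j" and least: "\<And>b. L b j \<Longrightarrow> a \<le> b"
    unfolding a_def by (auto intro: LeastI Least_le)
  have "\<not> T a j"
  proof
    assume T: "T a j"
    have "a < j" using link_bounds[OF a] by simp
    then obtain c where "pops M w a c" using pops_exists[of a] less not_zero(2)[OF T] by fastforce
    then show False using link_pops[OF _ a T] least pops_parent by (meson not_less)
  qed
  then show ?case using a link_defined[OF a] unfolding parent_def by blast
qed

text \<open>Every step of an \<open>Equals\<close> run is a parent edge, so the run is traced back
  from \<open>b\<close> without choice until the \<open>Yields\<close> edge. Uniqueness of parents
  is assumed only up to \<open>b\<close>, because the lemma is used inside the induction that proves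
  this uniqueness.\<close>

lemma pops_det:
  assumes uniq: "\<And>i i' j. j \<le> b \<Longrightarrow> pr i j \<Longrightarrow> pr i' j \<Longrightarrow> i = i'"
    and "pops M w b a" "pops M w b a'"
  shows "a = a'"
proof -
  obtain c c' where c: "eq_run M w c b" "L a c" "Y a c" and c': "eq_run M w c' b" "L a' c'" "Y a' c'"
    using assms by (auto simp: pops_def)
  have "eq_run M w c' b \<Longrightarrow> (\<And>i i' j. j \<le> b \<Longrightarrow> pr i j \<Longrightarrow> pr i' j \<Longrightarrow> i = i') \<Longrightarrow> a = a'"
    using c(1) unfolding eq_run_def
  proof (induction rule: rtranclp_induct)
    case base
    from base(1) show ?case
    proof (cases rule: rtranclp.cases)
      case rtrancl_refl
      then show ?thesis using c c' base(2)[of c a a'] by (auto simp: parent_def)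
    next
      case (rtrancl_into_rtrancl d)
      then show ?thesis using c base(2)[of c a d] prel_excl(1) by (auto simp: parent_def)
    qed
  next
    case (step d b)
    from step.prems(1) show ?case
    proof (cases rule: rtranclp.cases)
      case rtrancl_refl
      then show ?thesis using c' step.hyps(2) step.prems(2)[of b d a'] prel_excl(1) by (auto simp: parent_def)
    next
      case (rtrancl_into_rtrancl d')
      then have "d' = d" using step.hyps(2) step.prems(2)[of b d d'] by (auto simp: parent_def)
      moreover have "d < b" using step.hyps link_bounds by blast
      ultimately show ?thesis
        using step.IH rtrancl_into_rtrancl(1) step.prems(2)[OF order_trans[OF _ less_imp_le]] by simp
    qed
  qed
  then show ?thesis using c' uniq by blast
qed

text \<open>Both left ends lie on the reduction sequence starting at \<open>j - 1\<close>, which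
  moves to the left. So \<open>b\<close> is followed by a further reduction, and this requires
  \<open>Takes\<close> at \<open>b\<close>. The sequence is deterministic because, by induction,
  parents of positions before \<open>j\<close> are unique. Consequently only the leftmost link into
  \<open>j\<close> can be a parent edge.\<close>

lemma link_takes: "L a j \<Longrightarrow> L b j \<Longrightarrow> a < b \<Longrightarrow> T b j"
proof (induction j arbitrary: a b rule: less_induct)
  case (less j)
  have uniq: "i = i'" if "j' < j" "pr i j'" "pr i' j'" for i i' j'
    using less.IH[OF that(1), of i i'] less.IH[OF that(1), of i' i] that(2,3)
    by (cases i i' rule: linorder_cases) (auto simp: parent_def prel_def)
  let ?r = "\<lambda>b a. L b j \<and> T b j \<and> pops M w b a"
  have det: "x = y" if "?r b x" "?r b y" for b x y
  proof (rule pops_det[of b])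
    show "i = i'" if "j' \<le> b" "pr i j'" "pr i' j'" for i i' j'
      using uniq[of j' i i'] that \<open>?r b x\<close> link_bounds[of M w b j] by auto
  qed (use that in auto)
  have "?r\<^sup>*\<^sup>* a b \<or> ?r\<^sup>*\<^sup>* b a"
    by (rule deterministic_rtranclp[OF det link_by_pops[OF less.prems(1)] link_by_pops[OF less.prems(2)]])
  moreover have "y \<le> x" if "?r\<^sup>*\<^sup>* x y" for x y
    using that by induction (auto dest: pops_parent)
  ultimately have "?r\<^sup>*\<^sup>* b a" using less.prems(3) leD by blast
  then show ?case by (cases rule: converse_rtranclpE) (use less.prems in auto)
qed

lemma parent_unique: "pr i j \<Longrightarrow> pr i' j \<Longrightarrow> i = i'"
  using link_takes[of i j i'] link_takes[of i' j i]
  by (cases i i' rule: linorder_cases) (auto simp: parent_def prel_def)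

section \<open>Subtrees as intervals of positions\<close>

lemma link_ancestor: "L i j \<Longrightarrow> pr\<^sup>*\<^sup>* i (j - 1)"
proof -
  assume "L i j"
  from link_by_pops[OF this] show ?thesis
  proof induction
    case (step b a)
    then show ?case using pops_parent[of M w b a] rtranclp_trans[of pr a b "j - 1"] by blast
  qed simp
qed

lemma ancestor_pred: "pr\<^sup>*\<^sup>* i j \<Longrightarrow> i < j \<Longrightarrow> pr\<^sup>*\<^sup>* i (j - 1)"
proof -
  assume "pr\<^sup>*\<^sup>* i j" and lt: "i < j"
  then show ?thesis
  proof (cases rule: rtranclp.cases)
    case (rtrancl_into_rtrancl p)
    then show ?thesis
      using link_ancestor[of p j] rtranclp_trans[of pr i p "j - 1"] by (simp add: parent_def)
  qed (use lt in auto)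
qed

text \<open>Step back from \<open>j\<close> one position at a time: by \<open>link_ancestor\<close>
  the position before a child of \<open>p\<close> still lies in the subtree of \<open>p\<close>.
  This is why the order of positions is a preorder traversal.\<close>

lemma ancestor_interval: "pr\<^sup>*\<^sup>* i j \<Longrightarrow> i \<le> k \<Longrightarrow> k \<le> j \<Longrightarrow> pr\<^sup>*\<^sup>* i k"
proof (induction "j - k" arbitrary: j)
  case (Suc d)
  then have "i < j" by auto
  then show ?case using Suc.hyps(1)[of "j - 1"] ancestor_pred[OF Suc.prems(1)] Suc.hyps(2) Suc.prems by simp
qed simp

lemma en_exists: "i \<le> n + 1 \<Longrightarrow> i < n + 2 \<and> \<not> pr\<^sup>*\<^sup>* i (n + 2)"
  using ancestor_bound[of M w i "n + 2"] by auto

lemma en_not: "i \<le> n + 1 \<Longrightarrow> i < en i \<and> \<not> pr\<^sup>*\<^sup>* i (en i)"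
  unfolding sub_end_def using LeastI[of "\<lambda>k. i < k \<and> \<not> pr\<^sup>*\<^sup>* i k", OF en_exists] by simp

lemma en_le: "i \<le> n + 1 \<Longrightarrow> en i \<le> n + 2"
  unfolding sub_end_def by (rule Least_le) (rule en_exists)

lemma ancestor_iff: "i \<le> n + 1 \<Longrightarrow> pr\<^sup>*\<^sup>* i k \<longleftrightarrow> i \<le> k \<and> k < en i"
proof
  assume i: "i \<le> n + 1" and a: "pr\<^sup>*\<^sup>* i k"
  show "i \<le> k \<and> k < en i"
  proof
    show "i \<le> k" using ancestor_le[OF a] .
    show "k < en i"
    proof (rule ccontr)
      assume "\<not> k < en i"
      then show False using ancestor_interval[OF a, of "en i"] en_not[OF i] by auto
    qed
  qed
next
  assume "i \<le> n + 1" and k: "i \<le> k \<and> k < en i"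
  then show "pr\<^sup>*\<^sup>* i k"
    using not_less_Least[of k "\<lambda>k. i < k \<and> \<not> pr\<^sup>*\<^sup>* i k"] unfolding sub_end_def by (cases "i = k") auto
qed

lemma en_nested: "i \<le> k \<Longrightarrow> k < en i \<Longrightarrow> i \<le> n + 1 \<Longrightarrow> en k \<le> en i"
proof (rule ccontr)
  assume a: "i \<le> k" "k < en i" "i \<le> n + 1" "\<not> en k \<le> en i"
  then have "k \<le> n + 1" using en_le[of i] by simp
  then have "pr\<^sup>*\<^sup>* k (en i)" using a ancestor_iff by simp
  moreover have "pr\<^sup>*\<^sup>* i k" using a ancestor_iff by simp
  ultimately show False using en_not[OF a(3)] rtranclp_trans[of pr i k "en i"] by simp
qed

lemma root_ancestor: "j \<le> n + 1 \<Longrightarrow> pr\<^sup>*\<^sup>* 0 j"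
proof (induction j rule: less_induct)
  case (less j)
  show ?case
  proof (cases "j = 0")
    case False
    then obtain i where i: "pr i j" using parent_exists[of j] less.prems by auto
    then have "pr\<^sup>*\<^sup>* 0 i" using less parent_less[OF i] by simp
    then show ?thesis using i by (rule rtranclp.rtrancl_into_rtrancl)
  qed simp
qed

lemma en_zero: "en 0 = n + 2"
proof -
  have "n + 1 < en 0" using root_ancestor[of "n + 1"] ancestor_iff[of 0 "n + 1"] by simp
  then show ?thesis using en_le[of 0] by simp
qed

text \<open>Describes parents by subtree ends alone; the tree can henceforth be treated as a family
  of nested intervals, without reference to chains.\<close>

lemma parent_iff:
  assumes "i \<le> n + 1"
  shows "pr i j \<longleftrightarrow> i < j \<and> j < en i \<and> (\<forall>c. i < c \<and> c < j \<longrightarrow> en c \<le> j)"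
proof
  assume p: "pr i j"
  have j: "i < j" "j \<le> n + 1" using parent_less[OF p] by auto
  have "pr\<^sup>*\<^sup>* i j" using p by auto
  then have "j < en i" using ancestor_iff[OF assms] by simp
  moreover have "en c \<le> j" if c: "i < c" "c < j" for c
  proof (rule ccontr)
    assume "\<not> en c \<le> j"
    then have "pr\<^sup>*\<^sup>* c j" using ancestor_iff[of c j] c j by simp
    then show False
    proof (cases rule: rtranclp.cases)
      case (rtrancl_into_rtrancl q)
      then have "q = i" using parent_unique p by blast
      then show ?thesis using rtrancl_into_rtrancl ancestor_le[of M w c q] c by simp
    qed (use c in simp)
  qed
  ultimately show "i < j \<and> j < en i \<and> (\<forall>c. i < c \<and> c < j \<longrightarrow> en c \<le> j)" using j by blast
next
  assume a: "i < j \<and> j < en i \<and> (\<forall>c. i < c \<and> c < j \<longrightarrow> en c \<le> j)"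
  then have "pr\<^sup>*\<^sup>* i j" using ancestor_iff[OF assms] by simp
  then show "pr i j"
  proof (cases rule: rtranclp.cases)
    case (rtrancl_into_rtrancl q)
    have q: "i \<le> q" "q < j" "q \<le> n + 1" "j \<le> n + 1"
      using ancestor_le[OF rtrancl_into_rtrancl(1)] parent_less[OF rtrancl_into_rtrancl(2)] by auto
    have "pr\<^sup>*\<^sup>* q j" using rtrancl_into_rtrancl by auto
    then have "j < en q" using ancestor_iff[OF q(3)] by simp
    moreover have "en q \<le> j" if "i < q" using a q that by blast
    ultimately have "i = q" using q by fastforce
    then show ?thesis using rtrancl_into_rtrancl by simp
  qed (use a in simp)
qed

text \<open>If a child \<open>d\<close> followed directly after the subtree of \<open>c\<close>, the
  link from \<open>i\<close> to \<open>d\<close> would be a chain whose body starts with the child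
  of \<open>i\<close> whose subtree contains \<open>d - 1\<close>, that is with \<open>c\<close>.
  But the body of a chain starts with a \<open>Yields\<close> edge.\<close>

lemma equal_child_last:
  assumes p: "pr i c" and e: "E i c"
  shows "en c = en i"
proof (rule ccontr)
  assume ne: "en c \<noteq> en i"
  have ic: "i < c" "c \<le> n + 1" "i \<le> n + 1" using parent_less[OF p] by auto
  note pi = p[unfolded parent_iff[OF ic(3)]]
  have lt: "en c < en i" using en_nested[of i c] pi ic ne by simp
  define d where "d = en c"
  have cd: "c < d" using en_not[OF ic(2)] d_def by simp
  have di: "pr i d" unfolding parent_iff[OF ic(3)]
  proof (intro conjI allI impI)
    show "i < d" "d < en i" using ic cd lt d_def by auto
    fix x assume x: "i < x \<and> x < d"
    consider "x < c" | "c \<le> x" by linarith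
    then show "en x \<le> d"
    proof cases
      case 1
      then show ?thesis using pi x cd by fastforce
    next
      case 2
      then show ?thesis using en_nested[of c x] x ic d_def by simp
    qed
  qed
  have l: "L i d" "Suc i < d" using di ic cd by (auto simp: parent_def)
  obtain b where b: "pops M w b i" "L b d" using link_nonadjacent[OF l] by blast
  then obtain c1 where c1: "eq_run M w c1 b" "L i c1" "Y i c1" by (auto simp: pops_def)
  have pc1: "pr i c1" using c1 by (simp add: parent_def)
  have "pr\<^sup>*\<^sup>* c1 (d - 1)" using rtranclp_trans[OF eq_run_parent[OF c1(1)] link_ancestor[OF b(2)]] .
  moreover have "c1 \<le> n + 1" using parent_less[OF pc1] by simp
  ultimately have dc: "c1 \<le> d - 1" "d - 1 < en c1" using ancestor_iff[of c1 "d - 1"] by auto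
  have "c1 = c"
  proof (rule ccontr)
    assume "c1 \<noteq> c"
    then consider "c1 < c" | "c < c1" by linarith
    then show False
    proof cases
      case 1
      then show ?thesis using pi parent_less[OF pc1] dc cd by fastforce
    next
      case 2
      then show ?thesis using pc1[unfolded parent_iff[OF ic(3)]] ic dc d_def cd by fastforce
    qed
  qed
  then show False using c1 e prel_excl(1) by blast
qed

text \<open>Parents are unique, so the branch from \<open>c\<close> down to \<open>b\<close> is the
  run itself, and each of its edges is an \<open>Equals\<close> edge.\<close>

lemma eq_run_step:
  "eq_run M w c b \<Longrightarrow> pr\<^sup>*\<^sup>* c i \<Longrightarrow> pr i c1 \<Longrightarrow> pr\<^sup>*\<^sup>* c1 b \<Longrightarrow> E i c1"
  unfolding eq_run_def
proof (induction rule: rtranclp_induct)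
  case base
  then show ?case using ancestor_le[of M w c1 c] ancestor_le[of M w c i] parent_less[of M w i c1] by simp
next
  case (step d b)
  have db: "pr d b" using step by (auto simp: parent_def)
  from \<open>pr\<^sup>*\<^sup>* c1 b\<close> show ?case
  proof (cases rule: rtranclp.cases)
    case rtrancl_refl
    then show ?thesis using parent_unique[OF db] step by auto
  next
    case (rtrancl_into_rtrancl q)
    then have "q = d" using parent_unique[OF db] by simp
    then show ?thesis using step rtrancl_into_rtrancl by simp
  qed
qed

lemma ancestor_comparable: "pr\<^sup>*\<^sup>* a b \<Longrightarrow> pr\<^sup>*\<^sup>* a' b \<Longrightarrow> a \<le> a' \<Longrightarrow> pr\<^sup>*\<^sup>* a a'"
  using ancestor_interval[of a b a'] ancestor_le[of M w a' b] by simp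

text \<open>Links that are no tree edges are \<open>Takes\<close> links and go to the end of the
  subtree. Within the bounds such a link is missing exactly if some child is an
  \<open>Equals\<close> child: this child is the last one, whereas a chain from \<open>i\<close>
  would have to begin with a \<open>Yields\<close> edge to the last child.\<close>

lemma link_iff:
  "L i j \<longleftrightarrow> pr i j \<or> j = en i \<and> i \<le> n \<and> j \<le> n + 1 \<and> \<not> (\<exists>c. pr i c \<and> E i c)"
proof
  assume l: "L i j"
  have ij: "i < j" "j \<le> n + 1" "i \<le> n + 1" using link_bounds[OF l] by auto
  show "pr i j \<or> j = en i \<and> i \<le> n \<and> j \<le> n + 1 \<and> \<not> (\<exists>c. pr i c \<and> E i c)"
  proof (cases "pr i j")
    case False
    then have t: "T i j" using l link_defined[OF l] by (auto simp: parent_def)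
    have "j - 1 < en i" using link_ancestor[OF l] ancestor_iff[OF ij(3)] by simp
    moreover have "\<not> j < en i"
    proof
      assume "j < en i"
      then have "pr\<^sup>*\<^sup>* i j" using ancestor_iff[OF ij(3)] ij by simp
      then show False
      proof (cases rule: rtranclp.cases)
        case (rtrancl_into_rtrancl p)
        then have "i \<le> p" "p \<noteq> i" using ancestor_le[of M w i p] False by auto
        then have "T p j" using link_takes[OF l, of p] rtrancl_into_rtrancl by (simp add: parent_def)
        then show ?thesis using rtrancl_into_rtrancl(2) prel_excl by (auto simp: parent_def)
      qed (use ij in simp)
    qed
    ultimately have je: "j = en i" using ij by simp
    have "\<not> (\<exists>c. pr i c \<and> E i c)"
    proof
      assume "\<exists>c. pr i c \<and> E i c"
      then obtain c where c: "pr i c" "E i c" by blast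
      have ce: "en c = en i" using equal_child_last c by blast
      note pc = c(1)[unfolded parent_iff[OF ij(3)]]
      have "Suc i < j" using pc je by linarith
      then obtain b where b: "pops M w b i" "L b j" using link_nonadjacent[OF l] by blast
      then obtain c1 where c1: "eq_run M w c1 b" "L i c1" "Y i c1" by (auto simp: pops_def)
      have pc1: "pr i c1" using c1 by (simp add: parent_def)
      note pc1' = pc1[unfolded parent_iff[OF ij(3)]]
      have "pr\<^sup>*\<^sup>* c1 (j - 1)" using rtranclp_trans[OF eq_run_parent[OF c1(1)] link_ancestor[OF b(2)]] .
      moreover have "c1 \<le> n + 1" using parent_less[OF pc1] by simp
      ultimately have dc: "c1 \<le> j - 1" "j - 1 < en c1" using ancestor_iff[of c1 "j - 1"] by auto
      have "c \<noteq> c1" using c(2) c1(3) prel_excl(1) by blast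
      then consider "c < c1" | "c1 < c" by linarith
      then show False
      proof cases
        case 1
        then have "en c \<le> c1" using pc1' pc by blast
        then show ?thesis using ce pc1' by simp
      next
        case 2
        then have "en c1 \<le> c" using pc1' pc by blast
        then show ?thesis using dc pc je by linarith
      qed
    qed
    then show ?thesis using je ij by simp
  qed simp
next
  assume "pr i j \<or> j = en i \<and> i \<le> n \<and> j \<le> n + 1 \<and> \<not> (\<exists>c. pr i c \<and> E i c)"
  then show "L i j"
  proof
    assume a: "j = en i \<and> i \<le> n \<and> j \<le> n + 1 \<and> \<not> (\<exists>c. pr i c \<and> E i c)"
    then have i1: "i \<le> n + 1" and ie: "i < j" using en_not[of i] by auto
    show ?thesis
    proof (cases "j = Suc i")
      case True
      then show ?thesis using a link.adjacent[of i w M] by simp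
    next
      case False
      have "pr\<^sup>*\<^sup>* i (j - 1)" using ancestor_iff[OF i1] a ie by simp
      then obtain c1 where c1: "pr i c1" "pr\<^sup>*\<^sup>* c1 (j - 1)"
        by (cases rule: converse_rtranclpE) (use False ie in auto)
      have yc: "Y i c1" using a c1 by (auto simp: parent_def)
      have c1n: "c1 \<le> n + 1" "i < c1" using parent_less[OF c1(1)] by auto
      have c1j: "c1 \<le> j - 1" "j - 1 < en c1" using c1(2) ancestor_iff[OF c1n(1)] by auto
      \<comment> \<open>Leftmost link into \<open>j\<close> among those starting at or after the
        last child \<open>c1\<close>. It is no tree edge, so a reduction applies to it, and the
        exposed left end \<open>x\<close> lies before \<open>c1\<close>; it will turn out to be
        \<open>i\<close>.\<close>
      define b where "b = (LEAST b. L b j \<and> c1 \<le> b)"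
      have "L (j - 1) j \<and> c1 \<le> j - 1" using link.adjacent[of "j - 1" w M] a c1j ie by auto
      then have b: "L b j" "c1 \<le> b" and least: "\<And>x. L x j \<Longrightarrow> c1 \<le> x \<Longrightarrow> b \<le> x"
        unfolding b_def using LeastI[of "\<lambda>b. L b j \<and> c1 \<le> b" "j - 1"]
        by (blast, blast, simp add: Least_le)
      have bj: "b < j" using link_bounds[OF b(1)] by simp
      have c1b: "pr\<^sup>*\<^sup>* c1 b" using ancestor_iff[OF c1n(1)] b c1j bj by simp
      have "\<not> pr b j"
      proof
        assume "pr b j"
        then have "pr\<^sup>*\<^sup>* i j" using c1(1) c1b
          by (meson converse_rtranclp_into_rtranclp rtranclp.rtrancl_into_rtrancl)
        then show False using ancestor_iff[OF i1] a by simp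
      qed
      then have tb: "T b j" using link_defined[OF b(1)] b(1) by (auto simp: parent_def)
      have "b \<le> n + 1" using bj a by simp
      then obtain x where x: "pops M w b x"
        using pops_exists[of b] parent_exists not_zero(2)[OF tb] by (meson le_trans)
      have lx: "L x j" using link_pops[OF x b(1) tb] .
      have xb: "x < b" "pr\<^sup>*\<^sup>* x b" using pops_parent[OF x] by auto
      have xc: "x < c1" using least[OF lx] xb by linarith
      obtain c' where c': "eq_run M w c' b" "L x c'" "Y x c'" using x by (auto simp: pops_def)
      have pc': "pr x c'" using c' by (simp add: parent_def)
      have "pr\<^sup>*\<^sup>* i b" using c1(1) c1b by (rule converse_rtranclp_into_rtranclp)
      \<comment> \<open>Otherwise the \<open>Equals\<close> run that ends in \<open>b\<close> begins
        at \<open>i\<close> or above it and so passes through the edge from \<open>i\<close> to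
        \<open>c1\<close>, which is a \<open>Yields\<close> edge.\<close>
      have "x = i"
      proof (rule ccontr)
        assume ne: "x \<noteq> i"
        have "pr\<^sup>*\<^sup>* x c1" using ancestor_comparable[OF xb(2) c1b] xc by simp
        then have xi: "pr\<^sup>*\<^sup>* x i"
        proof (cases rule: rtranclp.cases)
          case (rtrancl_into_rtrancl q)
          then show ?thesis using parent_unique[OF c1(1)] by auto
        qed (use xc in simp)
        have "pr\<^sup>*\<^sup>* c' i"
        proof -
          from xi ne obtain q where q: "pr x q" "pr\<^sup>*\<^sup>* q i"
            by (cases rule: converse_rtranclpE) auto
          have qb: "pr\<^sup>*\<^sup>* q b" using rtranclp_trans[OF q(2) \<open>pr\<^sup>*\<^sup>* i b\<close>] .
          have xn: "x \<le> n + 1" using parent_less[OF pc'] by simp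
          have bn: "b < en q" "b < en c'"
            using ancestor_iff[of q b] qb ancestor_iff[of c' b] eq_run_parent[OF c'(1)]
              parent_less[OF q(1)] parent_less[OF pc'] by auto
          have "q = c'"
          proof (rule ccontr)
            assume "q \<noteq> c'"
            then consider "q < c'" | "c' < q" by linarith
            then show False
            proof cases
              case 1
              then have "en q \<le> c'" using pc'[unfolded parent_iff[OF xn]] parent_less[OF q(1)] by blast
              then show ?thesis using bn ancestor_le[OF eq_run_parent[OF c'(1)]] by simp
            next
              case 2
              then have "en c' \<le> q" using q(1)[unfolded parent_iff[OF xn]] parent_less[OF pc'] by blast
              then show ?thesis using bn ancestor_le[OF qb] by simp
            qed
          qed
          then show ?thesis using q by simp
        qed
        then have "E i c1" using eq_run_step[OF c'(1) _ c1(1) c1b] by blast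
        then show False using yc prel_excl(1) by blast
      qed
      then show ?thesis using lx by simp
    qed
  qed (simp add: parent_def)
qed

text \<open>A link from \<open>c\<close>, of either kind, ends no later than the subtree of
  \<open>c\<close>, and a link passing over \<open>c\<close> passes over this whole subtree.\<close>

lemma link_noncrossing: "L a b \<Longrightarrow> L c d \<Longrightarrow> a < c \<Longrightarrow> c < b \<Longrightarrow> d \<le> b"
proof -
  assume l: "L a b" "L c d" and c: "a < c" "c < b"
  have n: "a \<le> n + 1" "c \<le> n + 1" using link_bounds[OF l(1)] link_bounds[OF l(2)] by auto
  have "d \<le> en c" using l(2)[unfolded link_iff] parent_iff[OF n(2)] by auto
  moreover have "en c \<le> b"
    using l(1)[unfolded link_iff]
  proof
    assume "pr a b"
    then show ?thesis using parent_iff[OF n(1)] c by blast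
  next
    assume "b = en a \<and> a \<le> n \<and> b \<le> n + 1 \<and> \<not> (\<exists>c. pr a c \<and> E a c)"
    then show ?thesis using en_nested[of a c] c n by simp
  qed
  ultimately show ?thesis by simp
qed

end

section \<open>Until and since along summary and hierarchical paths\<close>

text \<open>Until puts its guard on the sources of the steps and since on the targets; hence this
  lemma and its twin \<open>list_path_tgt\<close>.\<close>

lemma list_path_src:
  "(\<exists>p. p \<noteq> [] \<and> hd p = i \<and> last p = j \<and> successively S p \<and> (\<forall>k\<in>set (butlast p). F k)) \<longleftrightarrow>
   (\<lambda>a b. S a b \<and> F a)\<^sup>*\<^sup>* i j"
proof
  assume "\<exists>p. p \<noteq> [] \<and> hd p = i \<and> last p = j \<and> successively S p \<and> (\<forall>k\<in>set (butlast p). F k)"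
  then obtain p where "p \<noteq> []" "hd p = i" "last p = j" "successively S p" "\<forall>k\<in>set (butlast p). F k" by blast
  then show "(\<lambda>a b. S a b \<and> F a)\<^sup>*\<^sup>* i j"
  proof (induction p arbitrary: i)
    case (Cons a p)
    show ?case
    proof (cases "p = []")
      case False
      have 1: "(\<lambda>a b. S a b \<and> F a)\<^sup>*\<^sup>* (hd p) j"
        by (rule Cons.IH[OF False refl]) (use Cons.prems False in \<open>simp_all add: successively_Cons\<close>)
      have 2: "S a (hd p) \<and> F a" using Cons.prems False by (simp add: successively_Cons)
      have "(\<lambda>a b. S a b \<and> F a)\<^sup>*\<^sup>* a j"
        using 2 1 by (rule converse_rtranclp_into_rtranclp[of "\<lambda>a b. S a b \<and> F a"])
      then show ?thesis using Cons.prems by simp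
    qed (use Cons.prems in auto)
  qed simp
next
  assume "(\<lambda>a b. S a b \<and> F a)\<^sup>*\<^sup>* i j"
  then show "\<exists>p. p \<noteq> [] \<and> hd p = i \<and> last p = j \<and> successively S p \<and> (\<forall>k\<in>set (butlast p). F k)"
  proof (induction rule: converse_rtranclp_induct)
    case base
    show ?case by (rule exI[of _ "[j]"]) simp
  next
    case (step a b)
    then obtain p where "p \<noteq> []" "hd p = b" "last p = j" "successively S p" "\<forall>k\<in>set (butlast p). F k" by blast
    then show ?case using step.hyps(1) by (intro exI[of _ "a # p"]) (auto simp: successively_Cons)
  qed
qed

lemma list_path_tgt:
  "(\<exists>p. p \<noteq> [] \<and> hd p = i \<and> last p = j \<and> successively S p \<and> (\<forall>k\<in>set (tl p). F k)) \<longleftrightarrow>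
   (\<lambda>a b. S a b \<and> F b)\<^sup>*\<^sup>* i j"
proof
  assume "\<exists>p. p \<noteq> [] \<and> hd p = i \<and> last p = j \<and> successively S p \<and> (\<forall>k\<in>set (tl p). F k)"
  then obtain p where "p \<noteq> []" "hd p = i" "last p = j" "successively S p" "\<forall>k\<in>set (tl p). F k" by blast
  then show "(\<lambda>a b. S a b \<and> F b)\<^sup>*\<^sup>* i j"
  proof (induction p arbitrary: i)
    case (Cons a p)
    show ?case
    proof (cases "p = []")
      case False
      have t: "\<forall>k\<in>set (tl p). F k" "F (hd p)" using Cons.prems(5) False by (cases p; simp)+
      have 1: "(\<lambda>a b. S a b \<and> F b)\<^sup>*\<^sup>* (hd p) j"
        by (rule Cons.IH[OF False refl _ _ t(1)]) (use Cons.prems False in \<open>simp_all add: successively_Cons\<close>)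
      have 2: "S a (hd p) \<and> F (hd p)" using Cons.prems False t by (simp add: successively_Cons)
      have "(\<lambda>a b. S a b \<and> F b)\<^sup>*\<^sup>* a j"
        using 2 1 by (rule converse_rtranclp_into_rtranclp[of "\<lambda>a b. S a b \<and> F b"])
      then show ?thesis using Cons.prems by simp
    qed (use Cons.prems in auto)
  qed simp
next
  assume "(\<lambda>a b. S a b \<and> F b)\<^sup>*\<^sup>* i j"
  then show "\<exists>p. p \<noteq> [] \<and> hd p = i \<and> last p = j \<and> successively S p \<and> (\<forall>k\<in>set (tl p). F k)"
  proof (induction rule: converse_rtranclp_induct)
    case base
    show ?case by (rule exI[of _ "[j]"]) simp
  next
    case (step a b)
    then obtain p where p: "p \<noteq> []" "hd p = b" "last p = j" "successively S p" "\<forall>k\<in>set (tl p). F k" by blast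
    have "\<forall>k\<in>set p. F k" using p(1,2,5) step.hyps(1) by (cases p) auto
    then show ?case using p step.hyps(1) by (intro exI[of _ "a # p"]) (auto simp: successively_Cons)
  qed
qed

text \<open>Step of a summary path whose final position is \<open>j\<close>. The jump taken depends
  on \<open>j\<close>, so every target has its own step relation.\<close>

definition sstep :: "'ap opm \<Rightarrow> 'ap set list \<Rightarrow> prec set \<Rightarrow> nat \<Rightarrow> nat \<Rightarrow> nat \<Rightarrow> bool" where
  "sstep M w \<Pi> j a b \<longleftrightarrow> (if {h. h \<le> j \<and> chi M w a h \<and> rel M w \<Pi> a h} \<noteq> {}
     then b = Max {h. h \<le> j \<and> chi M w a h \<and> rel M w \<Pi> a h} else b = a + 1 \<and> rel M w \<Pi> a (a + 1))"

lemma finite_jumps: "finite {h. h \<le> j \<and> chi M w a h \<and> rel M w \<Pi> a h}"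
  by (rule finite_subset[of _ "{..j}"]) auto

lemma chi_bounds: "chi M w i j \<Longrightarrow> Suc i < j \<and> j \<le> length w + 1"
  unfolding chi_def positions_def by simp

lemma sstep_cases:
  assumes "sstep M w \<Pi> j a b"
  shows "b \<le> j \<and> chi M w a b \<and> rel M w \<Pi> a b \<and> (\<forall>h. h \<le> j \<and> chi M w a h \<and> rel M w \<Pi> a h \<longrightarrow> h \<le> b) \<or>
    b = a + 1 \<and> rel M w \<Pi> a (a + 1) \<and> \<not> (\<exists>h. h \<le> j \<and> chi M w a h \<and> rel M w \<Pi> a h)"
proof (cases "{h. h \<le> j \<and> chi M w a h \<and> rel M w \<Pi> a h} = {}")
  case True
  then show ?thesis using assms unfolding sstep_def by auto
next
  case False
  then have b: "b = Max {h. h \<le> j \<and> chi M w a h \<and> rel M w \<Pi> a h}" using assms unfolding sstep_def by simp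
  have "b \<in> {h. h \<le> j \<and> chi M w a h \<and> rel M w \<Pi> a h}" unfolding b by (rule Max_in[OF finite_jumps False])
  moreover have "\<forall>h. h \<le> j \<and> chi M w a h \<and> rel M w \<Pi> a h \<longrightarrow> h \<le> b" unfolding b using Max_ge[OF finite_jumps] by blast
  ultimately show ?thesis by blast
qed

lemma sstep_jumpI:
  assumes "b \<le> j" "chi M w a b" "rel M w \<Pi> a b" "\<And>h. h \<le> j \<Longrightarrow> chi M w a h \<Longrightarrow> rel M w \<Pi> a h \<Longrightarrow> h \<le> b"
  shows "sstep M w \<Pi> j a b"
proof -
  have "Max {h. h \<le> j \<and> chi M w a h \<and> rel M w \<Pi> a h} = b"
    by (rule Max_eqI[OF finite_jumps]) (use assms in auto)
  moreover have "{h. h \<le> j \<and> chi M w a h \<and> rel M w \<Pi> a h} \<noteq> {}" using assms(1-3) by blast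
  ultimately show ?thesis unfolding sstep_def by simp
qed

lemma sstep_sucI:
  assumes "rel M w \<Pi> a (a + 1)" "\<And>h. h \<le> j \<Longrightarrow> chi M w a h \<Longrightarrow> rel M w \<Pi> a h \<Longrightarrow> False"
  shows "sstep M w \<Pi> j a (a + 1)"
proof -
  have "{h. h \<le> j \<and> chi M w a h \<and> rel M w \<Pi> a h} = {}" using assms(2) by blast
  then show ?thesis using assms(1) unfolding sstep_def by simp
qed

lemma sstep_less: "sstep M w \<Pi> j a b \<Longrightarrow> a < b"
proof -
  assume "sstep M w \<Pi> j a b"
  from sstep_cases[OF this] show "a < b"
  proof
    assume "b \<le> j \<and> chi M w a b \<and> rel M w \<Pi> a b \<and> (\<forall>h. h \<le> j \<and> chi M w a h \<and> rel M w \<Pi> a h \<longrightarrow> h \<le> b)"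
    then have "chi M w a b" by blast
    from chi_bounds[OF this] show ?thesis by simp
  qed simp
qed

lemma successively_less: "successively (sstep M w \<Pi> j) p \<Longrightarrow> sorted_wrt (<) p"
proof -
  assume "successively (sstep M w \<Pi> j) p"
  then have "successively (<) p" by (rule successively_mono) (rule sstep_less)
  then show ?thesis by (simp add: successively_conv_sorted_wrt[of "(<)"])
qed

lemma sorted_le_last: "sorted_wrt (<) p \<Longrightarrow> k \<in> set p \<Longrightarrow> k \<le> last (p :: nat list)"
proof (induction p)
  case (Cons a p)
  show ?case
  proof (cases "p = []")
    case False
    then have "a < last p" using Cons.prems(1) last_in_set[of p] by simp
    moreover have "k \<le> last p" if "k \<noteq> a" using Cons that by simp
    ultimately show ?thesis using False by (cases "k = a") (simp_all add: less_imp_le)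
  qed (use Cons.prems in simp)
qed simp

text \<open>Steps increase, so the ordering of the path and the bound by its final position come for
  free; only the final position has to be checked to lie in the word.\<close>

lemma summary_path_iff:
  "summary_path M w \<Pi> i j p \<longleftrightarrow> p \<noteq> [] \<and> hd p = i \<and> last p = j \<and> successively (sstep M w \<Pi> j) p \<and> j \<in> positions w"
proof -
  have 1: "(\<forall>q. q + 1 < length p \<longrightarrow>
        (let K = {h. h \<le> j \<and> chi M w (p ! q) h \<and> rel M w \<Pi> (p ! q) h}
         in if K \<noteq> {} then p ! (q + 1) = Max K
            else p ! (q + 1) = p ! q + 1 \<and> rel M w \<Pi> (p ! q) (p ! q + 1))) \<longleftrightarrow> successively (sstep M w \<Pi> j) p"
    unfolding successively_conv_nth sstep_def Let_def by simp
  have 2: "path w i j p" if "p \<noteq> []" "hd p = i" "last p = j" "successively (sstep M w \<Pi> j) p" "j \<in> positions w"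
  proof -
    have s: "sorted_wrt (<) p" using successively_less that(4) by blast
    have "set p \<subseteq> positions w"
    proof
      fix k assume "k \<in> set p"
      then have "k \<le> last p" by (rule sorted_le_last[OF s])
      then show "k \<in> positions w" using that(3,5) unfolding positions_def by simp
    qed
    then show ?thesis using that s unfolding path_def by blast
  qed
  have 3: "j \<in> positions w" if "path w i j p"
  proof -
    have p: "p \<noteq> []" "last p = j" "set p \<subseteq> positions w" using that unfolding path_def by simp_all
    show ?thesis using last_in_set[OF p(1)] p(2,3) by auto
  qed
  have "summary_path M w \<Pi> i j p \<longleftrightarrow> path w i j p \<and> successively (sstep M w \<Pi> j) p"
    unfolding summary_path_def 1 ..
  moreover have "p \<noteq> [] \<and> hd p = i \<and> last p = j" if "path w i j p" using that unfolding path_def by simp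
  ultimately show ?thesis using 2 3 by argo
qed

lemma until_summary:
  assumes "i \<in> positions w"
  shows "until_sat (summary_path M w \<Pi>) F G i \<longleftrightarrow>
    (\<exists>j\<in>positions w. (\<lambda>a b. sstep M w \<Pi> j a b \<and> F a)\<^sup>*\<^sup>* i j \<and> G j)"
proof -
  have le: "i \<le> j" if "(\<lambda>a b. sstep M w \<Pi> j a b \<and> F a)\<^sup>*\<^sup>* i j" for j
    using that by (induction rule: converse_rtranclp_induct) (auto dest: sstep_less)
  show ?thesis
  proof
    assume "until_sat (summary_path M w \<Pi>) F G i"
    then obtain j p where sp: "summary_path M w \<Pi> i j p" and F: "\<forall>k\<in>set (butlast p). F k" and G: "G (last p)"
      unfolding until_sat_def by blast
    note s = sp[unfolded summary_path_iff]
    have "\<exists>p. p \<noteq> [] \<and> hd p = i \<and> last p = j \<and> successively (sstep M w \<Pi> j) p \<and> (\<forall>k\<in>set (butlast p). F k)"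
      by (rule exI[of _ p]) (use s F in simp)
    then have "(\<lambda>a b. sstep M w \<Pi> j a b \<and> F a)\<^sup>*\<^sup>* i j" unfolding list_path_src .
    moreover have "j \<in> positions w" "G j" using s G by auto
    ultimately show "\<exists>j\<in>positions w. (\<lambda>a b. sstep M w \<Pi> j a b \<and> F a)\<^sup>*\<^sup>* i j \<and> G j" by (intro bexI conjI)
  next
    assume "\<exists>j\<in>positions w. (\<lambda>a b. sstep M w \<Pi> j a b \<and> F a)\<^sup>*\<^sup>* i j \<and> G j"
    then obtain j where j: "j \<in> positions w" "(\<lambda>a b. sstep M w \<Pi> j a b \<and> F a)\<^sup>*\<^sup>* i j" "G j" by (elim bexE conjE)
    from j(2) obtain p where p: "p \<noteq> []" "hd p = i" "last p = j" "successively (sstep M w \<Pi> j) p" "\<forall>k\<in>set (butlast p). F k"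
      unfolding list_path_src[symmetric] by (elim exE conjE)
    have "summary_path M w \<Pi> i j p" unfolding summary_path_iff using p j(1) by simp
    then show "until_sat (summary_path M w \<Pi>) F G i" unfolding until_sat_def
      using le[OF j(2)] p(5) j(3)[folded p(3)] by (intro exI[of _ j] conjI exI[of _ p])
  qed
qed

lemma since_summary:
  assumes "i \<in> positions w"
  shows "since_sat (summary_path M w \<Pi>) F G i \<longleftrightarrow>
    (\<exists>j\<in>positions w. (\<lambda>a b. sstep M w \<Pi> i a b \<and> F b)\<^sup>*\<^sup>* j i \<and> G j)"
proof -
  have le: "j \<le> i" if "(\<lambda>a b. sstep M w \<Pi> i a b \<and> F b)\<^sup>*\<^sup>* j i" for j
    using that by (induction rule: converse_rtranclp_induct) (auto dest: sstep_less)
  then have lp: "j \<in> positions w" if "(\<lambda>a b. sstep M w \<Pi> i a b \<and> F b)\<^sup>*\<^sup>* j i" for j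
    using le[OF that] assms unfolding positions_def by simp
  show ?thesis
  proof
    assume "since_sat (summary_path M w \<Pi>) F G i"
    then obtain j p where sp: "summary_path M w \<Pi> j i p" and F: "\<forall>k\<in>set (tl p). F k" and G: "G (hd p)"
      unfolding since_sat_def by blast
    note s = sp[unfolded summary_path_iff]
    have "\<exists>p. p \<noteq> [] \<and> hd p = j \<and> last p = i \<and> successively (sstep M w \<Pi> i) p \<and> (\<forall>k\<in>set (tl p). F k)"
      by (rule exI[of _ p]) (use s F in simp)
    then have r: "(\<lambda>a b. sstep M w \<Pi> i a b \<and> F b)\<^sup>*\<^sup>* j i" unfolding list_path_tgt .
    moreover have "G j" using s G by auto
    ultimately show "\<exists>j\<in>positions w. (\<lambda>a b. sstep M w \<Pi> i a b \<and> F b)\<^sup>*\<^sup>* j i \<and> G j"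
      using lp[OF r] by (intro bexI conjI)
  next
    assume "\<exists>j\<in>positions w. (\<lambda>a b. sstep M w \<Pi> i a b \<and> F b)\<^sup>*\<^sup>* j i \<and> G j"
    then obtain j where j: "j \<in> positions w" "(\<lambda>a b. sstep M w \<Pi> i a b \<and> F b)\<^sup>*\<^sup>* j i" "G j" by (elim bexE conjE)
    from j(2) obtain p where p: "p \<noteq> []" "hd p = j" "last p = i" "successively (sstep M w \<Pi> i) p" "\<forall>k\<in>set (tl p). F k"
      unfolding list_path_tgt[symmetric] by (elim exE conjE)
    have "summary_path M w \<Pi> j i p" unfolding summary_path_iff using p assms by simp
    then show "since_sat (summary_path M w \<Pi>) F G i" unfolding since_sat_def
      using le[OF j(2)] p(5) j(3)[folded p(2)] by (intro exI[of _ j] conjI exI[of _ p])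
  qed
qed

section \<open>Hierarchical paths\<close>

lemma sorted_gap:
  assumes "sorted_wrt (<) (p :: nat list)" "p \<noteq> []" "hd p \<le> k" "k \<le> last p" "k \<notin> set p"
  shows "\<exists>q. q + 1 < length p \<and> p ! q < k \<and> k < p ! (q + 1)"
  using assms
proof (induction p)
  case (Cons a p)
  have p: "p \<noteq> []" using Cons.prems by (cases p) auto
  show ?case
  proof (cases "k < hd p")
    case True
    have "a < k" using Cons.prems by (simp add: order_less_le)
    then show ?thesis using True p by (intro exI[of _ 0]) (auto simp: hd_conv_nth)
  next
    case False
    then obtain q where "q + 1 < length p \<and> p ! q < k \<and> k < p ! (q + 1)" using Cons p by auto
    then show ?thesis by (intro exI[of _ "Suc q"]) auto
  qed
qed simp

text \<open>A hierarchical path may not skip a position linked to its anchor \<open>h\<close>, so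
  the anchor and the two ends determine it: it lists all linked positions in between.\<close>

definition interval_list :: "nat \<Rightarrow> nat \<Rightarrow> (nat \<Rightarrow> bool) \<Rightarrow> nat list" where
  "interval_list i j C = sorted_list_of_set {k. i \<le> k \<and> k \<le> j \<and> C k}"

lemma finite_interval: "finite {k :: nat. i \<le> k \<and> k \<le> j \<and> C k}"
  by (rule finite_subset[of _ "{..j}"]) auto

lemma interval_list_props:
  assumes "i \<le> j" "C i" "C j"
  shows "interval_list i j C \<noteq> []" "hd (interval_list i j C) = i" "last (interval_list i j C) = j"
    "sorted_wrt (<) (interval_list i j C)" "set (interval_list i j C) = {k. i \<le> k \<and> k \<le> j \<and> C k}"
    "set (butlast (interval_list i j C)) = {k. i \<le> k \<and> k < j \<and> C k}"
    "set (tl (interval_list i j C)) = {k. i < k \<and> k \<le> j \<and> C k}"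
proof -
  let ?p = "interval_list i j C"
  show st: "set ?p = {k. i \<le> k \<and> k \<le> j \<and> C k}"
    unfolding interval_list_def using finite_interval by simp
  show so: "sorted_wrt (<) ?p" unfolding interval_list_def by simp
  have "j \<in> set ?p" using st assms by simp
  then show ne: "?p \<noteq> []" by auto
  obtain a q where q: "?p = a # q" using ne by (cases ?p) auto
  have "i \<in> set ?p" using st assms by simp
  then have "i = a \<or> a < i" using so unfolding q by auto
  moreover have "a \<in> set ?p" unfolding q by simp
  then have "i \<le> a" unfolding st by blast
  ultimately have a: "a = i" by linarith
  then show "hd ?p = i" using q by simp
  obtain r b where r: "?p = r @ [b]" using append_butlast_last_id[OF ne, symmetric] by blast
  have "b \<in> set ?p" unfolding r by simp
  then have "b \<le> j" unfolding st by blast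
  moreover have "b = j \<or> j < b" using \<open>j \<in> set ?p\<close> so unfolding r by (auto simp: sorted_wrt_append)
  ultimately have b: "b = j" by linarith
  then show "last ?p = j" using r by simp
  have lt: "\<forall>x\<in>set r. x < j" using so unfolding r b by (auto simp: sorted_wrt_append)
  have "set ?p = insert j (set r)" unfolding r b by simp
  then have e: "insert j (set r) = {k. i \<le> k \<and> k \<le> j \<and> C k}" unfolding st by simp
  have "set r = {k. i \<le> k \<and> k < j \<and> C k}"
  proof (intro set_eqI iffI)
    fix k assume "k \<in> set r"
    then have "k \<in> {k. i \<le> k \<and> k \<le> j \<and> C k}" "k < j" using lt unfolding e[symmetric] by blast+
    then show "k \<in> {k. i \<le> k \<and> k < j \<and> C k}" by simp
  next
    fix k assume k: "k \<in> {k. i \<le> k \<and> k < j \<and> C k}"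
    then have "k \<in> insert j (set r)" unfolding e by simp
    then show "k \<in> set r" using k by simp
  qed
  then show "set (butlast ?p) = {k. i \<le> k \<and> k < j \<and> C k}" using r by simp
  have lt2: "\<forall>x\<in>set q. i < x" using so unfolding q a by simp
  have "set ?p = insert i (set q)" unfolding q a by simp
  then have e2: "insert i (set q) = {k. i \<le> k \<and> k \<le> j \<and> C k}" unfolding st by simp
  have "set q = {k. i < k \<and> k \<le> j \<and> C k}"
  proof (intro set_eqI iffI)
    fix k assume "k \<in> set q"
    then have "k \<in> {k. i \<le> k \<and> k \<le> j \<and> C k}" "i < k" using lt2 unfolding e2[symmetric] by blast+
    then show "k \<in> {k. i < k \<and> k \<le> j \<and> C k}" by simp
  next
    fix k assume k: "k \<in> {k. i < k \<and> k \<le> j \<and> C k}"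
    then have "k \<in> insert i (set q)" unfolding e2 by simp
    then show "k \<in> set q" using k by simp
  qed
  then show "set (tl ?p) = {k. i < k \<and> k \<le> j \<and> C k}" using q by simp
qed

lemma gapless_iff:
  "p \<noteq> [] \<and> hd p = i \<and> last p = j \<and> sorted_wrt (<) p \<and> (\<forall>k\<in>set p. C k) \<and>
     (\<forall>q. q + 1 < length p \<longrightarrow> \<not> (\<exists>k. p ! q < k \<and> k < p ! (q + 1) \<and> C k)) \<longleftrightarrow>
   C i \<and> C j \<and> i \<le> j \<and> p = interval_list i j C"
proof
  assume l: "p \<noteq> [] \<and> hd p = i \<and> last p = j \<and> sorted_wrt (<) p \<and> (\<forall>k\<in>set p. C k) \<and>
     (\<forall>q. q + 1 < length p \<longrightarrow> \<not> (\<exists>k. p ! q < k \<and> k < p ! (q + 1) \<and> C k))"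
  then have ne: "p \<noteq> []" and hd: "hd p = i" and la: "last p = j" and so: "sorted_wrt (<) p" and C: "\<forall>k\<in>set p. C k"
    and gap: "\<forall>q. q + 1 < length p \<longrightarrow> \<not> (\<exists>k. p ! q < k \<and> k < p ! (q + 1) \<and> C k)" by blast+
  have ip: "i \<in> set p" "j \<in> set p" using hd_in_set[OF ne] last_in_set[OF ne] hd la by simp_all
  have rng: "i \<le> k \<and> k \<le> j" if k: "k \<in> set p" for k
  proof -
    have "hd p \<le> k" using so k by (cases p) auto
    moreover have "k \<le> last p" by (rule sorted_le_last[OF so k])
    ultimately show ?thesis unfolding hd la by blast
  qed
  have cov: "k \<in> set p" if k: "i \<le> k" "k \<le> j" "C k" for k
  proof (rule ccontr)
    assume nk: "k \<notin> set p"
    obtain q where "q + 1 < length p" "p ! q < k" "k < p ! (q + 1)"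
      using sorted_gap[OF so ne _ _ nk] k hd la by blast
    then show False using gap k(3) by blast
  qed
  have "set p = {k. i \<le> k \<and> k \<le> j \<and> C k}"
  proof (intro set_eqI iffI)
    fix k assume k: "k \<in> set p"
    show "k \<in> {k. i \<le> k \<and> k \<le> j \<and> C k}" using rng[OF k] C k by simp
  qed (use cov in simp)
  then have "set p = set (sorted_list_of_set {k. i \<le> k \<and> k \<le> j \<and> C k})" using finite_interval[of i j C] by simp
  moreover have "sorted_wrt (<) (sorted_list_of_set {k. i \<le> k \<and> k \<le> j \<and> C k})" by simp
  ultimately have "p = interval_list i j C" unfolding interval_list_def using so by (intro strict_sorted_equal)
  moreover have "C i" "C j" "i \<le> j" using C ip rng by simp_all
  ultimately show "C i \<and> C j \<and> i \<le> j \<and> p = interval_list i j C" by blast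
next
  assume "C i \<and> C j \<and> i \<le> j \<and> p = interval_list i j C"
  then have ij: "i \<le> j" "C i" "C j" and p: "p = interval_list i j C" by blast+
  note pr = interval_list_props[of i j C, OF ij, folded p]
  have "\<not> (\<exists>k. p ! q < k \<and> k < p ! (q + 1) \<and> C k)" if q: "q + 1 < length p" for q
  proof
    assume "\<exists>k. p ! q < k \<and> k < p ! (q + 1) \<and> C k"
    then obtain k where k: "p ! q < k" "k < p ! (q + 1)" "C k" by blast
    have "p ! q \<in> set p" "p ! (q + 1) \<in> set p" using q by simp_all
    then have "i \<le> p ! q" "p ! (q + 1) \<le> j" unfolding pr(5) by simp_all
    then have "k \<in> set p" unfolding pr(5) using k by simp
    then obtain s where s: "s < length p" "p ! s = k" by (auto simp: in_set_conv_nth)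
    have "\<not> s \<le> q" using sorted_wrt_nth_less[OF pr(4), of s q] s k q by (cases "s = q") auto
    moreover have "\<not> q + 1 \<le> s" using sorted_wrt_nth_less[OF pr(4), of "q + 1" s] s k q by (cases "s = q + 1") auto
    ultimately show False by simp
  qed
  moreover have "\<forall>k\<in>set p. C k" unfolding pr(5) by simp
  ultimately show "p \<noteq> [] \<and> hd p = i \<and> last p = j \<and> sorted_wrt (<) p \<and> (\<forall>k\<in>set p. C k) \<and>
     (\<forall>q. q + 1 < length p \<longrightarrow> \<not> (\<exists>k. p ! q < k \<and> k < p ! (q + 1) \<and> C k))" using pr(1-4) by blast
qed

lemma chi_position: "chi M w i j \<Longrightarrow> i \<in> positions w" "chi M w i j \<Longrightarrow> j \<in> positions w"
  by (simp_all add: chi_def)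

lemma chi_positions: "\<forall>k. chi M w h k \<longrightarrow> k \<in> positions w" "\<forall>k. chi M w k h \<longrightarrow> k \<in> positions w"
  by (simp_all add: chi_position)

text \<open>In hierarchical paths \<open>C\<close> is the chain relation to the anchor and
  \<open>R\<close> the precedence. The ban on gaps refers to \<open>C\<close> alone, so
  \<open>R\<close> has to hold at every position of \<open>C\<close> in the interval.\<close>

lemma gapless_path:
  assumes pos: "\<forall>k. C k \<longrightarrow> k \<in> positions w"
  shows "path w i j p \<and> (\<forall>k\<in>set p. C k \<and> R k) \<and>
     (\<forall>q. q + 1 < length p \<longrightarrow> \<not> (\<exists>k. p ! q < k \<and> k < p ! (q + 1) \<and> C k)) \<longleftrightarrow>
   C i \<and> C j \<and> i \<le> j \<and> p = interval_list i j (\<lambda>k. C k) \<and> (\<forall>k. i \<le> k \<and> k \<le> j \<and> C k \<longrightarrow> R k)"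
proof
  assume a: "path w i j p \<and> (\<forall>k\<in>set p. C k \<and> R k) \<and>
     (\<forall>q. q + 1 < length p \<longrightarrow> \<not> (\<exists>k. p ! q < k \<and> k < p ! (q + 1) \<and> C k))"
  then have "p \<noteq> [] \<and> hd p = i \<and> last p = j \<and> sorted_wrt (<) p \<and> (\<forall>k\<in>set p. C k) \<and>
     (\<forall>q. q + 1 < length p \<longrightarrow> \<not> (\<exists>k. p ! q < k \<and> k < p ! (q + 1) \<and> C k))"
    unfolding path_def by simp
  from gapless_iff[THEN iffD1, OF this] have g: "C i" "C j" "i \<le> j" "p = interval_list i j C" by simp_all
  have s: "set p = {k. i \<le> k \<and> k \<le> j \<and> C k}" unfolding g(4) by (rule interval_list_props(5)[OF g(3,1,2)])
  have "\<forall>k. i \<le> k \<and> k \<le> j \<and> C k \<longrightarrow> R k"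
  proof (intro allI impI)
    fix k assume "i \<le> k \<and> k \<le> j \<and> C k"
    then have "k \<in> set p" unfolding s by simp
    then show "R k" using a by simp
  qed
  then show "C i \<and> C j \<and> i \<le> j \<and> p = interval_list i j (\<lambda>k. C k) \<and> (\<forall>k. i \<le> k \<and> k \<le> j \<and> C k \<longrightarrow> R k)"
    using g by simp
next
  assume a: "C i \<and> C j \<and> i \<le> j \<and> p = interval_list i j (\<lambda>k. C k) \<and> (\<forall>k. i \<le> k \<and> k \<le> j \<and> C k \<longrightarrow> R k)"
  then have g: "C i" "C j" "i \<le> j" "p = interval_list i j C" by simp_all
  have s: "set p = {k. i \<le> k \<and> k \<le> j \<and> C k}" unfolding g(4) by (rule interval_list_props(5)[OF g(3,1,2)])
  have "set p \<subseteq> positions w" unfolding s using pos by (auto simp: subset_iff)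
  moreover have "\<forall>k\<in>set p. C k \<and> R k" unfolding s using a by simp
  moreover have "p \<noteq> [] \<and> hd p = i \<and> last p = j \<and> sorted_wrt (<) p \<and> (\<forall>k\<in>set p. C k) \<and>
     (\<forall>q. q + 1 < length p \<longrightarrow> \<not> (\<exists>k. p ! q < k \<and> k < p ! (q + 1) \<and> C k))"
    by (rule gapless_iff[THEN iffD2]) (use g in blast)
  ultimately show "path w i j p \<and> (\<forall>k\<in>set p. C k \<and> R k) \<and>
     (\<forall>q. q + 1 < length p \<longrightarrow> \<not> (\<exists>k. p ! q < k \<and> k < p ! (q + 1) \<and> C k))"
    unfolding path_def by blast
qed

lemma hier_yields:
  "hier_path M w HYields i j p \<longleftrightarrow> (\<exists>h. chi M w h i \<and> chi M w h j \<and> i \<le> j \<and> p = interval_list i j (\<lambda>k. chi M w h k) \<and>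
     (\<forall>k. i \<le> k \<and> k \<le> j \<and> chi M w h k \<longrightarrow> rel M w {Yields} h k))"
proof
  assume "hier_path M w HYields i j p"
  then obtain h where h: "path w i j p" "\<forall>k\<in>set p. chi M w h k \<and> rel M w {Yields} h k"
    "\<forall>q. q + 1 < length p \<longrightarrow> \<not> (\<exists>k. p ! q < k \<and> k < p ! (q + 1) \<and> chi M w h k)"
    unfolding hier_path.simps by (elim conjE exE)
  from gapless_path[where C = "\<lambda>k. chi M w h k" and w = w, OF chi_positions(1), THEN iffD1, OF conjI[OF h(1) conjI[OF h(2,3)]]]
  show "\<exists>h. chi M w h i \<and> chi M w h j \<and> i \<le> j \<and> p = interval_list i j (\<lambda>k. chi M w h k) \<and>
     (\<forall>k. i \<le> k \<and> k \<le> j \<and> chi M w h k \<longrightarrow> rel M w {Yields} h k)" by (rule exI)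
next
  assume "\<exists>h. chi M w h i \<and> chi M w h j \<and> i \<le> j \<and> p = interval_list i j (\<lambda>k. chi M w h k) \<and>
     (\<forall>k. i \<le> k \<and> k \<le> j \<and> chi M w h k \<longrightarrow> rel M w {Yields} h k)"
  then obtain h where h: "chi M w h i \<and> chi M w h j \<and> i \<le> j \<and> p = interval_list i j (\<lambda>k. chi M w h k) \<and>
     (\<forall>k. i \<le> k \<and> k \<le> j \<and> chi M w h k \<longrightarrow> rel M w {Yields} h k)" by (rule exE)
  note g = gapless_path[where C = "\<lambda>k. chi M w h k" and w = w, OF chi_positions(1), THEN iffD2, OF h]
  have "h < i" using h chi_bounds[of M w h i] by simp
  then show "hier_path M w HYields i j p" unfolding hier_path.simps
    by (intro conjI exI[of _ h] conjunct1[OF g] conjunct1[OF conjunct2[OF g]] conjunct2[OF conjunct2[OF g]])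
qed

lemma hier_takes:
  "hier_path M w HTakes i j p \<longleftrightarrow> (\<exists>h. chi M w i h \<and> chi M w j h \<and> i \<le> j \<and> p = interval_list i j (\<lambda>k. chi M w k h) \<and>
     (\<forall>k. i \<le> k \<and> k \<le> j \<and> chi M w k h \<longrightarrow> rel M w {Takes} k h))"
proof
  assume "hier_path M w HTakes i j p"
  then obtain h where h: "path w i j p" "\<forall>k\<in>set p. chi M w k h \<and> rel M w {Takes} k h"
    "\<forall>q. q + 1 < length p \<longrightarrow> \<not> (\<exists>k. p ! q < k \<and> k < p ! (q + 1) \<and> chi M w k h)"
    unfolding hier_path.simps by (elim conjE exE)
  from gapless_path[where C = "\<lambda>k. chi M w k h" and w = w, OF chi_positions(2), THEN iffD1, OF conjI[OF h(1) conjI[OF h(2,3)]]]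
  show "\<exists>h. chi M w i h \<and> chi M w j h \<and> i \<le> j \<and> p = interval_list i j (\<lambda>k. chi M w k h) \<and>
     (\<forall>k. i \<le> k \<and> k \<le> j \<and> chi M w k h \<longrightarrow> rel M w {Takes} k h)" by (rule exI)
next
  assume "\<exists>h. chi M w i h \<and> chi M w j h \<and> i \<le> j \<and> p = interval_list i j (\<lambda>k. chi M w k h) \<and>
     (\<forall>k. i \<le> k \<and> k \<le> j \<and> chi M w k h \<longrightarrow> rel M w {Takes} k h)"
  then obtain h where h: "chi M w i h \<and> chi M w j h \<and> i \<le> j \<and> p = interval_list i j (\<lambda>k. chi M w k h) \<and>
     (\<forall>k. i \<le> k \<and> k \<le> j \<and> chi M w k h \<longrightarrow> rel M w {Takes} k h)" by (rule exE)
  note g = gapless_path[where C = "\<lambda>k. chi M w k h" and w = w, OF chi_positions(2), THEN iffD2, OF h]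
  have "j < h" using h chi_bounds[of M w j h] by simp
  then show "hier_path M w HTakes i j p" unfolding hier_path.simps
    by (intro conjI exI[of _ h] conjunct1[OF g] conjunct1[OF conjunct2[OF g]] conjunct2[OF conjunct2[OF g]])
qed

text \<open>Path-free form of the operator, from which both directions of the equivalence
  start.\<close>

lemma until_hier_yields:
  "until_sat (hier_path M w HYields) F G i \<longleftrightarrow> (\<exists>h j. chi M w h i \<and> chi M w h j \<and> i \<le> j \<and>
     (\<forall>k. i \<le> k \<and> k \<le> j \<and> chi M w h k \<longrightarrow> rel M w {Yields} h k) \<and>
     (\<forall>k. i \<le> k \<and> k < j \<and> chi M w h k \<longrightarrow> F k) \<and> G j)"
proof -
  have p: "set (butlast (interval_list i j (chi M w h))) = {k. i \<le> k \<and> k < j \<and> chi M w h k}"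
    "last (interval_list i j (chi M w h)) = j" if "chi M w h i" "chi M w h j" "i \<le> j" for h j
    using interval_list_props[of i j "chi M w h"] that by blast+
  show ?thesis
  proof
    assume "until_sat (hier_path M w HYields) F G i"
    then obtain j p h where *: "chi M w h i" "chi M w h j" "i \<le> j" "p = interval_list i j (chi M w h)"
       "\<forall>k. i \<le> k \<and> k \<le> j \<and> chi M w h k \<longrightarrow> rel M w {Yields} h k" "\<forall>k\<in>set (butlast p). F k" "G (last p)"
      unfolding until_sat_def hier_yields by blast
    have "\<forall>k. i \<le> k \<and> k < j \<and> chi M w h k \<longrightarrow> F k" "G j" using *(6,7) unfolding *(4) p[OF *(1-3)] by auto
    then show "\<exists>h j. chi M w h i \<and> chi M w h j \<and> i \<le> j \<and>
     (\<forall>k. i \<le> k \<and> k \<le> j \<and> chi M w h k \<longrightarrow> rel M w {Yields} h k) \<and>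
     (\<forall>k. i \<le> k \<and> k < j \<and> chi M w h k \<longrightarrow> F k) \<and> G j" using *(1-3,5) by blast
  next
    assume "\<exists>h j. chi M w h i \<and> chi M w h j \<and> i \<le> j \<and>
     (\<forall>k. i \<le> k \<and> k \<le> j \<and> chi M w h k \<longrightarrow> rel M w {Yields} h k) \<and>
     (\<forall>k. i \<le> k \<and> k < j \<and> chi M w h k \<longrightarrow> F k) \<and> G j"
    then obtain h j where *: "chi M w h i" "chi M w h j" "i \<le> j" "\<forall>k. i \<le> k \<and> k \<le> j \<and> chi M w h k \<longrightarrow> rel M w {Yields} h k"
     "\<forall>k. i \<le> k \<and> k < j \<and> chi M w h k \<longrightarrow> F k" "G j" by blast
    have "\<forall>k\<in>set (butlast (interval_list i j (chi M w h))). F k" "G (last (interval_list i j (chi M w h)))"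
      unfolding p[OF *(1-3)] using *(5,6) by auto
    then show "until_sat (hier_path M w HYields) F G i" unfolding until_sat_def hier_yields using *(1-4) by blast
  qed
qed

lemma until_hier_takes:
  "until_sat (hier_path M w HTakes) F G i \<longleftrightarrow> (\<exists>h j. chi M w i h \<and> chi M w j h \<and> i \<le> j \<and>
     (\<forall>k. i \<le> k \<and> k \<le> j \<and> chi M w k h \<longrightarrow> rel M w {Takes} k h) \<and>
     (\<forall>k. i \<le> k \<and> k < j \<and> chi M w k h \<longrightarrow> F k) \<and> G j)"
proof -
  let ?I = "\<lambda>i j h. interval_list i j (\<lambda>k. chi M w k h)"
  have p: "set (butlast (?I i j h)) = {k. i \<le> k \<and> k < j \<and> chi M w k h}"
    "last (?I i j h) = j" if "chi M w i h" "chi M w j h" "i \<le> j" for h j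
    using interval_list_props[of i j "\<lambda>k. chi M w k h"] that by blast+
  show ?thesis
  proof
    assume "until_sat (hier_path M w HTakes) F G i"
    then obtain j p h where *: "chi M w i h" "chi M w j h" "i \<le> j" "p = ?I i j h"
       "\<forall>k. i \<le> k \<and> k \<le> j \<and> chi M w k h \<longrightarrow> rel M w {Takes} k h" "\<forall>k\<in>set (butlast p). F k" "G (last p)"
      unfolding until_sat_def hier_takes by blast
    have "\<forall>k. i \<le> k \<and> k < j \<and> chi M w k h \<longrightarrow> F k" "G j" using *(6,7) unfolding *(4) p[OF *(1-3)] by auto
    then show "\<exists>h j. chi M w i h \<and> chi M w j h \<and> i \<le> j \<and>
     (\<forall>k. i \<le> k \<and> k \<le> j \<and> chi M w k h \<longrightarrow> rel M w {Takes} k h) \<and>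
     (\<forall>k. i \<le> k \<and> k < j \<and> chi M w k h \<longrightarrow> F k) \<and> G j" using *(1-3,5) by blast
  next
    assume "\<exists>h j. chi M w i h \<and> chi M w j h \<and> i \<le> j \<and>
     (\<forall>k. i \<le> k \<and> k \<le> j \<and> chi M w k h \<longrightarrow> rel M w {Takes} k h) \<and>
     (\<forall>k. i \<le> k \<and> k < j \<and> chi M w k h \<longrightarrow> F k) \<and> G j"
    then obtain h j where *: "chi M w i h" "chi M w j h" "i \<le> j" "\<forall>k. i \<le> k \<and> k \<le> j \<and> chi M w k h \<longrightarrow> rel M w {Takes} k h"
     "\<forall>k. i \<le> k \<and> k < j \<and> chi M w k h \<longrightarrow> F k" "G j" by blast
    have "\<forall>k\<in>set (butlast (?I i j h)). F k" "G (last (?I i j h))"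
      unfolding p[OF *(1-3)] using *(5,6) by auto
    then show "until_sat (hier_path M w HTakes) F G i" unfolding until_sat_def hier_takes using *(1-4) by blast
  qed
qed

lemma since_hier_yields:
  "since_sat (hier_path M w HYields) F G i \<longleftrightarrow> (\<exists>h j. chi M w h i \<and> chi M w h j \<and> j \<le> i \<and>
     (\<forall>k. j \<le> k \<and> k \<le> i \<and> chi M w h k \<longrightarrow> rel M w {Yields} h k) \<and>
     (\<forall>k. j < k \<and> k \<le> i \<and> chi M w h k \<longrightarrow> F k) \<and> G j)"
proof -
  let ?I = "\<lambda>j h. interval_list j i (chi M w h)"
  have p: "set (tl (?I j h)) = {k. j < k \<and> k \<le> i \<and> chi M w h k}"
    "hd (?I j h) = j" if "chi M w h i" "chi M w h j" "j \<le> i" for h j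
    using interval_list_props[of j i "chi M w h"] that by blast+
  show ?thesis
  proof
    assume "since_sat (hier_path M w HYields) F G i"
    then obtain j p h where *: "chi M w h i" "chi M w h j" "j \<le> i" "p = ?I j h"
       "\<forall>k. j \<le> k \<and> k \<le> i \<and> chi M w h k \<longrightarrow> rel M w {Yields} h k" "\<forall>k\<in>set (tl p). F k" "G (hd p)"
      unfolding since_sat_def hier_yields by blast
    have "\<forall>k. j < k \<and> k \<le> i \<and> chi M w h k \<longrightarrow> F k" "G j" using *(6,7) unfolding *(4) p[OF *(1-3)] by auto
    then show "\<exists>h j. chi M w h i \<and> chi M w h j \<and> j \<le> i \<and>
     (\<forall>k. j \<le> k \<and> k \<le> i \<and> chi M w h k \<longrightarrow> rel M w {Yields} h k) \<and>
     (\<forall>k. j < k \<and> k \<le> i \<and> chi M w h k \<longrightarrow> F k) \<and> G j" using *(1-3,5) by blast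
  next
    assume "\<exists>h j. chi M w h i \<and> chi M w h j \<and> j \<le> i \<and>
     (\<forall>k. j \<le> k \<and> k \<le> i \<and> chi M w h k \<longrightarrow> rel M w {Yields} h k) \<and>
     (\<forall>k. j < k \<and> k \<le> i \<and> chi M w h k \<longrightarrow> F k) \<and> G j"
    then obtain h j where *: "chi M w h i" "chi M w h j" "j \<le> i" "\<forall>k. j \<le> k \<and> k \<le> i \<and> chi M w h k \<longrightarrow> rel M w {Yields} h k"
     "\<forall>k. j < k \<and> k \<le> i \<and> chi M w h k \<longrightarrow> F k" "G j" by blast
    have "\<forall>k\<in>set (tl (?I j h)). F k" "G (hd (?I j h))"
      unfolding p[OF *(1-3)] using *(5,6) by auto
    then show "since_sat (hier_path M w HYields) F G i" unfolding since_sat_def hier_yields using *(1-4) by blast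
  qed
qed

lemma since_hier_takes:
  "since_sat (hier_path M w HTakes) F G i \<longleftrightarrow> (\<exists>h j. chi M w i h \<and> chi M w j h \<and> j \<le> i \<and>
     (\<forall>k. j \<le> k \<and> k \<le> i \<and> chi M w k h \<longrightarrow> rel M w {Takes} k h) \<and>
     (\<forall>k. j < k \<and> k \<le> i \<and> chi M w k h \<longrightarrow> F k) \<and> G j)"
proof -
  let ?I = "\<lambda>j h. interval_list j i (\<lambda>k. chi M w k h)"
  have p: "set (tl (?I j h)) = {k. j < k \<and> k \<le> i \<and> chi M w k h}"
    "hd (?I j h) = j" if "chi M w i h" "chi M w j h" "j \<le> i" for h j
    using interval_list_props[of j i "\<lambda>k. chi M w k h"] that by blast+
  show ?thesis
  proof
    assume "since_sat (hier_path M w HTakes) F G i"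
    then obtain j p h where *: "chi M w i h" "chi M w j h" "j \<le> i" "p = ?I j h"
       "\<forall>k. j \<le> k \<and> k \<le> i \<and> chi M w k h \<longrightarrow> rel M w {Takes} k h" "\<forall>k\<in>set (tl p). F k" "G (hd p)"
      unfolding since_sat_def hier_takes by blast
    have "\<forall>k. j < k \<and> k \<le> i \<and> chi M w k h \<longrightarrow> F k" "G j" using *(6,7) unfolding *(4) p[OF *(1-3)] by auto
    then show "\<exists>h j. chi M w i h \<and> chi M w j h \<and> j \<le> i \<and>
     (\<forall>k. j \<le> k \<and> k \<le> i \<and> chi M w k h \<longrightarrow> rel M w {Takes} k h) \<and>
     (\<forall>k. j < k \<and> k \<le> i \<and> chi M w k h \<longrightarrow> F k) \<and> G j" using *(1-3,5) by blast
  next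
    assume "\<exists>h j. chi M w i h \<and> chi M w j h \<and> j \<le> i \<and>
     (\<forall>k. j \<le> k \<and> k \<le> i \<and> chi M w k h \<longrightarrow> rel M w {Takes} k h) \<and>
     (\<forall>k. j < k \<and> k \<le> i \<and> chi M w k h \<longrightarrow> F k) \<and> G j"
    then obtain h j where *: "chi M w i h" "chi M w j h" "j \<le> i" "\<forall>k. j \<le> k \<and> k \<le> i \<and> chi M w k h \<longrightarrow> rel M w {Takes} k h"
     "\<forall>k. j < k \<and> k \<le> i \<and> chi M w k h \<longrightarrow> F k" "G j" by blast
    have "\<forall>k\<in>set (tl (?I j h)). F k" "G (hd (?I j h))"
      unfolding p[OF *(1-3)] using *(5,6) by auto
    then show "since_sat (hier_path M w HTakes) F G i" unfolding since_sat_def hier_takes using *(1-4) by blast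
  qed
qed

section \<open>Aperiodic monoids and temporal closure\<close>

definition bool_closed :: "('x \<Rightarrow> bool) set \<Rightarrow> bool" where
  "bool_closed D \<longleftrightarrow> (\<lambda>x. False) \<in> D \<and> (\<forall>P\<in>D. (\<lambda>x. \<not> P x) \<in> D) \<and>
     (\<forall>P\<in>D. \<forall>Q\<in>D. (\<lambda>x. P x \<or> Q x) \<in> D)"

lemma bool_closed_not: "bool_closed D \<Longrightarrow> P \<in> D \<Longrightarrow> (\<lambda>x. \<not> P x) \<in> D"
  by (simp add: bool_closed_def)

lemma bool_closed_or: "bool_closed D \<Longrightarrow> P \<in> D \<Longrightarrow> Q \<in> D \<Longrightarrow> (\<lambda>x. P x \<or> Q x) \<in> D"
  by (simp add: bool_closed_def)

lemma bool_closed_and: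
  assumes "bool_closed D" "P \<in> D" "Q \<in> D" shows "(\<lambda>x. P x \<and> Q x) \<in> D"
  using bool_closed_not[OF assms(1) bool_closed_or[OF assms(1) bool_closed_not[OF assms(1,2)]
      bool_closed_not[OF assms(1,3)]]] by simp

lemma bool_closed_const: "bool_closed D \<Longrightarrow> (\<lambda>x. b) \<in> D"
  using bool_closed_not[of D "\<lambda>x. False"] by (cases b) (auto simp: bool_closed_def)

lemma bool_closed_bex:
  assumes "bool_closed D" "finite I" "\<And>i. i \<in> I \<Longrightarrow> P i \<in> D"
  shows "(\<lambda>x. \<exists>i\<in>I. P i x) \<in> D"
  using assms(2,3)
  by (induction I rule: finite_induct)
    (simp_all add: bool_closed_const bool_closed_or assms(1))

lemma bool_closed_ball:
  assumes "bool_closed D" "finite I" "\<And>i. i \<in> I \<Longrightarrow> P i \<in> D"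
  shows "(\<lambda>x. \<forall>i\<in>I. P i x) \<in> D"
  using assms(2,3)
  by (induction I rule: finite_induct)
    (simp_all add: bool_closed_const bool_closed_and assms(1))

text \<open>Strict until along an arbitrary relation: \<open>P\<close> is demanded only strictly
  between \<open>x\<close> and \<open>z\<close>, neither at \<open>x\<close> nor at
  \<open>z\<close>. The strict form contains the next operator, as the case of an unsatisfiable
  guard. If \<open>R\<close> branches, one suitable branch is enough.\<close>

definition until_on :: "('x \<Rightarrow> 'x \<Rightarrow> bool) \<Rightarrow> ('x \<Rightarrow> bool) \<Rightarrow> ('x \<Rightarrow> bool) \<Rightarrow> 'x \<Rightarrow> bool" where
  "until_on R P Q x \<longleftrightarrow> (\<exists>y z. (\<lambda>a b. R a b \<and> P b)\<^sup>*\<^sup>* x y \<and> R y z \<and> Q z)"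

definition since_on :: "('x \<Rightarrow> 'x \<Rightarrow> bool) \<Rightarrow> ('x \<Rightarrow> bool) \<Rightarrow> ('x \<Rightarrow> bool) \<Rightarrow> 'x \<Rightarrow> bool" where
  "since_on R P Q x \<longleftrightarrow> (\<exists>y z. R z y \<and> Q z \<and> (\<lambda>a b. R a b \<and> P a)\<^sup>*\<^sup>* y x)"

definition temporally_closed :: "('x \<Rightarrow> 'x \<Rightarrow> bool) \<Rightarrow> ('x \<Rightarrow> bool) set \<Rightarrow> bool" where
  "temporally_closed R D \<longleftrightarrow> bool_closed D \<and>
     (\<forall>P\<in>D. \<forall>Q\<in>D. until_on R P Q \<in> D \<and> since_on R P Q \<in> D)"

lemma until_on_False: "until_on R (\<lambda>x. False) Q = (\<lambda>x. \<exists>z. R x z \<and> Q z)"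
  by (fastforce simp: until_on_def fun_eq_iff elim: rtranclp.cases)

lemma since_on_False: "since_on R (\<lambda>x. False) Q = (\<lambda>x. \<exists>z. R z x \<and> Q z)"
  by (fastforce simp: since_on_def fun_eq_iff elim: rtranclp.cases)

lemma temporally_closed_next:
  assumes "temporally_closed R D" "Q \<in> D"
  shows "(\<lambda>x. \<exists>z. R x z \<and> Q z) \<in> D" "(\<lambda>x. \<exists>z. R z x \<and> Q z) \<in> D"
proof -
  have "until_on R (\<lambda>x. False) Q \<in> D" "since_on R (\<lambda>x. False) Q \<in> D"
    using assms bool_closed_const[of D False] by (auto simp: temporally_closed_def)
  then show "(\<lambda>x. \<exists>z. R x z \<and> Q z) \<in> D" "(\<lambda>x. \<exists>z. R z x \<and> Q z) \<in> D"
    by (simp_all only: until_on_False since_on_False)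
qed

section \<open>Aperiodic monoids and local divisors\<close>

primrec mpow :: "('m \<Rightarrow> 'm \<Rightarrow> 'm) \<Rightarrow> 'm \<Rightarrow> 'm \<Rightarrow> nat \<Rightarrow> 'm" where
  "mpow m u x 0 = u"
| "mpow m u x (Suc k) = m (mpow m u x k) x"

definition aperiodic_monoid :: "'m set \<Rightarrow> ('m \<Rightarrow> 'm \<Rightarrow> 'm) \<Rightarrow> 'm \<Rightarrow> bool" where
  "aperiodic_monoid N m u \<longleftrightarrow> finite N \<and> u \<in> N \<and> (\<forall>x\<in>N. \<forall>y\<in>N. m x y \<in> N) \<and>
     (\<forall>x\<in>N. \<forall>y\<in>N. \<forall>z\<in>N. m (m x y) z = m x (m y z)) \<and>
     (\<forall>x\<in>N. m u x = x \<and> m x u = x) \<and>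
     (\<forall>x\<in>N. \<exists>k. mpow m u x (Suc k) = mpow m u x k)"

lemma mpow_closed: "aperiodic_monoid N m u \<Longrightarrow> x \<in> N \<Longrightarrow> mpow m u x k \<in> N"
  by (induction k) (auto simp: aperiodic_monoid_def)

text \<open>From \<open>m c a = u\<close>, multiplying
  \<open>mpow m u c (Suc k) = mpow m u c k\<close> on the right by \<open>a\<close> again and again
  cancels all powers down to \<open>c = u\<close>. This keeps the unit out of the local divisor of
  \<open>c\<close>, which is therefore smaller than \<open>N\<close>.\<close>

lemma aperiodic_no_right_inverse:
  assumes mon: "aperiodic_monoid N m u" and c: "c \<in> N" "c \<noteq> u" and a: "a \<in> N"
  shows "m c a \<noteq> u"
proof
  assume inv: "m c a = u"
  have red: "m (mpow m u c (Suc k)) a = mpow m u c k" for k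
    using mon mpow_closed[OF mon c(1), of k] c a inv by (auto simp: aperiodic_monoid_def)
  obtain k where "mpow m u c (Suc k) = mpow m u c k"
    using mon c by (auto simp: aperiodic_monoid_def)
  then have "mpow m u c (Suc 0) = mpow m u c 0"
  proof (induction k)
    case (Suc k)
    then show ?case using red[of k] red[of "Suc k"] by metis
  qed simp
  then show False using mon c by (auto simp: aperiodic_monoid_def)
qed

text \<open>The local divisor of \<open>c\<close>: the set cN \<inter> Nc, to be equipped with the
  product (bc)(ca) = bca of \<open>ldiv_mult\<close>, for which \<open>c\<close> is the
  unit.\<close>

definition ldiv :: "'m set \<Rightarrow> ('m \<Rightarrow> 'm \<Rightarrow> 'm) \<Rightarrow> 'm \<Rightarrow> 'm set" where
  "ldiv N m c = {x. (\<exists>a\<in>N. x = m c a) \<and> (\<exists>b\<in>N. x = m b c)}"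

definition ldiv_mult :: "'m set \<Rightarrow> ('m \<Rightarrow> 'm \<Rightarrow> 'm) \<Rightarrow> 'm \<Rightarrow> 'm \<Rightarrow> 'm \<Rightarrow> 'm" where
  "ldiv_mult N m c x y = m (SOME b. b \<in> N \<and> x = m b c) y"

text \<open>The choice of \<open>b\<close> does not matter: \<open>m b (m c a)\<close> equals
  \<open>m (m b c) a\<close> and so depends on \<open>m b c\<close> only.\<close>

lemma ldiv_mult_eq:
  assumes mon: "aperiodic_monoid N m u" and "c \<in> N" "b \<in> N" "a \<in> N"
  shows "ldiv_mult N m c (m b c) (m c a) = m b (m c a)"
proof -
  define b' where "b' = (SOME b'. b' \<in> N \<and> m b c = m b' c)"
  have "b' \<in> N \<and> m b c = m b' c"
    unfolding b'_def by (rule someI_ex) (use assms in auto)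
  moreover have "m (m x c) a = m x (m c a)" if "x \<in> N" for x
    using mon assms that by (simp add: aperiodic_monoid_def)
  ultimately have "m b' (m c a) = m b (m c a)" using assms by metis
  then show ?thesis by (simp add: ldiv_mult_def b'_def)
qed

lemma ldiv_subset: "aperiodic_monoid N m u \<Longrightarrow> c \<in> N \<Longrightarrow> ldiv N m c \<subseteq> N"
  by (auto simp: ldiv_def aperiodic_monoid_def)

lemma ldiv_unit_notin:
  "aperiodic_monoid N m u \<Longrightarrow> c \<in> N \<Longrightarrow> c \<noteq> u \<Longrightarrow> u \<notin> ldiv N m c"
  using aperiodic_no_right_inverse[of N m u c] unfolding ldiv_def by blast

text \<open>All laws reduce to \<open>ldiv_mult N m c (m b c) y = m b y\<close>. In particular the
  powers of \<open>m b c\<close> are \<open>m (mpow m u b k) c\<close>, so aperiodicity is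
  inherited.\<close>

lemma ldiv_monoid:
  assumes mon: "aperiodic_monoid N m u" and c: "c \<in> N"
  shows "aperiodic_monoid (ldiv N m c) (ldiv_mult N m c) c"
proof -
  let ?N = "ldiv N m c" and ?m = "ldiv_mult N m c"
  note [simp] = ldiv_mult_eq[OF mon c]
  have asc: "\<And>x y z. x \<in> N \<Longrightarrow> y \<in> N \<Longrightarrow> z \<in> N \<Longrightarrow> m (m x y) z = m x (m y z)"
    and cl: "\<And>x y. x \<in> N \<Longrightarrow> y \<in> N \<Longrightarrow> m x y \<in> N" and u: "u \<in> N"
    and un: "\<And>x. x \<in> N \<Longrightarrow> m u x = x" "\<And>x. x \<in> N \<Longrightarrow> m x u = x"
    using mon by (auto simp: aperiodic_monoid_def)
  have fin: "finite ?N"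
    using ldiv_subset[OF mon c] mon by (auto simp: aperiodic_monoid_def intro: finite_subset)
  have left: "\<exists>a\<in>N. x = m c a" and right: "\<exists>b\<in>N. x = m b c" if "x \<in> ?N" for x
    using that by (auto simp: ldiv_def)
  have c': "c \<in> ?N" using un u c by (force simp: ldiv_def)
  have mul: "?m (m b c) y = m b y" if "b \<in> N" "y \<in> ?N" for b y
    using left[OF that(2)] that by auto
  have clo: "?m x y \<in> ?N" if x: "x \<in> ?N" and y: "y \<in> ?N" for x y
  proof -
    obtain a1 b1 where 1: "a1 \<in> N" "b1 \<in> N" "x = m c a1" "x = m b1 c"
      using left[OF x] right[OF x] by auto
    obtain a2 b2 where 2: "a2 \<in> N" "b2 \<in> N" "y = m c a2" "y = m b2 c"
      using left[OF y] right[OF y] by auto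
    have e: "?m x y = m b1 y" using mul[OF 1(2) y] 1 by simp
    have "m b1 y = m (m b1 b2) c" using asc 1 2 c by metis
    moreover have "m b1 y = m c (m a1 a2)" using asc 1 2 c by metis
    moreover have "m b1 b2 \<in> N" "m a1 a2 \<in> N" using cl 1 2 by auto
    ultimately show ?thesis unfolding ldiv_def e by blast
  qed
  have ass: "?m (?m x y) z = ?m x (?m y z)" if x: "x \<in> ?N" and y: "y \<in> ?N" and z: "z \<in> ?N" for x y z
  proof -
    obtain b1 b2 where 1: "b1 \<in> N" "x = m b1 c" and 2: "b2 \<in> N" "y = m b2 c"
      using right[OF x] right[OF y] by auto
    have zN: "z \<in> N" using z ldiv_subset[OF mon c] by auto
    have "?m x y = m (m b1 b2) c" using mul[OF 1(1) y] 1 2 asc c by simp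
    then have "?m (?m x y) z = m (m b1 b2) z" using mul[OF _ z] cl 1 2 by simp
    moreover have "?m x (?m y z) = m b1 (m b2 z)"
      using mul[OF 1(1) clo[OF y z]] mul[OF 2(1) z] 1 2 by simp
    ultimately show ?thesis using asc 1 2 zN by simp
  qed
  have uni: "?m c x = x \<and> ?m x c = x" if x: "x \<in> ?N" for x
  proof -
    have "?m (m u c) x = m u x" using mul u x by blast
    moreover obtain b where "b \<in> N" "x = m b c" using right[OF x] by auto
    ultimately show ?thesis using un c mul[OF _ c'] x ldiv_subset[OF mon c] by auto
  qed
  have ape: "\<exists>k. mpow ?m c x (Suc k) = mpow ?m c x k" if x: "x \<in> ?N" for x
  proof -
    obtain b where b: "b \<in> N" "x = m b c" using right[OF x] by auto
    have pw: "mpow ?m c x k = m (mpow m u b k) c" for k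
    proof (induction k)
      case (Suc k)
      then show ?case using mul[OF mpow_closed[OF mon b(1)] x] b asc mpow_closed[OF mon b(1)] c
        by simp
    qed (use un c in simp)
    obtain k where "mpow m u b (Suc k) = mpow m u b k"
      using mon b by (auto simp: aperiodic_monoid_def)
    then show ?thesis by (metis pw)
  qed
  show ?thesis unfolding aperiodic_monoid_def using fin c' clo ass uni ape by blast
qed

text \<open>A path with all labels in \<open>A\<close>, together with their product. The label of
  the start is not counted and that of the end is, so concatenation of paths is
  multiplication.\<close>

inductive pth :: "('x \<Rightarrow> 'x \<Rightarrow> bool) \<Rightarrow> ('x \<Rightarrow> 'm) \<Rightarrow> ('m \<Rightarrow> 'm \<Rightarrow> 'm) \<Rightarrow> 'm \<Rightarrow> 'm set \<Rightarrow>
    'x \<Rightarrow> 'm \<Rightarrow> 'x \<Rightarrow> bool" for R lam m u A where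
  refl: "pth R lam m u A x u x"
| step: "pth R lam m u A x n y \<Longrightarrow> R y z \<Longrightarrow> lam z \<in> A \<Longrightarrow> pth R lam m u A x (m n (lam z)) z"

lemma pth_closed:
  "pth R lam m u A x n y \<Longrightarrow> aperiodic_monoid N m u \<Longrightarrow> A \<subseteq> N \<Longrightarrow> n \<in> N"
  by (induction rule: pth.induct) (auto simp: aperiodic_monoid_def)

lemma pth_mono: "pth R lam m u A x n y \<Longrightarrow> A \<subseteq> B \<Longrightarrow> pth R lam m u B x n y"
  by (induction rule: pth.induct) (auto intro: pth.intros)

lemma pth_trans:
  assumes "pth R lam m u A y n' z" "pth R lam m u A x n y" "aperiodic_monoid N m u" "A \<subseteq> N"
  shows "pth R lam m u A x (m n n') z"
  using assms
proof (induction rule: pth.induct)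
  case (refl y)
  then show ?case using pth_closed[OF refl(1)] by (auto simp: aperiodic_monoid_def)
next
  case (step y n' y' z)
  have "n \<in> N" "n' \<in> N" using pth_closed step by metis+
  moreover have "lam z \<in> N" using step by auto
  ultimately have "m n (m n' (lam z)) = m (m n n') (lam z)"
    using step by (simp add: aperiodic_monoid_def)
  then show ?case using step pth.step by metis
qed

text \<open>One step of the induction on local divisors: paths are cut at the nodes labelled
  \<open>c\<close>. Predecessors under \<open>R\<close> are unique although successors need not be,
  so a node has at most one last node labelled \<open>c\<close> before it.\<close>

locale local_divisor_step =
  fixes R :: "'x \<Rightarrow> 'x \<Rightarrow> bool" and lam :: "'x \<Rightarrow> 'm" and m u N A and c :: 'm
  assumes mon: "aperiodic_monoid N m u" and AN: "A \<subseteq> N" and c: "c \<in> A" "c \<noteq> u"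
    and det: "\<And>x x' y. R x y \<Longrightarrow> R x' y \<Longrightarrow> x = x'"
begin

abbreviation "B \<equiv> A - {c}"
abbreviation "pB \<equiv> pth R lam m u B"
abbreviation "pA \<equiv> pth R lam m u A"

text \<open>\<open>p\<close> is the product of the labels strictly between \<open>y\<close> and the
  last node labelled \<open>c\<close> before it.\<close>

definition "blk p y \<longleftrightarrow> (\<exists>y0. R y0 y \<and> (\<exists>x. pB x p y0 \<and> lam x = c))"
definition "R' x y \<longleftrightarrow> lam x = c \<and> lam y = c \<and> (\<exists>p y0. pB x p y0 \<and> R y0 y)"
text \<open>The block between two consecutive nodes labelled \<open>c\<close>, with both of them, as
  an element of the local divisor. The default \<open>u\<close> lies outside the local divisor and
  cannot be confused with a block.\<close>

definition "lam' y = (if \<exists>p. blk p y then m c (m (THE p. blk p y) c) else u)"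

abbreviation "N' \<equiv> ldiv N m c"
abbreviation "m' \<equiv> ldiv_mult N m c"
abbreviation "p' \<equiv> pth R' lam' m' c N'"

lemma cN: "c \<in> N" using c AN by auto

lemma asc: "x \<in> N \<Longrightarrow> y \<in> N \<Longrightarrow> z \<in> N \<Longrightarrow> m (m x y) z = m x (m y z)"
  and cl: "x \<in> N \<Longrightarrow> y \<in> N \<Longrightarrow> m x y \<in> N" and uN: "u \<in> N"
  and un: "x \<in> N \<Longrightarrow> m u x = x" "x \<in> N \<Longrightarrow> m x u = x"
  using mon by (auto simp: aperiodic_monoid_def)

lemma BN: "B \<subseteq> N" using AN by auto

lemma pB_in: "pB x p y \<Longrightarrow> p \<in> N"
  using pth_closed mon BN by metis

lemma pB_unique: "pB x p y \<Longrightarrow> lam x = c \<Longrightarrow> pB x' q y \<Longrightarrow> lam x' = c \<Longrightarrow> x = x' \<and> p = q"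
proof (induction arbitrary: q rule: pth.induct)
  case (refl x)
  from refl(2) show ?case by cases (use refl in auto)
next
  case (step x n y z)
  from step(6) show ?case
  proof cases
    case refl
    then show ?thesis using step by auto
  next
    case (step n' y')
    then show ?thesis using step.prems step.hyps det[of y z y'] local.step(2) \<open>R y z\<close>
      using step.IH \<open>lam x = c\<close> \<open>lam x' = c\<close> by blast
  qed
qed

lemma blk_unique: "blk p y \<Longrightarrow> blk q y \<Longrightarrow> p = q"
proof -
  assume "blk p y" "blk q y"
  then obtain y0 y1 x x' where "R y0 y" "pB x p y0" "lam x = c" "R y1 y" "pB x' q y1" "lam x' = c"
    by (auto simp: blk_def)
  then show "p = q" using det[of y0 y y1] pB_unique[of x p y0 x' q] by simp
qed

lemma lam'_eq: "blk p y \<Longrightarrow> lam' y = m c (m p c)"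
proof -
  assume a: "blk p y"
  then have "(THE p. blk p y) = p" by (rule the_equality) (rule blk_unique[OF _ a])
  then show ?thesis using a by (auto simp: lam'_def)
qed

lemma blk_in: "blk p y \<Longrightarrow> p \<in> N"
  unfolding blk_def using pB_in by blast

lemma lam'_in: "blk p y \<Longrightarrow> lam' y \<in> N'"
proof -
  assume b: "blk p y"
  have "m c (m p c) = m (m c p) c" "m c p \<in> N" "m p c \<in> N"
    using asc cl cN blk_in[OF b] by simp_all
  then show ?thesis unfolding ldiv_def lam'_eq[OF b] by blast
qed

lemma lam'_iff: "a \<in> N' \<Longrightarrow> lam' y = a \<longleftrightarrow> (\<exists>p\<in>N. blk p y \<and> m c (m p c) = a)"
proof -
  assume a: "a \<in> N'"
  have "a \<noteq> u" using a ldiv_unit_notin[OF mon cN c(2)] by blast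
  then have "lam' y = a \<Longrightarrow> \<exists>p. blk p y" by (auto simp: lam'_def split: if_splits)
  then show ?thesis using lam'_eq[of _ y] blk_in[of _ y] by (auto, blast)
qed

lemma R'_det: "R' x y \<Longrightarrow> R' x' y \<Longrightarrow> x = x'"
proof -
  assume "R' x y" "R' x' y"
  then obtain y0 y1 p q where "R y0 y" "pB x p y0" "lam x = c" "R y1 y" "pB x' q y1" "lam x' = c"
    by (auto simp: R'_def)
  then show "x = x'" using det[of y0 y y1] pB_unique[of x p y0 x' q] by simp
qed

lemma R'_blk: "pB x p y0 \<Longrightarrow> lam x = c \<Longrightarrow> R y0 y \<Longrightarrow> blk p y"
  unfolding blk_def by blast

lemma p'_lam: "p' x n y \<Longrightarrow> lam x = c \<Longrightarrow> lam y = c"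
  by (induction rule: pth.induct) (auto simp: R'_def)

lemma p'_in: "p' x n y \<Longrightarrow> n \<in> N'"
  by (rule pth_closed[OF _ ldiv_monoid[OF mon cN] order_refl])

lemma m'_block:
  assumes "r \<in> N'" "p \<in> N"
  shows "m' r (m c (m p c)) = m r (m p c)"
proof -
  obtain b where "b \<in> N" "r = m b c" using assms by (auto simp: ldiv_def)
  then show ?thesis using ldiv_mult_eq[OF mon cN, of b "m p c"] cl asc assms cN by simp
qed

text \<open>Cut the path at its first and its last node labelled \<open>c\<close>. The middle part
  \<open>r\<close> counts both these letters and is a product in the local divisor; if the two nodes
  coincide, it is the unit \<open>c\<close> there.\<close>

lemma decompose:
  "pA x n y \<Longrightarrow> pB x n y \<or> (\<exists>p r q x1 z0 z1. pB x p x1 \<and> R x1 z0 \<and> lam z0 = c \<and>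
     p' z0 r z1 \<and> pB z1 q y \<and> n = m p (m r q))"
proof (induction rule: pth.induct)
  case (refl x)
  then show ?case by (auto intro: pth.refl)
next
  case (step x n y z)
  have zN: "lam z \<in> N" using step AN by auto
  consider (a) "lam z \<in> B" "pB x n y" | (b) "lam z = c" "pB x n y"
    | (d) p r q x1 z0 z1 where "lam z \<in> B" "pB x p x1" "R x1 z0" "lam z0 = c" "p' z0 r z1"
        "pB z1 q y" "n = m p (m r q)"
    | (e) p r q x1 z0 z1 where "lam z = c" "pB x p x1" "R x1 z0" "lam z0 = c" "p' z0 r z1"
        "pB z1 q y" "n = m p (m r q)"
    using step.IH step.hyps by blast
  then show ?case
  proof cases
    case a
    then show ?thesis using step pth.step by metis
  next
    case b
    have "m n (lam z) = m n (m c u)" using b un cN by simp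
    then show ?thesis using b step.hyps pth.refl by metis
  next
    case d
    have N: "p \<in> N" "r \<in> N" "q \<in> N"
      using d pB_in p'_in ldiv_subset[OF mon cN] by blast+
    have "m n (lam z) = m p (m r (m q (lam z)))"
      using d(7) N zN asc cl by simp
    then show ?thesis using d step.hyps pth.step[OF d(6) step.hyps(2) d(1)] by metis
  next
    \<comment> \<open>A new letter \<open>c\<close> closes the block \<open>q\<close> and lengthens
      the path in the local divisor; the remaining last part is empty.\<close>
    case e
    have rN: "r \<in> N'" using e p'_in by blast
    have N: "p \<in> N" "r \<in> N" "q \<in> N"
      using e rN pB_in ldiv_subset[OF mon cN] by blast+
    have z1: "lam z1 = c" using p'_lam e by blast
    have bl: "blk q z" using R'_blk e z1 step by blast
    have "R' z1 z" unfolding R'_def using e z1 step by blast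
    then have "p' z0 (m' r (lam' z)) z" using pth.step e lam'_in[OF bl] by metis
    moreover have "m' r (lam' z) = m r (m q c)"
      using lam'_eq[OF bl] m'_block[OF rN N(3)] by simp
    moreover have "m n (lam z) = m p (m (m r (m q c)) u)"
      using e(1,7) N cN asc cl un by simp
    ultimately show ?thesis using e step.hyps pth.refl by metis
  qed
qed

text \<open>The product in the local divisor counts the label \<open>c\<close> of its start
  \<open>z0\<close>, while an ordinary path leaves out the label of its start; this accounts for the
  left factor \<open>c\<close> of \<open>r\<close>.\<close>

lemma p'_expand: "p' z0 r z1 \<Longrightarrow> lam z0 = c \<Longrightarrow> \<exists>r0\<in>N. pA z0 r0 z1 \<and> m c r0 = r"
proof (induction rule: pth.induct)
  case (refl x)
  then show ?case using pth.refl un cN uN by metis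
next
  case (step x n y z)
  then obtain r0 where r0: "r0 \<in> N" "pA x r0 y" "m c r0 = n" by auto
  obtain p y0 where p: "pB y p y0" "R y0 z" "lam y = c" "lam z = c"
    using step.hyps(2) R'_def by auto
  have pN: "p \<in> N" using pB_in[OF p(1)] .
  have "pA y (m p c) z"
    using pth.step[OF pth_mono[OF p(1)] p(2)] p(4) c by auto
  then have "pA x (m r0 (m p c)) z" using pth_trans r0 mon AN by metis
  moreover have "m' n (lam' z) = m n (m p c)"
    using lam'_eq[OF R'_blk[OF p(1,3,2)]] m'_block[OF p'_in[OF step.hyps(1)] pN] by simp
  ultimately show ?case using r0 asc cl pN cN by metis
qed

lemma compose:
  assumes "pB x p x1" "R x1 z0" "lam z0 = c" "p' z0 r z1" "pB z1 q y"
  shows "pA x (m p (m r q)) y"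
proof -
  obtain r0 where r0: "r0 \<in> N" "pA z0 r0 z1" "m c r0 = r" using p'_expand assms by blast
  have N: "p \<in> N" "q \<in> N" using assms pB_in by blast+
  have "pA x (m p c) z0" using pth.step[OF pth_mono[OF assms(1)] assms(2)] assms(3) c by auto
  then have "pA x (m (m p c) r0) z1" using pth_trans r0 mon AN by metis
  then have "pA x (m (m (m p c) r0) q) y"
    using pth_trans[OF pth_mono[OF assms(5)] _ mon AN] by auto
  then show ?thesis using asc cl N r0 cN by auto
qed

text \<open>A step of \<open>R'\<close> goes to the next node labelled \<open>c\<close>, so a guard
  that lets all labels in \<open>B\<close> pass simulates it along \<open>R\<close>. This carries
  temporal closure over from \<open>R\<close> to \<open>R'\<close>.\<close>

lemma until_R':
  "until_on R' P Q = (\<lambda>x. lam x = c \<and>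
     until_on R (\<lambda>y. lam y \<in> B \<or> lam y = c \<and> P y) (\<lambda>z. lam z = c \<and> Q z) x)"
proof (intro ext iffI)
  let ?S = "\<lambda>a b. R a b \<and> (lam b \<in> B \<or> lam b = c \<and> P b)"
  have pS: "?S\<^sup>*\<^sup>* a b" if "pB a p b" for a p b
    using that by induction (auto intro: rtranclp.rtrancl_into_rtrancl)
  {
    fix x assume "until_on R' P Q x"
    then obtain y z where y: "(\<lambda>a b. R' a b \<and> P b)\<^sup>*\<^sup>* x y" "R' y z" "Q z"
      by (auto simp: until_on_def)
    have "?S\<^sup>*\<^sup>* x y" using y(1)
    proof induction
      case (step y z)
      then obtain p y0 where "pB y p y0" "R y0 z" "lam z = c" "P z" by (auto simp: R'_def)
      then have "?S\<^sup>*\<^sup>* y y0" "?S y0 z" using pS by auto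
      then show ?case
        by (rule rtranclp.rtrancl_into_rtrancl[OF rtranclp_trans[OF step.IH]])
    qed simp
    moreover obtain p y0 where y0: "pB y p y0" "R y0 z" "lam z = c" using y(2) by (auto simp: R'_def)
    ultimately have "?S\<^sup>*\<^sup>* x y0" using pS rtranclp_trans[of ?S x y y0] by blast
    moreover have "lam x = c" using y(1,2) by (induction rule: converse_rtranclp_induct) (auto simp: R'_def)
    ultimately show "lam x = c \<and> until_on R (\<lambda>y. lam y \<in> B \<or> lam y = c \<and> P y) (\<lambda>z. lam z = c \<and> Q z) x"
      unfolding until_on_def using y0 y(3) by blast
  }
  {
    fix x assume "lam x = c \<and> until_on R (\<lambda>y. lam y \<in> B \<or> lam y = c \<and> P y) (\<lambda>z. lam z = c \<and> Q z) x"
    then obtain y z where x: "lam x = c" and y: "?S\<^sup>*\<^sup>* x y" "R y z" "lam z = c" "Q z"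
      by (auto simp: until_on_def)
    \<comment> \<open>Invariant: \<open>x'\<close> is the last node labelled \<open>c\<close> on the
      walk so far.\<close>
    from y(1) have "\<exists>x'. (\<lambda>a b. R' a b \<and> P b)\<^sup>*\<^sup>* x x' \<and> lam x' = c \<and> (\<exists>p. pB x' p y)"
    proof induction
      case base
      then show ?case using x pth.refl by fast
    next
      case (step y z)
      then obtain x' p where x': "(\<lambda>a b. R' a b \<and> P b)\<^sup>*\<^sup>* x x'" "lam x' = c" "pB x' p y" by auto
      show ?case
      proof (cases "lam z \<in> B")
        case True
        then have "pB x' (m p (lam z)) z" using pth.step[OF x'(3)] step by blast
        then show ?thesis using x' by blast
      next
        case False
        then have "R' x' z" "P z" "lam z = c" using step x' by (auto simp: R'_def)
        then have "(\<lambda>a b. R' a b \<and> P b)\<^sup>*\<^sup>* x z"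
          using rtranclp.rtrancl_into_rtrancl[OF x'(1)] by blast
        then show ?thesis using pth.refl[of R lam m u B z] \<open>lam z = c\<close> by blast
      qed
    qed
    then obtain x' p where "(\<lambda>a b. R' a b \<and> P b)\<^sup>*\<^sup>* x x'" "lam x' = c" "pB x' p y" by auto
    then show "until_on R' P Q x" unfolding until_on_def R'_def using y by blast
  }
qed

lemma since_R':
  "since_on R' P Q = (\<lambda>x. lam x = c \<and>
     since_on R (\<lambda>y. lam y \<in> B \<or> lam y = c \<and> P y) (\<lambda>z. lam z = c \<and> Q z) x)"
proof (intro ext iffI)
  let ?S = "\<lambda>a b. R a b \<and> (lam a \<in> B \<or> lam a = c \<and> P a)"
  let ?T = "\<lambda>a b. R' a b \<and> P a"
  have pS: "\<exists>z1. R z z1 \<and> ?S\<^sup>*\<^sup>* z1 y" if "pB z p y0" "R y0 y" for z p y0 y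
    using that
  proof (induction arbitrary: y)
    case (step x n y' z)
    then obtain z1 where z1: "R x z1" "?S\<^sup>*\<^sup>* z1 z" by blast
    have "?S z y" using step by blast
    then show ?case using z1 rtranclp.rtrancl_into_rtrancl[OF z1(2)] by blast
  qed auto
  {
    fix x assume "since_on R' P Q x"
    then obtain y z where y: "R' z y" "Q z" "?T\<^sup>*\<^sup>* y x"
      by (auto simp: since_on_def)
    obtain z1 where z1: "R z z1" "?S\<^sup>*\<^sup>* z1 y" using y(1) pS unfolding R'_def by blast
    have "?S\<^sup>*\<^sup>* y x" using y(3)
    proof induction
      case (step y z)
      then obtain y1 where "R y y1" "?S\<^sup>*\<^sup>* y1 z" "P y" "lam y = c" using pS unfolding R'_def by blast
      then have "?S\<^sup>*\<^sup>* y z" by (simp add: converse_rtranclp_into_rtranclp)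
      then show ?case by (rule rtranclp_trans[OF step.IH])
    qed simp
    moreover have "lam x = c" using y(3,1) by induction (auto simp: R'_def)
    moreover have "lam z = c" using y by (auto simp: R'_def)
    moreover have "?S\<^sup>*\<^sup>* z1 x" using calculation rtranclp_trans[OF z1(2)] by blast
    ultimately show "lam x = c \<and> since_on R (\<lambda>y. lam y \<in> B \<or> lam y = c \<and> P y) (\<lambda>z. lam z = c \<and> Q z) x"
      unfolding since_on_def using z1 y(2) by blast
  }
  {
    fix x assume "lam x = c \<and> since_on R (\<lambda>y. lam y \<in> B \<or> lam y = c \<and> P y) (\<lambda>z. lam z = c \<and> Q z) x"
    then obtain y z where x: "lam x = c" and y: "R z y" "lam z = c" "Q z" "?S\<^sup>*\<^sup>* y x"
      by (auto simp: since_on_def)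
    \<comment> \<open>Walking forward from \<open>z\<close>, the node \<open>a\<close> is the last
      one labelled \<open>c\<close> that has been passed: \<open>z\<close> itself or a node reached
      by guarded steps of \<open>R'\<close>.\<close>
    from y(4) have "\<exists>a p y1. pB a p y1 \<and> R y1 x \<and> lam a = c \<and>
        (a = z \<or> (\<exists>y. R' z y \<and> ?T\<^sup>*\<^sup>* y a) \<and> P a)"
    proof induction
      case base
      then show ?case using y pth.refl[of R lam m u B z] by blast
    next
      case (step w w')
      then obtain a p y1 where a: "pB a p y1" "R y1 w" "lam a = c"
        "a = z \<or> (\<exists>y. R' z y \<and> ?T\<^sup>*\<^sup>* y a) \<and> P a" by blast
      show ?case
      proof (cases "lam w \<in> B")
        case True
        then have "pB a (m p (lam w)) w" using pth.step[OF a(1,2)] by blast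
        then show ?thesis using a step by blast
      next
        case False
        then have w: "R' a w" "P w" "lam w = c" using step a by (auto simp: R'_def)
        have "\<exists>y. R' z y \<and> ?T\<^sup>*\<^sup>* y w"
          using a(4)
        proof
          assume "(\<exists>y. R' z y \<and> ?T\<^sup>*\<^sup>* y a) \<and> P a"
          then show ?thesis using w(1) rtranclp.rtrancl_into_rtrancl[of ?T _ a w] by blast
        qed (use w(1) in blast)
        then show ?thesis using w step pth.refl[of R lam m u B w] by blast
      qed
    qed
    then obtain a p y1 where a: "pB a p y1" "R y1 x" "lam a = c"
        "a = z \<or> (\<exists>y. R' z y \<and> ?T\<^sup>*\<^sup>* y a) \<and> P a" by blast
    then have "R' a x" using x by (auto simp: R'_def)
    have "\<exists>y. R' z y \<and> ?T\<^sup>*\<^sup>* y x"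
      using a(4)
    proof
      assume "(\<exists>y. R' z y \<and> ?T\<^sup>*\<^sup>* y a) \<and> P a"
      then show ?thesis using \<open>R' a x\<close> rtranclp.rtrancl_into_rtrancl[of ?T _ a x] by blast
    qed (use \<open>R' a x\<close> in blast)
    then show "since_on R' P Q x" unfolding since_on_def using y by blast
  }
qed

end

lemma pth_trivial_alphabet:
  assumes "A \<subseteq> {u}" "aperiodic_monoid N m u"
  shows "pth R lam m u A x n y \<longleftrightarrow> n = u \<and> (\<lambda>a b. R a b \<and> lam b \<in> A)\<^sup>*\<^sup>* x y"
proof
  have uu: "m u u = u" using assms by (auto simp: aperiodic_monoid_def)
  show "pth R lam m u A x n y \<Longrightarrow> n = u \<and> (\<lambda>a b. R a b \<and> lam b \<in> A)\<^sup>*\<^sup>* x y"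
  proof (induction rule: pth.induct)
    case (step x n y z)
    then have "lam z = u" using assms by auto
    with step uu show ?case by (auto intro: rtranclp.rtrancl_into_rtrancl)
  qed simp
  assume "n = u \<and> (\<lambda>a b. R a b \<and> lam b \<in> A)\<^sup>*\<^sup>* x y"
  then have "(\<lambda>a b. R a b \<and> lam b \<in> A)\<^sup>*\<^sup>* x y" "n = u" by auto
  then show "pth R lam m u A x n y"
  proof induction
    case (step y z)
    then have "lam z = u" using assms by auto
    with step pth.step[of R lam m u A x u y z] uu show ?case by auto
  qed (auto intro: pth.refl)
qed

lemma rtranclp_until:
  "(\<exists>y. (\<lambda>a b. R a b \<and> P b)\<^sup>*\<^sup>* x y \<and> Q y) \<longleftrightarrow> Q x \<or> until_on R P (\<lambda>z. P z \<and> Q z) x"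
proof
  assume "\<exists>y. (\<lambda>a b. R a b \<and> P b)\<^sup>*\<^sup>* x y \<and> Q y"
  then obtain y where y: "(\<lambda>a b. R a b \<and> P b)\<^sup>*\<^sup>* x y" "Q y" by auto
  from y(1) show "Q x \<or> until_on R P (\<lambda>z. P z \<and> Q z) x"
    by cases (use y(2) in \<open>auto simp: until_on_def\<close>)
next
  assume "Q x \<or> until_on R P (\<lambda>z. P z \<and> Q z) x"
  then show "\<exists>y. (\<lambda>a b. R a b \<and> P b)\<^sup>*\<^sup>* x y \<and> Q y"
    unfolding until_on_def by (auto intro: rtranclp.rtrancl_into_rtrancl)
qed

lemma rtranclp_since:
  "(\<exists>x. (\<lambda>a b. R a b \<and> P b)\<^sup>*\<^sup>* x y \<and> Q x) \<longleftrightarrow> Q y \<or> P y \<and> since_on R P Q y"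
proof
  assume "\<exists>x. (\<lambda>a b. R a b \<and> P b)\<^sup>*\<^sup>* x y \<and> Q x"
  then obtain x where "(\<lambda>a b. R a b \<and> P b)\<^sup>*\<^sup>* x y" "Q x" by auto
  then have "x = y \<or> P y \<and> (\<exists>z. R x z \<and> (\<lambda>a b. R a b \<and> P a)\<^sup>*\<^sup>* z y)"
    by induction (auto intro: rtranclp.rtrancl_into_rtrancl)
  then show "Q y \<or> P y \<and> since_on R P Q y" unfolding since_on_def using \<open>Q x\<close> by auto
next
  assume "Q y \<or> P y \<and> since_on R P Q y"
  then show "\<exists>x. (\<lambda>a b. R a b \<and> P b)\<^sup>*\<^sup>* x y \<and> Q x"
  proof
    assume "P y \<and> since_on R P Q y"
    then obtain z w where w: "P y" "R z w" "Q z" "(\<lambda>a b. R a b \<and> P a)\<^sup>*\<^sup>* w y"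
      by (auto simp: since_on_def)
    from w(4,1) have "P w \<and> (\<lambda>a b. R a b \<and> P b)\<^sup>*\<^sup>* w y"
      by (induction rule: converse_rtranclp_induct) (auto intro: converse_rtranclp_into_rtranclp)
    then have "(\<lambda>a b. R a b \<and> P b)\<^sup>*\<^sup>* z y"
      using w converse_rtranclp_into_rtranclp[of "\<lambda>a b. R a b \<and> P b" z w y] by blast
    then show ?thesis using w by auto
  qed auto
qed

text \<open>Induction on the size of the monoid and, inside it, on the size of the alphabet. For a
  letter \<open>c\<close> other than the unit, the parts of the path before the first and after the
  last \<open>c\<close> use a smaller alphabet, and the middle part is a path over the smaller local
  divisor. Future and past are proved together, because the labels \<open>lam'\<close> of the middle
  part speak about the past.\<close>

theorem aperiodic_paths_definable:
  fixes D :: "('x \<Rightarrow> bool) set"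
  assumes "temporally_closed R D" "\<And>x x' y. R x y \<Longrightarrow> R x' y \<Longrightarrow> x = x'"
    and "aperiodic_monoid N m u" "A \<subseteq> N" "\<And>a. a \<in> A \<Longrightarrow> (\<lambda>x. lam x = a) \<in> D" "Q \<in> D"
  shows "(\<lambda>x. \<exists>y. pth R lam m u A x n y \<and> Q y) \<in> D \<and>
         (\<lambda>y. \<exists>x. pth R lam m u A x n y \<and> Q x) \<in> D"
  using assms
proof (induction "card N" arbitrary: N m u R lam A n Q rule: less_induct)
  case (less N)
  note outer = less.hyps and mon = less.prems(3) and tc = less.prems(1) and det = less.prems(2)
  have bc: "bool_closed D" using tc by (simp add: temporally_closed_def)
  have finN: "finite N" using mon by (simp add: aperiodic_monoid_def)
  note bcs = bool_closed_not[OF bc] bool_closed_or[OF bc] bool_closed_and[OF bc]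
    bool_closed_bex[OF bc] bool_closed_const[OF bc]
  have tcs: "until_on R P P' \<in> D" "since_on R P P' \<in> D" if "P \<in> D" "P' \<in> D" for P P'
    using tc that by (auto simp: temporally_closed_def)
  show ?case using less.prems(4-6)
  proof (induction "card A" arbitrary: A n Q rule: less_induct)
    case (less A)
    note inner = less.hyps and AN = less.prems(1) and lamD = less.prems(2) and QD = less.prems(3)
    have finA: "finite A" using finN AN finite_subset by auto
    have inA: "(\<lambda>x. lam x \<in> C) \<in> D" if "C \<subseteq> A" for C
    proof -
      have "(\<lambda>x. lam x \<in> C) = (\<lambda>x. \<exists>a\<in>C. lam x = a)" by auto
      then show ?thesis using bcs(4)[of C "\<lambda>a x. lam x = a"] that finA finite_subset lamD by auto
    qed
    show ?case
    \<comment> \<open>Base case: all labels are the unit, and a path is a plain until or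
      since.\<close>
    proof (cases "A \<subseteq> {u}")
      case True
      have "(\<lambda>x. \<exists>y. pth R lam m u A x n y \<and> Q y) =
          (\<lambda>x. n = u \<and> (Q x \<or> until_on R (\<lambda>y. lam y \<in> A) (\<lambda>y. lam y \<in> A \<and> Q y) x))"
        unfolding pth_trivial_alphabet[OF True mon]
        by (intro ext) (simp add: rtranclp_until[of R "\<lambda>y. lam y \<in> A" _ Q, symmetric])
      moreover have "(\<lambda>x. \<exists>y. pth R lam m u A y n x \<and> Q y) =
          (\<lambda>x. n = u \<and> (Q x \<or> lam x \<in> A \<and> since_on R (\<lambda>y. lam y \<in> A) Q x))"
        unfolding pth_trivial_alphabet[OF True mon]
        by (intro ext) (simp add: rtranclp_since[of R "\<lambda>y. lam y \<in> A" _ Q, symmetric])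
      moreover have "\<dots> \<in> D" by (intro bcs tcs QD inA subset_refl)
      moreover have "(\<lambda>x. n = u \<and> (Q x \<or> until_on R (\<lambda>y. lam y \<in> A) (\<lambda>y. lam y \<in> A \<and> Q y) x)) \<in> D"
        by (intro bcs tcs QD inA subset_refl)
      ultimately show ?thesis by simp
    next
      case False
      then obtain c where c: "c \<in> A" "c \<noteq> u" by auto
      interpret L: local_divisor_step R lam m u N A c
        using mon AN c det by unfold_locales auto
      have cD: "(\<lambda>x. lam x = c) \<in> D" using lamD c by auto
      have "card L.B < card A" using card_Diff1_less[OF finA c(1)] .
      then have IB: "(\<lambda>x. \<exists>y. L.pB x p y \<and> P y) \<in> D" "(\<lambda>y. \<exists>x. L.pB x p y \<and> P x) \<in> D"
        if "P \<in> D" for p P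
        using inner[of L.B P p] AN lamD that by auto
      have nx: "(\<lambda>x. \<exists>z. R x z \<and> P z) \<in> D" "(\<lambda>x. \<exists>z. R z x \<and> P z) \<in> D" if "P \<in> D" for P
        using temporally_closed_next[OF tc that] .
      have blkD: "(\<lambda>y. L.blk p y) \<in> D" for p
        unfolding L.blk_def using nx(2)[OF IB(2)[OF cD, of p]] .
      have lam'D: "(\<lambda>x. L.lam' x = a) \<in> D" if "a \<in> L.N'" for a
        unfolding L.lam'_iff[OF that] by (intro bcs finN blkD)
      have tc': "temporally_closed L.R' D"
        unfolding temporally_closed_def L.until_R' L.since_R'
        by (intro conjI ballI bc bcs tcs cD inA Diff_subset)
      \<comment> \<open>The unit of \<open>N\<close> is missing from the local divisor, so the outer
        induction hypothesis applies to it.\<close>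
      have "L.N' \<subset> N"
        using ldiv_subset[OF mon L.cN] ldiv_unit_notin[OF mon L.cN c(2)] L.uN by auto
      then have lt: "card L.N' < card N" using finN psubset_card_mono by auto
      have IN: "(\<lambda>x. \<exists>y. L.p' x r y \<and> P y) \<in> D" "(\<lambda>y. \<exists>x. L.p' x r y \<and> P x) \<in> D"
        if "P \<in> D" for r P
        using outer[OF lt tc' L.R'_det ldiv_monoid[OF mon L.cN] subset_refl lam'D that, where n = r] by auto
      have N'N: "L.N' \<subseteq> N" using ldiv_subset[OF mon L.cN] .
      \<comment> \<open>\<open>decompose\<close> and \<open>compose\<close> as one equivalence. The
        factors range over the finite set \<open>N\<close>, so the right-hand side is a finite
        disjunction of nested path predicates.\<close>
      have dec: "L.pA x n y \<longleftrightarrow> L.pB x n y \<or> (\<exists>p\<in>N. \<exists>r\<in>N. \<exists>q\<in>N. n = m p (m r q) \<and>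
          (\<exists>x1. L.pB x p x1 \<and> (\<exists>z0. R x1 z0 \<and> lam z0 = c \<and> (\<exists>z1. L.p' z0 r z1 \<and> L.pB z1 q y))))"
        (is "_ \<longleftrightarrow> ?rhs x y") for x y
      proof
        assume "L.pA x n y"
        from L.decompose[OF this] show "?rhs x y"
        proof (elim disjE exE conjE)
          fix p r q x1 z0 z1
          assume *: "L.pB x p x1" "R x1 z0" "lam z0 = c" "L.p' z0 r z1" "L.pB z1 q y" "n = m p (m r q)"
          have "p \<in> N" "r \<in> N" "q \<in> N" using L.pB_in *(1,5) L.p'_in[OF *(4)] N'N by blast+
          then show ?thesis using * by blast
        qed blast
      next
        assume "?rhs x y"
        then show "L.pA x n y"
        proof (elim disjE bexE exE conjE)
          assume "L.pB x n y"
          then show ?thesis by (rule pth_mono) blast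
        next
          fix p r q x1 z0 z1
          assume *: "L.pB x p x1" "R x1 z0" "lam z0 = c" "L.p' z0 r z1" "L.pB z1 q y" "n = m p (m r q)"
          show ?thesis unfolding *(6) by (rule L.compose[OF *(1-5)])
        qed
      qed
      have "(\<lambda>x. \<exists>y. L.pA x n y \<and> Q y) = (\<lambda>x. (\<exists>y. L.pB x n y \<and> Q y) \<or>
          (\<exists>p\<in>N. \<exists>r\<in>N. \<exists>q\<in>N. n = m p (m r q) \<and>
          (\<exists>x1. L.pB x p x1 \<and> (\<exists>z0. R x1 z0 \<and> lam z0 = c \<and>
             (\<exists>z1. L.p' z0 r z1 \<and> (\<exists>y. L.pB z1 q y \<and> Q y))))))"
        unfolding dec
        by (intro ext iffI; elim exE conjE disjE bexE; (rule disjI1, blast | intro exI conjI disjI2 bexI; assumption | blast))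
      moreover have "\<dots> \<in> D"
        by (intro bcs finN IB IN nx cD QD)
      moreover have "(\<lambda>y. \<exists>x. L.pA x n y \<and> Q x) = (\<lambda>y. (\<exists>x. L.pB x n y \<and> Q x) \<or>
          (\<exists>p\<in>N. \<exists>r\<in>N. \<exists>q\<in>N. n = m p (m r q) \<and>
          (\<exists>z1. L.pB z1 q y \<and> (\<exists>z0. L.p' z0 r z1 \<and> (lam z0 = c \<and>
             (\<exists>x1. R x1 z0 \<and> (\<exists>x. L.pB x p x1 \<and> Q x)))))))"
        unfolding dec
        by (intro ext iffI; elim exE conjE disjE bexE; (rule disjI1, blast | intro exI conjI disjI2 bexI; assumption | blast))
      moreover have "\<dots> \<in> D"
        by (intro bcs finN IB IN nx cD QD)
      ultimately show ?thesis by simp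
    qed
  qed
qed

section \<open>Ehrenfeucht-Fraisse classes of forests\<close>

text \<open>\<open>FC a P X Y\<close> is a first root with label \<open>a\<close>, pebbles
  \<open>P\<close> and child forest \<open>X\<close>, followed by the forest \<open>Y\<close> of its
  right siblings.\<close>

datatype 'l forest = FN | FC 'l "nat set" "'l forest" "'l forest"

primrec app :: "'l forest \<Rightarrow> 'l forest \<Rightarrow> 'l forest" where
  "app FN G = G"
| "app (FC a P X Y) G = FC a P X (app Y G)"

text \<open>Only pebbles below \<open>N\<close> are seen, which keeps the number of classes
  finite.\<close>

primrec occ :: "nat \<Rightarrow> 'l forest \<Rightarrow> (nat \<times> 'l) set" where
  "occ N FN = {}"
| "occ N (FC a P X Y) = (P \<inter> {..<N}) \<times> {a} \<union> occ N X \<union> occ N Y"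

abbreviation pebs :: "nat \<Rightarrow> 'l forest \<Rightarrow> nat set" where
  "pebs N F \<equiv> fst ` occ N F"

primrec lts :: "nat \<Rightarrow> 'l forest \<Rightarrow> (nat \<times> nat) set" where
  "lts N FN = {}"
| "lts N (FC a P X Y) = (P \<inter> {..<N}) \<times> (pebs N X \<union> pebs N Y) \<union> pebs N X \<times> pebs N Y \<union>
     lts N X \<union> lts N Y"

primrec ancs :: "nat \<Rightarrow> 'l forest \<Rightarrow> (nat \<times> nat) set" where
  "ancs N FN = {}"
| "ancs N (FC a P X Y) = (P \<inter> {..<N}) \<times> pebs N X \<union> ancs N X \<union> ancs N Y"

definition atomic :: "nat \<Rightarrow> 'l forest \<Rightarrow> (nat \<times> 'l) set \<times> (nat \<times> nat) set \<times> (nat \<times> nat) set" where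
  "atomic N F = (occ N F, lts N F, ancs N F)"

primrec marks :: "nat \<Rightarrow> 'l forest \<Rightarrow> 'l forest set" where
  "marks p FN = {}"
| "marks p (FC a P X Y) = insert (FC a (insert p P) X Y)
     ((\<lambda>X'. FC a P X' Y) ` marks p X \<union> (\<lambda>Y'. FC a P X Y') ` marks p Y)"

text \<open>A class is the set of its members, so that equivalence becomes equality of sets. With
  \<open>Suc k\<close> rounds left the next pebble is \<open>k\<close>: pebbles are placed in
  descending order, and the number of rounds tells which of them are still free.\<close>

primrec cls :: "nat \<Rightarrow> nat \<Rightarrow> 'l forest \<Rightarrow> 'l forest set" where
  "cls N 0 = (\<lambda>F. {G. atomic N G = atomic N F})"
| "cls N (Suc k) = (\<lambda>F. {G. cls N k G = cls N k F \<and> cls N k ` marks k G = cls N k ` marks k F})"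

definition eqv :: "nat \<Rightarrow> nat \<Rightarrow> 'l forest \<Rightarrow> 'l forest \<Rightarrow> bool" where
  "eqv N k F G \<longleftrightarrow> cls N k F = cls N k G"

lemma cls_eq_iff: "cls N k F = cls N k G \<longleftrightarrow> eqv N k F G"
  by (simp add: eqv_def)

lemma eqv_refl [simp]: "eqv N k F F"
  by (simp add: eqv_def)

lemma eqv_sym: "eqv N k F G \<Longrightarrow> eqv N k G F"
  by (simp add: eqv_def)

lemma eqv_trans: "eqv N k F G \<Longrightarrow> eqv N k G H \<Longrightarrow> eqv N k F H"
  by (simp add: eqv_def)

lemma self_in_cls: "F \<in> cls N k F"
  by (cases k) auto

lemma eqv_0: "eqv N 0 F G \<longleftrightarrow> atomic N F = atomic N G"
proof
  assume "eqv N 0 F G"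
  then have "F \<in> cls N 0 G" using self_in_cls[of F N 0] by (simp only: eqv_def)
  then show "atomic N F = atomic N G" by simp
qed (simp add: eqv_def)

lemma eqv_Suc_iff: "eqv N (Suc k) F G \<longleftrightarrow>
    cls N k F = cls N k G \<and> cls N k ` marks k F = cls N k ` marks k G"
proof
  assume "eqv N (Suc k) F G"
  then have "F \<in> cls N (Suc k) G" using self_in_cls[of F N "Suc k"] by (simp only: eqv_def)
  then show "cls N k F = cls N k G \<and> cls N k ` marks k F = cls N k ` marks k G" by simp
qed (simp add: eqv_def)

lemma eqv_Suc:
  "eqv N (Suc k) F G \<longleftrightarrow> eqv N k F G \<and>
     (\<forall>F'\<in>marks k F. \<exists>G'\<in>marks k G. eqv N k F' G') \<and>
     (\<forall>G'\<in>marks k G. \<exists>F'\<in>marks k F. eqv N k F' G')"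
proof -
  have "A = B \<longleftrightarrow> (\<forall>a\<in>A. a \<in> B) \<and> (\<forall>b\<in>B. b \<in> A)" for A B :: "'a forest set set" by blast
  then show ?thesis unfolding eqv_Suc_iff by (simp add: image_iff eqv_def Bex_def eq_commute)
qed

lemma eqv_mono: "eqv N k F G \<Longrightarrow> j \<le> k \<Longrightarrow> eqv N j F G"
  by (induction k) (auto simp: le_Suc_eq eqv_Suc)

lemma occ_subset: "occ N F \<subseteq> {..<N} \<times> UNIV"
  by (induction F) auto

lemma lts_subset: "lts N F \<subseteq> {..<N} \<times> {..<N}"
proof (induction F)
  case (FC a P X Y)
  have "pebs N G \<subseteq> {..<N}" for G :: "'a forest" using occ_subset[of N G] by auto
  then show ?case using FC by (simp) blast
qed simp

lemma ancs_subset: "ancs N F \<subseteq> {..<N} \<times> {..<N}"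
proof (induction F)
  case (FC a P X Y)
  have "pebs N G \<subseteq> {..<N}" for G :: "'a forest" using occ_subset[of N G] by auto
  then show ?case using FC by (simp) blast
qed simp

text \<open>A class of rank \<open>Suc k\<close> is determined by one class of rank \<open>k\<close>
  and one set of such classes.\<close>

lemma finite_cls:
  assumes "finite (UNIV :: 'l set)"
  shows "finite (range (cls N k :: 'l forest \<Rightarrow> _))"
proof (induction k)
  case 0
  have "finite (range (atomic N :: 'l forest \<Rightarrow> _))"
  proof (rule finite_subset)
    show "range (atomic N :: 'l forest \<Rightarrow> _) \<subseteq>
      Pow ({..<N} \<times> UNIV) \<times> Pow ({..<N} \<times> {..<N}) \<times> Pow ({..<N} \<times> {..<N})"
      by (rule image_subsetI) (simp add: atomic_def occ_subset lts_subset ancs_subset)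
    show "finite (Pow ({..<N} \<times> (UNIV :: 'l set)) \<times> Pow ({..<N} \<times> {..<N}) \<times> Pow ({..<N} \<times> {..<N}))"
      using assms by simp
  qed
  then have "finite ((\<lambda>t. {G :: 'l forest. atomic N G = t}) ` range (atomic N :: 'l forest \<Rightarrow> _))" by simp
  moreover have "range (cls N 0 :: 'l forest \<Rightarrow> _) = (\<lambda>t. {G. atomic N G = t}) ` range (atomic N :: 'l forest \<Rightarrow> _)"
    unfolding image_image by simp
  ultimately show ?case by simp
next
  case (Suc k)
  let ?C = "range (cls N k :: 'l forest \<Rightarrow> _)"
  let ?h = "\<lambda>(t, S). {G :: 'l forest. cls N k G = t \<and> cls N k ` marks k G = S}"
  have "cls N (Suc k) F = ?h (cls N k F, cls N k ` marks k F)" for F :: "'l forest"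
    by simp
  moreover have "(cls N k F, cls N k ` marks k F) \<in> ?C \<times> Pow ?C" for F :: "'l forest" by blast
  ultimately have "cls N (Suc k) F \<in> ?h ` (?C \<times> Pow ?C)" for F :: "'l forest"
    by (rule image_eqI)
  then have "range (cls N (Suc k) :: 'l forest \<Rightarrow> _) \<subseteq> ?h ` (?C \<times> Pow ?C)"
    by (rule image_subsetI)
  moreover have "finite (?h ` (?C \<times> Pow ?C))" using Suc by simp
  ultimately show ?case by (rule finite_subset)
qed

lemma app_FN [simp]: "app F FN = F"
  by (induction F) auto

lemma app_assoc: "app (app F G) H = app F (app G H)"
  by (induction F) auto

lemma occ_app [simp]: "occ N (app F G) = occ N F \<union> occ N G"
  by (induction F) auto

lemma pebs_FC: "pebs N (FC a P X Y) = (P \<inter> {..<N}) \<union> pebs N X \<union> pebs N Y"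
  by (simp add: image_Un)

lemma lts_app [simp]: "lts N (app F G) = lts N F \<union> lts N G \<union> pebs N F \<times> pebs N G"
proof (induction F)
  case (FC a P X Y)
  have "Q \<times> (x \<union> (y \<union> g)) \<union> x \<times> (y \<union> g) \<union> lx \<union> (ly \<union> lg \<union> y \<times> g) =
      (Q \<times> (x \<union> y) \<union> x \<times> y \<union> lx \<union> ly) \<union> lg \<union> (Q \<union> x \<union> y) \<times> g"
    for Q x y g :: "nat set" and lx ly lg by blast
  then show ?case unfolding app.simps lts.simps pebs_FC occ_app image_Un FC.IH .
qed simp

lemma ancs_app [simp]: "ancs N (app F G) = ancs N F \<union> ancs N G"
  by (induction F) auto

lemma marks_app: "marks p (app F G) = (\<lambda>F'. app F' G) ` marks p F \<union> app F ` marks p G"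
  by (induction F) (auto simp: image_Un image_image)

text \<open>The strategy for sums of structures: a pebble placed in one of the two parts is answered
  in the same part.\<close>

lemma eqv_app:
  fixes F F' G G' :: "'l forest"
  shows "eqv N k F F' \<Longrightarrow> eqv N k G G' \<Longrightarrow> eqv N k (app F G) (app F' G')"
proof (induction k arbitrary: F F' G G')
  case 0
  then show ?case by (simp add: eqv_0 atomic_def)
next
  case (Suc k)
  have half: "\<exists>H'\<in>marks k (app F' G'). eqv N k H H'"
    if F: "eqv N (Suc k) F F'" and G: "eqv N (Suc k) G G'" and H: "H \<in> marks k (app F G)" for F F' G G' H :: "'l forest"
  proof -
    have FG: "eqv N k F F'" "eqv N k G G'" using F G by (simp_all add: eqv_Suc)
    from H consider F1 where "F1 \<in> marks k F" "H = app F1 G" | G1 where "G1 \<in> marks k G" "H = app F G1"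
      unfolding marks_app by blast
    then show ?thesis
    proof cases
      case 1
      then obtain F2 where F2: "F2 \<in> marks k F'" "eqv N k F1 F2" using F by (auto simp: eqv_Suc)
      have "eqv N k H (app F2 G')" unfolding 1(2) by (rule Suc.IH[OF F2(2) FG(2)])
      then show ?thesis using F2(1) unfolding marks_app by blast
    next
      case 2
      then obtain G2 where G2: "G2 \<in> marks k G'" "eqv N k G1 G2" using G by (auto simp: eqv_Suc)
      have "eqv N k H (app F' G2)" unfolding 2(2) by (rule Suc.IH[OF FG(1) G2(2)])
      then show ?thesis using G2(1) unfolding marks_app by blast
    qed
  qed
  have "eqv N k (app F G) (app F' G')" using Suc.IH[of F F' G G'] Suc.prems by (simp add: eqv_Suc)
  moreover have "\<exists>H\<in>marks k (app F G). eqv N k H H'" if H': "H' \<in> marks k (app F' G')" for H'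
    using half[OF Suc.prems[THEN eqv_sym] H'] eqv_sym[of N k H'] by fast
  ultimately show ?case unfolding eqv_Suc[of N k "app F G"] using half[OF Suc.prems] by simp
qed

lemma eqv_FC:
  fixes X X' Y Y' :: "'l forest"
  shows "eqv N k X X' \<Longrightarrow> eqv N k Y Y' \<Longrightarrow> eqv N k (FC a P X Y) (FC a P X' Y')"
proof (induction k arbitrary: X X' Y Y' P)
  case 0
  then show ?case by (simp add: eqv_0 atomic_def)
next
  case (Suc k)
  have half: "\<exists>H'\<in>marks k (FC a P X' Y'). eqv N k H H'"
    if X: "eqv N (Suc k) X X'" and Y: "eqv N (Suc k) Y Y'" and H: "H \<in> marks k (FC a P X Y)" for X X' Y Y' H :: "'l forest"
  proof -
    have XY: "eqv N k X X'" "eqv N k Y Y'" using X Y by (simp_all add: eqv_Suc)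
    from H consider "H = FC a (insert k P) X Y" | X1 where "X1 \<in> marks k X" "H = FC a P X1 Y"
      | Y1 where "Y1 \<in> marks k Y" "H = FC a P X Y1"
      unfolding marks.simps by blast
    then show ?thesis
    proof cases
      case 1
      have "eqv N k H (FC a (insert k P) X' Y')" unfolding 1 by (rule Suc.IH[OF XY])
      then show ?thesis by auto
    next
      case 2
      then obtain X2 where X2: "X2 \<in> marks k X'" "eqv N k X1 X2" using X by (auto simp: eqv_Suc)
      have "eqv N k H (FC a P X2 Y')" unfolding 2(2) by (rule Suc.IH[OF X2(2) XY(2)])
      then show ?thesis using X2(1) by auto
    next
      case 3
      then obtain Y2 where Y2: "Y2 \<in> marks k Y'" "eqv N k Y1 Y2" using Y by (auto simp: eqv_Suc)
      have "eqv N k H (FC a P X' Y2)" unfolding 3(2) by (rule Suc.IH[OF XY(1) Y2(2)])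
      then show ?thesis using Y2(1) by auto
    qed
  qed
  have "eqv N k (FC a P X Y) (FC a P X' Y')" using Suc.IH[of X X' Y Y' P] Suc.prems by (simp add: eqv_Suc)
  moreover have "\<exists>H\<in>marks k (FC a P X Y). eqv N k H H'" if H': "H' \<in> marks k (FC a P X' Y')" for H'
    using half[OF Suc.prems[THEN eqv_sym] H'] eqv_sym[of N k H'] by fast
  ultimately show ?case unfolding eqv_Suc[of N k "FC a P X Y"] using half[OF Suc.prems] by simp
qed

section \<open>Contexts with one hole, pumping, and the finite monoid of their actions\<close>

definition congruent_ctx :: "nat \<Rightarrow> ('l forest \<Rightarrow> 'l forest) \<Rightarrow> bool" where
  "congruent_ctx N c \<longleftrightarrow> (\<forall>k X X'. eqv N k X X' \<longrightarrow> eqv N k (c X) (c X'))"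

text \<open>The forests in \<open>Cs\<close> are the versions of the context \<open>c\<close> with the new pebble placed outside the hole.\<close>

definition ctx :: "nat \<Rightarrow> ('l forest \<Rightarrow> 'l forest) \<Rightarrow> bool" where
  "ctx N c \<longleftrightarrow> congruent_ctx N c \<and> (\<forall>X. atomic N (c X) = atomic N X) \<and>
     (\<forall>p. \<exists>Cs. (\<forall>c'\<in>Cs. congruent_ctx N c') \<and>
        (\<forall>X. marks p (c X) = (\<lambda>c'. c' X) ` Cs \<union> c ` marks p X))"

text \<open>Contexts are built from pebble-free forests: filling the hole then leaves the atomic
  type unchanged, which is what pumping needs when no round is left.\<close>

primrec clean :: "'l forest \<Rightarrow> bool" where
  "clean FN \<longleftrightarrow> True"
| "clean (FC a P X Y) \<longleftrightarrow> P = {} \<and> clean X \<and> clean Y"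

lemma clean_atomic: "clean F \<Longrightarrow> occ N F = {} \<and> lts N F = {} \<and> ancs N F = {}"
  by (induction F) auto

lemma ctx_id: "ctx N (\<lambda>X. X)"
  unfolding ctx_def congruent_ctx_def by (auto intro!: exI[of _ "{}"])

lemma ctx_app: "clean L \<Longrightarrow> ctx N (app L)"
  unfolding ctx_def
proof (intro conjI allI)
  assume cl: "clean L"
  show "congruent_ctx N (app L)" by (simp add: congruent_ctx_def eqv_app)
  show "atomic N (app L X) = atomic N X" for X using clean_atomic[OF cl, of N] by (simp add: atomic_def)
  show "\<exists>Cs. (\<forall>c'\<in>Cs. congruent_ctx N c') \<and>
        (\<forall>X. marks p (app L X) = (\<lambda>c'. c' X) ` Cs \<union> app L ` marks p X)" for p
    by (rule exI[of _ "app ` marks p L"])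
      (auto simp: marks_app congruent_ctx_def eqv_app image_image)
qed

lemma ctx_FC: "clean R \<Longrightarrow> ctx N (\<lambda>X. FC a {} X R)"
  unfolding ctx_def
proof (intro conjI allI)
  assume cl: "clean R"
  show "congruent_ctx N (\<lambda>X. FC a {} X R)" by (simp add: congruent_ctx_def eqv_FC)
  show "atomic N (FC a {} X R) = atomic N X" for X
    using clean_atomic[OF cl, of N] by (simp add: atomic_def)
  show "\<exists>Cs. (\<forall>c'\<in>Cs. congruent_ctx N c') \<and>
        (\<forall>X. marks p (FC a {} X R) = (\<lambda>c'. c' X) ` Cs \<union> (\<lambda>X. FC a {} X R) ` marks p X)" for p
    by (rule exI[of _ "insert (\<lambda>X. FC a {p} X R) ((\<lambda>R' X. FC a {} X R') ` marks p R)"])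
      (auto simp: congruent_ctx_def eqv_FC image_image)
qed

lemma congruent_ctx_comp: "congruent_ctx N c \<Longrightarrow> congruent_ctx N d \<Longrightarrow> congruent_ctx N (c \<circ> d)"
  by (simp add: congruent_ctx_def)

lemma ctx_comp:
  assumes c: "ctx N c" and d: "ctx N d"
  shows "ctx N (c \<circ> d)"
  unfolding ctx_def
proof (intro conjI allI)
  have cc: "congruent_ctx N c" "congruent_ctx N d" using c d by (auto simp: ctx_def)
  show "congruent_ctx N (c \<circ> d)" using congruent_ctx_comp cc .
  show "atomic N ((c \<circ> d) X) = atomic N X" for X using c d by (simp add: ctx_def)
  show "\<exists>Cs. (\<forall>c'\<in>Cs. congruent_ctx N c') \<and>
        (\<forall>X. marks p ((c \<circ> d) X) = (\<lambda>c'. c' X) ` Cs \<union> (c \<circ> d) ` marks p X)" for p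
  proof -
    obtain C where C: "\<forall>c'\<in>C. congruent_ctx N c'"
      "\<forall>X. marks p (c X) = (\<lambda>c'. c' X) ` C \<union> c ` marks p X"
      using c unfolding ctx_def by blast
    obtain E where E: "\<forall>c'\<in>E. congruent_ctx N c'"
      "\<forall>X. marks p (d X) = (\<lambda>c'. c' X) ` E \<union> d ` marks p X"
      using d unfolding ctx_def by blast
    show ?thesis
      by (rule exI[of _ "(\<lambda>c'. c' \<circ> d) ` C \<union> (\<lambda>d'. c \<circ> d') ` E"])
        (use C E cc in \<open>auto simp: image_Un image_image intro: congruent_ctx_comp\<close>)
  qed
qed

text \<open>The new pebble falls either into one of the \<open>n\<close> copies, with
  \<open>i\<close> copies around it and \<open>j\<close> inside it, or into the filling.\<close>

lemma marks_funpow: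
  assumes "\<forall>X. marks p (c X) = (\<lambda>c'. c' X) ` Cs \<union> c ` marks p X"
  shows "marks p ((c ^^ n) X) =
    {(c ^^ i) (c' ((c ^^ j) X)) | i j c'. c' \<in> Cs \<and> i + j + 1 = n} \<union> (c ^^ n) ` marks p X"
proof (induction n)
  case (Suc n)
  have "marks p ((c ^^ Suc n) X) = (\<lambda>c'. c' ((c ^^ n) X)) ` Cs \<union> c ` marks p ((c ^^ n) X)"
    using assms by simp
  also have "\<dots> = {(c ^^ i) (c' ((c ^^ j) X)) | i j c'. c' \<in> Cs \<and> i + j + 1 = Suc n} \<union> (c ^^ Suc n) ` marks p X"
    (is "?l = ?r")
  proof
    show "?l \<subseteq> ?r"
    proof
      fix F assume "F \<in> ?l"
      then consider c' where "c' \<in> Cs" "F = c' ((c ^^ n) X)"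
        | i j c' where "c' \<in> Cs" "i + j + 1 = n" "F = c ((c ^^ i) (c' ((c ^^ j) X)))"
        | X' where "X' \<in> marks p X" "F = c ((c ^^ n) X')"
        using Suc.IH by auto
      then show "F \<in> ?r"
      proof cases
        case 1
        then have "F = (c ^^ 0) (c' ((c ^^ n) X))" "0 + n + 1 = Suc n" by auto
        then show ?thesis using 1(1) by blast
      next
        case 2
        then have "F = (c ^^ Suc i) (c' ((c ^^ j) X))" "Suc i + j + 1 = Suc n" by auto
        then show ?thesis using 2(1) by blast
      qed auto
    qed
    show "?r \<subseteq> ?l"
    proof
      fix F assume "F \<in> ?r"
      then consider i j c' where "c' \<in> Cs" "i + j + 1 = Suc n" "F = (c ^^ i) (c' ((c ^^ j) X))"
        | X' where "X' \<in> marks p X" "F = (c ^^ Suc n) X'" by blast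
      then show "F \<in> ?l"
      proof cases
        case 1
        show ?thesis
        proof (cases i)
          case 0
          then show ?thesis using 1 by auto
        next
          case (Suc i')
          then have "F = c ((c ^^ i') (c' ((c ^^ j) X)))" "i' + j + 1 = n" using 1 by auto
          then show ?thesis using 1(1) Suc.IH unfolding \<open>marks p ((c ^^ n) X) = _\<close> by blast
        qed
      qed (use Suc.IH in auto)
    qed
  qed
  finally show ?case .
qed auto

lemma congruent_ctx_funpow: "congruent_ctx N c \<Longrightarrow> eqv N k X X' \<Longrightarrow> eqv N k ((c ^^ n) X) ((c ^^ n) X')"
  by (induction n) (auto simp: congruent_ctx_def)

text \<open>The bound solves b(k + 1) = 2 b(k) + 1 with b(0) = 0: one copy receives the pebble and
  splits the others into an outer and an inner power. A side with at most b(k) copies is reproduced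
  exactly, and a longer side may change its number of copies by induction.\<close>

lemma ctx_pumping:
  assumes c: "ctx N c"
  shows "2 ^ k - 1 \<le> n \<Longrightarrow> 2 ^ k - 1 \<le> m \<Longrightarrow> eqv N k ((c ^^ n) X) ((c ^^ m) X)"
proof (induction k arbitrary: n m X)
  case 0
  have "atomic N ((c ^^ n) X) = atomic N X" for n
    using c by (induction n) (auto simp: ctx_def)
  then show ?case by (simp add: eqv_0)
next
  case (Suc k)
  define b :: nat where "b = 2 ^ k - 1"
  have cc: "congruent_ctx N c" using c by (simp add: ctx_def)
  have b2: "2 ^ Suc k - 1 = 2 * b + 1" 
    using one_le_power[of "2::nat" k] unfolding b_def power_Suc by linarith
  obtain Cs where C: "\<forall>c'\<in>Cs. congruent_ctx N c'"
      "\<forall>X. marks k (c X) = (\<lambda>c'. c' X) ` Cs \<union> c ` marks k X"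
    using c unfolding ctx_def by blast
  have half: "\<exists>G'\<in>marks k ((c ^^ m) X). eqv N k F' G'"
    if "2 * b + 1 \<le> n" "2 * b + 1 \<le> m" "F' \<in> marks k ((c ^^ n) X)" for n m F'
  proof -
    from that(3) consider i j c' where "c' \<in> Cs" "i + j + 1 = n" "F' = (c ^^ i) (c' ((c ^^ j) X))"
      | X' where "X' \<in> marks k X" "F' = (c ^^ n) X'"
      unfolding marks_funpow[OF C(2)] by blast
    then show ?thesis
    proof cases
      case 1
      \<comment> \<open>\<open>b\<close> is the bound for \<open>k\<close> rounds. If one side has
        at most \<open>b\<close> copies it is kept, and then at least \<open>b\<close> copies remain
        on the other side in both powers; if both sides are longer, \<open>b\<close> outer copies
        and at least \<open>b\<close> inner ones are used for the answer.\<close>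
      have "\<exists>i' j'. i' + j' + 1 = m \<and> (i = i' \<or> b \<le> i \<and> b \<le> i') \<and> (j = j' \<or> b \<le> j \<and> b \<le> j')"
      proof (cases "i \<le> b")
        case True
        then show ?thesis using that 1 by (intro exI[of _ i] exI[of _ "m - 1 - i"]) auto
      next
        case False
        show ?thesis
        proof (cases "j \<le> b")
          case True
          then show ?thesis using that 1 False
            by (intro exI[of _ "m - 1 - j"] exI[of _ "j"]) auto
        next
          case F: False
          then show ?thesis using that 1 False
            by (intro exI[of _ b] exI[of _ "m - 1 - b"]) auto
        qed
      qed
      then obtain i' j' where ij: "i' + j' + 1 = m" "i = i' \<or> b \<le> i \<and> b \<le> i'" "j = j' \<or> b \<le> j \<and> b \<le> j'"
        by blast
      have pump: "eqv N k ((c ^^ i) Y) ((c ^^ i') Y)" "eqv N k ((c ^^ j) Y) ((c ^^ j') Y)" for Y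
        using ij Suc.IH[of i i' Y] Suc.IH[of j j' Y] unfolding b_def by auto
      have "eqv N k (c' ((c ^^ j) X)) (c' ((c ^^ j') X))"
        using C(1) 1(1) pump(2) unfolding congruent_ctx_def by blast
      then have "eqv N k F' ((c ^^ i) (c' ((c ^^ j') X)))"
        unfolding 1(3) by (rule congruent_ctx_funpow[OF cc])
      then have "eqv N k F' ((c ^^ i') (c' ((c ^^ j') X)))"
        using pump(1) by (rule eqv_trans)
      moreover have "(c ^^ i') (c' ((c ^^ j') X)) \<in> marks k ((c ^^ m) X)"
        unfolding marks_funpow[OF C(2)] using ij 1(1) by blast
      ultimately show ?thesis by blast
    next
      case 2
      then have "eqv N k F' ((c ^^ m) X')" using Suc.IH[of n m X'] that b_def by auto
      then show ?thesis unfolding marks_funpow[OF C(2)] using 2(1) by blast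
    qed
  qed
  have nm: "2 * b + 1 \<le> n" "2 * b + 1 \<le> m" using Suc.prems b2 by auto
  then have "eqv N k ((c ^^ n) X) ((c ^^ m) X)" using Suc.IH[of n m X] b_def by auto
  moreover have "\<exists>F'\<in>marks k ((c ^^ n) X). eqv N k F' G'" if "G' \<in> marks k ((c ^^ m) X)" for G'
    using half[OF nm(2,1) that] eqv_sym by blast
  ultimately show ?case unfolding eqv_Suc using half[OF nm] by blast
qed

text \<open>Action of a context on classes, computed on a chosen representative. Outside the set of
  classes the value is fixed, so contexts with the same effect on classes have equal actions, and
  there are only finitely many actions.\<close>

definition act :: "nat \<Rightarrow> nat \<Rightarrow> ('l forest \<Rightarrow> 'l forest) \<Rightarrow> 'l forest set \<Rightarrow> 'l forest set" where
  "act N k c t = (if t \<in> range (cls N k) then cls N k (c (SOME F. cls N k F = t)) else {})"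

lemma act_cls:
  assumes "congruent_ctx N c"
  shows "act N k c (cls N k F) = cls N k (c F)"
proof -
  have "cls N k (SOME G. cls N k G = cls N k F) = cls N k F"
    by (rule someI[of "\<lambda>G. cls N k G = cls N k F"]) simp
  then have "cls N k (c (SOME G. cls N k G = cls N k F)) = cls N k (c F)"
    using assms unfolding cls_eq_iff congruent_ctx_def by blast
  then show ?thesis by (simp add: act_def)
qed

lemma act_eqI: "(\<And>F. cls N k (c F) = cls N k (d F)) \<Longrightarrow> act N k c = act N k d"
  by (auto simp: act_def fun_eq_iff)

lemma cls_nonempty: "cls N k F \<noteq> {}"
  using self_in_cls by blast

text \<open>On arguments that are no classes both sides give the empty set, because the empty set is
  no class itself.\<close>

lemma act_comp:
  fixes c d :: "'a forest \<Rightarrow> 'a forest"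
  assumes "congruent_ctx N c" "congruent_ctx N d"
  shows "act N k c \<circ> act N k d = act N k (c \<circ> d)"
proof
  fix t
  show "(act N k c \<circ> act N k d) t = act N k (c \<circ> d) t"
  proof (cases "t \<in> range (cls N k)")
    case True
    then obtain F where "t = cls N k F" by auto
    then show ?thesis
      using act_cls[OF assms(1)] act_cls[OF assms(2)] act_cls[OF congruent_ctx_comp[OF assms]] by simp
  next
    case False
    then have "act N k d t = {}" "act N k (c \<circ> d) t = {}" by (simp_all add: act_def)
    moreover have "{} \<notin> range (cls N k :: 'a forest \<Rightarrow> _)" using cls_nonempty[of N k] by force
    ultimately show ?thesis by (simp add: act_def)
  qed
qed

definition ctx_monoid :: "nat \<Rightarrow> nat \<Rightarrow> ('l forest set \<Rightarrow> 'l forest set) set" where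
  "ctx_monoid N k = act N k ` {c. ctx N c}"

lemma ctx_funpow: "ctx N c \<Longrightarrow> ctx N (c ^^ n)"
  by (induction n) (auto simp: ctx_comp id_def ctx_id)

text \<open>Finiteness comes from \<open>finite_cls\<close>, and by pumping the powers of an action
  are stationary from the exponent 2^k - 1 on.\<close>

lemma ctx_monoid:
  assumes "finite (UNIV :: 'l set)"
  shows "aperiodic_monoid (ctx_monoid N k :: ('l forest set \<Rightarrow> 'l forest set) set) (\<circ>) (act N k (\<lambda>X. X))"
proof -
  let ?M = "ctx_monoid N k :: ('l forest set \<Rightarrow> 'l forest set) set"
  let ?u = "act N k (\<lambda>X. X) :: 'l forest set \<Rightarrow> 'l forest set"
  let ?C = "range (cls N k :: 'l forest \<Rightarrow> _)"
  have cong: "congruent_ctx N c" if "ctx N c" for c :: "'l forest \<Rightarrow> _" using that by (simp add: ctx_def)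
  have fin: "finite ?M"
  proof (rule finite_subset)
    show "?M \<subseteq> {f. \<forall>x. (x \<in> ?C \<longrightarrow> f x \<in> ?C) \<and> (x \<notin> ?C \<longrightarrow> f x = {})}"
      by (auto simp: ctx_monoid_def act_def)
    show "finite {f. \<forall>x. (x \<in> ?C \<longrightarrow> f x \<in> ?C) \<and> (x \<notin> ?C \<longrightarrow> f x = {})}"
      by (rule finite_set_of_finite_funs) (rule finite_cls[OF assms])+
  qed
  have rep: "\<exists>c. ctx N c \<and> f = act N k c" if f: "f \<in> ?M" for f
    using f unfolding ctx_monoid_def by blast
  have clo: "f \<circ> g \<in> ?M" if fg: "f \<in> ?M" "g \<in> ?M" for f g
  proof -
    obtain c d where c: "ctx N c" "f = act N k c" and d: "ctx N d" "g = act N k d"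
      using rep[OF fg(1)] rep[OF fg(2)] by blast
    have "f \<circ> g = act N k (c \<circ> d)"
      unfolding c(2) d(2) by (rule act_comp[OF cong[OF c(1)] cong[OF d(1)]])
    then show ?thesis using ctx_comp[OF c(1) d(1)] unfolding ctx_monoid_def by blast
  qed
  have uni: "?u \<circ> f = f \<and> f \<circ> ?u = f" if f: "f \<in> ?M" for f
  proof -
    obtain c where c: "ctx N c" "f = act N k c" using rep[OF f] by blast
    then show ?thesis using act_comp[OF cong[OF ctx_id] cong[OF c(1)]]
        act_comp[OF cong[OF c(1)] cong[OF ctx_id]] by (simp add: comp_def)
  qed
  have ape: "\<exists>n. mpow (\<circ>) ?u f (Suc n) = mpow (\<circ>) ?u f n" if f: "f \<in> ?M" for f
  proof -
    obtain c where c: "ctx N c" "f = act N k c" using rep[OF f] by blast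
    have pw: "mpow (\<circ>) ?u f n = act N k (c ^^ n)" for n
    proof (induction n)
      case 0
      then show ?case by (simp add: id_def)
    next
      case (Suc n)
      then show ?case using act_comp[OF cong[OF ctx_funpow[OF c(1)]] cong[OF c(1)], of k n] c(2)
        by (simp only: mpow.simps funpow_Suc_right)
    qed
    have "act N k (c ^^ Suc (2 ^ k - 1)) = act N k (c ^^ (2 ^ k - 1))"
      by (rule act_eqI) (simp only: cls_eq_iff, rule ctx_pumping[OF c(1)], auto)
    then show ?thesis unfolding pw by blast
  qed
  have "?u \<in> ?M" using ctx_id by (auto simp: ctx_monoid_def)
  then show ?thesis unfolding aperiodic_monoid_def using fin clo uni ape by (auto simp: comp_assoc)
qed

section \<open>Forests of intervals\<close>

text \<open>Forest on the positions from \<open>a\<close> to \<open>b - 1\<close>, where the subtree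
  of \<open>a\<close> stops before \<open>e a\<close>. Minimum and maximum secure termination for an
  arbitrary \<open>e\<close>; on closed intervals they disappear by \<open>ivf_step\<close>.\<close>

function ivf :: "(nat \<Rightarrow> nat) \<Rightarrow> (nat \<Rightarrow> 'l) \<Rightarrow> (nat \<Rightarrow> nat set) \<Rightarrow> nat \<Rightarrow> nat \<Rightarrow> 'l forest" where
  "ivf e l P a b = (if a < b then FC (l a) (P a) (ivf e l P (a + 1) (min (e a) b)) (ivf e l P (max (a + 1) (e a)) b)
     else FN)"
  by auto
termination by (relation "measure (\<lambda>(e, l, P, a, b). b - a)") auto

declare ivf.simps [simp del]

lemma ex_pair_split:
  assumes "\<And>i j. X i j \<longleftrightarrow> i = a \<and> K j \<or> i = a \<and> R j \<or> K i \<and> R j \<or> Y i j \<or> Z i j"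
  shows "(\<exists>i j. X i j \<and> A i \<and> B j) \<longleftrightarrow> A a \<and> (\<exists>j. K j \<and> B j) \<or> A a \<and> (\<exists>j. R j \<and> B j) \<or>
      (\<exists>i. K i \<and> A i) \<and> (\<exists>j. R j \<and> B j) \<or> (\<exists>i j. Y i j \<and> A i \<and> B j) \<or> (\<exists>i j. Z i j \<and> A i \<and> B j)"
  unfolding assms by auto

lemma ex_pair_split':
  assumes "\<And>i j. X i j \<longleftrightarrow> i = a \<and> K j \<or> Y i j \<or> Z i j"
  shows "(\<exists>i j. X i j \<and> A i \<and> B j) \<longleftrightarrow> A a \<and> (\<exists>j. K j \<and> B j) \<or>
      (\<exists>i j. Y i j \<and> A i \<and> B j) \<or> (\<exists>i j. Z i j \<and> A i \<and> B j)"
  unfolding assms by auto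

locale itree =
  fixes e :: "nat \<Rightarrow> nat" and m :: nat
  assumes e_gt: "a < m \<Longrightarrow> a < e a" and e_le: "a < m \<Longrightarrow> e a \<le> m"
    and e_nested: "a \<le> k \<Longrightarrow> k < e a \<Longrightarrow> a < m \<Longrightarrow> e k \<le> e a"
begin

text \<open>The interval consists of whole subtrees, so \<open>ivf\<close> truncates
  nothing.\<close>

definition closed :: "nat \<Rightarrow> nat \<Rightarrow> bool" where
  "closed a b \<longleftrightarrow> b \<le> m \<and> (\<forall>x. a \<le> x \<and> x < b \<longrightarrow> e x \<le> b)"

lemma closed_sub: "a < m \<Longrightarrow> closed a (e a)"
  unfolding closed_def using e_le e_nested by blast

lemma closed_Suc: "closed a b \<Longrightarrow> closed (Suc a) b"
  unfolding closed_def by simp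

lemma closed_kids: "a < m \<Longrightarrow> closed (Suc a) (e a)"
  by (rule closed_Suc[OF closed_sub])

lemma closed_right: "closed a b \<Longrightarrow> a \<le> c \<Longrightarrow> closed c b"
  unfolding closed_def by simp

lemma closed_less: "closed a b \<Longrightarrow> a \<le> x \<Longrightarrow> x < b \<Longrightarrow> e x \<le> b \<and> x < e x \<and> x < m"
  unfolding closed_def using e_gt[of x] by auto

lemma ivf_empty [simp]: "ivf e l P a a = FN"
  by (subst ivf.simps) simp

lemma ivf_step: "closed a b \<Longrightarrow> a < b \<Longrightarrow>
    ivf e l P a b = FC (l a) (P a) (ivf e l P (Suc a) (e a)) (ivf e l P (e a) b)"
  using closed_less[of a b a] by (subst ivf.simps) (simp add: min_def max_def)

text \<open>Follows the recursion of \<open>ivf\<close>: a nonempty closed interval splits into its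
  first node, the proper descendants of this node, and the rest.\<close>

lemma closed_induct [consumes 2, case_names empty step]:
  assumes "closed a b" "a \<le> b" "\<And>a. Q a a"
    and "\<And>a b. closed a b \<Longrightarrow> a < b \<Longrightarrow> a < e a \<Longrightarrow> e a \<le> b \<Longrightarrow> Q (Suc a) (e a) \<Longrightarrow> Q (e a) b \<Longrightarrow> Q a b"
  shows "Q a b"
  using assms(1,2)
proof (induction "b - a" arbitrary: a b rule: less_induct)
  case less
  show ?case
  proof (cases "a = b")
    case False
    then have ab: "a < b" using less.prems by simp
    note c = closed_less[OF less.prems(1) order_refl ab]
    show ?thesis
    proof (rule assms(4)[OF less.prems(1) ab])
      have "e a - Suc a < b - a" using c by linarith
      then show "Q (Suc a) (e a)" using less.hyps[of "e a" "Suc a"] closed_kids[of a] c by simp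
      have "b - e a < b - a" using c by linarith
      then show "Q (e a) b" using less.hyps[of b "e a"] closed_right[OF less.prems(1), of "e a"] c by simp
    qed (use c in auto)
  qed (use assms(3) in simp)
qed

lemma ivf_cong:
  assumes "closed a b" "a \<le> b" "\<And>j. a \<le> j \<Longrightarrow> j < b \<Longrightarrow> l j = l' j \<and> P j = P' j"
  shows "ivf e l P a b = ivf e l' P' a b"
  using assms
proof (induction rule: closed_induct)
  case (step a b)
  have "ivf e l P (Suc a) (e a) = ivf e l' P' (Suc a) (e a)" using step by simp
  moreover have "ivf e l P (e a) b = ivf e l' P' (e a) b" using step by simp
  ultimately show ?case using step.prems[of a] step.hyps(2) by (simp add: ivf_step[OF step.hyps(1,2)])
qed simp

lemma ivf_split:
  assumes "closed a c" "a \<le> c" "closed c b" "c \<le> b"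
  shows "ivf e l P a b = app (ivf e l P a c) (ivf e l P c b)"
  using assms
proof (induction rule: closed_induct)
  case (step a c)
  have cl: "closed a b" unfolding closed_def
  proof (intro conjI allI impI)
    show "b \<le> m" using step.prems by (simp add: closed_def)
    fix x assume x: "a \<le> x \<and> x < b"
    show "e x \<le> b"
    proof (cases "x < c")
      case True
      then show ?thesis using step.hyps(1) step.prems x closed_less[of a c x] by simp
    next
      case False
      then show ?thesis using step.prems x closed_less[of c b x] by simp
    qed
  qed
  have "ivf e l P (e a) b = app (ivf e l P (e a) c) (ivf e l P c b)" using step by simp
  moreover have "a < b" using step by simp
  ultimately show ?case by (simp add: ivf_step[OF cl] ivf_step[OF step.hyps(1,2)])
qed simp

lemma ivf_clean:
  assumes "closed a b" "a \<le> b" "\<And>j. a \<le> j \<Longrightarrow> j < b \<Longrightarrow> P j = {}"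
  shows "clean (ivf e l P a b)"
  using assms
proof (induction rule: closed_induct)
  case (step a b)
  then show ?case using ivf_step[OF step.hyps(1,2), of l P] by simp
qed simp

text \<open>Nodes of the forest are positions, so a move in the game amounts to changing the pebble
  assignment at one position.\<close>

lemma marks_ivf:
  assumes "closed a b" "a \<le> b"
  shows "marks p (ivf e l P a b) = {ivf e l (P(j := insert p (P j))) a b | j. a \<le> j \<and> j < b}"
  using assms
proof (induction rule: closed_induct)
  case (step a b)
  have ub: "a < m" using closed_less[OF step.hyps(1) order_refl step.hyps(2)] by simp
  let ?P = "\<lambda>j. P(j := insert p (P j))"
  note st = ivf_step[OF step.hyps(1,2), of l]
  note cl1 = closed_kids[OF ub] and cl2 = closed_right[OF step.hyps(1) less_imp_le[OF step.hyps(3)]]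
  have ae: "Suc a \<le> e a" using step.hyps(3) by simp
  have 1: "ivf e l (?P a) a b = FC (l a) (insert p (P a)) (ivf e l P (Suc a) (e a)) (ivf e l P (e a) b)"
    using st[of "?P a"] ivf_cong[OF cl1 ae, of l l "?P a" P] ivf_cong[OF cl2 step.hyps(4), of l l "?P a" P]
      step.hyps(3) by simp
  have 2: "ivf e l (?P j) a b = FC (l a) (P a) (ivf e l (?P j) (Suc a) (e a)) (ivf e l P (e a) b)"
    if "Suc a \<le> j" "j < e a" for j
    using st[of "?P j"] ivf_cong[OF cl2 step.hyps(4), of l l "?P j" P] that by simp
  have 3: "ivf e l (?P j) a b = FC (l a) (P a) (ivf e l P (Suc a) (e a)) (ivf e l (?P j) (e a) b)"
    if "e a \<le> j" "j < b" for j
    using st[of "?P j"] ivf_cong[OF cl1 ae, of l l "?P j" P] that step.hyps(3) by simp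
  have split: "{F j | j. a \<le> j \<and> j < b} = insert (F a) ({F j | j. Suc a \<le> j \<and> j < e a} \<union> {F j | j. e a \<le> j \<and> j < b})"
    for F :: "nat \<Rightarrow> 'a forest"
  proof -
    have "{j. a \<le> j \<and> j < b} = insert a ({j. Suc a \<le> j \<and> j < e a} \<union> {j. e a \<le> j \<and> j < b})"
      using step.hyps by auto
    then show ?thesis unfolding setcompr_eq_image by (simp only: image_insert image_Un)
  qed
  have "marks p (ivf e l P a b) = insert (FC (l a) (insert p (P a)) (ivf e l P (Suc a) (e a)) (ivf e l P (e a) b))
     ((\<lambda>X'. FC (l a) (P a) X' (ivf e l P (e a) b)) ` marks p (ivf e l P (Suc a) (e a)) \<union>
      (\<lambda>Y'. FC (l a) (P a) (ivf e l P (Suc a) (e a)) Y') ` marks p (ivf e l P (e a) b))"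
    unfolding st[of P] by simp
  also have "\<dots> = insert (ivf e l (?P a) a b) ({ivf e l (?P j) a b | j. Suc a \<le> j \<and> j < e a} \<union>
      {ivf e l (?P j) a b | j. e a \<le> j \<and> j < b})"
  proof -
    have "(\<lambda>X'. FC (l a) (P a) X' (ivf e l P (e a) b)) ` {ivf e l (?P j) (Suc a) (e a) | j. Suc a \<le> j \<and> j < e a} =
        {ivf e l (?P j) a b | j. Suc a \<le> j \<and> j < e a}"
      unfolding setcompr_eq_image image_image by (rule image_cong) (simp_all add: 2)
    moreover have "(\<lambda>Y'. FC (l a) (P a) (ivf e l P (Suc a) (e a)) Y') ` {ivf e l (?P j) (e a) b | j. e a \<le> j \<and> j < b} =
        {ivf e l (?P j) a b | j. e a \<le> j \<and> j < b}"
      unfolding setcompr_eq_image image_image by (rule image_cong) (simp_all add: 3)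
    ultimately show ?thesis unfolding step.IH 1 by (simp only:)
  qed
  finally show ?case unfolding split .
qed simp

text \<open>This lemma, \<open>lts_ivf\<close> and \<open>ancs_ivf\<close> translate the atomic type
  of the forest back into labels, order and ancestors of positions; first-order atoms are evaluated
  through them.\<close>

lemma occ_ivf:
  assumes "closed a b" "a \<le> b"
  shows "occ N (ivf e l P a b) = {(p, s). \<exists>j. a \<le> j \<and> j < b \<and> p \<in> P j \<and> p < N \<and> s = l j}"
  using assms
proof (induction rule: closed_induct)
  case (step a b)
  have dec: "a \<le> j \<and> j < b \<longleftrightarrow> j = a \<or> (Suc a \<le> j \<and> j < e a) \<or> (e a \<le> j \<and> j < b)" for j
    using step.hyps by auto
  have "(\<exists>j. (a \<le> j \<and> j < b) \<and> Q j) \<longleftrightarrow> Q a \<or> (\<exists>j. (Suc a \<le> j \<and> j < e a) \<and> Q j) \<or>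
      (\<exists>j. (e a \<le> j \<and> j < b) \<and> Q j)" for Q
    unfolding dec by blast
  note ex = this[unfolded conj_assoc]
  show ?case unfolding ivf_step[OF step.hyps(1,2)] occ.simps step.IH ex
    by (intro set_eqI, simp only: split_paired_all mem_Collect_eq Un_iff mem_Sigma_iff Int_iff
        lessThan_iff prod.case singleton_iff) blast
qed simp

lemma pebs_ivf:
  assumes "closed a b" "a \<le> b"
  shows "pebs N (ivf e l P a b) = {p. \<exists>j. (a \<le> j \<and> j < b) \<and> p \<in> P j \<and> p < N}"
  unfolding occ_ivf[OF assms] by (auto simp: image_def)

lemma lts_ivf:
  assumes "closed a b" "a \<le> b"
  shows "lts N (ivf e l P a b) = 
    {(p, q). \<exists>i j. (a \<le> i \<and> i < j \<and> j < b) \<and> (p \<in> P i \<and> p < N) \<and> (q \<in> P j \<and> q < N)}"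
  using assms
proof (induction rule: closed_induct)
  case (step a b)
  have ub: "a < m" using closed_less[OF step.hyps(1) order_refl step.hyps(2)] by simp
  note cl1 = closed_kids[OF ub] and cl2 = closed_right[OF step.hyps(1) less_imp_le[OF step.hyps(3)]]
  have ae: "Suc a \<le> e a" using step.hyps(3) by simp
  have dec: "a \<le> i \<and> i < j \<and> j < b \<longleftrightarrow>
      i = a \<and> (Suc a \<le> j \<and> j < e a) \<or> i = a \<and> (e a \<le> j \<and> j < b) \<or> (Suc a \<le> i \<and> i < e a) \<and> (e a \<le> j \<and> j < b) \<or>
      (Suc a \<le> i \<and> i < j \<and> j < e a) \<or> (e a \<le> i \<and> i < j \<and> j < b)" for i j
    using step.hyps by auto
  have ex: "(\<exists>i j. (a \<le> i \<and> i < j \<and> j < b) \<and> A i \<and> B j) \<longleftrightarrow>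
      A a \<and> (\<exists>j. (Suc a \<le> j \<and> j < e a) \<and> B j) \<or> A a \<and> (\<exists>j. (e a \<le> j \<and> j < b) \<and> B j) \<or>
      (\<exists>i. (Suc a \<le> i \<and> i < e a) \<and> A i) \<and> (\<exists>j. (e a \<le> j \<and> j < b) \<and> B j) \<or>
      (\<exists>i j. (Suc a \<le> i \<and> i < j \<and> j < e a) \<and> A i \<and> B j) \<or>
      (\<exists>i j. (e a \<le> i \<and> i < j \<and> j < b) \<and> A i \<and> B j)" for A B
    by (rule ex_pair_split[OF dec])
  show ?case
    unfolding ivf_step[OF step.hyps(1,2)] lts.simps step.IH pebs_ivf[OF cl1 ae] pebs_ivf[OF cl2 step.hyps(4)] ex
    by (intro set_eqI, simp only: split_paired_all mem_Collect_eq Un_iff mem_Sigma_iff Int_iff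
        lessThan_iff prod.case) argo
qed auto

lemma ancs_ivf:
  assumes "closed a b" "a \<le> b"
  shows "ancs N (ivf e l P a b) =
    {(p, q). \<exists>i j. (a \<le> i \<and> i < b \<and> i < j \<and> j < e i) \<and> (p \<in> P i \<and> p < N) \<and> (q \<in> P j \<and> q < N)}"
  using assms
proof (induction rule: closed_induct)
  case (step a b)
  have ub: "a < m" using closed_less[OF step.hyps(1) order_refl step.hyps(2)] by simp
  note cl1 = closed_kids[OF ub]
  have ae: "Suc a \<le> e a" using step.hyps(3) by simp
  have dec: "a \<le> i \<and> i < b \<and> i < j \<and> j < e i \<longleftrightarrow> i = a \<and> (Suc a \<le> j \<and> j < e a) \<or>
      (Suc a \<le> i \<and> i < e a \<and> i < j \<and> j < e i) \<or> (e a \<le> i \<and> i < b \<and> i < j \<and> j < e i)" for i j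
    using step.hyps by (cases "i = a") auto
  have ex: "(\<exists>i j. (a \<le> i \<and> i < b \<and> i < j \<and> j < e i) \<and> A i \<and> B j) \<longleftrightarrow>
      A a \<and> (\<exists>j. (Suc a \<le> j \<and> j < e a) \<and> B j) \<or>
      (\<exists>i j. (Suc a \<le> i \<and> i < e a \<and> i < j \<and> j < e i) \<and> A i \<and> B j) \<or>
      (\<exists>i j. (e a \<le> i \<and> i < b \<and> i < j \<and> j < e i) \<and> A i \<and> B j)" for A B
    by (rule ex_pair_split'[OF dec])
  show ?case
    unfolding ivf_step[OF step.hyps(1,2)] ancs.simps step.IH pebs_ivf[OF cl1 ae] ex
    by (intro set_eqI, simp only: split_paired_all mem_Collect_eq Un_iff mem_Sigma_iff Int_iff
        lessThan_iff prod.case) argo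
qed auto

definition child :: "nat \<Rightarrow> nat \<Rightarrow> bool" where
  "child h j \<longleftrightarrow> h < m \<and> h < j \<and> j < e h \<and> (\<forall>c. h < c \<and> c < j \<longrightarrow> e c \<le> j)"

lemma child_closed:
  assumes "child h j"
  shows "closed (Suc h) j" "Suc h \<le> j" "closed j (e j)" "j < e j" "closed (e j) (e h)" "e j \<le> e h" "j < m"
proof -
  have jm: "j < m" using assms e_le[of h] unfolding child_def by simp
  then show "j < m" "closed j (e j)" "j < e j" using closed_sub e_gt by auto
  show "closed (Suc h) j" using assms jm unfolding closed_def child_def by simp
  show "Suc h \<le> j" using assms unfolding child_def by simp
  show "e j \<le> e h" using assms e_nested[of h j] unfolding child_def by simp
  show "closed (e j) (e h)"
    using closed_right[OF closed_sub[of h], of "e j"] assms \<open>j < e j\<close> unfolding child_def by simp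
qed

text \<open>Splitting at a child exhibits the child forest of \<open>h\<close> as a context around
  the child forest of \<open>j\<close>, made of the left siblings, the node \<open>j\<close> and the
  right siblings.\<close>

lemma ivf_child:
  assumes "child h j"
  shows "ivf e l P (Suc h) (e h) = app (ivf e l P (Suc h) j)
    (FC (l j) (P j) (ivf e l P (Suc j) (e j)) (ivf e l P (e j) (e h)))"
proof -
  note c = child_closed[OF assms]
  have cl: "closed j (e h)" using closed_right[OF closed_kids[of h], of j] assms unfolding child_def by simp
  have "j \<le> e h" using assms unfolding child_def by simp
  then show ?thesis using assms unfolding child_def
    by (simp add: ivf_split[OF c(1,2) cl] ivf_step[OF cl])
qed

lemma next_child: "child h j \<Longrightarrow> e j < e h \<Longrightarrow> child h (e j)"
proof -
  assume c: "child h j" and lt: "e j < e h"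
  note cc = child_closed[OF c]
  have "e x \<le> e j" if "h < x" "x < e j" for x
  proof (cases "x < j")
    case True
    then show ?thesis using c that cc unfolding child_def by fastforce
  next
    case False
    then show ?thesis using closed_less[OF cc(3), of x] that by simp
  qed
  then show ?thesis using c lt cc unfolding child_def by auto
qed

lemma first_child: "h < m \<Longrightarrow> Suc h < e h \<Longrightarrow> child h (Suc h)"
  unfolding child_def by auto

text \<open>Take the largest child starting at or before \<open>j\<close>; if its subtree ended at
  or before \<open>j\<close>, the next sibling would be a larger one.\<close>

lemma child_covering:
  assumes "h < m" "h < j" "j < e h"
  shows "\<exists>c. child h c \<and> c \<le> j \<and> j < e c"
proof -
  define S where "S = {c. child h c \<and> c \<le> j}"
  have fin: "finite S" unfolding S_def by (rule finite_subset[of _ "{..j}"]) auto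
  have "Suc h \<in> S" unfolding S_def using first_child assms by simp
  then have mx: "Max S \<in> S" "\<And>c. c \<in> S \<Longrightarrow> c \<le> Max S" using fin by (auto intro: Max_in)
  define c where "c = Max S"
  have c: "child h c" "c \<le> j" using mx(1) unfolding c_def S_def by auto
  have "j < e c"
  proof (rule ccontr)
    assume a: "\<not> j < e c"
    then have "child h (e c)" using next_child[OF c(1)] assms by simp
    then have "e c \<in> S" using a unfolding S_def by simp
    then show False using mx(2)[of "e c"] child_closed(4)[OF c(1)] unfolding c_def by simp
  qed
  then show ?thesis using c by blast
qed

lemma previous_child:
  assumes "child h j" "j \<noteq> Suc h"
  shows "\<exists>c. child h c \<and> e c = j"
proof -
  have "h < m" "h < j - 1" "j - 1 < e h" using assms unfolding child_def by auto
  from child_covering[OF this] obtain c where c: "child h c" "c \<le> j - 1" "j - 1 < e c" by blast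
  then have "e c \<le> j" using assms unfolding child_def by auto
  then have "e c = j" using c by simp
  then show ?thesis using c by blast
qed

end

section \<open>Definability of the class of a marked tree\<close>

lemma pth_exists:
  assumes "R\<^sup>*\<^sup>* x y" "\<And>y z. R y z \<Longrightarrow> lam z \<in> A"
  shows "\<exists>f. pth R lam m u A x f y"
  using assms(1)
proof induction
  case base
  show ?case by (rule exI[of _ u]) (rule pth.refl)
next
  case (step y z)
  then obtain f where "pth R lam m u A x f y" by blast
  then have "pth R lam m u A x (m f (lam z)) z" using step.hyps(2) assms(2)[OF step.hyps(2)] by (rule pth.step)
  then show ?case by blast
qed

text \<open>Stands for a finite family of formulas that computes the value of \<open>f\<close>, such
  as the class of a forest attached to a point.\<close>

definition dfn :: "('x \<Rightarrow> bool) set \<Rightarrow> ('x \<Rightarrow> 'b) \<Rightarrow> bool" where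
  "dfn D f \<longleftrightarrow> finite (range f) \<and> (\<forall>v. (\<lambda>x. f x = v) \<in> D)"

lemma dfn_pred:
  assumes "bool_closed D" "dfn D f"
  shows "(\<lambda>x. Q (f x)) \<in> D"
proof -
  have "(\<lambda>x. \<exists>v\<in>{v \<in> range f. Q v}. f x = v) \<in> D"
    by (rule bool_closed_bex[OF assms(1)]) (use assms(2) in \<open>auto simp: dfn_def\<close>)
  moreover have "(\<lambda>x. \<exists>v\<in>{v \<in> range f. Q v}. f x = v) = (\<lambda>x. Q (f x))" by auto
  ultimately show ?thesis by simp
qed

lemma dfnI:
  assumes "bool_closed D" "finite S" "\<And>x. f x \<in> S" "\<And>v. v \<in> S \<Longrightarrow> (\<lambda>x. f x = v) \<in> D"
  shows "dfn D f"
  unfolding dfn_def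
proof (intro conjI allI)
  show "finite (range f)" by (rule finite_subset[OF _ assms(2)]) (use assms(3) in auto)
  fix v
  show "(\<lambda>x. f x = v) \<in> D"
  proof (cases "v \<in> S")
    case False
    then have "(\<lambda>x. f x = v) = (\<lambda>x. False)" using assms(3) by auto
    then show ?thesis using bool_closed_const[OF assms(1)] by simp
  qed (use assms(4) in simp)
qed

text \<open>Lets congruence do the work of constructing formulas: whatever is determined by a
  definable function is definable.\<close>

lemma dfn_factor:
  assumes "bool_closed D" "dfn D f" "\<And>x y. f x = f y \<Longrightarrow> g x = g y"
  shows "dfn D g"
proof -
  define h where "h v = g (SOME x. f x = v)" for v
  have gh: "g x = h (f x)" for x
  proof -
    have "f (SOME y. f y = f x) = f x" by (rule someI[of "\<lambda>y. f y = f x"]) simp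
    then show ?thesis unfolding h_def by (rule assms(3)[OF sym])
  qed
  have "range g = h ` range f" by (auto simp: gh image_iff)
  then have "finite (range g)" using assms(2) by (simp add: dfn_def)
  moreover have "(\<lambda>x. g x = v) \<in> D" for v
    unfolding gh using dfn_pred[OF assms(1,2), of "\<lambda>u. h u = v"] .
  ultimately show ?thesis by (simp add: dfn_def)
qed

lemma dfn_pair:
  assumes "bool_closed D" "dfn D f" "dfn D g"
  shows "dfn D (\<lambda>x. (f x, g x))"
proof (rule dfnI[OF assms(1)])
  show "finite (range f \<times> range g)" using assms by (simp add: dfn_def)
  show "(\<lambda>x. (f x, g x) = v) \<in> D" for v
    using bool_closed_and[OF assms(1), of "\<lambda>x. f x = fst v" "\<lambda>x. g x = snd v"] assms(2,3)
    by (simp add: dfn_def prod_eq_iff)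
qed simp

lemma dfn_set:
  assumes "bool_closed D" "finite S" "\<And>x. V x \<subseteq> S" "\<And>s. s \<in> S \<Longrightarrow> (\<lambda>x. s \<in> V x) \<in> D"
  shows "dfn D V"
proof (rule dfnI[OF assms(1)])
  show "finite (Pow S)" using assms by simp
  show "V x \<in> Pow S" for x using assms by simp
  fix v assume v: "v \<in> Pow S"
  have "(\<lambda>x. \<forall>s\<in>S. s \<in> V x \<longleftrightarrow> s \<in> v) \<in> D"
  proof (rule bool_closed_ball[OF assms(1,2)])
    fix s assume s: "s \<in> S"
    show "(\<lambda>x. (s \<in> V x) = (s \<in> v)) \<in> D"
      using assms(4)[OF s] bool_closed_not[OF assms(1) assms(4)[OF s]] by (cases "s \<in> v") simp_all
  qed
  moreover have "(\<lambda>x. \<forall>s\<in>S. s \<in> V x \<longleftrightarrow> s \<in> v) = (\<lambda>x. V x = v)"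
  proof
    fix x
    have "V x \<subseteq> S" "v \<subseteq> S" using v assms(3) by auto
    then show "(\<forall>s\<in>S. s \<in> V x \<longleftrightarrow> s \<in> v) = (V x = v)" by (auto simp: set_eq_iff subset_iff)
  qed
  ultimately show "(\<lambda>x. V x = v) \<in> D" by simp
qed

context opword begin

sublocale itree "sub_end M w" "length w + 2"
  by unfold_locales (use en_not en_le en_nested in auto)

lemma child_iff: "child h j \<longleftrightarrow> pr h j"
proof (cases "h \<le> n + 1")
  case True
  then show ?thesis unfolding child_def parent_iff[OF True] by auto
next
  case False
  then show ?thesis unfolding child_def using parent_less[of M w h j] by auto
qed

end

text \<open>Predicates range over the points of all words at once, which makes the resulting
  formulas independent of the word.\<close>

type_synonym 'ap pt = "'ap set list \<times> nat"

definition child_pt :: "'ap opm \<Rightarrow> 'ap pt \<Rightarrow> 'ap pt \<Rightarrow> bool" where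
  "child_pt M x y \<longleftrightarrow> fst y = fst x \<and> compatible M (fst x) \<and> parent M (fst x) (snd x) (snd y)"

definition sib_pt :: "'ap opm \<Rightarrow> 'ap pt \<Rightarrow> 'ap pt \<Rightarrow> bool" where
  "sib_pt M x y \<longleftrightarrow> fst y = fst x \<and> compatible M (fst x) \<and> snd y = sub_end M (fst x) (snd x) \<and>
     (\<exists>h. parent M (fst x) h (snd x) \<and> parent M (fst x) h (snd y))"

definition valid_pt :: "'ap opm \<Rightarrow> 'ap pt \<Rightarrow> bool" where
  "valid_pt M x \<longleftrightarrow> compatible M (fst x) \<and> snd x \<le> length (fst x) + 1"

abbreviation symb_pt :: "'ap pt \<Rightarrow> 'ap symb" where
  "symb_pt x \<equiv> symb_at (fst x) (snd x)"

definition wforest :: "'ap opm \<Rightarrow> 'ap set list \<Rightarrow> (nat \<Rightarrow> nat set) \<Rightarrow> nat \<Rightarrow> nat \<Rightarrow> 'ap symb forest" where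
  "wforest M w = ivf (sub_end M w) (symb_at w)"

definition kids :: "'ap opm \<Rightarrow> 'ap pt \<Rightarrow> 'ap symb forest" where
  "kids M x = wforest M (fst x) (\<lambda>_. {}) (Suc (snd x)) (sub_end M (fst x) (snd x))"

definition parent_of :: "'ap opm \<Rightarrow> 'ap pt \<Rightarrow> nat" where
  "parent_of M x = (THE h. parent M (fst x) h (snd x))"

definition lefts :: "'ap opm \<Rightarrow> 'ap pt \<Rightarrow> 'ap symb forest" where
  "lefts M x = (if \<exists>z. child_pt M z x then wforest M (fst x) (\<lambda>_. {}) (Suc (parent_of M x)) (snd x) else FN)"

definition rights :: "'ap opm \<Rightarrow> 'ap pt \<Rightarrow> 'ap symb forest" where
  "rights M x = (if \<exists>z. child_pt M z x then wforest M (fst x) (\<lambda>_. {}) (sub_end M (fst x) (snd x))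
     (sub_end M (fst x) (parent_of M x)) else FN)"

definition subt :: "'ap opm \<Rightarrow> 'ap pt \<Rightarrow> 'ap symb forest" where
  "subt M x = FC (symb_pt x) {} (kids M x) FN"

lemma finite_symb: "finite (UNIV :: ('ap::finite) symb set)"
proof (rule finite_subset)
  show "UNIV \<subseteq> insert Hash (range (Letter :: 'ap set \<Rightarrow> _))"
  proof
    fix x :: "'ap symb"
    show "x \<in> insert Hash (range Letter)" by (cases x) auto
  qed
qed simp

text \<open>Interface to POTL: \<open>D\<close> may be any set of predicates closed under until and
  since along branches and along siblings. By \<open>restrict\<close>, only the values at positions
  of OP words matter.\<close>

locale tree_logic =
  fixes M :: "('ap::finite) opm" and SL :: "'ap set" and D :: "('ap pt \<Rightarrow> bool) set"
  assumes opm: "is_opm SL M"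
    and down: "temporally_closed (child_pt M) D" and side: "temporally_closed (sib_pt M) D"
    and sym: "dfn D symb_pt"
    and restrict: "\<And>P Q. P \<in> D \<Longrightarrow> (\<And>x. valid_pt M x \<Longrightarrow> Q x = P x) \<Longrightarrow> Q \<in> D"
begin

lemma opwordI: "compatible M w \<Longrightarrow> opword M SL w"
  using opm by unfold_locales

lemma bc: "bool_closed D" using down by (simp add: temporally_closed_def)

lemmas bcs = bool_closed_not[OF bc] bool_closed_or[OF bc] bool_closed_and[OF bc]
    bool_closed_bex[OF bc] bool_closed_const[OF bc]

lemmas down_next = temporally_closed_next[OF down]

lemmas side_next = temporally_closed_next[OF side]

lemma child_pt_det: "child_pt M x y \<Longrightarrow> child_pt M x' y \<Longrightarrow> x = x'"
proof -
  assume a: "child_pt M x y" "child_pt M x' y"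
  then have w: "compatible M (fst y)" "fst x = fst y" "fst x' = fst y"
    "parent M (fst y) (snd x) (snd y)" "parent M (fst y) (snd x') (snd y)" by (auto simp: child_pt_def)
  interpret opword M SL "fst y" using opwordI w by blast
  show ?thesis using parent_unique[OF w(4,5)] w(2,3) by (simp add: prod_eq_iff)
qed

lemma parent_of_eq: "compatible M w \<Longrightarrow> parent M w h j \<Longrightarrow> parent_of M (w, j) = h"
proof -
  assume a: "compatible M w" "parent M w h j"
  interpret opword M SL w using opwordI a by blast
  show ?thesis unfolding parent_of_def fst_conv snd_conv
    by (rule the_equality, rule a(2), rule parent_unique[OF _ a(2)])
qed

lemma sib_pt_det: "sib_pt M x y \<Longrightarrow> sib_pt M x' y \<Longrightarrow> x = x'"
proof -
  assume a: "sib_pt M x y" "sib_pt M x' y"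
  then have w: "compatible M (fst y)" "fst x = fst y" "fst x' = fst y" unfolding sib_pt_def by metis+
  obtain h where p1: "parent M (fst y) h (snd x)" "parent M (fst y) h (snd y)"
    using a(1) w(2) unfolding sib_pt_def by metis
  obtain h' where p2: "parent M (fst y) h' (snd x')" "parent M (fst y) h' (snd y)"
    using a(2) w(3) unfolding sib_pt_def by metis
  have e: "snd y = sub_end M (fst y) (snd x)" "snd y = sub_end M (fst y) (snd x')"
    using a w(2,3) unfolding sib_pt_def by metis+
  note p = p1 p2
  interpret opword M SL "fst y" using opwordI w by blast
  have "h' = h" using parent_unique[OF p(2,4)] by simp
  then have c: "child h (snd x)" "child h (snd x')" using p child_iff by auto
  have "snd x = snd x'"
  proof (rule ccontr)
    assume "snd x \<noteq> snd x'"
    then consider "snd x < snd x'" | "snd x' < snd x" by linarith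
    then show False
    proof cases
      case 1
      then have "en (snd x) \<le> snd x'" using c unfolding child_def by blast
      then show False using e child_closed(4)[OF c(2)] by linarith
    next
      case 2
      then have "en (snd x') \<le> snd x" using c unfolding child_def by blast
      then show False using e child_closed(4)[OF c(1)] by linarith
    qed
  qed
  then show ?thesis using w by (simp add: prod_eq_iff)
qed

lemma lefts_eq: "compatible M w \<Longrightarrow> parent M w h j \<Longrightarrow> lefts M (w, j) = wforest M w (\<lambda>_. {}) (Suc h) j"
proof -
  assume a: "compatible M w" "parent M w h j"
  then have "child_pt M (w, h) (w, j)" by (simp add: child_pt_def)
  then have ex: "\<exists>z. child_pt M z (w, j)" by blast
  show ?thesis unfolding lefts_def if_P[OF ex] parent_of_eq[OF a] by simp
qed

lemma rights_eq: "compatible M w \<Longrightarrow> parent M w h j \<Longrightarrow>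
    rights M (w, j) = wforest M w (\<lambda>_. {}) (sub_end M w j) (sub_end M w h)"
proof -
  assume a: "compatible M w" "parent M w h j"
  then have "child_pt M (w, h) (w, j)" by (simp add: child_pt_def)
  then have ex: "\<exists>z. child_pt M z (w, j)" by blast
  show ?thesis unfolding rights_def if_P[OF ex] parent_of_eq[OF a] by simp
qed

lemma clean_lefts: "clean (lefts M x)" and clean_rights: "clean (rights M x)"
proof -
  have "clean (lefts M x) \<and> clean (rights M x)"
  proof (cases "\<exists>z. child_pt M z x")
    case True
    then obtain w h j where x: "x = (w, j)" and c: "compatible M w" "parent M w h j"
      by (cases x) (auto simp: child_pt_def)
    interpret opword M SL w using opwordI c by blast
    have ch: "child h j" using c child_iff by simp
    note cc = child_closed[OF ch]
    show ?thesis unfolding x lefts_eq[OF c] rights_eq[OF c] wforest_def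
      by (intro conjI ivf_clean[OF cc(1,2)] ivf_clean[OF cc(5,6)]) simp_all
  qed (simp add: lefts_def rights_def)
  then show "clean (lefts M x)" "clean (rights M x)" by auto
qed

lemma subt_eq: "compatible M w \<Longrightarrow> j \<le> length w + 1 \<Longrightarrow> subt M (w, j) = wforest M w (\<lambda>_. {}) j (sub_end M w j)"
proof -
  assume a: "compatible M w" "j \<le> length w + 1"
  interpret opword M SL w using opwordI a by blast
  show ?thesis unfolding subt_def wforest_def kids_def
    using ivf_step[OF closed_sub[of j], of "symb_at w" "\<lambda>_. {}"] e_gt[of j] a(2) by simp
qed

section \<open>Classes of the forests to the left and to the right of a node\<close>

context
  fixes N k :: nat
begin

abbreviation "\<tau> \<equiv> cls N k :: 'ap symb forest \<Rightarrow> _"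
abbreviation "mon \<equiv> ctx_monoid N k :: ('ap symb forest set \<Rightarrow> 'ap symb forest set) set"
abbreviation "unit \<equiv> act N k (\<lambda>X. X) :: 'ap symb forest set \<Rightarrow> 'ap symb forest set"

lemma mon: "aperiodic_monoid mon (\<circ>) unit"
  by (rule ctx_monoid[OF finite_symb])

lemma finite_mon: "finite mon" using mon by (simp add: aperiodic_monoid_def)

lemma act_app_in: "clean F \<Longrightarrow> act N k (app F) \<in> mon"
  unfolding ctx_monoid_def using ctx_app by blast

text \<open>Filling in the empty forest recovers the class, so the product of the actions of some
  siblings determines the class of the forest they form.\<close>

lemma act_app_apply: "act N k (app F) (\<tau> FN) = \<tau> F"
  using act_cls[of N "app F" k FN] by (simp add: congruent_ctx_def eqv_app)

lemma act_app_comp: "act N k (app F) \<circ> act N k (app G) = act N k (app (app F G))"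
proof -
  have "act N k (app F) \<circ> act N k (app G) = act N k (app F \<circ> app G)"
    by (rule act_comp) (auto simp: congruent_ctx_def eqv_app)
  also have "app F \<circ> app G = app (app F G)" by (auto simp: app_assoc)
  finally show ?thesis .
qed

text \<open>Paths count the label of their end but not of their start. Labelling a node with its
  left neighbour makes the product from the first sibling to \<open>x\<close> the forest strictly
  left of \<open>x\<close>. \<open>lamR\<close> labels a node with its own subtree, so that the
  product from \<open>x\<close> to the last sibling is the forest strictly right of
  \<open>x\<close>.\<close>

definition "lamL z = (if \<exists>y. sib_pt M y z then act N k (app (subt M (THE y. sib_pt M y z))) else unit)"
definition "lamR z = act N k (app (subt M z))"

lemma lamL_eq: "sib_pt M y z \<Longrightarrow> lamL z = act N k (app (subt M y))"
proof -
  assume a: "sib_pt M y z"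
  then have "(THE y. sib_pt M y z) = y" by (rule the_equality) (rule sib_pt_det[OF _ a])
  moreover have ex: "\<exists>y. sib_pt M y z" using a by blast
  ultimately show ?thesis unfolding lamL_def if_P[OF ex] by (simp only:)
qed

lemma sib_clean: "sib_pt M y z \<Longrightarrow> clean (subt M y)" "sib_pt M y z \<Longrightarrow> clean (subt M z)"
proof -
  assume s: "sib_pt M y z"
  then obtain h where c: "compatible M (fst y)" "fst z = fst y" and p: "parent M (fst y) h (snd y)" "parent M (fst y) h (snd z)"
    by (auto simp: sib_pt_def)
  interpret opword M SL "fst y" using opwordI c by blast
  have ch: "child h (snd y)" "child h (snd z)" using p child_iff by auto
  have b: "snd y \<le> length (fst y) + 1" "snd z \<le> length (fst y) + 1" using parent_less p by blast+
  have "clean (subt M (fst y, snd y))" "clean (subt M (fst y, snd z))"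
    unfolding subt_eq[OF c(1) b(1)] subt_eq[OF c(1) b(2)] wforest_def
    using child_closed(4)[OF ch(1)] child_closed(4)[OF ch(2)]
    by (intro ivf_clean[OF child_closed(3)[OF ch(1)]] ivf_clean[OF child_closed(3)[OF ch(2)]]; simp)+
  moreover have "(fst y, snd z) = z" using c by (simp add: prod_eq_iff)
  ultimately show "clean (subt M y)" "clean (subt M z)" by simp_all
qed

lemma lamL_in: "sib_pt M y z \<Longrightarrow> lamL z \<in> mon"
  using lamL_eq[of y z] act_app_in[OF sib_clean(1)[of y z]] by simp

lemma lamR_in: "sib_pt M y z \<Longrightarrow> lamR z \<in> mon"
  unfolding lamR_def using act_app_in[OF sib_clean(2)[of y z]] by simp

lemma pathL:
  assumes "pth (sib_pt M) lamL (\<circ>) unit mon y f x" "compatible M (fst y)" "parent M (fst y) h (snd y)"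
  shows "fst x = fst y \<and> parent M (fst y) h (snd x) \<and> snd y \<le> snd x \<and>
    f = act N k (app (wforest M (fst y) (\<lambda>_. {}) (snd y) (snd x)))"
  using assms
proof (induction rule: pth.induct)
  case (refl x)
  interpret opword M SL "fst x" using opwordI refl by blast
  show ?case using refl by (simp add: wforest_def fun_eq_iff)
next
  case (step y f x z)
  interpret opword M SL "fst y" using opwordI step by blast
  have IH: "fst x = fst y" "pr h (snd x)" "snd y \<le> snd x"
     "f = act N k (app (wforest M (fst y) (\<lambda>_. {}) (snd y) (snd x)))" using step by auto
  obtain h' where z: "fst z = fst y" "snd z = en (snd x)" "pr h' (snd x)" "pr h' (snd z)"
    using step.hyps(2) IH(1) by (auto simp: sib_pt_def)
  have "h' = h" using parent_unique z IH by blast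
  have ch: "child h (snd y)" "child h (snd x)" "child h (snd z)" using child_iff step z IH \<open>h' = h\<close> by auto
  have c1: "closed (snd y) (snd x)"
    using closed_right[OF child_closed(1)[OF ch(2)]] ch(1) unfolding child_def by simp
  have sx: "subt M x = wforest M (fst y) (\<lambda>_. {}) (snd x) (snd z)"
    using subt_eq[of "fst y" "snd x"] parent_less[OF IH(2)] step.prems IH(1) z(2) by (metis prod.collapse)
  have "lamL z = act N k (app (wforest M (fst y) (\<lambda>_. {}) (snd x) (snd z)))"
    unfolding lamL_eq[OF step.hyps(2)] sx ..
  then have "f \<circ> lamL z = act N k (app (app (wforest M (fst y) (\<lambda>_. {}) (snd y) (snd x)) (wforest M (fst y) (\<lambda>_. {}) (snd x) (snd z))))"
    unfolding IH(4) by (simp only: act_app_comp)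
  also have "app (wforest M (fst y) (\<lambda>_. {}) (snd y) (snd x)) (wforest M (fst y) (\<lambda>_. {}) (snd x) (snd z)) =
      wforest M (fst y) (\<lambda>_. {}) (snd y) (snd z)"
    unfolding wforest_def z(2)
    by (rule ivf_split[symmetric, OF c1 IH(3) child_closed(3)[OF ch(2)]]) (use child_closed(4)[OF ch(2)] in simp)
  finally show ?case using z \<open>h' = h\<close> IH(3) child_closed(4)[OF ch(2)] by simp
qed

lemma pathR:
  assumes "pth (sib_pt M) lamR (\<circ>) unit mon y f x" "compatible M (fst y)" "parent M (fst y) h (snd y)"
  shows "fst x = fst y \<and> parent M (fst y) h (snd x) \<and> snd y \<le> snd x \<and>
    f = act N k (app (wforest M (fst y) (\<lambda>_. {}) (sub_end M (fst y) (snd y)) (sub_end M (fst y) (snd x))))"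
  using assms
proof (induction rule: pth.induct)
  case (refl x)
  interpret opword M SL "fst x" using opwordI refl by blast
  show ?case using refl by (simp add: wforest_def fun_eq_iff)
next
  case (step y f x z)
  interpret opword M SL "fst y" using opwordI step by blast
  have IH: "fst x = fst y" "pr h (snd x)" "snd y \<le> snd x"
     "f = act N k (app (wforest M (fst y) (\<lambda>_. {}) (en (snd y)) (en (snd x))))" using step by auto
  obtain h' where z: "fst z = fst y" "snd z = en (snd x)" "pr h' (snd x)" "pr h' (snd z)"
    using step.hyps(2) IH(1) by (auto simp: sib_pt_def)
  have "h' = h" using parent_unique z IH by blast
  have ch: "child h (snd y)" "child h (snd x)" "child h (snd z)" using child_iff step z IH \<open>h' = h\<close> by auto
  have le: "en (snd y) \<le> en (snd x)"
    using ch(2) IH(3) child_closed(4)[OF ch(2)] ch(1) unfolding child_def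
    by (cases "snd y = snd x") (auto intro: order_trans)
  have c1: "closed (en (snd y)) (en (snd x))"
    using closed_right[OF child_closed(1)[OF ch(3)], of "en (snd y)"] child_closed(4)[OF ch(1)] ch(1) z(2)
    unfolding child_def by simp
  have sx: "subt M z = wforest M (fst y) (\<lambda>_. {}) (en (snd x)) (en (snd z))"
    using subt_eq[of "fst y" "snd z"] parent_less[OF z(4)] step.prems z(1,2) by (metis prod.collapse)
  have "f \<circ> lamR z = act N k (app (app (wforest M (fst y) (\<lambda>_. {}) (en (snd y)) (en (snd x)))
      (wforest M (fst y) (\<lambda>_. {}) (en (snd x)) (en (snd z)))))"
    unfolding IH(4) lamR_def sx by (simp only: act_app_comp)
  also have "app (wforest M (fst y) (\<lambda>_. {}) (en (snd y)) (en (snd x))) (wforest M (fst y) (\<lambda>_. {}) (en (snd x)) (en (snd z))) =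
      wforest M (fst y) (\<lambda>_. {}) (en (snd y)) (en (snd z))"
    unfolding wforest_def
    by (rule ivf_split[symmetric, OF c1 le]) (use child_closed(3,4)[OF ch(3)] z(2) in simp_all)
  finally show ?case using z \<open>h' = h\<close> IH(3) child_closed(4)[OF ch(2)] by simp
qed

lemma reach_from_first:
  assumes c: "compatible M w" and p: "parent M w h j"
  shows "(sib_pt M)\<^sup>*\<^sup>* (w, Suc h) (w, j) \<and> parent M w h (Suc h)"
  using p
proof (induction j rule: less_induct)
  case (less j)
  interpret opword M SL w using opwordI c by blast
  have ch: "child h j" using less.prems child_iff by simp
  show ?case
  proof (cases "j = Suc h")
    case False
    then obtain i where i: "child h i" "en i = j" using previous_child[OF ch] by blast
    then have "(sib_pt M)\<^sup>*\<^sup>* (w, Suc h) (w, i) \<and> parent M w h (Suc h)"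
      using less.IH[of i] child_iff child_closed(4)[OF i(1)] by simp
    moreover have "sib_pt M (w, i) (w, j)" using i ch child_iff c by (auto simp: sib_pt_def)
    ultimately show ?thesis by (auto intro: rtranclp.rtrancl_into_rtrancl)
  qed (use less.prems in simp)
qed

lemma reach_last:
  assumes c: "compatible M w" and p: "parent M w h j"
  shows "\<exists>i. (sib_pt M)\<^sup>*\<^sup>* (w, j) (w, i) \<and> parent M w h i \<and> sub_end M w i = sub_end M w h"
  using p
proof (induction "sub_end M w h - j" arbitrary: j rule: less_induct)
  case less
  interpret opword M SL w using opwordI c by blast
  have ch: "child h j" using less.prems child_iff by simp
  show ?case
  proof (cases "en j = en h")
    case False
    then have nx: "child h (en j)" using next_child[OF ch] child_closed(6)[OF ch] by simp
    have lt: "en h - en j < en h - j" using child_closed(4,6)[OF ch] ch unfolding child_def by linarith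
    have "sib_pt M (w, j) (w, en j)" using nx ch child_iff c by (auto simp: sib_pt_def)
    then show ?thesis using less.hyps[OF lt] nx child_iff by (meson converse_rtranclp_into_rtranclp)
  qed (use less.prems in auto)
qed

abbreviation "hp x \<equiv> \<exists>z. child_pt M z x"

lemma hp_D: "(\<lambda>x. hp x) \<in> D"
  using down_next(2)[OF bcs(5)[of True]] by simp

lemma subt_dfn: "dfn D (\<lambda>x. \<tau> (kids M x)) \<Longrightarrow> dfn D (\<lambda>x. \<tau> (subt M x))"
proof (rule dfn_factor[OF bc dfn_pair[OF bc sym]], assumption)
  fix x y assume "(symb_pt x, \<tau> (kids M x)) = (symb_pt y, \<tau> (kids M y))"
  then have s: "symb_pt x = symb_pt y" and e: "eqv N k (kids M x) (kids M y)" by (simp_all add: cls_eq_iff)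
  show "\<tau> (subt M x) = \<tau> (subt M y)" unfolding subt_def cls_eq_iff s by (rule eqv_FC[OF e eqv_refl])
qed

lemma act_app_cong:
  assumes "\<tau> F = \<tau> G" shows "act N k (app F) = act N k (app G)"
proof (rule act_eqI)
  fix H
  have "eqv N k F G" using assms unfolding cls_eq_iff .
  then show "\<tau> (app F H) = \<tau> (app G H)" unfolding cls_eq_iff by (rule eqv_app[OF _ eqv_refl])
qed

lemma subt_act_D:
  assumes "dfn D (\<lambda>x. \<tau> (kids M x))" shows "(\<lambda>y. act N k (app (subt M y)) = a) \<in> D"
proof -
  have "dfn D (\<lambda>y. act N k (app (subt M y)))"
    by (rule dfn_factor[OF bc subt_dfn[OF assms]]) (rule act_app_cong)
  then show ?thesis unfolding dfn_def by blast
qed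

text \<open>Apply \<open>aperiodic_paths_definable\<close> to the sibling relation, looking back
  from \<open>x\<close> to the first sibling, which is recognised as a node with a parent but
  without a left neighbour.\<close>

lemma lefts_dfn:
  assumes K: "dfn D (\<lambda>x. \<tau> (kids M x))"
  shows "dfn D (\<lambda>x. \<tau> (lefts M x))"
proof (rule dfnI[OF bc finite_cls[OF finite_symb, of N k]])
  fix v
  have lam: "(\<lambda>x. lamL x = a) \<in> D" for a
  proof -
    have "(\<lambda>x. (\<exists>y. sib_pt M y x \<and> act N k (app (subt M y)) = a) \<or> \<not> (\<exists>y. sib_pt M y x \<and> True) \<and> unit = a) \<in> D"
      by (intro bcs side_next subt_act_D[OF K])
    moreover have "(\<lambda>x. (\<exists>y. sib_pt M y x \<and> act N k (app (subt M y)) = a) \<or> \<not> (\<exists>y. sib_pt M y x \<and> True) \<and> unit = a) =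
        (\<lambda>x. lamL x = a)"
    proof
      fix x
      show "((\<exists>y. sib_pt M y x \<and> act N k (app (subt M y)) = a) \<or> \<not> (\<exists>y. sib_pt M y x \<and> True) \<and> unit = a) = (lamL x = a)"
      proof (cases "\<exists>y. sib_pt M y x")
        case True
        then obtain y where y: "sib_pt M y x" by blast
        have "(\<exists>y'. sib_pt M y' x \<and> act N k (app (subt M y')) = a) \<longleftrightarrow> act N k (app (subt M y)) = a"
          using y sib_pt_det[OF _ y] by blast
        then show ?thesis using True lamL_eq[OF y] by simp
      qed (simp add: lamL_def)
    qed
    ultimately show ?thesis by simp
  qed
  let ?first = "\<lambda>y. hp y \<and> \<not> (\<exists>z. sib_pt M z y \<and> True)"
  have first: "?first \<in> D" by (intro bcs hp_D side_next)
  have inD: "(\<lambda>x. \<not> hp x \<and> \<tau> FN = v \<or> (\<exists>f\<in>mon. f (\<tau> FN) = v \<and>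
      (\<exists>y. pth (sib_pt M) lamL (\<circ>) unit mon y f x \<and> ?first y))) \<in> D"
    by (intro bcs hp_D finite_mon)
      (rule conjunct2[OF aperiodic_paths_definable[OF side sib_pt_det mon subset_refl lam first]])
  have eqn: "(\<tau> (lefts M x) = v) = (\<not> hp x \<and> \<tau> FN = v \<or> (\<exists>f\<in>mon. f (\<tau> FN) = v \<and>
      (\<exists>y. pth (sib_pt M) lamL (\<circ>) unit mon y f x \<and> ?first y)))" (is "?a = ?b") for x
  proof -
    have path: "hp x \<and> f (\<tau> FN) = \<tau> (lefts M x)" if pt: "pth (sib_pt M) lamL (\<circ>) unit mon y f x" and fy: "?first y" for f y
    proof -
      obtain h where c: "compatible M (fst y)" "parent M (fst y) h (snd y)" using fy by (auto simp: child_pt_def)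
      note pl = pathL[OF pt c]
      interpret opword M SL "fst y" using opwordI c by blast
      \<comment> \<open>A child without a left neighbour is the adjacent one.\<close>
      have "snd y = Suc h"
      proof (rule ccontr)
        assume "snd y \<noteq> Suc h"
        then obtain i where "child h i" "en i = snd y" using previous_child[of h "snd y"] c child_iff by blast
        then have "sib_pt M (fst y, i) y" using c child_iff unfolding sib_pt_def by fastforce
        then show False using fy by blast
      qed
      moreover have "lefts M x = wforest M (fst y) (\<lambda>_. {}) (Suc h) (snd x)"
        using lefts_eq[of "fst y" h "snd x"] pl c by (metis prod.collapse)
      moreover have "child_pt M (fst y, h) x" using pl c by (simp add: child_pt_def)
      ultimately show ?thesis using pl act_app_apply by auto
    qed
    show "?a = ?b"
    proof (cases "hp x")
      case True
      then obtain w h j where x: "x = (w, j)" and c: "compatible M w" "parent M w h j"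
        by (cases x) (auto simp: child_pt_def)
      interpret opword M SL w using opwordI c by blast
      note r = reach_from_first[OF c]
      obtain f where f: "pth (sib_pt M) lamL (\<circ>) unit mon (w, Suc h) f x"
        using pth_exists[OF conjunct1[OF r], of lamL mon "(\<circ>)" unit] lamL_in x by blast
      have fm: "f \<in> mon" using pth_closed[OF f mon] by simp
      have ff: "?first (w, Suc h)"
      proof
        show "hp (w, Suc h)" using r c by (auto simp: child_pt_def)
        show "\<not> (\<exists>z. sib_pt M z (w, Suc h) \<and> True)"
        proof
          assume "\<exists>z. sib_pt M z (w, Suc h) \<and> True"
          then obtain z where z: "sib_pt M z (w, Suc h)" by blast
          then have fz: "fst z = w" unfolding sib_pt_def by simp
          obtain h' where "pr h' (snd z)" "pr h' (Suc h)" using z fz unfolding sib_pt_def by auto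
          moreover have "Suc h = en (snd z)" using z fz unfolding sib_pt_def by simp
          ultimately obtain i where i: "pr h' i" "pr h' (Suc h)" "Suc h = en i" by blast
          have "h' = h" using parent_unique i(2) r by blast
          then have "child h i" using i child_iff by simp
          then show False using child_closed(2,4)[of h i] i(3) by simp
        qed
      qed
      show ?thesis
      proof
        assume ?a
        then have "f (\<tau> FN) = v" using path[OF f ff] by simp
        then show ?b using fm f ff by blast
      next
        assume ?b
        then obtain g y where g: "g (\<tau> FN) = v" "pth (sib_pt M) lamL (\<circ>) unit mon y g x" "?first y"
          using True by blast
        then show ?a using path[OF g(2,3)] by simp
      qed
    next
      case False
      then have l: "lefts M x = FN" by (simp only: lefts_def if_False)
      show ?thesis
      proof
        assume ?a
        then show ?b using False unfolding l by blast
      next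
        assume ?b
        then have "\<tau> FN = v" using path False by blast
        then show ?a unfolding l .
      qed
    qed
  qed
  show "(\<lambda>x. \<tau> (lefts M x) = v) \<in> D" 
    by (rule ssubst[OF ext[OF eqn], where P = "\<lambda>S. S \<in> D"]) (rule inD)
qed (rule rangeI)

text \<open>Mirror image of \<open>lefts_dfn\<close>, with paths into the future that end at a node
  without a right neighbour.\<close>

lemma rights_dfn:
  assumes K: "dfn D (\<lambda>x. \<tau> (kids M x))"
  shows "dfn D (\<lambda>x. \<tau> (rights M x))"
proof (rule dfnI[OF bc finite_cls[OF finite_symb, of N k]])
  fix v
  have lam: "(\<lambda>x. lamR x = a) \<in> D" for a
    unfolding lamR_def by (rule subt_act_D[OF K])
  let ?last = "\<lambda>y. \<not> (\<exists>z. sib_pt M y z \<and> True)"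
  have last: "?last \<in> D" by (intro bcs side_next)
  have inD: "(\<lambda>x. \<not> hp x \<and> \<tau> FN = v \<or> hp x \<and> (\<exists>f\<in>mon. f (\<tau> FN) = v \<and>
      (\<exists>y. pth (sib_pt M) lamR (\<circ>) unit mon x f y \<and> ?last y))) \<in> D"
    by (intro bcs hp_D finite_mon)
      (rule conjunct1[OF aperiodic_paths_definable[OF side sib_pt_det mon subset_refl lam last]])
  have eqn: "(\<tau> (rights M x) = v) = (\<not> hp x \<and> \<tau> FN = v \<or> hp x \<and> (\<exists>f\<in>mon. f (\<tau> FN) = v \<and>
      (\<exists>y. pth (sib_pt M) lamR (\<circ>) unit mon x f y \<and> ?last y)))" (is "?a = ?b") for x
  proof (cases "hp x")
    case True
    then obtain w h j where x: "x = (w, j)" and c: "compatible M w" "parent M w h j"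
      by (cases x) (auto simp: child_pt_def)
    interpret opword M SL w using opwordI c by blast
    have path: "f (\<tau> FN) = \<tau> (rights M x)" if pt: "pth (sib_pt M) lamR (\<circ>) unit mon x f y" and ly: "?last y" for f y
    proof -
      have pl: "fst y = w" "pr h (snd y)" "f = act N k (app (wforest M w (\<lambda>_. {}) (en j) (en (snd y))))"
        using pathR[OF pt, of h] x c by auto
      have ch: "child h (snd y)" using pl child_iff by simp
      have "en (snd y) = en h"
      proof (rule ccontr)
        assume "en (snd y) \<noteq> en h"
        then have "child h (en (snd y))" using next_child[OF ch] child_closed(6)[OF ch] by simp
        then have "sib_pt M y (w, en (snd y))" using pl c child_iff by (auto simp: sib_pt_def)
        then show False using ly by blast
      qed
      then show ?thesis using pl act_app_apply x rights_eq[OF c] by simp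
    qed
    obtain i where i: "(sib_pt M)\<^sup>*\<^sup>* (w, j) (w, i)" "pr h i" "en i = en h" using reach_last[OF c] by blast
    obtain f where f: "pth (sib_pt M) lamR (\<circ>) unit mon x f (w, i)"
      using pth_exists[OF i(1), of lamR mon "(\<circ>)" unit] lamR_in x by blast
    have fm: "f \<in> mon" using pth_closed[OF f mon] by simp
    have ff: "?last (w, i)"
    proof
      assume "\<exists>z. sib_pt M (w, i) z \<and> True"
      then obtain z where z: "sib_pt M (w, i) z" by blast
      then have "fst z = w" "snd z = en i" unfolding sib_pt_def by simp_all
      then obtain h' where h': "pr h' i" "pr h' (en i)" using z unfolding sib_pt_def by auto
      have "h' = h" using parent_unique h'(1) i(2) by blast
      then have "child h (en h)" using h'(2) i(3) child_iff by simp
      then show False unfolding child_def by simp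
    qed
    show ?thesis
    proof
      assume ?a
      then have "f (\<tau> FN) = v" using path[OF f ff] by simp
      then show ?b using fm f ff True by blast
    next
      assume ?b
      then obtain g y where g: "g (\<tau> FN) = v" "pth (sib_pt M) lamR (\<circ>) unit mon x g y" "?last y"
        using True by blast
      then show ?a using path[OF g(2,3)] by simp
    qed
  next
    case False
    then have l: "rights M x = FN" by (simp only: rights_def if_False)
    show ?thesis unfolding l using False by blast
  qed
  show "(\<lambda>x. \<tau> (rights M x) = v) \<in> D" 
    by (rule ssubst[OF ext[OF eqn], where P = "\<lambda>S. S \<in> D"]) (rule inD)
qed (rule rangeI)

text \<open>For a point with a parent, this is the context that turns its own child forest into the
  child forest of the parent.\<close>

definition "lamV x = act N k (\<lambda>X. app (lefts M x) (FC (symb_pt x) {} X (rights M x)))"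

lemma ctx_frame: "ctx N (\<lambda>X. app (lefts M x) (FC (symb_pt x) {} X (rights M x)))"
  using ctx_comp[OF ctx_app[OF clean_lefts[of x], of N] ctx_FC[OF clean_rights[of x], of N "symb_pt x"]]
  unfolding comp_def .

lemma lamV_in: "lamV x \<in> mon"
  unfolding lamV_def ctx_monoid_def using ctx_frame by blast

lemma lamV_cls: "lamV x (\<tau> X) = \<tau> (app (lefts M x) (FC (symb_pt x) {} X (rights M x)))"
proof -
  have "congruent_ctx N (\<lambda>X. app (lefts M x) (FC (symb_pt x) {} X (rights M x)))"
    using ctx_frame[of x] unfolding ctx_def by blast
  from act_cls[OF this] show ?thesis unfolding lamV_def .
qed

lemma unit_cls: "unit (\<tau> X) = \<tau> X"
proof -
  have "congruent_ctx N (\<lambda>X :: 'ap symb forest. X)" unfolding congruent_ctx_def by blast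
  from act_cls[OF this] show ?thesis .
qed

lemma lamV_D:
  assumes K: "dfn D (\<lambda>x. \<tau> (kids M x))"
  shows "(\<lambda>x. lamV x = a) \<in> D"
proof -
  have "dfn D lamV"
  proof (rule dfn_factor[OF bc dfn_pair[OF bc sym dfn_pair[OF bc lefts_dfn[OF K] rights_dfn[OF K]]]])
    fix x y
    assume "(symb_pt x, \<tau> (lefts M x), \<tau> (rights M x)) = (symb_pt y, \<tau> (lefts M y), \<tau> (rights M y))"
    then have s: "symb_pt x = symb_pt y" and e: "eqv N k (lefts M x) (lefts M y)" "eqv N k (rights M x) (rights M y)"
      by (simp_all add: cls_eq_iff)
    show "lamV x = lamV y" unfolding lamV_def s
    proof (rule act_eqI)
      fix F
      show "\<tau> (app (lefts M x) (FC (symb_pt y) {} F (rights M x))) = \<tau> (app (lefts M y) (FC (symb_pt y) {} F (rights M y)))"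
        unfolding cls_eq_iff by (rule eqv_app[OF e(1) eqv_FC[OF eqv_refl e(2)]])
    qed
  qed
  then show ?thesis unfolding dfn_def by blast
qed

text \<open>Innermost factor of the products below: the class of the child forest of the parent of
  \<open>x\<close> with the pebble on \<open>x\<close> itself.\<close>

definition "base p x = \<tau> (app (lefts M x) (FC (symb_pt x) {p} (kids M x) (rights M x)))"

lemma base_dfn:
  assumes K: "dfn D (\<lambda>x. \<tau> (kids M x))"
  shows "dfn D (base p)"
proof (rule dfn_factor[OF bc dfn_pair[OF bc dfn_pair[OF bc sym K] dfn_pair[OF bc lefts_dfn[OF K] rights_dfn[OF K]]]])
  fix x y
  assume "((symb_pt x, \<tau> (kids M x)), \<tau> (lefts M x), \<tau> (rights M x)) = ((symb_pt y, \<tau> (kids M y)), \<tau> (lefts M y), \<tau> (rights M y))"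
  then have s: "symb_pt x = symb_pt y" and e: "eqv N k (lefts M x) (lefts M y)" "eqv N k (rights M x) (rights M y)"
    "eqv N k (kids M x) (kids M y)"
    by (simp_all add: cls_eq_iff)
  show "base p x = base p y"
    unfolding base_def s cls_eq_iff by (rule eqv_app[OF e(1) eqv_FC[OF e(3,2)]])
qed

text \<open>If all pebbles lie strictly below \<open>y\<close>, the contexts on the path from
  \<open>x\<close> to \<open>y\<close> are pebble-free, and their product carries the class of the
  child forest of \<open>y\<close> to that of \<open>x\<close>.\<close>

lemma path_down:
  assumes "pth (child_pt M) lamV (\<circ>) unit mon x f y" "valid_pt M x"
  shows "fst y = fst x \<and> snd x \<le> snd y \<and> snd y \<le> length (fst x) + 1 \<and>
    sub_end M (fst x) (snd y) \<le> sub_end M (fst x) (snd x) \<and>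
    (\<forall>P. (\<forall>j. \<not> (snd y < j \<and> j < sub_end M (fst x) (snd y)) \<longrightarrow> P j = {}) \<longrightarrow>
      \<tau> (wforest M (fst x) P (Suc (snd x)) (sub_end M (fst x) (snd x))) =
      f (\<tau> (wforest M (fst x) P (Suc (snd y)) (sub_end M (fst x) (snd y)))))"
  using assms
proof (induction rule: pth.induct)
  case (refl x)
  then show ?case by (simp add: unit_cls valid_pt_def)
next
  case (step x f y z)
  have cw: "compatible M (fst x)" using step.prems unfolding valid_pt_def by blast
  interpret opword M SL "fst x" using opwordI cw by blast
  note IH = step.IH[OF step.prems]
  have fz: "fst z = fst x" and p: "pr (snd y) (snd z)" using step.hyps(2) IH unfolding child_pt_def by auto
  have ch: "child (snd y) (snd z)" using p child_iff by blast
  note cc = child_closed[OF ch]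
  have main: "\<tau> (wforest M (fst x) P (Suc (snd x)) (en (snd x))) =
      (f \<circ> lamV z) (\<tau> (wforest M (fst x) P (Suc (snd z)) (en (snd z))))"
    if P: "\<forall>j. \<not> (snd z < j \<and> j < en (snd z)) \<longrightarrow> P j = {}" for P
  proof -
    have "\<forall>j. \<not> (snd y < j \<and> j < en (snd y)) \<longrightarrow> P j = {}"
    proof (intro allI impI)
      fix j assume "\<not> (snd y < j \<and> j < en (snd y))"
      then have "\<not> (snd z < j \<and> j < en (snd z))" using cc(2,6) by linarith
      then show "P j = {}" using P by blast
    qed
    then have 1: "\<tau> (wforest M (fst x) P (Suc (snd x)) (en (snd x))) =
        f (\<tau> (wforest M (fst x) P (Suc (snd y)) (en (snd y))))" using IH by blast
    have Pz: "P (snd z) = {}" using P by blast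
    have l: "wforest M (fst x) P (Suc (snd y)) (snd z) = lefts M z"
    proof -
      have "lefts M (fst x, snd z) = wforest M (fst x) P (Suc (snd y)) (snd z)"
        unfolding lefts_eq[OF cw p] wforest_def
      proof (rule ivf_cong[OF cc(1,2)])
        fix j assume "Suc (snd y) \<le> j" "j < snd z"
        then have "P j = {}" using P by simp
        then show "symb_at (fst x) j = symb_at (fst x) j \<and> {} = P j" by simp
      qed
      moreover have "(fst x, snd z) = z" using fz by (simp add: prod_eq_iff)
      ultimately show ?thesis by simp
    qed
    have r: "wforest M (fst x) P (en (snd z)) (en (snd y)) = rights M z"
    proof -
      have "rights M (fst x, snd z) = wforest M (fst x) P (en (snd z)) (en (snd y))"
        unfolding rights_eq[OF cw p] wforest_def
      proof (rule ivf_cong[OF cc(5,6)])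
        fix j assume "en (snd z) \<le> j" "j < en (snd y)"
        then have "P j = {}" using P by simp
        then show "symb_at (fst x) j = symb_at (fst x) j \<and> {} = P j" by simp
      qed
      moreover have "(fst x, snd z) = z" using fz by (simp add: prod_eq_iff)
      ultimately show ?thesis by simp
    qed
    have "wforest M (fst x) P (Suc (snd y)) (en (snd y)) =
        app (lefts M z) (FC (symb_pt z) {} (wforest M (fst x) P (Suc (snd z)) (en (snd z))) (rights M z))"
      using ivf_child[OF ch, of "symb_at (fst x)" P] unfolding l[symmetric] r[symmetric] wforest_def Pz fz .
    then show ?thesis unfolding 1 comp_apply lamV_cls by (simp only:)
  qed
  have "snd z \<le> length (fst x) + 1" using parent_less[OF p] by blast
  moreover have "snd x \<le> snd z" using IH cc(2) by linarith
  moreover have "en (snd z) \<le> en (snd x)" using IH cc(6) by linarith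
  ultimately show ?case using main fz by blast
qed

lemma marked_child:
  assumes c: "compatible M w" and p: "parent M w h j"
  shows "\<tau> (wforest M w ((\<lambda>_. {})(j := {q})) (Suc h) (sub_end M w h)) = base q (w, j)"
proof -
  interpret opword M SL w using opwordI c by blast
  have ch: "child h j" using p child_iff by blast
  note cc = child_closed[OF ch]
  let ?P = "(\<lambda>_. {})(j := {q}) :: nat \<Rightarrow> nat set"
  have l: "wforest M w ?P (Suc h) j = lefts M (w, j)"
    unfolding lefts_eq[OF c p] wforest_def by (rule ivf_cong[OF cc(1,2)]) simp
  have r: "wforest M w ?P (en j) (en h) = rights M (w, j)"
    unfolding rights_eq[OF c p] wforest_def by (rule ivf_cong[OF cc(5,6)]) (use cc(4) in simp)
  have k: "wforest M w ?P (Suc j) (en j) = kids M (w, j)"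
    unfolding kids_def wforest_def fst_conv snd_conv
    by (rule ivf_cong[OF closed_Suc[OF cc(3)]]) (use cc(4) in simp_all)
  have "wforest M w ?P (Suc h) (en h) = app (lefts M (w, j)) (FC (symb_at w j) (?P j) (kids M (w, j)) (rights M (w, j)))"
    using ivf_child[OF ch, of "symb_at w" ?P] unfolding l[symmetric] r[symmetric] k[symmetric] wforest_def .
  then show ?thesis unfolding base_def by (simp only: fun_upd_same fst_conv snd_conv)
qed

lemma marked_path:
  assumes v: "valid_pt M x" and pt: "pth (child_pt M) lamV (\<circ>) unit mon x f y" and yz: "child_pt M y z"
  shows "fst z = fst x \<and> snd x < snd z \<and> snd z < sub_end M (fst x) (snd x) \<and>
    \<tau> (wforest M (fst x) ((\<lambda>_. {})(snd z := {q})) (Suc (snd x)) (sub_end M (fst x) (snd x))) = f (base q z)"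
proof -
  have cw: "compatible M (fst x)" using v unfolding valid_pt_def by blast
  interpret opword M SL "fst x" using opwordI cw by blast
  note pd = path_down[OF pt v]
  have fy: "fst y = fst x" using pd by blast
  have fz: "fst z = fst x" and p: "pr (snd y) (snd z)" using yz fy unfolding child_pt_def by auto
  have ch: "child (snd y) (snd z)" using p child_iff by blast
  then have yz': "snd y < snd z" "snd z < en (snd y)" unfolding child_def by auto
  let ?P = "(\<lambda>_. {})(snd z := {q}) :: nat \<Rightarrow> nat set"
  have "\<forall>j. \<not> (snd y < j \<and> j < en (snd y)) \<longrightarrow> ?P j = {}" using yz' by simp
  then have "\<tau> (wforest M (fst x) ?P (Suc (snd x)) (en (snd x))) = f (\<tau> (wforest M (fst x) ?P (Suc (snd y)) (en (snd y))))"
    using pd by blast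
  also have "\<dots> = f (base q (fst x, snd z))" by (simp only: marked_child[OF cw p])
  also have "(fst x, snd z) = z" using fz by (simp add: prod_eq_iff)
  finally have "\<tau> (wforest M (fst x) ?P (Suc (snd x)) (en (snd x))) = f (base q z)" .
  moreover have "snd x \<le> snd y" "en (snd y) \<le> en (snd x)" using pd by blast+
  then have "snd x < snd z" "snd z < en (snd x)" using yz' by linarith+
  ultimately show ?thesis using fz by blast
qed

lemma path_exists:
  assumes v: "valid_pt M (w, i)" and ij: "i < j" "j < sub_end M w i"
  shows "\<exists>f\<in>mon. \<exists>y. pth (child_pt M) lamV (\<circ>) unit mon (w, i) f y \<and> child_pt M y (w, j)"
proof -
  have c: "compatible M w" "i \<le> length w + 1" using v unfolding valid_pt_def by auto
  interpret opword M SL w using opwordI c by blast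
  have "pr\<^sup>*\<^sup>* i j" using ancestor_iff[OF c(2)] ij by simp
  then obtain q where q: "pr\<^sup>*\<^sup>* i q" "pr q j"
    by (cases rule: rtranclp.cases) (use ij in auto)
  have "(child_pt M)\<^sup>*\<^sup>* (w, i) (w, q)"
    using q(1)
  proof induction
    case (step y z)
    have "child_pt M (w, y) (w, z)" using step.hyps(2) c by (simp add: child_pt_def)
    then show ?case by (rule rtranclp.rtrancl_into_rtrancl[OF step.IH])
  qed simp
  from pth_exists[where lam = lamV and A = mon and m = "(\<circ>)" and u = unit, OF this lamV_in] obtain f
    where f: "pth (child_pt M) lamV (\<circ>) unit mon (w, i) f (w, q)" by blast
  have "f \<in> mon" by (rule pth_closed[OF f mon subset_refl])
  moreover have "child_pt M (w, q) (w, j)" using q(2) c by (simp add: child_pt_def)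
  ultimately show ?thesis using f by blast
qed

lemma path_future_D:
  assumes "dfn D (\<lambda>x. \<tau> (kids M x))" "Q \<in> D"
  shows "(\<lambda>x. \<exists>y. pth (child_pt M) lamV (\<circ>) unit mon x f y \<and> Q y) \<in> D"
  by (rule conjunct1[OF aperiodic_paths_definable[OF down child_pt_det mon subset_refl lamV_D[OF assms(1)] assms(2)]])

lemma path_past_D:
  assumes "dfn D (\<lambda>x. \<tau> (kids M x))" "Q \<in> D"
  shows "(\<lambda>y. \<exists>x. pth (child_pt M) lamV (\<circ>) unit mon x f y \<and> Q x) \<in> D"
  by (rule conjunct2[OF aperiodic_paths_definable[OF down child_pt_det mon subset_refl lamV_D[OF assms(1)] assms(2)]])

text \<open>A position strictly below \<open>x\<close> is a child \<open>z\<close> of the end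
  \<open>y\<close> of a downward path from \<open>x\<close>, and the class of the forest with the
  pebble on \<open>z\<close> is the product along this path applied to \<open>base q z\<close>. The
  existence of such a path with a given product is definable by aperiodicity.\<close>

lemma marks_dfn:
  assumes K: "dfn D (\<lambda>x. \<tau> (kids M x))"
  shows "dfn D (\<lambda>x. \<tau> ` marks q (kids M x))"
proof (rule dfn_set[OF bc finite_cls[OF finite_symb, of N k]])
  fix s :: "'ap symb forest set"
  have "(\<lambda>z. f (base q z) = s) \<in> D" for f by (rule dfn_pred[OF bc base_dfn[OF K]])
  then have inD: "(\<lambda>x. \<exists>f\<in>mon. \<exists>y. pth (child_pt M) lamV (\<circ>) unit mon x f y \<and> (\<exists>z. child_pt M y z \<and> f (base q z) = s)) \<in> D"
    by (intro bool_closed_bex[OF bc finite_mon] path_future_D[OF K] down_next(1))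
  show "(\<lambda>x. s \<in> \<tau> ` marks q (kids M x)) \<in> D"
  proof (rule restrict[OF inD])
    fix x assume v: "valid_pt M x"
    have c: "compatible M (fst x)" "snd x \<le> length (fst x) + 1" using v unfolding valid_pt_def by auto
    interpret opword M SL "fst x" using opwordI c by blast
    have xm: "snd x < length (fst x) + 2" using c by simp
    have le: "Suc (snd x) \<le> en (snd x)" using e_gt[OF xm] by simp
    have mk: "marks q (kids M x) = {wforest M (fst x) ((\<lambda>_. {})(j := {q})) (Suc (snd x)) (en (snd x)) | j. Suc (snd x) \<le> j \<and> j < en (snd x)}"
      unfolding kids_def wforest_def marks_ivf[OF closed_kids[OF xm] le] ..
    show "(s \<in> \<tau> ` marks q (kids M x)) = (\<exists>f\<in>mon. \<exists>y. pth (child_pt M) lamV (\<circ>) unit mon x f y \<and> (\<exists>z. child_pt M y z \<and> f (base q z) = s))"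
    proof
      assume "s \<in> \<tau> ` marks q (kids M x)"
      then obtain j where j: "Suc (snd x) \<le> j" "j < en (snd x)"
        and s: "s = \<tau> (wforest M (fst x) ((\<lambda>_. {})(j := {q})) (Suc (snd x)) (en (snd x)))" unfolding mk by blast
      have "valid_pt M (fst x, snd x)" using v by simp
      moreover have "snd x < j" using j by simp
      ultimately obtain f y where f: "f \<in> mon" "pth (child_pt M) lamV (\<circ>) unit mon (fst x, snd x) f y" "child_pt M y (fst x, j)"
        using path_exists[of "fst x" "snd x" j] j by blast
      have f2: "pth (child_pt M) lamV (\<circ>) unit mon x f y" using f(2) by simp
      have "s = f (base q (fst x, j))" using marked_path[OF v f2 f(3), of q] s by simp
      then show "\<exists>f\<in>mon. \<exists>y. pth (child_pt M) lamV (\<circ>) unit mon x f y \<and> (\<exists>z. child_pt M y z \<and> f (base q z) = s)"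
        using f(1,3) f2 by blast
    next
      assume "\<exists>f\<in>mon. \<exists>y. pth (child_pt M) lamV (\<circ>) unit mon x f y \<and> (\<exists>z. child_pt M y z \<and> f (base q z) = s)"
      then obtain f y z where f: "pth (child_pt M) lamV (\<circ>) unit mon x f y" "child_pt M y z" "f (base q z) = s" by blast
      note mp = marked_path[OF v f(1,2), of q]
      have "Suc (snd x) \<le> snd z" "snd z < en (snd x)" using mp by auto
      then have "wforest M (fst x) ((\<lambda>_. {})(snd z := {q})) (Suc (snd x)) (en (snd x)) \<in> marks q (kids M x)" unfolding mk by blast
      moreover have "\<tau> (wforest M (fst x) ((\<lambda>_. {})(snd z := {q})) (Suc (snd x)) (en (snd x))) = s" using mp f(3) by simp
      ultimately show "s \<in> \<tau> ` marks q (kids M x)" by blast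
    qed
  qed
qed blast

text \<open>The same product read upwards: from \<open>x\<close> look back along the branch to the
  root, which is recognised by having no parent, and wrap the result in the root node. The root as
  marked position is a separate case.\<close>

lemma marked_tree_D:
  assumes K: "dfn D (\<lambda>x. \<tau> (kids M x))"
  shows "(\<lambda>x. Q (\<tau> (wforest M (fst x) ((\<lambda>_. {})(snd x := {q})) 0 (length (fst x) + 2)))) \<in> D"
proof -
  \<comment> \<open>Context of the root: position 0 has the label \<open>Hash\<close> and no
    siblings, and its subtree is the whole word.\<close>
  let ?r = "act N k (\<lambda>X. FC Hash {} X FN)"
  have rt: "?r (\<tau> X) = \<tau> (FC Hash {} X FN)" for X
  proof -
    have "congruent_ctx N (\<lambda>X :: 'ap symb forest. FC Hash {} X FN)" unfolding congruent_ctx_def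
      by (intro allI impI) (rule eqv_FC[OF _ eqv_refl])
    from act_cls[OF this] show ?thesis .
  qed
  have b: "(\<lambda>x. Q (?r (f (base q x)))) \<in> D" for f by (rule dfn_pred[OF bc base_dfn[OF K]])
  have "dfn D (\<lambda>x. \<tau> (FC Hash {q} (kids M x) FN))"
  proof (rule dfn_factor[OF bc K])
    fix x y assume "\<tau> (kids M x) = \<tau> (kids M y)"
    then show "\<tau> (FC Hash {q} (kids M x) FN) = \<tau> (FC Hash {q} (kids M y) FN)"
      unfolding cls_eq_iff by (rule eqv_FC[OF _ eqv_refl])
  qed
  then have r: "(\<lambda>x. Q (\<tau> (FC Hash {q} (kids M x) FN))) \<in> D" by (rule dfn_pred[OF bc])
  have hpn: "(\<lambda>x. \<not> hp x) \<in> D" by (rule bcs(1)[OF hp_D])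
  have inD: "(\<lambda>x. (\<not> hp x \<and> Q (\<tau> (FC Hash {q} (kids M x) FN))) \<or> (\<exists>f\<in>mon.
      (\<exists>y. child_pt M y x \<and> (\<exists>z. pth (child_pt M) lamV (\<circ>) unit mon z f y \<and> \<not> hp z)) \<and> Q (?r (f (base q x))))) \<in> D"
    by (intro bcs(2) bcs(3) bool_closed_bex[OF bc finite_mon] hpn r b down_next(2) path_past_D[OF K])
  show ?thesis
  proof (rule restrict[OF inD])
    fix x assume v: "valid_pt M x"
    have c: "compatible M (fst x)" "snd x \<le> length (fst x) + 1" using v unfolding valid_pt_def by auto
    interpret opword M SL "fst x" using opwordI c by blast
    let ?w = "fst x" and ?i = "snd x"
    let ?P = "(\<lambda>_. {})(?i := {q}) :: nat \<Rightarrow> nat set"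
    have m0: "(0::nat) < length ?w + 2" by simp
    have H: "symb_at ?w 0 = Hash" by (simp add: symb_at_def)
    have cl0: "closed 0 (length ?w + 2)" using closed_sub[OF m0] unfolding en_zero .
    have t: "wforest M ?w ?P 0 (length ?w + 2) = FC Hash (?P 0) (wforest M ?w ?P (Suc 0) (length ?w + 2)) FN"
      unfolding wforest_def using ivf_step[OF cl0 m0, of "symb_at ?w" ?P] unfolding en_zero H by simp
    have v0: "valid_pt M (?w, 0)" using c by (simp add: valid_pt_def)
    have hp0: "\<not> hp (?w, 0)"
    proof
      assume "hp (?w, 0)"
      then obtain z where "child_pt M z (?w, 0)" by blast
      then have "parent M (fst z) (snd z) 0" unfolding child_pt_def by simp
      from parent_less[OF this] show False by simp
    qed
    show "Q (\<tau> (wforest M ?w ?P 0 (length ?w + 2))) = ((\<not> hp x \<and> Q (\<tau> (FC Hash {q} (kids M x) FN))) \<or> (\<exists>f\<in>mon.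
      (\<exists>y. child_pt M y x \<and> (\<exists>z. pth (child_pt M) lamV (\<circ>) unit mon z f y \<and> \<not> hp z)) \<and> Q (?r (f (base q x)))))"
    proof (cases "?i = 0")
      case True
      then have x0: "x = (?w, 0)" by (simp add: prod_eq_iff)
      have nh: "\<not> hp x" using hp0 x0 by simp
      have "wforest M ?w ?P (Suc 0) (length ?w + 2) = kids M x"
        unfolding kids_def wforest_def True en_zero
        by (rule ivf_cong[OF closed_Suc[OF cl0]]) simp_all
      then have "wforest M ?w ?P 0 (length ?w + 2) = FC Hash {q} (kids M x) FN" using t True by simp
      then show ?thesis using nh by auto
    next
      case False
      then obtain h where h: "pr h ?i" using parent_exists[of ?i] c by auto
      then have "child_pt M (?w, h) x" using c by (simp add: child_pt_def)
      then have hx: "hp x" by blast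
      have tt: "\<tau> (wforest M ?w ?P 0 (length ?w + 2)) = ?r (\<tau> (wforest M ?w ?P (Suc 0) (length ?w + 2)))"
        unfolding rt t using False by simp
      have eq: "\<tau> (wforest M ?w ?P (Suc 0) (length ?w + 2)) = f (base q x)"
        if a: "child_pt M y x" "pth (child_pt M) lamV (\<circ>) unit mon z f y" "\<not> hp z" for f y z
      proof -
        have fz: "fst y = fst z \<and> snd z \<le> snd y"
          using a(2)
        proof induction
          case (step x n y z)
          have p: "parent M (fst y) (snd y) (snd z)" "fst z = fst y" using step.hyps(2) unfolding child_pt_def by auto
          from parent_less[OF p(1)] p(2) step.IH show ?case by simp
        qed simp
        have fy: "fst y = ?w" "pr (snd y) ?i" using a(1) unfolding child_pt_def by auto
        have zb: "snd z \<le> length ?w + 1" using fz parent_less[OF fy(2)] by linarith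
        have "snd z = 0"
        proof (rule ccontr)
          assume "snd z \<noteq> 0"
          then obtain g where "pr g (snd z)" using parent_exists[of "snd z"] zb by auto
          then have "child_pt M (?w, g) z" using c fz fy by (simp add: child_pt_def)
          then show False using a(3) by blast
        qed
        then have z: "z = (?w, 0)" using fz fy by (simp add: prod_eq_iff)
        show ?thesis using marked_path[OF v0 a(2)[unfolded z] a(1), of q] en_zero by simp
      qed
      have "?i < en 0" "0 < ?i" using en_zero c False by simp_all
      from path_exists[OF v0 this(2,1)] obtain f y where f: "f \<in> mon" "pth (child_pt M) lamV (\<circ>) unit mon (?w, 0) f y"
         "child_pt M y (?w, ?i)" by blast
      have f3: "child_pt M y x" using f(3) by simp
      show ?thesis
      proof
        assume "Q (\<tau> (wforest M ?w ?P 0 (length ?w + 2)))"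
        then have "Q (?r (f (base q x)))" unfolding tt eq[OF f3 f(2) hp0] .
        then show "(\<not> hp x \<and> Q (\<tau> (FC Hash {q} (kids M x) FN))) \<or> (\<exists>f\<in>mon.
          (\<exists>y. child_pt M y x \<and> (\<exists>z. pth (child_pt M) lamV (\<circ>) unit mon z f y \<and> \<not> hp z)) \<and> Q (?r (f (base q x))))"
          using f(1,2) f3 hp0 by blast
      next
        assume "(\<not> hp x \<and> Q (\<tau> (FC Hash {q} (kids M x) FN))) \<or> (\<exists>f\<in>mon.
          (\<exists>y. child_pt M y x \<and> (\<exists>z. pth (child_pt M) lamV (\<circ>) unit mon z f y \<and> \<not> hp z)) \<and> Q (?r (f (base q x))))"
        then obtain g y z where g: "child_pt M y x" "pth (child_pt M) lamV (\<circ>) unit mon z g y" "\<not> hp z" "Q (?r (g (base q x)))"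
          using hx by blast
        show "Q (\<tau> (wforest M ?w ?P 0 (length ?w + 2)))" unfolding tt eq[OF g(1-3)] by (rule g(4))
      qed
    qed
  qed
qed

end

lemma clean_ivf: "clean (ivf e l (\<lambda>_. {}) a b)"
proof (induction "b - a" arbitrary: a b rule: less_induct)
  case less
  show ?case
  proof (cases "a < b")
    case True
    have 1: "min (e a) b - (a + 1) < b - a" using True by (auto simp: min_def)
    have 2: "b - max (a + 1) (e a) < b - a" using True by (auto simp: max_def)
    note less.hyps[OF 1] less.hyps[OF 2]
    then show ?thesis using True by (subst ivf.simps) simp
  next
    case False
    then show ?thesis by (subst ivf.simps) simp
  qed
qed

lemma dfn_const: "dfn D (\<lambda>x. c)"
  unfolding dfn_def by (intro conjI allI bcs(5)) simp

text \<open>At rank 0 the class is constant because the forest carries no pebbles. In the step,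
  \<open>marks_dfn\<close> at rank \<open>k\<close> supplies the second component of the class of
  rank \<open>Suc k\<close>.\<close>

lemma kids_dfn: "dfn D (\<lambda>x. cls N k (kids M x))"
proof (induction k)
  case 0
  have "cls N 0 (kids M x) = cls N 0 FN" for x
  proof -
    have "clean (kids M x)" unfolding kids_def wforest_def by (rule clean_ivf)
    from clean_atomic[OF this, of N] show ?thesis unfolding cls_eq_iff eqv_0 atomic_def by simp
  qed
  then have e: "(\<lambda>x. cls N 0 (kids M x)) = (\<lambda>x. cls N 0 FN)" by (rule ext)
  show ?case unfolding e by (rule dfn_const)
next
  case (Suc k)
  show ?case
  proof (rule dfn_factor[OF bc dfn_pair[OF bc Suc marks_dfn[OF Suc, of k]]])
    fix x y
    assume "(cls N k (kids M x), cls N k ` marks k (kids M x)) = (cls N k (kids M y), cls N k ` marks k (kids M y))"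
    then have "eqv N (Suc k) (kids M x) (kids M y)" unfolding eqv_Suc_iff by simp
    then show "cls N (Suc k) (kids M x) = cls N (Suc k) (kids M y)" unfolding cls_eq_iff .
  qed
qed

lemma marked_tree_definable:
  "(\<lambda>x. Q (cls N k (wforest M (fst x) ((\<lambda>_. {})(snd x := {q})) 0 (length (fst x) + 2)))) \<in> D"
  by (rule marked_tree_D[OF kids_dfn])

end

section \<open>Tree navigation in POTL\<close>

text \<open>The instance of \<open>D\<close> in \<open>tree_logic\<close>, see
  \<open>PD_tree_logic\<close>. The values outside OP words are left open, which yields
  \<open>PD_restrict\<close>.\<close>

definition PD :: "'ap opm \<Rightarrow> ('ap pt \<Rightarrow> bool) set" where
  "PD M = {P. \<exists>\<phi>. potl_wf \<phi> \<and> (\<forall>w i. compatible M w \<longrightarrow> i \<le> length w + 1 \<longrightarrow> (potl_sat M w \<phi> i \<longleftrightarrow> P (w, i)))}"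

lemma PD_I:
  assumes "potl_wf \<phi>" "\<And>w i. compatible M w \<Longrightarrow> i \<le> length w + 1 \<Longrightarrow> P (w, i) = potl_sat M w \<phi> i"
  shows "P \<in> PD M"
  unfolding PD_def using assms by (intro CollectI exI[of _ \<phi>]) simp

lemma PD_E:
  assumes "P \<in> PD M"
  obtains \<phi> where "potl_wf \<phi>" "\<And>w i. compatible M w \<Longrightarrow> i \<le> length w + 1 \<Longrightarrow> potl_sat M w \<phi> i = P (w, i)"
  using assms unfolding PD_def by blast

lemma PD_restrict:
  assumes "P \<in> PD M" "\<And>x. valid_pt M x \<Longrightarrow> Q x = P x"
  shows "Q \<in> PD M"
proof (rule PD_E[OF assms(1)])
  fix \<phi> assume f: "potl_wf \<phi>" "\<And>w i. compatible M w \<Longrightarrow> i \<le> length w + 1 \<Longrightarrow> potl_sat M w \<phi> i = P (w, i)"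
  show ?thesis
  proof (rule PD_I[OF f(1)])
    fix w i assume w: "compatible M w" "i \<le> length w + 1"
    then have "valid_pt M (w, i)" by (simp add: valid_pt_def)
    then show "Q (w, i) = potl_sat M w \<phi> i" using assms(2) f(2)[OF w] by blast
  qed
qed

lemma PD_bool: "bool_closed (PD M)"
  unfolding bool_closed_def
proof (intro conjI ballI)
  fix P Q assume "P \<in> PD M" "Q \<in> PD M"
  then obtain \<phi> \<psi> where f: "potl_wf \<phi>" "\<And>w i. compatible M w \<Longrightarrow> i \<le> length w + 1 \<Longrightarrow> potl_sat M w \<phi> i = P (w, i)"
    and g: "potl_wf \<psi>" "\<And>w i. compatible M w \<Longrightarrow> i \<le> length w + 1 \<Longrightarrow> potl_sat M w \<psi> i = Q (w, i)"
    by (elim PD_E) blast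
  show "(\<lambda>x. P x \<or> Q x) \<in> PD M" by (rule PD_I[of "Or \<phi> \<psi>"]) (simp_all add: f g)
next
  fix P assume "P \<in> PD M"
  then obtain \<phi> where f: "potl_wf \<phi>" "\<And>w i. compatible M w \<Longrightarrow> i \<le> length w + 1 \<Longrightarrow> potl_sat M w \<phi> i = P (w, i)"
    by (elim PD_E) blast
  show "(\<lambda>x. \<not> P x) \<in> PD M" by (rule PD_I[of "Neg \<phi>"]) (simp_all add: f)
next
  \<comment> \<open>POTL has no constant for falsity; any atom serves to write down a
    contradiction.\<close>
  show "(\<lambda>x. False) \<in> PD M" by (rule PD_I[of "Neg (Or (Atom undefined) (Neg (Atom undefined)))"]) simp_all
qed

lemmas pbs = bool_closed_not[OF PD_bool] bool_closed_or[OF PD_bool] bool_closed_and[OF PD_bool]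
    bool_closed_const[OF PD_bool]

lemma PD_next:
  assumes "P \<in> PD M" "\<Pi> \<noteq> {}"
  shows "(\<lambda>x. snd x \<le> length (fst x) \<and> rel M (fst x) \<Pi> (snd x) (Suc (snd x)) \<and> P (fst x, Suc (snd x))) \<in> PD M"
proof (rule PD_E[OF assms(1)])
  fix \<phi> assume f: "potl_wf \<phi>" "\<And>w i. compatible M w \<Longrightarrow> i \<le> length w + 1 \<Longrightarrow> potl_sat M w \<phi> i = P (w, i)"
  show ?thesis
    by (rule PD_I[of "Next \<Pi> \<phi>"]) (use assms(2) f in \<open>auto simp: positions_def\<close>)
qed

lemma PD_back:
  assumes "P \<in> PD M" "\<Pi> \<noteq> {}"
  shows "(\<lambda>x. 1 \<le> snd x \<and> rel M (fst x) \<Pi> (snd x - 1) (snd x) \<and> P (fst x, snd x - 1)) \<in> PD M"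
proof (rule PD_E[OF assms(1)])
  fix \<phi> assume f: "potl_wf \<phi>" "\<And>w i. compatible M w \<Longrightarrow> i \<le> length w + 1 \<Longrightarrow> potl_sat M w \<phi> i = P (w, i)"
  show ?thesis
    by (rule PD_I[of "Back \<Pi> \<phi>"]) (use assms(2) f in \<open>auto simp: positions_def\<close>)
qed

lemma PD_cnext:
  assumes "P \<in> PD M" "\<Pi> \<noteq> {}"
  shows "(\<lambda>x. \<exists>j. chi M (fst x) (snd x) j \<and> rel M (fst x) \<Pi> (snd x) j \<and> P (fst x, j)) \<in> PD M"
proof (rule PD_E[OF assms(1)])
  fix \<phi> assume f: "potl_wf \<phi>" "\<And>w i. compatible M w \<Longrightarrow> i \<le> length w + 1 \<Longrightarrow> potl_sat M w \<phi> i = P (w, i)"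
  show ?thesis
  proof (rule PD_I[of "ChainNext \<Pi> \<phi>"])
    fix w i assume w: "compatible M w" "i \<le> length w + 1"
    have "(chi M w i j \<and> rel M w \<Pi> i j \<and> P (w, j)) = (i < j \<and> chi M w i j \<and> rel M w \<Pi> i j \<and> potl_sat M w \<phi> j)" for j
      using chi_bounds[of M w i j] f(2)[OF w(1), of j] by auto
    then show "(\<exists>j. chi M (fst (w, i)) (snd (w, i)) j \<and> rel M (fst (w, i)) \<Pi> (snd (w, i)) j \<and> P (fst (w, i), j)) =
        potl_sat M w (ChainNext \<Pi> \<phi>) i" by simp
  qed (use f assms in simp)
qed

lemma PD_cback:
  assumes "P \<in> PD M" "\<Pi> \<noteq> {}"
  shows "(\<lambda>x. \<exists>j. chi M (fst x) j (snd x) \<and> rel M (fst x) \<Pi> j (snd x) \<and> P (fst x, j)) \<in> PD M"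
proof (rule PD_E[OF assms(1)])
  fix \<phi> assume f: "potl_wf \<phi>" "\<And>w i. compatible M w \<Longrightarrow> i \<le> length w + 1 \<Longrightarrow> potl_sat M w \<phi> i = P (w, i)"
  show ?thesis
  proof (rule PD_I[of "ChainBack \<Pi> \<phi>"])
    fix w i assume w: "compatible M w" "i \<le> length w + 1"
    have "(chi M w j i \<and> rel M w \<Pi> j i \<and> P (w, j)) = (j < i \<and> chi M w j i \<and> rel M w \<Pi> j i \<and> potl_sat M w \<phi> j)" for j
      using chi_bounds[of M w j i] f(2)[OF w(1), of j] by auto
    then show "(\<exists>j. chi M (fst (w, i)) j (snd (w, i)) \<and> rel M (fst (w, i)) \<Pi> j (snd (w, i)) \<and> P (fst (w, i), j)) =
        potl_sat M w (ChainBack \<Pi> \<phi>) i" by simp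
  qed (use f assms in simp)
qed

lemma rel_YE: "rel M w {Yields, Equals} i j \<longleftrightarrow> prel M w Yields i j \<or> prel M w Equals i j"
  by (auto simp: rel_def prel_def)

lemma rel_single: "rel M w {\<pi>} i j \<longleftrightarrow> prel M w \<pi> i j"
  by (auto simp: rel_def prel_def)

context opword begin

lemma L_iff: "L i j \<longleftrightarrow> j = Suc i \<and> i \<le> n \<or> chi M w i j"
proof
  assume l: "L i j"
  show "j = Suc i \<and> i \<le> n \<or> chi M w i j"
  proof (cases "Suc i < j")
    case True
    then show ?thesis using l chi_iff_link[of M w i j] by simp
  next
    case False
    then show ?thesis using link_bounds[OF l] by simp
  qed
next
  assume "j = Suc i \<and> i \<le> n \<or> chi M w i j"
  then show "L i j" using link.adjacent[of i w M] chi_iff_link[of M w i j] by auto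
qed

lemma pr_iff: "pr i j \<longleftrightarrow> (j = Suc i \<and> i \<le> n \<or> chi M w i j) \<and> rel M w {Yields, Equals} i j"
  unfolding parent_def L_iff rel_YE ..

text \<open>For these two relations every step goes to a child. Among the children of
  \<open>a\<close> that start at or before \<open>j\<close>, the largest is the one whose subtree
  contains \<open>j\<close>; hence the summary path to a descendant is the branch leading to
  it.\<close>

lemma summary_YE:
  assumes "j \<le> n + 1"
  shows "(\<lambda>a b. sstep M w {Yields, Equals} j a b \<and> G a b)\<^sup>*\<^sup>* i j \<longleftrightarrow> (\<lambda>a b. pr a b \<and> G a b)\<^sup>*\<^sup>* i j"
proof
  assume "(\<lambda>a b. sstep M w {Yields, Equals} j a b \<and> G a b)\<^sup>*\<^sup>* i j"
  then have "i \<le> j \<and> (\<lambda>a b. pr a b \<and> G a b)\<^sup>*\<^sup>* i j"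
  proof (induction rule: converse_rtranclp_induct)
    case (step a b)
    have s: "sstep M w {Yields, Equals} j a b" "G a b" "b \<le> j" using step by auto
    have ab: "a < b" using sstep_less[OF s(1)] .
    have "pr a b"
      using sstep_cases[OF s(1)]
    proof
      assume "b = a + 1 \<and> rel M w {Yields, Equals} a (a + 1) \<and> \<not> (\<exists>h. h \<le> j \<and> chi M w a h \<and> rel M w {Yields, Equals} a h)"
      then show ?thesis unfolding pr_iff using s(3) assms by simp
    qed (unfold pr_iff, blast)
    then have "(\<lambda>a b. pr a b \<and> G a b) a b" using s by blast
    then have "(\<lambda>a b. pr a b \<and> G a b)\<^sup>*\<^sup>* a j"
      using converse_rtranclp_into_rtranclp[of "\<lambda>a b. pr a b \<and> G a b" a b j] step.IH by blast
    then show ?case using ab s(3) by simp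
  qed simp
  then show "(\<lambda>a b. pr a b \<and> G a b)\<^sup>*\<^sup>* i j" by blast
next
  assume "(\<lambda>a b. pr a b \<and> G a b)\<^sup>*\<^sup>* i j"
  then have "pr\<^sup>*\<^sup>* i j \<and> (\<lambda>a b. sstep M w {Yields, Equals} j a b \<and> G a b)\<^sup>*\<^sup>* i j"
  proof (induction rule: converse_rtranclp_induct)
    case (step a b)
    have p: "pr a b" "G a b" "pr\<^sup>*\<^sup>* b j" using step by auto
    have bn: "b \<le> n + 1" "a < b" "a \<le> n + 1" using parent_less[OF p(1)] by auto
    have bj: "b \<le> j" "j < en b" using ancestor_iff[OF bn(1)] p(3) by auto
    have mx: "h \<le> b" if "h \<le> j" "pr a h" for h
    proof (rule ccontr)
      assume "\<not> h \<le> b"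
      then have "en b \<le> h" using that(2)[unfolded parent_iff[OF bn(3)]] bn(2) by simp
      then show False using that(1) bj by simp
    qed
    have "sstep M w {Yields, Equals} j a b"
    proof (cases "b = a + 1")
      case True
      have "sstep M w {Yields, Equals} j a (a + 1)"
      proof (rule sstep_sucI)
        show "rel M w {Yields, Equals} a (a + 1)" using p(1) True unfolding pr_iff by simp
        fix h assume h: "h \<le> j" "chi M w a h" "rel M w {Yields, Equals} a h"
        have "h \<le> b" by (rule mx[OF h(1)]) (use h in \<open>simp add: pr_iff\<close>)
        then show False using chi_bounds[OF h(2)] True by simp
      qed
      then show ?thesis using True by simp
    next
      case False
      then have c: "chi M w a b" "rel M w {Yields, Equals} a b" using p(1) unfolding pr_iff by auto
      show ?thesis by (rule sstep_jumpI[OF bj(1) c]) (rule mx, assumption, simp add: pr_iff)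
    qed
    then have "(\<lambda>a b. sstep M w {Yields, Equals} j a b \<and> G a b) a b" using p(2) by blast
    then have "(\<lambda>a b. sstep M w {Yields, Equals} j a b \<and> G a b)\<^sup>*\<^sup>* a j"
      using converse_rtranclp_into_rtranclp[of "\<lambda>a b. sstep M w {Yields, Equals} j a b \<and> G a b" a b j] step.IH by blast
    then show ?case using converse_rtranclp_into_rtranclp[of pr, OF p(1,3)] by simp
  qed simp
  then show "(\<lambda>a b. sstep M w {Yields, Equals} j a b \<and> G a b)\<^sup>*\<^sup>* i j" by blast
qed

end

text \<open>The nodes strictly between \<open>x\<close> and \<open>z\<close> are the targets of all
  steps but the last, and likewise the sources of all steps but the first.\<close>

lemma step_shift:
  "(\<exists>y. (\<lambda>a b. R a b \<and> P b)\<^sup>*\<^sup>* x y \<and> R y z) \<longleftrightarrow> (\<exists>c. R x c \<and> (\<lambda>a b. R a b \<and> P a)\<^sup>*\<^sup>* c z)"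
proof
  assume "\<exists>y. (\<lambda>a b. R a b \<and> P b)\<^sup>*\<^sup>* x y \<and> R y z"
  then obtain y where "(\<lambda>a b. R a b \<and> P b)\<^sup>*\<^sup>* x y" "R y z" by blast
  then show "\<exists>c. R x c \<and> (\<lambda>a b. R a b \<and> P a)\<^sup>*\<^sup>* c z"
  proof (induction arbitrary: z)
    case base
    then show ?case by blast
  next
    case (step y y')
    obtain c where c: "R x c" "(\<lambda>a b. R a b \<and> P a)\<^sup>*\<^sup>* c y'" using step.IH step.hyps(2) by blast
    have "(\<lambda>a b. R a b \<and> P a) y' z" using step by blast
    then show ?case using c(1) rtranclp.rtrancl_into_rtrancl[OF c(2)] by blast
  qed
next
  assume "\<exists>c. R x c \<and> (\<lambda>a b. R a b \<and> P a)\<^sup>*\<^sup>* c z"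
  then obtain c where c: "R x c" "(\<lambda>a b. R a b \<and> P a)\<^sup>*\<^sup>* c z" by blast
  from c(2) show "\<exists>y. (\<lambda>a b. R a b \<and> P b)\<^sup>*\<^sup>* x y \<and> R y z"
  proof induction
    case base
    then show ?case using c(1) by blast
  next
    case (step z z')
    obtain y where y: "(\<lambda>a b. R a b \<and> P b)\<^sup>*\<^sup>* x y" "R y z" using step.IH by blast
    have "(\<lambda>a b. R a b \<and> P b) y z" using y step by blast
    then show ?case using step.hyps(2) rtranclp.rtrancl_into_rtrancl[OF y(1)] by blast
  qed
qed

text \<open>Strict until is one step followed by a reflexive until guarded at the sources, the form
  in which POTL offers it on summary paths.\<close>

lemma until_on_shift: "until_on R P Q x \<longleftrightarrow> (\<exists>c. R x c \<and> (\<exists>z. (\<lambda>a b. R a b \<and> P a)\<^sup>*\<^sup>* c z \<and> Q z))"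
  unfolding until_on_def using step_shift[of R P x] by blast

lemma since_on_shift: "since_on R P Q x \<longleftrightarrow> (\<exists>p. R p x \<and> (\<exists>z. (\<lambda>a b. R a b \<and> P b)\<^sup>*\<^sup>* z p \<and> Q z))"
  unfolding since_on_def using step_shift[of R P _ x] by blast

lemma child_pt_paths:
  assumes "compatible M w"
  shows "(\<lambda>a b. child_pt M a b \<and> G a b)\<^sup>*\<^sup>* (w, i) z \<longleftrightarrow>
    (\<exists>j. z = (w, j) \<and> (\<lambda>a b. parent M w a b \<and> G (w, a) (w, b))\<^sup>*\<^sup>* i j)"
proof
  assume "(\<lambda>a b. child_pt M a b \<and> G a b)\<^sup>*\<^sup>* (w, i) z"
  then show "\<exists>j. z = (w, j) \<and> (\<lambda>a b. parent M w a b \<and> G (w, a) (w, b))\<^sup>*\<^sup>* i j"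
  proof induction
    case (step y z)
    obtain j where j: "y = (w, j)" "(\<lambda>a b. parent M w a b \<and> G (w, a) (w, b))\<^sup>*\<^sup>* i j" using step.IH by blast
    have z: "z = (w, snd z)" "parent M w j (snd z)" "G (w, j) z" using step.hyps(2) unfolding j child_pt_def
      by (auto simp: prod_eq_iff)
    then have "(\<lambda>a b. parent M w a b \<and> G (w, a) (w, b)) j (snd z)" by simp
    then show ?case using z(1) rtranclp.rtrancl_into_rtrancl[OF j(2)] by blast
  qed simp
next
  assume "\<exists>j. z = (w, j) \<and> (\<lambda>a b. parent M w a b \<and> G (w, a) (w, b))\<^sup>*\<^sup>* i j"
  then obtain j where j: "z = (w, j)" "(\<lambda>a b. parent M w a b \<and> G (w, a) (w, b))\<^sup>*\<^sup>* i j" by blast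
  from j(2) have "(\<lambda>a b. child_pt M a b \<and> G a b)\<^sup>*\<^sup>* (w, i) (w, j)"
  proof induction
    case (step y z)
    have "(\<lambda>a b. child_pt M a b \<and> G a b) (w, y) (w, z)" using step.hyps(2) assms by (simp add: child_pt_def)
    then show ?case by (rule rtranclp.rtrancl_into_rtrancl[OF step.IH])
  qed simp
  then show "(\<lambda>a b. child_pt M a b \<and> G a b)\<^sup>*\<^sup>* (w, i) z" unfolding j(1) .
qed

lemma rtranclp_conj_left: "(\<lambda>a b. R a b \<and> G a b)\<^sup>*\<^sup>* x y \<Longrightarrow> R\<^sup>*\<^sup>* x y"
  by (induction rule: rtranclp_induct) (auto intro: rtranclp.rtrancl_into_rtrancl)

lemma ex_pt: "(\<exists>z. (\<exists>j. z = (w, j) \<and> A j) \<and> Q z) = (\<exists>j. A j \<and> Q (w, j))"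
  by blast

lemma ex_pt_eq: "(\<exists>j. (w, i) = (w, j) \<and> A j) = A i"
  by blast

context
  fixes M :: "'ap opm" and SL
  assumes opm: "is_opm SL M"
begin

lemma opw: "compatible M w \<Longrightarrow> opword M SL w"
  using opm by unfold_locales

lemma PD_child:
  assumes "P \<in> PD M"
  shows "(\<lambda>x. \<exists>c. child_pt M x c \<and> P c) \<in> PD M"
proof (rule PD_restrict)
  show "(\<lambda>x. (snd x \<le> length (fst x) \<and> rel M (fst x) {Yields, Equals} (snd x) (Suc (snd x)) \<and> P (fst x, Suc (snd x))) \<or>
      (\<exists>j. chi M (fst x) (snd x) j \<and> rel M (fst x) {Yields, Equals} (snd x) j \<and> P (fst x, j))) \<in> PD M"
    by (intro pbs PD_next PD_cnext assms) simp_all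
  fix x assume "valid_pt M x"
  then have c: "compatible M (fst x)" by (simp add: valid_pt_def)
  interpret opword M SL "fst x" using opw c by blast
  have "(\<exists>c. child_pt M x c \<and> P c) = (\<exists>j. pr (snd x) j \<and> P (fst x, j))"
    unfolding child_pt_def using c by (simp add: split_paired_Ex)
  then show "(\<exists>c. child_pt M x c \<and> P c) = ((snd x \<le> length (fst x) \<and> rel M (fst x) {Yields, Equals} (snd x) (Suc (snd x)) \<and> P (fst x, Suc (snd x))) \<or>
      (\<exists>j. chi M (fst x) (snd x) j \<and> rel M (fst x) {Yields, Equals} (snd x) j \<and> P (fst x, j)))"
    unfolding pr_iff by blast
qed

lemma PD_parent:
  assumes "P \<in> PD M"
  shows "(\<lambda>x. \<exists>c. child_pt M c x \<and> P c) \<in> PD M"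
proof (rule PD_restrict)
  show "(\<lambda>x. (1 \<le> snd x \<and> rel M (fst x) {Yields, Equals} (snd x - 1) (snd x) \<and> P (fst x, snd x - 1)) \<or>
      (\<exists>j. chi M (fst x) j (snd x) \<and> rel M (fst x) {Yields, Equals} j (snd x) \<and> P (fst x, j))) \<in> PD M"
    by (intro pbs PD_back PD_cback assms) simp_all
  fix x assume v: "valid_pt M x"
  then have c: "compatible M (fst x)" "snd x \<le> length (fst x) + 1" by (simp_all add: valid_pt_def)
  interpret opword M SL "fst x" using opw c by blast
  have e: "(\<exists>c. child_pt M c x \<and> P c) = (\<exists>j. pr j (snd x) \<and> P (fst x, j))"
    unfolding child_pt_def using c by (simp add: split_paired_Ex)
  have s: "(snd x = Suc j \<and> j \<le> n) = (1 \<le> snd x \<and> j = snd x - 1)" for j using c by auto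
  show "(\<exists>c. child_pt M c x \<and> P c) = ((1 \<le> snd x \<and> rel M (fst x) {Yields, Equals} (snd x - 1) (snd x) \<and> P (fst x, snd x - 1)) \<or>
      (\<exists>j. chi M (fst x) j (snd x) \<and> rel M (fst x) {Yields, Equals} j (snd x) \<and> P (fst x, j)))"
    unfolding e pr_iff s by blast
qed

lemma PD_until_down:
  assumes "P \<in> PD M" "Q \<in> PD M"
  shows "(\<lambda>x. \<exists>z. (\<lambda>a b. child_pt M a b \<and> P a)\<^sup>*\<^sup>* x z \<and> Q z) \<in> PD M"
proof -
  obtain \<phi> \<psi> where f: "potl_wf \<phi>" "\<And>w i. compatible M w \<Longrightarrow> i \<le> length w + 1 \<Longrightarrow> potl_sat M w \<phi> i = P (w, i)"
    and g: "potl_wf \<psi>" "\<And>w i. compatible M w \<Longrightarrow> i \<le> length w + 1 \<Longrightarrow> potl_sat M w \<psi> i = Q (w, i)"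
    using assms by (elim PD_E) blast
  show ?thesis
  proof (rule PD_I[of "ChainUntil {Yields, Equals} \<phi> \<psi>"])
    fix w i assume w: "compatible M w" "i \<le> length w + 1"
    interpret opword M SL w using opw w by blast
    have ip: "i \<in> positions w" using w by (simp add: positions_def)
    have "(\<exists>z. (\<lambda>a b. child_pt M a b \<and> P a)\<^sup>*\<^sup>* (w, i) z \<and> Q z) = (\<exists>j. (\<lambda>a b. pr a b \<and> P (w, a))\<^sup>*\<^sup>* i j \<and> Q (w, j))"
      unfolding child_pt_paths[OF w(1), of "\<lambda>a b. P a"] ex_pt ..
    also have "(\<lambda>a b. pr a b \<and> P (w, a)) = (\<lambda>a b. pr a b \<and> potl_sat M w \<phi> a)"
    proof (intro ext)
      fix a b
      show "(pr a b \<and> P (w, a)) = (pr a b \<and> potl_sat M w \<phi> a)" using f(2)[OF w(1), of a] parent_less[of M w a b] by auto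
    qed
    also have "(\<exists>j. (\<lambda>a b. pr a b \<and> potl_sat M w \<phi> a)\<^sup>*\<^sup>* i j \<and> Q (w, j)) =
        (\<exists>j\<in>positions w. (\<lambda>a b. sstep M w {Yields, Equals} j a b \<and> potl_sat M w \<phi> a)\<^sup>*\<^sup>* i j \<and> potl_sat M w \<psi> j)"
      (is "?l = ?r")
    proof
      assume ?l
      then obtain j where j: "(\<lambda>a b. pr a b \<and> potl_sat M w \<phi> a)\<^sup>*\<^sup>* i j" "Q (w, j)" by (elim exE conjE)
      have "pr\<^sup>*\<^sup>* i j" using j(1) by (rule rtranclp_conj_left)
      then have jn: "j \<le> n + 1" using ancestor_bound[of M w i j] w(2) by auto
      have "(\<lambda>a b. sstep M w {Yields, Equals} j a b \<and> potl_sat M w \<phi> a)\<^sup>*\<^sup>* i j"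
        using j(1) unfolding summary_YE[OF jn, of "\<lambda>a b. potl_sat M w \<phi> a"] .
      moreover have "potl_sat M w \<psi> j" using g(2)[OF w(1) jn] j(2) by simp
      moreover have "j \<in> positions w" using jn by (simp add: positions_def)
      ultimately show ?r by (intro bexI conjI)
    next
      assume ?r
      then obtain j where j: "j \<in> positions w" "(\<lambda>a b. sstep M w {Yields, Equals} j a b \<and> potl_sat M w \<phi> a)\<^sup>*\<^sup>* i j" "potl_sat M w \<psi> j"
        by (elim bexE conjE)
      have jn: "j \<le> n + 1" using j(1) by (simp add: positions_def)
      have "(\<lambda>a b. pr a b \<and> potl_sat M w \<phi> a)\<^sup>*\<^sup>* i j"
        using j(2) unfolding summary_YE[OF jn, of "\<lambda>a b. potl_sat M w \<phi> a"] .
      moreover have "Q (w, j)" using g(2)[OF w(1) jn] j(3) by simp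
      ultimately show ?l by (intro exI conjI)
    qed
    finally show "(\<exists>z. (\<lambda>a b. child_pt M a b \<and> P a)\<^sup>*\<^sup>* (w, i) z \<and> Q z) = potl_sat M w (ChainUntil {Yields, Equals} \<phi> \<psi>) i"
      unfolding potl_sat.simps until_summary[OF ip] .
  qed (simp add: f g)
qed

lemma PD_since_down:
  assumes "P \<in> PD M" "Q \<in> PD M"
  shows "(\<lambda>x. \<exists>z. (\<lambda>a b. child_pt M a b \<and> P b)\<^sup>*\<^sup>* z x \<and> Q z) \<in> PD M"
proof -
  obtain \<phi> \<psi> where f: "potl_wf \<phi>" "\<And>w i. compatible M w \<Longrightarrow> i \<le> length w + 1 \<Longrightarrow> potl_sat M w \<phi> i = P (w, i)"
    and g: "potl_wf \<psi>" "\<And>w i. compatible M w \<Longrightarrow> i \<le> length w + 1 \<Longrightarrow> potl_sat M w \<psi> i = Q (w, i)"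
    using assms by (elim PD_E) blast
  show ?thesis
  proof (rule PD_I[of "ChainSince {Yields, Equals} \<phi> \<psi>"])
    fix w i assume w: "compatible M w" "i \<le> length w + 1"
    interpret opword M SL w using opw w by blast
    have ip: "i \<in> positions w" using w by (simp add: positions_def)
    have fz: "fst z = w" if "(\<lambda>a b. child_pt M a b \<and> P b)\<^sup>*\<^sup>* z (w, i)" for z
      using that by (induction rule: converse_rtranclp_induct) (auto simp: child_pt_def)
    have "(\<exists>z. (\<lambda>a b. child_pt M a b \<and> P b)\<^sup>*\<^sup>* z (w, i) \<and> Q z) = (\<exists>j. (\<lambda>a b. child_pt M a b \<and> P b)\<^sup>*\<^sup>* (w, j) (w, i) \<and> Q (w, j))"
    proof
      assume "\<exists>z. (\<lambda>a b. child_pt M a b \<and> P b)\<^sup>*\<^sup>* z (w, i) \<and> Q z"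
      then obtain z where z: "(\<lambda>a b. child_pt M a b \<and> P b)\<^sup>*\<^sup>* z (w, i)" "Q z" by (elim exE conjE)
      have e: "z = (w, snd z)" using fz[OF z(1)] by (simp add: prod_eq_iff)
      show "\<exists>j. (\<lambda>a b. child_pt M a b \<and> P b)\<^sup>*\<^sup>* (w, j) (w, i) \<and> Q (w, j)"
        by (intro exI[of _ "snd z"] conjI) (subst e[symmetric], rule z)+
    next
      assume "\<exists>j. (\<lambda>a b. child_pt M a b \<and> P b)\<^sup>*\<^sup>* (w, j) (w, i) \<and> Q (w, j)"
      then show "\<exists>z. (\<lambda>a b. child_pt M a b \<and> P b)\<^sup>*\<^sup>* z (w, i) \<and> Q z" by (elim exE) (rule exI)
    qed
    also have "\<dots> = (\<exists>j. (\<lambda>a b. pr a b \<and> P (w, b))\<^sup>*\<^sup>* j i \<and> Q (w, j))"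
      unfolding child_pt_paths[OF w(1), of "\<lambda>a b. P b"] ex_pt_eq ..
    also have "(\<lambda>a b. pr a b \<and> P (w, b)) = (\<lambda>a b. pr a b \<and> potl_sat M w \<phi> b)"
    proof (intro ext)
      fix a b
      show "(pr a b \<and> P (w, b)) = (pr a b \<and> potl_sat M w \<phi> b)" using f(2)[OF w(1), of b] parent_less[of M w a b] by auto
    qed
    also have "(\<exists>j. (\<lambda>a b. pr a b \<and> potl_sat M w \<phi> b)\<^sup>*\<^sup>* j i \<and> Q (w, j)) =
        (\<exists>j\<in>positions w. (\<lambda>a b. sstep M w {Yields, Equals} i a b \<and> potl_sat M w \<phi> b)\<^sup>*\<^sup>* j i \<and> potl_sat M w \<psi> j)"
      (is "?l = ?r")
    proof
      assume ?l
      then obtain j where j: "(\<lambda>a b. pr a b \<and> potl_sat M w \<phi> b)\<^sup>*\<^sup>* j i" "Q (w, j)" by (elim exE conjE)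
      have "pr\<^sup>*\<^sup>* j i" using j(1) by (rule rtranclp_conj_left)
      then have jn: "j \<le> n + 1" using ancestor_le[of M w j i] w(2) by simp
      have "(\<lambda>a b. sstep M w {Yields, Equals} i a b \<and> potl_sat M w \<phi> b)\<^sup>*\<^sup>* j i"
        using j(1) unfolding summary_YE[OF w(2), of "\<lambda>a b. potl_sat M w \<phi> b"] .
      moreover have "potl_sat M w \<psi> j" using g(2)[OF w(1) jn] j(2) by simp
      moreover have "j \<in> positions w" using jn by (simp add: positions_def)
      ultimately show ?r by (intro bexI conjI)
    next
      assume ?r
      then obtain j where j: "j \<in> positions w" "(\<lambda>a b. sstep M w {Yields, Equals} i a b \<and> potl_sat M w \<phi> b)\<^sup>*\<^sup>* j i" "potl_sat M w \<psi> j"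
        by (elim bexE conjE)
      have jn: "j \<le> n + 1" using j(1) by (simp add: positions_def)
      have "(\<lambda>a b. pr a b \<and> potl_sat M w \<phi> b)\<^sup>*\<^sup>* j i"
        using j(2) unfolding summary_YE[OF w(2), of "\<lambda>a b. potl_sat M w \<phi> b"] .
      moreover have "Q (w, j)" using g(2)[OF w(1) jn] j(3) by simp
      ultimately show ?l by (intro exI conjI)
    qed
    finally show "(\<exists>z. (\<lambda>a b. child_pt M a b \<and> P b)\<^sup>*\<^sup>* z (w, i) \<and> Q z) = potl_sat M w (ChainSince {Yields, Equals} \<phi> \<psi>) i"
      unfolding potl_sat.simps since_summary[OF ip] .
  qed (simp add: f g)
qed

lemma PD_down: "temporally_closed (child_pt M) (PD M)"
  unfolding temporally_closed_def
proof (intro conjI ballI PD_bool)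
  fix P Q assume PQ: "P \<in> PD M" "Q \<in> PD M"
  show "until_on (child_pt M) P Q \<in> PD M"
    by (rule ssubst[OF ext[OF until_on_shift], where P = "\<lambda>S. S \<in> PD M"]) (rule PD_child[OF PD_until_down[OF PQ]])
  show "since_on (child_pt M) P Q \<in> PD M"
    by (rule ssubst[OF ext[OF since_on_shift], where P = "\<lambda>S. S \<in> PD M"]) (rule PD_parent[OF PD_since_down[OF PQ]])
qed

text \<open>With all three relations allowed, a step to a neighbour fails only if the neighbour does
  not exist, since adjacent positions are always related.\<close>

lemma PD_zero: "(\<lambda>x. snd x = 0) \<in> PD M"
proof (rule PD_restrict)
  show "(\<lambda>x. \<not> (1 \<le> snd x \<and> rel M (fst x) UNIV (snd x - 1) (snd x) \<and> True)) \<in> PD M"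
    by (intro pbs(1) PD_back[OF pbs(4)]) simp
  fix x assume v: "valid_pt M x"
  then have c: "compatible M (fst x)" "snd x \<le> length (fst x) + 1" by (simp_all add: valid_pt_def)
  interpret opword M SL "fst x" using opw c by blast
  show "(snd x = 0) = (\<not> (1 \<le> snd x \<and> rel M (fst x) UNIV (snd x - 1) (snd x) \<and> True))"
  proof (cases "snd x")
    case (Suc i)
    then have "L i (snd x)" using c link.adjacent[of i "fst x" M] by simp
    then have "rel M (fst x) UNIV (snd x - 1) (snd x)"
      using link_defined[of i "snd x"] Suc by (auto simp: rel_def prel_def)
    then show ?thesis using Suc by simp
  qed simp
qed

lemma PD_last: "(\<lambda>x. snd x = length (fst x) + 1) \<in> PD M"
proof (rule PD_restrict)
  show "(\<lambda>x. \<not> (snd x \<le> length (fst x) \<and> rel M (fst x) UNIV (snd x) (Suc (snd x)) \<and> True)) \<in> PD M"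
    by (intro pbs(1) PD_next[OF pbs(4)]) simp
  fix x assume v: "valid_pt M x"
  then have c: "compatible M (fst x)" "snd x \<le> length (fst x) + 1" by (simp_all add: valid_pt_def)
  interpret opword M SL "fst x" using opw c by blast
  show "(snd x = length (fst x) + 1) = (\<not> (snd x \<le> length (fst x) \<and> rel M (fst x) UNIV (snd x) (Suc (snd x)) \<and> True))"
  proof (cases "snd x \<le> length (fst x)")
    case True
    then have "L (snd x) (Suc (snd x))" by (rule link.adjacent)
    then have "rel M (fst x) UNIV (snd x) (Suc (snd x))"
      using link_defined[of "snd x" "Suc (snd x)"] by (auto simp: rel_def prel_def)
    then show ?thesis using True by simp
  qed (use c in simp)
qed

end

section \<open>Siblings in POTL\<close>

lemma next_least:
  fixes H :: "nat \<Rightarrow> bool"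
  assumes "H j" "i < j"
  shows "\<exists>k. H k \<and> i < k \<and> k \<le> j \<and> (\<forall>l. i < l \<and> H l \<longrightarrow> k \<le> l)"
proof -
  let ?k = "LEAST k. H k \<and> i < k"
  have "H ?k \<and> i < ?k" by (rule LeastI[of "\<lambda>k. H k \<and> i < k" j]) (use assms in simp)
  moreover have "?k \<le> l" if "i < l" "H l" for l by (rule Least_le) (use that in simp)
  ultimately show ?thesis using assms by blast
qed

lemma prev_greatest:
  fixes H :: "nat \<Rightarrow> bool"
  assumes "H j" "j < i"
  shows "\<exists>k. H k \<and> k < i \<and> j \<le> k \<and> (\<forall>l. l < i \<and> H l \<longrightarrow> l \<le> k)"
proof -
  let ?K = "{k. H k \<and> k < i}"
  have fin: "finite ?K" by (rule finite_subset[of _ "{..<i}"]) auto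
  have "Max ?K \<in> ?K" by (rule Max_in[OF fin]) (use assms in blast)
  moreover have "l \<le> Max ?K" if "l < i" "H l" for l by (rule Max_ge[OF fin]) (use that in simp)
  ultimately show ?thesis using assms by blast
qed

lemma Min_iff_ex: "finite (K :: nat set) \<Longrightarrow> (K \<noteq> {} \<and> F (Min K)) \<longleftrightarrow> (\<exists>k\<in>K. (\<forall>l\<in>K. k \<le> l) \<and> F k)"
proof
  assume "finite K" "\<exists>k\<in>K. (\<forall>l\<in>K. k \<le> l) \<and> F k"
  then obtain k where k: "k \<in> K" "\<forall>l\<in>K. k \<le> l" "F k" by blast
  have "Min K = k" by (rule Min_eqI) (use \<open>finite K\<close> k in auto)
  then show "K \<noteq> {} \<and> F (Min K)" using k by auto
next
  assume "finite K" "K \<noteq> {} \<and> F (Min K)"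
  then show "\<exists>k\<in>K. (\<forall>l\<in>K. k \<le> l) \<and> F k" by (intro bexI[of _ "Min K"]) auto
qed

lemma Max_iff_ex: "finite (K :: nat set) \<Longrightarrow> (K \<noteq> {} \<and> F (Max K)) \<longleftrightarrow> (\<exists>k\<in>K. (\<forall>l\<in>K. l \<le> k) \<and> F k)"
proof
  assume "finite K" "\<exists>k\<in>K. (\<forall>l\<in>K. l \<le> k) \<and> F k"
  then obtain k where k: "k \<in> K" "\<forall>l\<in>K. l \<le> k" "F k" by blast
  have "Max K = k" by (rule Max_eqI) (use \<open>finite K\<close> k in auto)
  then show "K \<noteq> {} \<and> F (Max K)" using k by auto
next
  assume "finite K" "K \<noteq> {} \<and> F (Max K)"
  then show "\<exists>k\<in>K. (\<forall>l\<in>K. l \<le> k) \<and> F k" by (intro bexI[of _ "Max K"]) auto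
qed

text \<open>Children linked to \<open>h\<close> by a chain are of the kinds \<open>yk\<close> and
  \<open>ek\<close>; the third kind is the adjacent child, see \<open>pr_cases\<close>.\<close>

definition yk :: "'ap opm \<Rightarrow> 'ap set list \<Rightarrow> nat \<Rightarrow> nat \<Rightarrow> bool" where
  "yk M w h k \<longleftrightarrow> chi M w h k \<and> rel M w {Yields} h k"

definition ek :: "'ap opm \<Rightarrow> 'ap set list \<Rightarrow> nat \<Rightarrow> nat \<Rightarrow> bool" where
  "ek M w h k \<longleftrightarrow> chi M w h k \<and> rel M w {Equals} h k"

lemma yk_bounds: "yk M w h k \<Longrightarrow> Suc h < k \<and> k \<le> length w + 1"
  unfolding yk_def using chi_bounds by blast

lemma hnext_yields: "hnext_sat M w HYields F i \<longleftrightarrow> (\<exists>h k. yk M w h i \<and> yk M w h k \<and> i < k \<and>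
    (\<forall>l. i < l \<and> yk M w h l \<longrightarrow> k \<le> l) \<and> F k)"
proof -
  have fin: "finite {k. k > i \<and> chi M w h k \<and> rel M w {Yields} h k}" for h
    by (rule finite_subset[of _ "{..length w + 1}"]) (auto dest: chi_bounds)
  have hi: "chi M w h i \<Longrightarrow> h < i" for h using chi_bounds[of M w h i] by simp
  show ?thesis unfolding hnext_sat.simps Let_def Min_iff_ex[OF fin] yk_def using hi by blast
qed

lemma hback_yields: "hback_sat M w HYields F i \<longleftrightarrow> (\<exists>h k. yk M w h i \<and> yk M w h k \<and> k < i \<and>
    (\<forall>l. l < i \<and> yk M w h l \<longrightarrow> l \<le> k) \<and> F k)"
proof -
  have fin: "finite {k. k < i \<and> chi M w h k \<and> rel M w {Yields} h k}" for h
    by (rule finite_subset[of _ "{..<i}"]) auto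
  have hi: "chi M w h i \<Longrightarrow> h < i" for h using chi_bounds[of M w h i] by simp
  show ?thesis unfolding hback_sat.simps Let_def Max_iff_ex[OF fin] yk_def using hi by blast
qed

lemma PD_hnext:
  assumes "P \<in> PD M"
  shows "(\<lambda>x. \<exists>h k. yk M (fst x) h (snd x) \<and> yk M (fst x) h k \<and> snd x < k \<and>
    (\<forall>l. snd x < l \<and> yk M (fst x) h l \<longrightarrow> k \<le> l) \<and> P (fst x, k)) \<in> PD M"
proof (rule PD_E[OF assms(1)])
  fix \<phi> assume f: "potl_wf \<phi>" "\<And>w i. compatible M w \<Longrightarrow> i \<le> length w + 1 \<Longrightarrow> potl_sat M w \<phi> i = P (w, i)"
  show ?thesis
  proof (rule PD_I[of "HNext HYields \<phi>"])
    fix w i assume w: "compatible M w" "i \<le> length w + 1"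
    have "(yk M w h k \<and> X \<and> Z \<and> P (w, k)) = (yk M w h k \<and> X \<and> Z \<and> potl_sat M w \<phi> k)" for h k X Z
      using yk_bounds[of M w h k] f(2)[OF w(1), of k] by blast
    then show "(\<exists>h k. yk M (fst (w, i)) h (snd (w, i)) \<and> yk M (fst (w, i)) h k \<and> snd (w, i) < k \<and>
        (\<forall>l. snd (w, i) < l \<and> yk M (fst (w, i)) h l \<longrightarrow> k \<le> l) \<and> P (fst (w, i), k)) = potl_sat M w (HNext HYields \<phi>) i"
      unfolding potl_sat.simps hnext_yields fst_conv snd_conv by simp
  qed (use f in simp)
qed

lemma PD_hback:
  assumes "P \<in> PD M"
  shows "(\<lambda>x. \<exists>h k. yk M (fst x) h (snd x) \<and> yk M (fst x) h k \<and> k < snd x \<and>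
    (\<forall>l. l < snd x \<and> yk M (fst x) h l \<longrightarrow> l \<le> k) \<and> P (fst x, k)) \<in> PD M"
proof (rule PD_E[OF assms(1)])
  fix \<phi> assume f: "potl_wf \<phi>" "\<And>w i. compatible M w \<Longrightarrow> i \<le> length w + 1 \<Longrightarrow> potl_sat M w \<phi> i = P (w, i)"
  show ?thesis
  proof (rule PD_I[of "HBack HYields \<phi>"])
    fix w i assume w: "compatible M w" "i \<le> length w + 1"
    have "(yk M w h k \<and> X \<and> Z \<and> P (w, k)) = (yk M w h k \<and> X \<and> Z \<and> potl_sat M w \<phi> k)" for h k X Z
      using yk_bounds[of M w h k] f(2)[OF w(1), of k] by blast
    then show "(\<exists>h k. yk M (fst (w, i)) h (snd (w, i)) \<and> yk M (fst (w, i)) h k \<and> k < snd (w, i) \<and>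
        (\<forall>l. l < snd (w, i) \<and> yk M (fst (w, i)) h l \<longrightarrow> l \<le> k) \<and> P (fst (w, i), k)) = potl_sat M w (HBack HYields \<phi>) i"
      unfolding potl_sat.simps hback_yields fst_conv snd_conv by simp
  qed (use f in simp)
qed

context opword begin

lemma pr_cases: "pr h k \<longleftrightarrow> k = Suc h \<and> h \<le> n \<and> rel M w {Yields, Equals} h k \<or> yk M w h k \<or> ek M w h k"
  unfolding pr_iff yk_def ek_def rel_YE rel_single by blast

lemma ek_last: "ek M w h k \<Longrightarrow> pr h k' \<Longrightarrow> k' \<le> k"
proof (rule ccontr)
  assume k: "ek M w h k" and k': "pr h k'" "\<not> k' \<le> k"
  have p: "pr h k" using k pr_cases by blast
  have "E h k" using k unfolding ek_def rel_single by blast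
  then have e: "en k = en h" by (rule equal_child_last[OF p])
  have h: "h \<le> n + 1" "h < k" using parent_less[OF p] by auto
  have "en k \<le> k'" "k' < en h" using k'[unfolded parent_iff[OF h(1)]] h by auto
  then show False using e by simp
qed

lemma yk_not_ek: "\<not> (yk M w h k \<and> ek M w h k)"
  unfolding yk_def ek_def rel_single using prel_excl by blast

lemma yk_before_ek: "ek M w h k \<Longrightarrow> yk M w h k' \<Longrightarrow> k' < k"
  using ek_last[of h k k'] yk_not_ek[of h k] pr_cases[of h k'] by (metis le_neq_implies_less)

text \<open>Hierarchical paths forbid gaps with respect to all chains from \<open>h\<close>, also
  the chain to an \<open>Equals\<close> child and the \<open>Takes\<close> chain to the end of the
  subtree. Both end after every \<open>yk\<close> child, so up to such a child only
  \<open>yk\<close> children are met.\<close>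

lemma chi_before_yk:
  assumes "chi M w h k" "yk M w h j" "k \<le> j"
  shows "rel M w {Yields} h k"
proof (cases "k = j")
  case True
  then show ?thesis using assms unfolding yk_def by blast
next
  case False
  have pj: "pr h j" using assms(2) pr_cases by blast
  have h: "h \<le> n + 1" "h < j" using parent_less[OF pj] by auto
  have jl: "j < en h" using pj[unfolded parent_iff[OF h(1)]] by blast
  have l: "L h k" using assms(1) L_iff by blast
  then have "pr h k" using link_iff[of h k] jl assms(3) by auto
  then have "yk M w h k \<or> ek M w h k" using assms(1) unfolding pr_cases using chi_bounds[OF assms(1)] by auto
  moreover have "\<not> ek M w h k" using yk_before_ek[of h k j] assms(2,3) by auto
  ultimately show ?thesis unfolding yk_def by blast
qed

lemma yk_unique: "yk M w h k \<Longrightarrow> yk M w h' k \<Longrightarrow> h' = h"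
  using parent_unique[of h k h'] pr_cases[of h k] pr_cases[of h' k] by blast

end

context
  fixes M :: "'ap opm" and SL
  assumes opm: "is_opm SL M"
begin

abbreviation "HU P Q x \<equiv> \<exists>h j. yk M (fst x) h (snd x) \<and> yk M (fst x) h j \<and> snd x \<le> j \<and>
    (\<forall>k. snd x \<le> k \<and> k < j \<and> yk M (fst x) h k \<longrightarrow> P (fst x, k)) \<and> Q (fst x, j)"

abbreviation "HS P Q x \<equiv> \<exists>h j. yk M (fst x) h (snd x) \<and> yk M (fst x) h j \<and> j \<le> snd x \<and>
    (\<forall>k. j < k \<and> k \<le> snd x \<and> yk M (fst x) h k \<longrightarrow> P (fst x, k)) \<and> Q (fst x, j)"

abbreviation "SHU P Q x \<equiv> \<exists>h j. yk M (fst x) h (snd x) \<and> yk M (fst x) h j \<and> snd x < j \<and>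
    (\<forall>k. snd x < k \<and> k < j \<and> yk M (fst x) h k \<longrightarrow> P (fst x, k)) \<and> Q (fst x, j)"

abbreviation "SHS P Q x \<equiv> \<exists>h j. yk M (fst x) h (snd x) \<and> yk M (fst x) h j \<and> j < snd x \<and>
    (\<forall>k. j < k \<and> k < snd x \<and> yk M (fst x) h k \<longrightarrow> P (fst x, k)) \<and> Q (fst x, j)"

lemma PD_huntil:
  assumes "P \<in> PD M" "Q \<in> PD M"
  shows "(\<lambda>x. HU P Q x) \<in> PD M"
proof -
  obtain \<phi> \<psi> where f: "potl_wf \<phi>" "\<And>w i. compatible M w \<Longrightarrow> i \<le> length w + 1 \<Longrightarrow> potl_sat M w \<phi> i = P (w, i)"
    and g: "potl_wf \<psi>" "\<And>w i. compatible M w \<Longrightarrow> i \<le> length w + 1 \<Longrightarrow> potl_sat M w \<psi> i = Q (w, i)"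
    using assms by (elim PD_E) blast
  show ?thesis
  proof (rule PD_I[of "HUntil HYields \<phi> \<psi>"])
    fix w i assume w: "compatible M w" "i \<le> length w + 1"
    interpret opword M SL w using opw[OF opm] w by blast
    show "HU P Q (w, i) = potl_sat M w (HUntil HYields \<phi> \<psi>) i"
      unfolding potl_sat.simps until_hier_yields fst_conv snd_conv
    proof
      assume "\<exists>h j. yk M w h i \<and> yk M w h j \<and> i \<le> j \<and> (\<forall>k. i \<le> k \<and> k < j \<and> yk M w h k \<longrightarrow> P (w, k)) \<and> Q (w, j)"
      then obtain h j where j: "yk M w h i" "yk M w h j" "i \<le> j" "\<forall>k. i \<le> k \<and> k < j \<and> yk M w h k \<longrightarrow> P (w, k)" "Q (w, j)" by blast
      have c: "chi M w h i" "chi M w h j" using j unfolding yk_def by blast+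
      have r: "\<forall>k. i \<le> k \<and> k \<le> j \<and> chi M w h k \<longrightarrow> rel M w {Yields} h k" using chi_before_yk j(2) by blast
      have s: "\<forall>k. i \<le> k \<and> k < j \<and> chi M w h k \<longrightarrow> potl_sat M w \<phi> k"
      proof (intro allI impI)
        fix k assume k: "i \<le> k \<and> k < j \<and> chi M w h k"
        then have "yk M w h k" using r unfolding yk_def by auto
        then show "potl_sat M w \<phi> k" using j(4) k f(2)[OF w(1), of k] yk_bounds[of M w h k] by blast
      qed
      have "potl_sat M w \<psi> j" using j(5) g(2)[OF w(1), of j] yk_bounds[OF j(2)] by blast
      then show "\<exists>h j. chi M w h i \<and> chi M w h j \<and> i \<le> j \<and> (\<forall>k. i \<le> k \<and> k \<le> j \<and> chi M w h k \<longrightarrow> rel M w {Yields} h k) \<and>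
         (\<forall>k. i \<le> k \<and> k < j \<and> chi M w h k \<longrightarrow> potl_sat M w \<phi> k) \<and> potl_sat M w \<psi> j" using c r s j(3) by blast
    next
      assume "\<exists>h j. chi M w h i \<and> chi M w h j \<and> i \<le> j \<and> (\<forall>k. i \<le> k \<and> k \<le> j \<and> chi M w h k \<longrightarrow> rel M w {Yields} h k) \<and>
         (\<forall>k. i \<le> k \<and> k < j \<and> chi M w h k \<longrightarrow> potl_sat M w \<phi> k) \<and> potl_sat M w \<psi> j"
      then obtain h j where j: "chi M w h i" "chi M w h j" "i \<le> j" "\<forall>k. i \<le> k \<and> k \<le> j \<and> chi M w h k \<longrightarrow> rel M w {Yields} h k"
         "\<forall>k. i \<le> k \<and> k < j \<and> chi M w h k \<longrightarrow> potl_sat M w \<phi> k" "potl_sat M w \<psi> j" by blast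
      have y: "yk M w h i" "yk M w h j" using j(1-4) unfolding yk_def by blast+
      have "\<forall>k. i \<le> k \<and> k < j \<and> yk M w h k \<longrightarrow> P (w, k)"
      proof (intro allI impI)
        fix k assume k: "i \<le> k \<and> k < j \<and> yk M w h k"
        then have "potl_sat M w \<phi> k" using j(5) unfolding yk_def by blast
        then show "P (w, k)" using k f(2)[OF w(1), of k] yk_bounds[of M w h k] by blast
      qed
      moreover have "Q (w, j)" using j(6) g(2)[OF w(1), of j] yk_bounds[OF y(2)] by blast
      ultimately show "\<exists>h j. yk M w h i \<and> yk M w h j \<and> i \<le> j \<and> (\<forall>k. i \<le> k \<and> k < j \<and> yk M w h k \<longrightarrow> P (w, k)) \<and> Q (w, j)"
        using y j(3) by blast
    qed
  qed (simp add: f g)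
qed

lemma PD_hsince:
  assumes "P \<in> PD M" "Q \<in> PD M"
  shows "(\<lambda>x. HS P Q x) \<in> PD M"
proof -
  obtain \<phi> \<psi> where f: "potl_wf \<phi>" "\<And>w i. compatible M w \<Longrightarrow> i \<le> length w + 1 \<Longrightarrow> potl_sat M w \<phi> i = P (w, i)"
    and g: "potl_wf \<psi>" "\<And>w i. compatible M w \<Longrightarrow> i \<le> length w + 1 \<Longrightarrow> potl_sat M w \<psi> i = Q (w, i)"
    using assms by (elim PD_E) blast
  show ?thesis
  proof (rule PD_I[of "HSince HYields \<phi> \<psi>"])
    fix w i assume w: "compatible M w" "i \<le> length w + 1"
    interpret opword M SL w using opw[OF opm] w by blast
    show "HS P Q (w, i) = potl_sat M w (HSince HYields \<phi> \<psi>) i"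
      unfolding potl_sat.simps since_hier_yields fst_conv snd_conv
    proof
      assume "\<exists>h j. yk M w h i \<and> yk M w h j \<and> j \<le> i \<and> (\<forall>k. j < k \<and> k \<le> i \<and> yk M w h k \<longrightarrow> P (w, k)) \<and> Q (w, j)"
      then obtain h j where j: "yk M w h i" "yk M w h j" "j \<le> i" "\<forall>k. j < k \<and> k \<le> i \<and> yk M w h k \<longrightarrow> P (w, k)" "Q (w, j)" by blast
      have c: "chi M w h i" "chi M w h j" using j unfolding yk_def by blast+
      have r: "\<forall>k. j \<le> k \<and> k \<le> i \<and> chi M w h k \<longrightarrow> rel M w {Yields} h k" using chi_before_yk j(1) by blast
      have s: "\<forall>k. j < k \<and> k \<le> i \<and> chi M w h k \<longrightarrow> potl_sat M w \<phi> k"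
      proof (intro allI impI)
        fix k assume k: "j < k \<and> k \<le> i \<and> chi M w h k"
        then have "yk M w h k" using r unfolding yk_def by auto
        then show "potl_sat M w \<phi> k" using j(4) k f(2)[OF w(1), of k] yk_bounds[of M w h k] by blast
      qed
      have "potl_sat M w \<psi> j" using j(5) g(2)[OF w(1), of j] yk_bounds[OF j(2)] by blast
      then show "\<exists>h j. chi M w h i \<and> chi M w h j \<and> j \<le> i \<and> (\<forall>k. j \<le> k \<and> k \<le> i \<and> chi M w h k \<longrightarrow> rel M w {Yields} h k) \<and>
         (\<forall>k. j < k \<and> k \<le> i \<and> chi M w h k \<longrightarrow> potl_sat M w \<phi> k) \<and> potl_sat M w \<psi> j" using c r s j(3) by blast
    next
      assume "\<exists>h j. chi M w h i \<and> chi M w h j \<and> j \<le> i \<and> (\<forall>k. j \<le> k \<and> k \<le> i \<and> chi M w h k \<longrightarrow> rel M w {Yields} h k) \<and>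
         (\<forall>k. j < k \<and> k \<le> i \<and> chi M w h k \<longrightarrow> potl_sat M w \<phi> k) \<and> potl_sat M w \<psi> j"
      then obtain h j where j: "chi M w h i" "chi M w h j" "j \<le> i" "\<forall>k. j \<le> k \<and> k \<le> i \<and> chi M w h k \<longrightarrow> rel M w {Yields} h k"
         "\<forall>k. j < k \<and> k \<le> i \<and> chi M w h k \<longrightarrow> potl_sat M w \<phi> k" "potl_sat M w \<psi> j" by blast
      have y: "yk M w h i" "yk M w h j" using j(1-4) unfolding yk_def by blast+
      have "\<forall>k. j < k \<and> k \<le> i \<and> yk M w h k \<longrightarrow> P (w, k)"
      proof (intro allI impI)
        fix k assume k: "j < k \<and> k \<le> i \<and> yk M w h k"
        then have "potl_sat M w \<phi> k" using j(5) unfolding yk_def by blast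
        then show "P (w, k)" using k f(2)[OF w(1), of k] yk_bounds[of M w h k] by blast
      qed
      moreover have "Q (w, j)" using j(6) g(2)[OF w(1), of j] yk_bounds[OF y(2)] by blast
      ultimately show "\<exists>h j. yk M w h i \<and> yk M w h j \<and> j \<le> i \<and> (\<forall>k. j < k \<and> k \<le> i \<and> yk M w h k \<longrightarrow> P (w, k)) \<and> Q (w, j)"
        using y j(3) by blast
    qed
  qed (simp add: f g)
qed

text \<open>Strict until is one hierarchical step followed by the reflexive hierarchical until;
  \<open>yk_unique\<close> ensures that both refer to the same parent.\<close>

lemma PD_SHU:
  assumes "P \<in> PD M" "Q \<in> PD M"
  shows "(\<lambda>x. SHU P Q x) \<in> PD M"
proof (rule PD_restrict[OF PD_hnext[OF PD_huntil[OF assms]]])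
  fix x assume "valid_pt M x"
  then have c: "compatible M (fst x)" by (simp add: valid_pt_def)
  interpret opword M SL "fst x" using opw[OF opm] c by blast
  let ?w = "fst x" and ?i = "snd x"
  show "SHU P Q x = (\<exists>h k. yk M ?w h ?i \<and> yk M ?w h k \<and> ?i < k \<and> (\<forall>l. ?i < l \<and> yk M ?w h l \<longrightarrow> k \<le> l) \<and> HU P Q (?w, k))"
    unfolding fst_conv snd_conv
  proof
    assume "SHU P Q x"
    then obtain h j where j: "yk M ?w h ?i" "yk M ?w h j" "?i < j" "\<forall>k. ?i < k \<and> k < j \<and> yk M ?w h k \<longrightarrow> P (?w, k)" "Q (?w, j)" by blast
    obtain k where k: "yk M ?w h k" "?i < k" "k \<le> j" "\<forall>l. ?i < l \<and> yk M ?w h l \<longrightarrow> k \<le> l" using next_least[of "yk M ?w h", OF j(2,3)] by blast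
    have "\<forall>l. k \<le> l \<and> l < j \<and> yk M ?w h l \<longrightarrow> P (?w, l)" using j(4) k(2) by auto
    then show "\<exists>h k. yk M ?w h ?i \<and> yk M ?w h k \<and> ?i < k \<and> (\<forall>l. ?i < l \<and> yk M ?w h l \<longrightarrow> k \<le> l) \<and>
      (\<exists>h j. yk M ?w h k \<and> yk M ?w h j \<and> k \<le> j \<and> (\<forall>l. k \<le> l \<and> l < j \<and> yk M ?w h l \<longrightarrow> P (?w, l)) \<and> Q (?w, j))"
      using j(1,2,5) k by blast
  next
    assume "\<exists>h k. yk M ?w h ?i \<and> yk M ?w h k \<and> ?i < k \<and> (\<forall>l. ?i < l \<and> yk M ?w h l \<longrightarrow> k \<le> l) \<and>
      (\<exists>h j. yk M ?w h k \<and> yk M ?w h j \<and> k \<le> j \<and> (\<forall>l. k \<le> l \<and> l < j \<and> yk M ?w h l \<longrightarrow> P (?w, l)) \<and> Q (?w, j))"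
    then obtain h k h' j where k: "yk M ?w h ?i" "yk M ?w h k" "?i < k" "\<forall>l. ?i < l \<and> yk M ?w h l \<longrightarrow> k \<le> l"
      and j: "yk M ?w h' k" "yk M ?w h' j" "k \<le> j" "\<forall>l. k \<le> l \<and> l < j \<and> yk M ?w h' l \<longrightarrow> P (?w, l)" "Q (?w, j)" by blast
    have "h' = h" using yk_unique[OF k(2) j(1)] .
    then have "yk M ?w h j" "\<forall>l. ?i < l \<and> l < j \<and> yk M ?w h l \<longrightarrow> P (?w, l)" using j k(4) by blast+
    moreover have "?i < j" using k(3) j(3) by simp
    ultimately show "SHU P Q x" using k(1) j(5) by blast
  qed
qed

lemma PD_SHS:
  assumes "P \<in> PD M" "Q \<in> PD M"
  shows "(\<lambda>x. SHS P Q x) \<in> PD M"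
proof (rule PD_restrict[OF PD_hback[OF PD_hsince[OF assms]]])
  fix x assume "valid_pt M x"
  then have c: "compatible M (fst x)" by (simp add: valid_pt_def)
  interpret opword M SL "fst x" using opw[OF opm] c by blast
  let ?w = "fst x" and ?i = "snd x"
  show "SHS P Q x = (\<exists>h k. yk M ?w h ?i \<and> yk M ?w h k \<and> k < ?i \<and> (\<forall>l. l < ?i \<and> yk M ?w h l \<longrightarrow> l \<le> k) \<and> HS P Q (?w, k))"
    unfolding fst_conv snd_conv
  proof
    assume "SHS P Q x"
    then obtain h j where j: "yk M ?w h ?i" "yk M ?w h j" "j < ?i" "\<forall>k. j < k \<and> k < ?i \<and> yk M ?w h k \<longrightarrow> P (?w, k)" "Q (?w, j)" by blast
    obtain k where k: "yk M ?w h k" "k < ?i" "j \<le> k" "\<forall>l. l < ?i \<and> yk M ?w h l \<longrightarrow> l \<le> k" using prev_greatest[of "yk M ?w h", OF j(2,3)] by blast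
    have "\<forall>l. j < l \<and> l \<le> k \<and> yk M ?w h l \<longrightarrow> P (?w, l)" using j(4) k(2) by auto
    then show "\<exists>h k. yk M ?w h ?i \<and> yk M ?w h k \<and> k < ?i \<and> (\<forall>l. l < ?i \<and> yk M ?w h l \<longrightarrow> l \<le> k) \<and>
      (\<exists>h j. yk M ?w h k \<and> yk M ?w h j \<and> j \<le> k \<and> (\<forall>l. j < l \<and> l \<le> k \<and> yk M ?w h l \<longrightarrow> P (?w, l)) \<and> Q (?w, j))"
      using j(1,2,5) k by blast
  next
    assume "\<exists>h k. yk M ?w h ?i \<and> yk M ?w h k \<and> k < ?i \<and> (\<forall>l. l < ?i \<and> yk M ?w h l \<longrightarrow> l \<le> k) \<and>
      (\<exists>h j. yk M ?w h k \<and> yk M ?w h j \<and> j \<le> k \<and> (\<forall>l. j < l \<and> l \<le> k \<and> yk M ?w h l \<longrightarrow> P (?w, l)) \<and> Q (?w, j))"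
    then obtain h k h' j where k: "yk M ?w h ?i" "yk M ?w h k" "k < ?i" "\<forall>l. l < ?i \<and> yk M ?w h l \<longrightarrow> l \<le> k"
      and j: "yk M ?w h' k" "yk M ?w h' j" "j \<le> k" "\<forall>l. j < l \<and> l \<le> k \<and> yk M ?w h' l \<longrightarrow> P (?w, l)" "Q (?w, j)" by blast
    have "h' = h" using yk_unique[OF k(2) j(1)] .
    then have "yk M ?w h j" "\<forall>l. j < l \<and> l < ?i \<and> yk M ?w h l \<longrightarrow> P (?w, l)" using j k(4) by blast+
    moreover have "j < ?i" using k(3) j(3) by simp
    ultimately show "SHS P Q x" using k(1) j(5) by blast
  qed
qed

text \<open>Turns a walk along \<open>sib_pt\<close> into a bounded quantifier over the children of
  a common parent, which is the form of the hierarchical operators.\<close>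

lemma sib_reach:
  assumes c: "compatible M w"
  shows "(\<exists>y. (\<lambda>a b. sib_pt M a b \<and> P b)\<^sup>*\<^sup>* (w, i) y \<and> sib_pt M y z) \<longleftrightarrow>
    (\<exists>h j. z = (w, j) \<and> parent M w h i \<and> parent M w h j \<and> i < j \<and> (\<forall>k. i < k \<and> k < j \<and> parent M w h k \<longrightarrow> P (w, k)))"
proof
  interpret opword M SL w using opw[OF opm] c by blast
  let ?T = "\<lambda>a b. sib_pt M a b \<and> P b"
  have gap: "k \<le> a" if "pr h a" "pr h k" "k < en a" for h a k
  proof (rule ccontr)
    assume "\<not> k \<le> a"
    moreover have h: "h \<le> n + 1" "h < a" using parent_less[OF that(1)] by auto
    ultimately have "en a \<le> k" using that(2)[unfolded parent_iff[OF h(1)]] by simp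
    then show False using that(3) by simp
  qed
  {
    assume "\<exists>y. ?T\<^sup>*\<^sup>* (w, i) y \<and> sib_pt M y z"
    then obtain y where y: "?T\<^sup>*\<^sup>* (w, i) y" "sib_pt M y z" by (elim exE conjE)
    \<comment> \<open>The parent is quantified inside the invariant, because at the start of the
      walk \<open>i\<close> is not yet known to have one.\<close>
    from y(1) have "fst y = w \<and> i \<le> snd y \<and> (\<forall>h. pr h (snd y) \<longrightarrow> pr h i \<and> (\<forall>k. i < k \<and> k \<le> snd y \<and> pr h k \<longrightarrow> P (w, k)))"
    proof induction
      case base
      then show ?case by auto
    next
      case (step y u)
      have fy: "fst y = w" "i \<le> snd y" using step.IH by blast+
      obtain h where h: "fst u = w" "snd u = en (snd y)" "pr h (snd y)" "pr h (snd u)" "P u"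
        using step.hyps(2) fy unfolding sib_pt_def by auto
      have lt: "snd y < snd u" using child_closed(4)[of h "snd y"] h(2,3) child_iff by simp
      have "pr h' i \<and> (\<forall>k. i < k \<and> k \<le> snd u \<and> pr h' k \<longrightarrow> P (w, k))" if "pr h' (snd u)" for h'
      proof -
        have hh: "h' = h" using parent_unique that h(4) by blast
        have IH: "pr h i" "\<forall>k. i < k \<and> k \<le> snd y \<and> pr h k \<longrightarrow> P (w, k)" using step.IH h(3) by blast+
        have "P (w, k)" if k: "i < k" "k \<le> snd u" "pr h k" for k
        proof (cases "k = snd u")
          case True
          then have "(w, k) = u" using h(1) by (simp add: prod_eq_iff)
          then show ?thesis using h(5) by simp
        next
          case False
          then have "k \<le> snd y" using gap[OF h(3) k(3)] k(2) h(2) by simp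
          then show ?thesis using IH(2) k by blast
        qed
        then show ?thesis using IH(1) hh by blast
      qed
      then show ?case using h(1) fy lt by auto
    qed
    then have Y: "fst y = w" "i \<le> snd y" "\<forall>h. pr h (snd y) \<longrightarrow> pr h i \<and> (\<forall>k. i < k \<and> k \<le> snd y \<and> pr h k \<longrightarrow> P (w, k))" by blast+
    obtain h where h: "fst z = w" "snd z = en (snd y)" "pr h (snd y)" "pr h (snd z)"
      using y(2) Y(1) unfolding sib_pt_def by auto
    have lt: "snd y < snd z" using child_closed(4)[of h "snd y"] h(2,3) child_iff by simp
    have "\<forall>k. i < k \<and> k < snd z \<and> pr h k \<longrightarrow> P (w, k)" using gap[OF h(3)] h(2) Y(3) h(3) by auto
    moreover have "z = (w, snd z)" using h(1) by (simp add: prod_eq_iff)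
    moreover have "i < snd z" using lt Y(2) by simp
    ultimately show "\<exists>h j. z = (w, j) \<and> pr h i \<and> pr h j \<and> i < j \<and> (\<forall>k. i < k \<and> k < j \<and> pr h k \<longrightarrow> P (w, k))"
      using Y(3) h(3,4) by blast
  }
  assume "\<exists>h j. z = (w, j) \<and> pr h i \<and> pr h j \<and> i < j \<and> (\<forall>k. i < k \<and> k < j \<and> pr h k \<longrightarrow> P (w, k))"
  then obtain h j where j: "z = (w, j)" "pr h i" "pr h j" "i < j" "\<forall>k. i < k \<and> k < j \<and> pr h k \<longrightarrow> P (w, k)" by blast
  from j(3-5) have "\<exists>y. ?T\<^sup>*\<^sup>* (w, i) y \<and> sib_pt M y (w, j)"
  proof (induction j rule: less_induct)
    case (less j)
    have chj: "child h j" and chi': "child h i" using less.prems j(2) child_iff by auto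
    have "j \<noteq> Suc h" using less.prems(2) child_closed(2)[OF chi'] by simp
    then obtain a where a: "child h a" "en a = j" using previous_child[OF chj] by blast
    have aj: "a < j" using child_closed(4)[OF a(1)] a(2) by simp
    have pa: "pr h a" using a child_iff by simp
    have s: "sib_pt M (w, a) (w, j)" using pa less.prems(1) a(2) c unfolding sib_pt_def by auto
    have ia: "i \<le> a" using gap[OF pa j(2)] less.prems(2) a(2) by simp
    show ?case
    proof (cases "i = a")
      case True
      then show ?thesis using s by blast
    next
      case False
      then have lt: "i < a" using ia by simp
      have q: "\<forall>k. i < k \<and> k < a \<and> pr h k \<longrightarrow> P (w, k)" using less.prems(3) aj by auto
      obtain y where y: "?T\<^sup>*\<^sup>* (w, i) y" "sib_pt M y (w, a)" using less.IH[OF aj pa lt q] by (elim exE conjE)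
      have "P (w, a)" using less.prems(3) lt aj pa by blast
      then have "?T\<^sup>*\<^sup>* (w, i) (w, a)" using rtranclp.rtrancl_into_rtrancl[of ?T, OF y(1)] y(2) by blast
      then show ?thesis using s by (intro exI[of _ "(w, a)"] conjI)
    qed
  qed
  then show "\<exists>y. ?T\<^sup>*\<^sup>* (w, i) y \<and> sib_pt M y z" unfolding j(1) .
qed

lemma PD_yback:
  assumes "P \<in> PD M" shows "(\<lambda>x. \<exists>h. yk M (fst x) h (snd x) \<and> P (fst x, h)) \<in> PD M"
  unfolding yk_def conj_assoc by (rule PD_cback[OF assms]) simp

lemma PD_eback:
  assumes "P \<in> PD M" shows "(\<lambda>x. \<exists>h. ek M (fst x) h (snd x) \<and> P (fst x, h)) \<in> PD M"
  unfolding ek_def conj_assoc by (rule PD_cback[OF assms]) simp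

lemma PD_ynext:
  assumes "P \<in> PD M" shows "(\<lambda>x. \<exists>k. yk M (fst x) (snd x) k \<and> P (fst x, k)) \<in> PD M"
  unfolding yk_def conj_assoc by (rule PD_cnext[OF assms]) simp

lemma PD_enext:
  assumes "P \<in> PD M" shows "(\<lambda>x. \<exists>k. ek M (fst x) (snd x) k \<and> P (fst x, k)) \<in> PD M"
  unfolding ek_def conj_assoc by (rule PD_cnext[OF assms]) simp

lemma PD_first:
  assumes "P \<in> PD M"
  shows "(\<lambda>x. \<exists>h. snd x = Suc h \<and> rel M (fst x) {Yields, Equals} h (snd x) \<and> P (fst x, h)) \<in> PD M"
proof (rule PD_restrict[OF PD_back[OF assms, of "{Yields, Equals}"]])
  fix x
  show "(\<exists>h. snd x = Suc h \<and> rel M (fst x) {Yields, Equals} h (snd x) \<and> P (fst x, h)) =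
    (1 \<le> snd x \<and> rel M (fst x) {Yields, Equals} (snd x - 1) (snd x) \<and> P (fst x, snd x - 1))"
    by (cases "snd x") auto
qed simp

text \<open>The start is the adjacent child or a \<open>yk\<close> child, since nothing follows an
  \<open>ek\<close> child, and the target is a \<open>yk\<close> or an \<open>ek\<close> child. Each
  of the four combinations gets its own formula; between two \<open>yk\<close> children it is
  \<open>SHU\<close>.\<close>

lemma PD_side_until:
  assumes P: "P \<in> PD M" and Q: "Q \<in> PD M"
  shows "until_on (sib_pt M) P Q \<in> PD M"
proof -
  note nP = pbs(1)[OF P] and T = pbs(4)[of True M]
  \<comment> \<open>From the adjacent child to a \<open>yk\<close> child: go to the parent, then to
    its first \<open>yk\<close> child, recognised by having no \<open>yk\<close> sibling before it,
    and evaluate the reflexive until there.\<close>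
  note A = PD_first[OF PD_ynext[OF pbs(3)[OF pbs(1)[OF PD_SHS[OF T T]] PD_huntil[OF P Q]]]]
  \<comment> \<open>From the adjacent child to the \<open>ek\<close> child: all \<open>yk\<close>
    children lie in between and have to satisfy \<open>P\<close>.\<close>
  note B = PD_first[OF pbs(3)[OF PD_enext[OF Q] pbs(1)[OF PD_ynext[OF nP]]]]
  \<comment> \<open>From a \<open>yk\<close> child to the \<open>ek\<close> child: no later
    \<open>yk\<close> sibling may violate \<open>P\<close>.\<close>
  note C = pbs(3)[OF PD_yback[OF PD_enext[OF Q]] pbs(1)[OF PD_SHU[OF T nP]]]
  note D = pbs(2)[OF PD_SHU[OF P Q] pbs(2)[OF C pbs(2)[OF A B]]]
  show ?thesis
  proof (rule PD_restrict[OF D], goal_cases)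
    case v: (1 x)
    then have c: "compatible M (fst x)" by (simp add: valid_pt_def)
    interpret opword M SL "fst x" using opw[OF opm] c by blast
    let ?w = "fst x" and ?i = "snd x"
    have "until_on (sib_pt M) P Q x = (\<exists>z. (\<exists>y. (\<lambda>a b. sib_pt M a b \<and> P b)\<^sup>*\<^sup>* (?w, ?i) y \<and> sib_pt M y z) \<and> Q z)"
      unfolding until_on_def prod.collapse by (rule iffI; elim exE conjE; intro exI conjI; assumption)
    also have "\<dots> = (\<exists>h j. pr h ?i \<and> pr h j \<and> ?i < j \<and> (\<forall>k. ?i < k \<and> k < j \<and> pr h k \<longrightarrow> P (?w, k)) \<and> Q (?w, j))"
      unfolding sib_reach[OF c] by blast
    finally have O: "until_on (sib_pt M) P Q x =
      (\<exists>h j. pr h ?i \<and> pr h j \<and> ?i < j \<and> (\<forall>k. ?i < k \<and> k < j \<and> pr h k \<longrightarrow> P (?w, k)) \<and> Q (?w, j))" .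
    have ypr: "yk M ?w h k \<Longrightarrow> pr h k" and epr: "ek M ?w h k \<Longrightarrow> pr h k" for h k using pr_cases by blast+
    have yb: "yk M ?w h k \<Longrightarrow> Suc h < k" and eb: "ek M ?w h k \<Longrightarrow> Suc h < k" for h k
      unfolding yk_def ek_def using chi_bounds by blast+
    have main: "until_on (sib_pt M) P Q x = (SHU P Q x \<or>
      (\<exists>h. yk M ?w h ?i \<and> (\<exists>k. ek M ?w h k \<and> Q (?w, k))) \<and> \<not> SHU (\<lambda>x. True) (\<lambda>x. \<not> P x) x \<or>
      (\<exists>h. ?i = Suc h \<and> rel M ?w {Yields, Equals} h ?i \<and> (\<exists>k. yk M ?w h k \<and> \<not> SHS (\<lambda>x. True) (\<lambda>x. True) (?w, k) \<and> HU P Q (?w, k))) \<or>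
      (\<exists>h. ?i = Suc h \<and> rel M ?w {Yields, Equals} h ?i \<and> (\<exists>k. ek M ?w h k \<and> Q (?w, k)) \<and> \<not> (\<exists>k. yk M ?w h k \<and> \<not> P (?w, k))))"
      unfolding O fst_conv snd_conv
    proof (rule iffI, goal_cases)
      case 1
      then obtain h j where j: "pr h ?i" "pr h j" "?i < j" "\<forall>k. ?i < k \<and> k < j \<and> pr h k \<longrightarrow> P (?w, k)" "Q (?w, j)" by blast
      consider (f) "?i = Suc h" "rel M ?w {Yields, Equals} h ?i" | (y) "yk M ?w h ?i" | (e) "ek M ?w h ?i"
        using j(1) pr_cases by blast
      then show ?case
      proof cases
        case f
        consider (y) "yk M ?w h j" | (e) "ek M ?w h j" using j(2,3) f(1) pr_cases[of h j] by auto
        then show ?thesis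
        proof cases
          case y
          obtain k where k: "yk M ?w h k" "k \<le> j" "\<forall>l. ?i < l \<and> yk M ?w h l \<longrightarrow> k \<le> l"
            using next_least[of "yk M ?w h", OF y j(3)] by blast
          have ns: "\<not> (\<exists>h' j'. yk M ?w h' k \<and> yk M ?w h' j' \<and> j' < k \<and> (\<forall>l. j' < l \<and> l < k \<and> yk M ?w h' l \<longrightarrow> True) \<and> True)"
          proof
            assume "\<exists>h' j'. yk M ?w h' k \<and> yk M ?w h' j' \<and> j' < k \<and> (\<forall>l. j' < l \<and> l < k \<and> yk M ?w h' l \<longrightarrow> True) \<and> True"
            then obtain h' j' where a: "yk M ?w h' k" "yk M ?w h' j'" "j' < k" by blast
            have "h' = h" using yk_unique[OF k(1) a(1)] .
            then have "k \<le> j'" using k(3) a(2) yb[of h j'] f(1) by simp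
            then show False using a(3) by simp
          qed
          have "\<forall>l. k \<le> l \<and> l < j \<and> yk M ?w h l \<longrightarrow> P (?w, l)" using j(4) ypr[of h] yb[of h] f(1) by auto
          then have hu: "\<exists>h j. yk M ?w h k \<and> yk M ?w h j \<and> k \<le> j \<and> (\<forall>l. k \<le> l \<and> l < j \<and> yk M ?w h l \<longrightarrow> P (?w, l)) \<and> Q (?w, j)"
            using k(1,2) y j(5) by blast
          show ?thesis by (rule disjI2, rule disjI2, rule disjI1) (use f k(1) ns hu in blast)
        next
          case e
          have nn: "\<not> (\<exists>k. yk M ?w h k \<and> \<not> P (?w, k))" using j(4) ypr[of h] yb[of h] f(1) yk_before_ek[OF e] by auto
          show ?thesis by (rule disjI2, rule disjI2, rule disjI2, rule exI[of _ h]) (intro conjI exI[of _ j] f e j(5) nn)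
        qed
      next
        case y
        have "j \<noteq> Suc h" using yb[OF y] j(3) by simp
        then consider (a) "yk M ?w h j" | (b) "ek M ?w h j" using j(2)[unfolded pr_cases] by blast
        then show ?thesis
        proof cases
          case a
          have "\<forall>k. ?i < k \<and> k < j \<and> yk M ?w h k \<longrightarrow> P (?w, k)" using j(4) ypr[of h] by blast
          then show ?thesis by (intro disjI1 exI[of _ h] exI[of _ j] conjI y a j(3,5))
        next
          case b
          have "\<not> (\<exists>h' j'. yk M ?w h' ?i \<and> yk M ?w h' j' \<and> ?i < j' \<and> (\<forall>l. ?i < l \<and> l < j' \<and> yk M ?w h' l \<longrightarrow> True) \<and> \<not> P (?w, j'))"
          proof
            assume "\<exists>h' j'. yk M ?w h' ?i \<and> yk M ?w h' j' \<and> ?i < j' \<and> (\<forall>l. ?i < l \<and> l < j' \<and> yk M ?w h' l \<longrightarrow> True) \<and> \<not> P (?w, j')"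
            then obtain h' j' where a: "yk M ?w h' ?i" "yk M ?w h' j'" "?i < j'" "\<not> P (?w, j')" by blast
            have "h' = h" using yk_unique[OF y a(1)] .
            then have "j' < j" "pr h j'" using yk_before_ek[OF b, of j'] a(2) ypr by blast+
            then show False using j(4) a(3,4) by blast
          qed
          moreover have "\<exists>h. yk M ?w h ?i \<and> (\<exists>k. ek M ?w h k \<and> Q (?w, k))" using y b j(5) by blast
          ultimately show ?thesis by (intro disjI2[OF disjI1[OF conjI]])
        qed
      next
        case e
        then show ?thesis using ek_last[OF e j(2)] j(3) by simp
      qed
    next
      case 2
      then show ?case
      proof (elim disjE exE conjE, goal_cases)
        case (1 h j)
        then have a: "yk M ?w h ?i" "yk M ?w h j" "?i < j" "\<forall>k. ?i < k \<and> k < j \<and> yk M ?w h k \<longrightarrow> P (?w, k)" "Q (?w, j)" by - assumption+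
        have "P (?w, k)" if k: "?i < k" "k < j" "pr h k" for k
        proof -
          have "\<not> ek M ?w h k" using ek_last[of h k j] ypr[OF a(2)] k(2) by auto
          then have "yk M ?w h k" using k yb[OF a(1)] pr_cases[of h k] by auto
          then show ?thesis using a(4) k by blast
        qed
        then show ?thesis using a ypr by blast
      next
        case (2 h j)
        then have b: "yk M ?w h ?i" "ek M ?w h j" "Q (?w, j)"
           "\<not> (\<exists>h' j'. yk M ?w h' ?i \<and> yk M ?w h' j' \<and> ?i < j' \<and> (\<forall>l. ?i < l \<and> l < j' \<and> yk M ?w h' l \<longrightarrow> True) \<and> \<not> P (?w, j'))" by - assumption+
        have "P (?w, k)" if k: "?i < k" "k < j" "pr h k" for k
        proof -
          have "\<not> ek M ?w h k" using ek_last[of h k j] epr[OF b(2)] k(2) by auto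
          then have "yk M ?w h k" using k yb[OF b(1)] pr_cases[of h k] by auto
          then show ?thesis using b(1,4) k(1) by blast
        qed
        moreover have "?i < j" using yk_before_ek[OF b(2,1)] .
        ultimately show ?thesis using b ypr epr by blast
      next
        case (3 h k h' j)
        then have d: "?i = Suc h" "rel M ?w {Yields, Equals} h ?i" "yk M ?w h k"
           "\<not> (\<exists>h' j'. yk M ?w h' k \<and> yk M ?w h' j' \<and> j' < k \<and> (\<forall>l. j' < l \<and> l < k \<and> yk M ?w h' l \<longrightarrow> True) \<and> True)"
           "yk M ?w h' k" "yk M ?w h' j" "k \<le> j" "\<forall>l. k \<le> l \<and> l < j \<and> yk M ?w h' l \<longrightarrow> P (?w, l)" "Q (?w, j)" by - assumption+
        have hh: "h' = h" using yk_unique[OF d(3,5)] .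
        have pi: "pr h ?i" using d(1,2) v pr_cases[of h ?i] by (simp add: valid_pt_def)
        have "P (?w, l)" if l: "?i < l" "l < j" "pr h l" for l
        proof -
          have "\<not> ek M ?w h l" using ek_last[of h l j] ypr[OF d(6)] hh l(2) by auto
          then have y: "yk M ?w h l" using l d(1) pr_cases[of h l] by auto
          have "\<not> l < k" using d(3,4) y by blast
          then have "k \<le> l" by simp
          then show ?thesis using d(8) l y hh by blast
        qed
        moreover have "?i < j" using yb[OF d(6)] hh d(1) by simp
        ultimately show ?thesis using pi ypr[OF d(6)] hh d(9) by blast
      next
        case (4 h j)
        then have e: "?i = Suc h" "rel M ?w {Yields, Equals} h ?i" "ek M ?w h j" "Q (?w, j)" "\<not> (\<exists>k. yk M ?w h k \<and> \<not> P (?w, k))" by - assumption+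
        have pi: "pr h ?i" using e(1,2) v pr_cases[of h ?i] by (simp add: valid_pt_def)
        have "P (?w, l)" if l: "?i < l" "l < j" "pr h l" for l
        proof -
          have "\<not> ek M ?w h l" using ek_last[of h l j] epr[OF e(3)] l(2) by auto
          then have y: "yk M ?w h l" using l e(1) pr_cases[of h l] by auto
          then show ?thesis using e(5) by blast
        qed
        moreover have "?i < j" using eb[OF e(3)] e(1) by simp
        ultimately show ?thesis using pi epr[OF e(3)] e(4) by blast
      qed
    qed
    show ?case using main unfolding fst_conv snd_conv .
  qed
qed

text \<open>Again four combinations: the start is a \<open>yk\<close> or the \<open>ek\<close>
  child, the target a \<open>yk\<close> or the adjacent child, as nothing precedes the adjacent
  child.\<close>

lemma PD_side_since:
  assumes P: "P \<in> PD M" and Q: "Q \<in> PD M"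
  shows "since_on (sib_pt M) P Q \<in> PD M"
proof -
  note nP = pbs(1)[OF P] and T = pbs(4)[of True M]
  \<comment> \<open>Read at the parent: the adjacent position is a child and satisfies
    \<open>Q\<close>.\<close>
  have N: "(\<lambda>x. snd x \<le> length (fst x) \<and> rel M (fst x) {Yields, Equals} (snd x) (Suc (snd x)) \<and> Q (fst x, Suc (snd x))) \<in> PD M"
    by (rule PD_next[OF Q]) simp
  \<comment> \<open>From the \<open>ek\<close> child back to a \<open>yk\<close> child: via the
    parent to its last \<open>yk\<close> child, and from there the reflexive since.\<close>
  note A = PD_eback[OF PD_ynext[OF pbs(3)[OF pbs(1)[OF PD_SHU[OF T T]] PD_hsince[OF P Q]]]]
  note B = PD_eback[OF pbs(3)[OF N pbs(1)[OF PD_ynext[OF nP]]]]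
  note C = pbs(3)[OF PD_yback[OF N] pbs(1)[OF PD_SHS[OF T nP]]]
  note D = pbs(2)[OF PD_SHS[OF P Q] pbs(2)[OF C pbs(2)[OF A B]]]
  show ?thesis
  proof (rule PD_restrict[OF D], goal_cases)
    case v: (1 x)
    then have c: "compatible M (fst x)" by (simp add: valid_pt_def)
    interpret opword M SL "fst x" using opw[OF opm] c by blast
    let ?w = "fst x" and ?i = "snd x"
    have fz: "fst z = ?w" if "(\<lambda>a b. sib_pt M a b \<and> P b)\<^sup>*\<^sup>* z y" "sib_pt M y x" for z y
    proof -
      have "fst z = fst y" using that(1) by (induction rule: rtranclp_induct) (auto simp: sib_pt_def)
      then show ?thesis using that(2) by (simp add: sib_pt_def)
    qed
    have "since_on (sib_pt M) P Q x = (\<exists>z. Q z \<and> (\<exists>y. (\<lambda>a b. sib_pt M a b \<and> P b)\<^sup>*\<^sup>* z y \<and> sib_pt M y x))"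
      unfolding step_shift since_on_def by (rule iffI; elim exE conjE; intro exI conjI; assumption)
    also have "\<dots> = (\<exists>j. Q (?w, j) \<and> (\<exists>y. (\<lambda>a b. sib_pt M a b \<and> P b)\<^sup>*\<^sup>* (?w, j) y \<and> sib_pt M y x))"
    proof
      assume "\<exists>z. Q z \<and> (\<exists>y. (\<lambda>a b. sib_pt M a b \<and> P b)\<^sup>*\<^sup>* z y \<and> sib_pt M y x)"
      then obtain z y where z: "Q z" "(\<lambda>a b. sib_pt M a b \<and> P b)\<^sup>*\<^sup>* z y" "sib_pt M y x" by (elim exE conjE)
      have e: "(?w, snd z) = z" using fz[OF z(2,3)] by (simp add: prod_eq_iff)
      show "\<exists>j. Q (?w, j) \<and> (\<exists>y. (\<lambda>a b. sib_pt M a b \<and> P b)\<^sup>*\<^sup>* (?w, j) y \<and> sib_pt M y x)"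
        by (rule exI[of _ "snd z"], unfold e, intro conjI exI[of _ y] z)
    next
      assume "\<exists>j. Q (?w, j) \<and> (\<exists>y. (\<lambda>a b. sib_pt M a b \<and> P b)\<^sup>*\<^sup>* (?w, j) y \<and> sib_pt M y x)"
      then show "\<exists>z. Q z \<and> (\<exists>y. (\<lambda>a b. sib_pt M a b \<and> P b)\<^sup>*\<^sup>* z y \<and> sib_pt M y x)" by (elim exE) (rule exI)
    qed
    also have "\<dots> = (\<exists>h j. pr h ?i \<and> pr h j \<and> j < ?i \<and> (\<forall>k. j < k \<and> k < ?i \<and> pr h k \<longrightarrow> P (?w, k)) \<and> Q (?w, j))"
    proof -
      have xs: "x = (?w, j') \<longleftrightarrow> j' = ?i" for j' by (auto simp: prod_eq_iff)
      show ?thesis unfolding sib_reach[OF c] xs by blast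
    qed
    finally have O: "since_on (sib_pt M) P Q x =
      (\<exists>h j. pr h ?i \<and> pr h j \<and> j < ?i \<and> (\<forall>k. j < k \<and> k < ?i \<and> pr h k \<longrightarrow> P (?w, k)) \<and> Q (?w, j))" .
    have ypr: "yk M ?w h k \<Longrightarrow> pr h k" and epr: "ek M ?w h k \<Longrightarrow> pr h k" for h k using pr_cases by blast+
    have yb: "yk M ?w h k \<Longrightarrow> Suc h < k" and eb: "ek M ?w h k \<Longrightarrow> Suc h < k" for h k
      unfolding yk_def ek_def using chi_bounds by blast+
    have main: "since_on (sib_pt M) P Q x = (SHS P Q x \<or>
      (\<exists>h. yk M ?w h ?i \<and> h \<le> length ?w \<and> rel M ?w {Yields, Equals} h (Suc h) \<and> Q (?w, Suc h)) \<and> \<not> SHS (\<lambda>x. True) (\<lambda>x. \<not> P x) x \<or>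
      (\<exists>h. ek M ?w h ?i \<and> (\<exists>k. yk M ?w h k \<and> \<not> SHU (\<lambda>x. True) (\<lambda>x. True) (?w, k) \<and> HS P Q (?w, k))) \<or>
      (\<exists>h. ek M ?w h ?i \<and> (h \<le> length ?w \<and> rel M ?w {Yields, Equals} h (Suc h) \<and> Q (?w, Suc h)) \<and> \<not> (\<exists>k. yk M ?w h k \<and> \<not> P (?w, k))))"
      unfolding O fst_conv snd_conv
    proof (rule iffI, goal_cases)
      case 1
      then obtain h j where j: "pr h ?i" "pr h j" "j < ?i" "\<forall>k. j < k \<and> k < ?i \<and> pr h k \<longrightarrow> P (?w, k)" "Q (?w, j)" by blast
      have hj: "h < j" using parent_less[OF j(2)] by blast
      consider (y) "yk M ?w h ?i" | (e) "ek M ?w h ?i"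
        using j(1,3) hj pr_cases[of h ?i] by auto
      then show ?case
      proof cases
        case y
        consider (f) "j = Suc h" "h \<le> length ?w" "rel M ?w {Yields, Equals} h j" | (a) "yk M ?w h j" | (b) "ek M ?w h j"
          using j(2) pr_cases by blast
        then show ?thesis
        proof cases
          case f
          have "\<not> (\<exists>h' j'. yk M ?w h' ?i \<and> yk M ?w h' j' \<and> j' < ?i \<and> (\<forall>l. j' < l \<and> l < ?i \<and> yk M ?w h' l \<longrightarrow> True) \<and> \<not> P (?w, j'))"
          proof
            assume "\<exists>h' j'. yk M ?w h' ?i \<and> yk M ?w h' j' \<and> j' < ?i \<and> (\<forall>l. j' < l \<and> l < ?i \<and> yk M ?w h' l \<longrightarrow> True) \<and> \<not> P (?w, j')"
            then obtain h' j' where a: "yk M ?w h' ?i" "yk M ?w h' j'" "j' < ?i" "\<not> P (?w, j')" by blast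
            have "h' = h" using yk_unique[OF y a(1)] .
            then have "j < j'" "pr h j'" using yb[of h j'] f(1) a(2) ypr by auto
            then show False using j(4) a(3,4) by blast
          qed
          moreover have "rel M ?w {Yields, Equals} h (Suc h)" "Q (?w, Suc h)" using f j(5) by auto
          ultimately show ?thesis using y f(2) by blast
        next
          case a
          then show ?thesis using y j(3,4,5) ypr by blast
        next
          case b
          then show ?thesis using ek_last[OF b j(1)] j(3) by simp
        qed
      next
        case e
        consider (f) "j = Suc h" "h \<le> length ?w" "rel M ?w {Yields, Equals} h j" | (a) "yk M ?w h j" | (b) "ek M ?w h j"
          using j(2) pr_cases by blast
        then show ?thesis
        proof cases
          case f
          have "\<not> (\<exists>k. yk M ?w h k \<and> \<not> P (?w, k))" using j(4) ypr[of h] yb[of h] f(1) yk_before_ek[OF e] by auto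
          moreover have "rel M ?w {Yields, Equals} h (Suc h)" "Q (?w, Suc h)" using f j(5) by auto
          ultimately show ?thesis using e f(2) by blast
        next
          case a
          obtain k where k: "yk M ?w h k" "j \<le> k" "k < ?i" "\<forall>l. l < ?i \<and> yk M ?w h l \<longrightarrow> l \<le> k"
            using prev_greatest[of "yk M ?w h", OF a j(3)] by blast
          have ns: "\<not> (\<exists>h' j'. yk M ?w h' k \<and> yk M ?w h' j' \<and> k < j' \<and> (\<forall>l. k < l \<and> l < j' \<and> yk M ?w h' l \<longrightarrow> True) \<and> True)"
          proof
            assume "\<exists>h' j'. yk M ?w h' k \<and> yk M ?w h' j' \<and> k < j' \<and> (\<forall>l. k < l \<and> l < j' \<and> yk M ?w h' l \<longrightarrow> True) \<and> True"
            then obtain h' j' where a: "yk M ?w h' k" "yk M ?w h' j'" "k < j'" by blast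
            have "h' = h" using yk_unique[OF k(1) a(1)] .
            then have "j' \<le> k" using k(4) a(2) yk_before_ek[OF e, of j'] by simp
            then show False using a(3) by simp
          qed
          have "\<forall>l. j < l \<and> l \<le> k \<and> yk M ?w h l \<longrightarrow> P (?w, l)" using j(4) ypr[of h] k(3) by auto
          then have hs: "\<exists>h j. yk M ?w h k \<and> yk M ?w h j \<and> j \<le> k \<and> (\<forall>l. j < l \<and> l \<le> k \<and> yk M ?w h l \<longrightarrow> P (?w, l)) \<and> Q (?w, j)"
            using k(1,2) a j(5) by blast
          show ?thesis by (rule disjI2, rule disjI2, rule disjI1) (use e k(1) ns hs in blast)
        next
          case b
          then show ?thesis using ek_last[OF b j(1)] j(3) by simp
        qed
      qed
    next
      case 2
      then consider (a) h j where "yk M ?w h ?i" "yk M ?w h j" "j < ?i" "\<forall>k. j < k \<and> k < ?i \<and> yk M ?w h k \<longrightarrow> P (?w, k)" "Q (?w, j)"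
        | (b) h where "yk M ?w h ?i" "h \<le> length ?w" "rel M ?w {Yields, Equals} h (Suc h)" "Q (?w, Suc h)"
           "\<not> (\<exists>h' j'. yk M ?w h' ?i \<and> yk M ?w h' j' \<and> j' < ?i \<and> (\<forall>l. j' < l \<and> l < ?i \<and> yk M ?w h' l \<longrightarrow> True) \<and> \<not> P (?w, j'))"
        | (d) h k h' j where "ek M ?w h ?i" "yk M ?w h k"
           "\<not> (\<exists>h' j'. yk M ?w h' k \<and> yk M ?w h' j' \<and> k < j' \<and> (\<forall>l. k < l \<and> l < j' \<and> yk M ?w h' l \<longrightarrow> True) \<and> True)"
           "yk M ?w h' k" "yk M ?w h' j" "j \<le> k" "\<forall>l. j < l \<and> l \<le> k \<and> yk M ?w h' l \<longrightarrow> P (?w, l)" "Q (?w, j)"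
        | (e) h where "ek M ?w h ?i" "h \<le> length ?w" "rel M ?w {Yields, Equals} h (Suc h)" "Q (?w, Suc h)" "\<not> (\<exists>k. yk M ?w h k \<and> \<not> P (?w, k))"
        by blast
      then show ?case
      proof cases
        case a
        have "P (?w, k)" if k: "j < k" "k < ?i" "pr h k" for k
        proof -
          have "\<not> ek M ?w h k" using ek_last[of h k ?i] ypr[OF a(1)] k(2) by auto
          then have "yk M ?w h k" using k yb[OF a(2)] pr_cases[of h k] by auto
          then show ?thesis using a(4) k by blast
        qed
        then show ?thesis using a ypr by blast
      next
        case b
        have "P (?w, k)" if k: "Suc h < k" "k < ?i" "pr h k" for k
        proof -
          have "\<not> ek M ?w h k" using ek_last[of h k ?i] ypr[OF b(1)] k(2) by auto
          then have "yk M ?w h k" using k pr_cases[of h k] by auto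
          then show ?thesis using b(1,5) k(2) by blast
        qed
        moreover have "Suc h < ?i" using yb[OF b(1)] .
        moreover have "pr h (Suc h)" using b pr_cases[of h "Suc h"] by blast
        ultimately show ?thesis using b(4) ypr[OF b(1)] by blast
      next
        case d
        have hh: "h' = h" using yk_unique[OF d(2,4)] .
        have "P (?w, l)" if l: "j < l" "l < ?i" "pr h l" for l
        proof -
          have "\<not> ek M ?w h l" using ek_last[of h l ?i] epr[OF d(1)] l(2) by auto
          then have y: "yk M ?w h l" using l yb[OF d(5)] hh pr_cases[of h l] by auto
          have "\<not> k < l" using d(2,3) y by blast
          then have "l \<le> k" by simp
          then show ?thesis using d(7) l y hh by blast
        qed
        moreover have "j < ?i" using yk_before_ek[OF d(1), of j] d(5) hh by simp
        ultimately show ?thesis using epr[OF d(1)] ypr[OF d(5)] hh d(8) by blast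
      next
        case e
        have "P (?w, l)" if l: "Suc h < l" "l < ?i" "pr h l" for l
        proof -
          have "\<not> ek M ?w h l" using ek_last[of h l ?i] epr[OF e(1)] l(2) by auto
          then have y: "yk M ?w h l" using l pr_cases[of h l] by auto
          then show ?thesis using e(5) by blast
        qed
        moreover have "Suc h < ?i" using eb[OF e(1)] .
        moreover have "pr h (Suc h)" using e pr_cases[of h "Suc h"] by blast
        ultimately show ?thesis using e(4) epr[OF e(1)] by blast
      qed
    qed
    show ?case using main unfolding fst_conv snd_conv .
  qed
qed

lemma PD_side: "temporally_closed (sib_pt M) (PD M)"
  unfolding temporally_closed_def by (intro conjI ballI PD_bool PD_side_until PD_side_since)

lemma PD_prop: "(\<lambda>x. prop_at (fst x) a (snd x)) \<in> PD M"
  by (rule PD_I[of "Atom a"]) simp_all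

end

text \<open>Atoms cannot tell an end marker from the empty letter, so the two end positions are
  excluded first; the letter is then read off from its finitely many propositions.\<close>

lemma PD_symb:
  fixes M :: "('ap::finite) opm"
  assumes opm: "is_opm SL M"
  shows "dfn (PD M) symb_pt"
proof (rule dfnI[OF PD_bool finite_symb])
  fix s :: "'ap symb"
  show "(\<lambda>x. symb_pt x = s) \<in> PD M"
  proof (cases s)
    case Hash
    show ?thesis
      by (rule PD_restrict[OF pbs(2)[OF PD_zero[OF opm] PD_last[OF opm]]])
        (auto simp: Hash symb_at_def valid_pt_def)
  next
    case (Letter b)
    have a: "(\<lambda>x. prop_at (fst x) a (snd x) = (a \<in> b)) \<in> PD M" for a
      using PD_prop[OF opm, of a] pbs(1)[OF PD_prop[OF opm, of a]] by (cases "a \<in> b") simp_all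
    have "(\<lambda>x. \<forall>a\<in>UNIV. prop_at (fst x) a (snd x) = (a \<in> b)) \<in> PD M"
      by (rule bool_closed_ball[OF PD_bool finite]) (rule a)
    note D = pbs(3)[OF pbs(1)[OF PD_zero[OF opm]] pbs(3)[OF pbs(1)[OF PD_last[OF opm]] this]]
    show ?thesis
    proof (rule PD_restrict[OF D])
      fix x assume "valid_pt M x"
      then show "(symb_pt x = s) = (snd x \<noteq> 0 \<and> snd x \<noteq> length (fst x) + 1 \<and> (\<forall>a\<in>UNIV. prop_at (fst x) a (snd x) = (a \<in> b)))"
        unfolding Letter prop_at_def symb_at_def valid_pt_def by auto
    qed
  qed
qed simp

lemma PD_tree_logic:
  fixes M :: "('ap::finite) opm"
  assumes "is_opm SL M"
  shows "tree_logic M SL (PD M)"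
  by (rule tree_logic.intro[OF assms PD_down[OF assms] PD_side[OF assms] PD_symb[OF assms]]) (rule PD_restrict)

section \<open>From POTL to first-order logic\<close>

text \<open>Definability by a formula with free variables in \<open>X\<close>, stated on the
  semantics. Closure rules then replace explicit formulas and the management of bound
  variables.\<close>

definition fdef :: "'ap opm \<Rightarrow> nat set \<Rightarrow> ('ap set list \<Rightarrow> (nat \<Rightarrow> nat) \<Rightarrow> bool) \<Rightarrow> bool" where
  "fdef M X Q \<longleftrightarrow> (\<exists>\<psi>. fo_fv \<psi> \<subseteq> X \<and>
     (\<forall>w v. compatible M w \<longrightarrow> (\<forall>x\<in>X. v x \<le> length w + 1) \<longrightarrow> fo_sat M w \<psi> v = Q w v))"

lemma fdefI:
  assumes "fo_fv \<psi> \<subseteq> X" "\<And>w v. compatible M w \<Longrightarrow> \<forall>x\<in>X. v x \<le> length w + 1 \<Longrightarrow> fo_sat M w \<psi> v = Q w v"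
  shows "fdef M X Q"
  unfolding fdef_def using assms by (intro exI[of _ \<psi>]) simp

lemma fdefE:
  assumes "fdef M X Q"
  obtains \<psi> where "fo_fv \<psi> \<subseteq> X" "\<And>w v. compatible M w \<Longrightarrow> \<forall>x\<in>X. v x \<le> length w + 1 \<Longrightarrow> fo_sat M w \<psi> v = Q w v"
  using assms unfolding fdef_def by auto

lemma fd_cong:
  assumes "fdef M X R" "\<And>w v. compatible M w \<Longrightarrow> \<forall>x\<in>X. v x \<le> length w + 1 \<Longrightarrow> Q w v = R w v"
  shows "fdef M X Q"
proof (rule fdefE[OF assms(1)])
  fix \<psi> assume p: "fo_fv \<psi> \<subseteq> X" "\<And>w v. compatible M w \<Longrightarrow> \<forall>x\<in>X. v x \<le> length w + 1 \<Longrightarrow> fo_sat M w \<psi> v = R w v"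
  show ?thesis by (rule fdefI[OF p(1)]) (simp only: p(2) assms(2))
qed

lemma fd_weaken:
  assumes "fdef M X Q" "X \<subseteq> Y" shows "fdef M Y Q"
proof (rule fdefE[OF assms(1)])
  fix \<psi> assume p: "fo_fv \<psi> \<subseteq> X" "\<And>w v. compatible M w \<Longrightarrow> \<forall>x\<in>X. v x \<le> length w + 1 \<Longrightarrow> fo_sat M w \<psi> v = Q w v"
  show ?thesis
  proof (rule fdefI)
    show "fo_fv \<psi> \<subseteq> Y" using p(1) assms(2) by blast
    fix w v assume "compatible M w" "\<forall>x\<in>Y. v x \<le> length w + 1"
    then show "fo_sat M w \<psi> v = Q w v" using p(2)[of w v] assms(2) by blast
  qed
qed

lemma fd_less: "x \<in> X \<Longrightarrow> y \<in> X \<Longrightarrow> fdef M X (\<lambda>w v. v x < v y)"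
  by (rule fdefI[of "FLess x y"]) simp_all

lemma fd_eq: "x \<in> X \<Longrightarrow> y \<in> X \<Longrightarrow> fdef M X (\<lambda>w v. v x = v y)"
  by (rule fdefI[of "FEq x y"]) simp_all

lemma fd_chi: "x \<in> X \<Longrightarrow> y \<in> X \<Longrightarrow> fdef M X (\<lambda>w v. chi M w (v x) (v y))"
  by (rule fdefI[of "FChi x y"]) simp_all

lemma fd_prop: "x \<in> X \<Longrightarrow> fdef M X (\<lambda>w v. prop_at w a (v x))"
  by (rule fdefI[of "FProp a x"]) simp_all

lemma fd_not:
  assumes "fdef M X Q" shows "fdef M X (\<lambda>w v. \<not> Q w v)"
proof (rule fdefE[OF assms])
  fix \<psi> assume p: "fo_fv \<psi> \<subseteq> X" "\<And>w v. compatible M w \<Longrightarrow> \<forall>x\<in>X. v x \<le> length w + 1 \<Longrightarrow> fo_sat M w \<psi> v = Q w v"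
  show ?thesis by (rule fdefI[of "FNeg \<psi>"]) (simp_all only: fo_fv.simps fo_sat.simps p)
qed

lemma fd_or:
  assumes "fdef M X Q" "fdef M X R" shows "fdef M X (\<lambda>w v. Q w v \<or> R w v)"
proof (rule fdefE[OF assms(1)], rule fdefE[OF assms(2)])
  fix \<psi> \<theta> assume p: "fo_fv \<psi> \<subseteq> X" "\<And>w v. compatible M w \<Longrightarrow> \<forall>x\<in>X. v x \<le> length w + 1 \<Longrightarrow> fo_sat M w \<psi> v = Q w v"
    and q: "fo_fv \<theta> \<subseteq> X" "\<And>w v. compatible M w \<Longrightarrow> \<forall>x\<in>X. v x \<le> length w + 1 \<Longrightarrow> fo_sat M w \<theta> v = R w v"
  show ?thesis by (rule fdefI[of "FOr \<psi> \<theta>"]) (simp_all only: fo_fv.simps fo_sat.simps p q Un_least)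
qed

lemma fd_and:
  assumes "fdef M X Q" "fdef M X R" shows "fdef M X (\<lambda>w v. Q w v \<and> R w v)"
  by (rule fd_cong[OF fd_not[OF fd_or[OF fd_not[OF assms(1)] fd_not[OF assms(2)]]]]) simp

lemma fd_imp:
  assumes "fdef M X Q" "fdef M X R" shows "fdef M X (\<lambda>w v. Q w v \<longrightarrow> R w v)"
  by (rule fd_cong[OF fd_or[OF fd_not[OF assms(1)] assms(2)]]) simp

text \<open>The bound variable is chosen outside \<open>X\<close>. The last premise says that
  \<open>R\<close> does not look at such variables, so overwriting the value of the bound one is
  harmless.\<close>

lemma fd_ex:
  assumes "\<And>y. y \<notin> X \<Longrightarrow> fdef M (insert y X) (\<lambda>w v. R w v (v y))" "finite X"
    and "\<And>w v y k a. y \<notin> X \<Longrightarrow> R w (v(y := k)) a = R w v a"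
  shows "fdef M X (\<lambda>w v. \<exists>k\<le>length w + 1. R w v k)"
proof -
  obtain y where y: "y \<notin> X" using ex_new_if_finite[OF infinite_UNIV_nat assms(2)] by blast
  show ?thesis
  proof (rule fdefE[OF assms(1)[OF y]])
    fix \<psi> assume p: "fo_fv \<psi> \<subseteq> insert y X"
      "\<And>w v. compatible M w \<Longrightarrow> \<forall>x\<in>insert y X. v x \<le> length w + 1 \<Longrightarrow> fo_sat M w \<psi> v = R w v (v y)"
    show ?thesis
    proof (rule fdefI[of "FEx y \<psi>"])
      show "fo_fv (FEx y \<psi>) \<subseteq> X" using p(1) by auto
      fix w v assume a: "compatible M w" "\<forall>x\<in>X. v x \<le> length w + 1"
      have e: "fo_sat M w \<psi> (v(y := k)) = R w v k" if "k \<le> length w + 1" for k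
      proof -
        have "\<forall>x\<in>insert y X. (v(y := k)) x \<le> length w + 1" using a(2) that by simp
        from p(2)[OF a(1) this] show ?thesis by (simp only: assms(3)[OF y] fun_upd_same)
      qed
      have "fo_sat M w (FEx y \<psi>) v = (\<exists>k\<le>length w + 1. fo_sat M w \<psi> (v(y := k)))"
        by (simp add: positions_def Bex_def)
      also have "\<dots> = (\<exists>k\<le>length w + 1. R w v k)" by (rule ex_cong1) (use e in blast)
      finally show "fo_sat M w (FEx y \<psi>) v = (\<exists>k\<le>length w + 1. R w v k)" .
    qed
  qed
qed

lemma fd_all:
  assumes "\<And>y. y \<notin> X \<Longrightarrow> fdef M (insert y X) (\<lambda>w v. R w v (v y))" "finite X"
    and "\<And>w v y k a. y \<notin> X \<Longrightarrow> R w (v(y := k)) a = R w v a"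
  shows "fdef M X (\<lambda>w v. \<forall>k\<le>length w + 1. R w v k)"
proof -
  have "fdef M X (\<lambda>w v. \<exists>k\<le>length w + 1. \<not> R w v k)"
    by (rule fd_ex[OF fd_not[OF assms(1)] assms(2)]) (simp_all only: assms(3) not_False_eq_True)
  from fd_not[OF this] show ?thesis by (rule fd_cong) blast
qed

lemmas fdi = fd_not fd_or fd_and fd_imp fd_ex fd_all fd_less fd_chi fd_prop

lemma fd_bex:
  assumes "finite S" "x \<in> X" "\<And>s. s \<in> S \<Longrightarrow> fdef M X (Q s)"
  shows "fdef M X (\<lambda>w v. \<exists>s\<in>S. Q s w v)"
  using assms(1,3)
proof (induction S)
  case empty
  show ?case by (rule fd_cong[OF fd_not[OF fd_eq[OF assms(2) assms(2)]]]) simp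
next
  case (insert a S)
  have 1: "fdef M X (Q a)" and 2: "fdef M X (\<lambda>w v. \<exists>s\<in>S. Q s w v)" using insert by simp_all
  show ?case by (rule fd_cong[OF fd_or[OF 1 2]]) simp
qed

text \<open>The end markers are the positions with nothing before or nothing after them.\<close>

lemma fd_symb:
  fixes M :: "('ap::finite) opm"
  assumes "x \<in> X" shows "fdef M X (\<lambda>w v. symb_at w (v x) = s)"
proof -
  have h: "fdef M {x} (\<lambda>w v. \<not> (\<exists>k\<le>length w + 1. k < v x) \<or> \<not> (\<exists>k\<le>length w + 1. v x < k))"
    by (intro fdi) simp_all
  have hash: "fdef M {x} (\<lambda>w v. symb_at w (v x) = Hash)"
  proof (rule fd_cong[OF h])
    fix w :: "'ap set list" and v assume a: "\<forall>y\<in>{x}. v y \<le> length w + 1"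
    have "\<not> (\<exists>k\<le>length w + 1. k < v x) \<longleftrightarrow> v x = 0" using a by (auto intro: exI[of _ 0])
    moreover have "\<not> (\<exists>k\<le>length w + 1. v x < k) \<longleftrightarrow> v x = length w + 1"
      using a by (auto intro: exI[of _ "length w + 1"])
    ultimately show "(symb_at w (v x) = Hash) = (\<not> (\<exists>k\<le>length w + 1. k < v x) \<or> \<not> (\<exists>k\<le>length w + 1. v x < k))"
      using a unfolding symb_at_def by auto
  qed
  show ?thesis
  proof (rule fd_weaken)
    show "fdef M {x} (\<lambda>w v. symb_at w (v x) = s)"
    proof (cases s)
      case Hash
      then show ?thesis using hash by simp
    next
      case (Letter b)
      have p: "fdef M {x} (\<lambda>w v. prop_at w a (v x) \<noteq> (a \<in> b))" for a
        using fd_prop[of x "{x}" M a] fd_not[OF fd_prop[of x "{x}" M a]] by (cases "a \<in> b") simp_all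
      have q: "fdef M {x} (\<lambda>w v. \<exists>a\<in>UNIV. prop_at w a (v x) \<noteq> (a \<in> b))"
        by (rule fd_bex[where x = x, OF finite _ p]) simp
      show ?thesis
      proof (rule fd_cong[OF fd_and[OF fd_not[OF hash] fd_not[OF q]]])
        fix w :: "'ap set list" and v
        show "(symb_at w (v x) = s) = (symb_at w (v x) \<noteq> Hash \<and> \<not> (\<exists>a\<in>UNIV. prop_at w a (v x) \<noteq> (a \<in> b)))"
          unfolding Letter prop_at_def by (cases "symb_at w (v x)") auto
      qed
    qed
    show "{x} \<subseteq> X" using assms by simp
  qed
qed

text \<open>There are finitely many symbols and the matrix is fixed, so a precedence between two
  positions is a finite disjunction over pairs of symbols.\<close>

lemma fd_rel:
  fixes M :: "('ap::finite) opm"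
  assumes x: "x \<in> X" "y \<in> X" shows "fdef M X (\<lambda>w v. rel M w \<Pi> (v x) (v y))"
proof -
  let ?S = "{p. \<exists>\<pi>\<in>\<Pi>. M (fst p) (snd p) = Some \<pi>}"
  have "finite (UNIV :: ('ap symb \<times> 'ap symb) set)" using finite_symb finite_prod by blast
  then have f: "finite ?S" by (rule finite_subset[rotated]) simp
  have "fdef M X (\<lambda>w v. \<exists>p\<in>?S. symb_at w (v x) = fst p \<and> symb_at w (v y) = snd p)"
    by (rule fd_bex[OF f x(1)], rule fd_and[OF fd_symb[OF x(1)] fd_symb[OF x(2)]])
  then show ?thesis by (rule fd_cong) (auto simp: rel_def)
qed

text \<open>Successor expressed by the order. Here and below, weak inequalities between positions
  are written as negated strict ones, matching the signature of the first-order language.\<close>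

definition sc :: "'ap set list \<Rightarrow> nat \<Rightarrow> nat \<Rightarrow> bool" where
  "sc w k l \<longleftrightarrow> k < l \<and> \<not> (\<exists>t\<le>length w + 1. k < t \<and> t < l)"

lemma sc_iff: "l \<le> length w + 1 \<Longrightarrow> sc w k l \<longleftrightarrow> l = Suc k"
proof
  assume a: "l \<le> length w + 1" "sc w k l"
  have "\<not> Suc k < l"
  proof
    assume "Suc k < l"
    moreover then have "Suc k \<le> length w + 1" using a(1) by simp
    ultimately show False using a(2) unfolding sc_def by blast
  qed
  then show "l = Suc k" using a(2) unfolding sc_def by simp
qed (simp add: sc_def)

lemma fd_sc: assumes "x \<in> X" "y \<in> X" shows "fdef M X (\<lambda>w v. sc w (v x) (v y))"
proof (rule fd_weaken)
  show "fdef M {x, y} (\<lambda>w v. sc w (v x) (v y))" unfolding sc_def by (intro fdi) simp_all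
qed (use assms in simp)

text \<open>\<open>k\<close> is not strictly inside a jump that starts at or after \<open>i\<close>
  and ends at or before \<open>j\<close>.\<close>

definition onp :: "'ap opm \<Rightarrow> 'ap set list \<Rightarrow> prec set \<Rightarrow> nat \<Rightarrow> nat \<Rightarrow> nat \<Rightarrow> bool" where
  "onp M w \<Pi> i j k \<longleftrightarrow> \<not> (\<exists>a\<le>length w + 1. \<exists>h\<le>length w + 1.
     \<not> a < i \<and> a < k \<and> k < h \<and> \<not> j < h \<and> chi M w a h \<and> rel M w \<Pi> a h)"

text \<open>A path towards \<open>j\<close> does not get stuck at \<open>k\<close>: a jump or an
  adjacent step is available.\<close>

definition good :: "'ap opm \<Rightarrow> 'ap set list \<Rightarrow> prec set \<Rightarrow> nat \<Rightarrow> nat \<Rightarrow> bool" where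
  "good M w \<Pi> j k \<longleftrightarrow> (\<exists>h\<le>length w + 1. \<not> j < h \<and> chi M w k h \<and> rel M w \<Pi> k h) \<or>
     (\<exists>l\<le>length w + 1. sc w k l \<and> rel M w \<Pi> k l)"

lemma fd_onp:
  fixes M :: "('ap::finite) opm"
  assumes "x \<in> X" "y \<in> X" "z \<in> X" shows "fdef M X (\<lambda>w v. onp M w \<Pi> (v x) (v y) (v z))"
proof (rule fd_weaken)
  show "fdef M {x, y, z} (\<lambda>w v. onp M w \<Pi> (v x) (v y) (v z))" unfolding onp_def by (intro fdi fd_rel) simp_all
qed (use assms in simp)

lemma fd_good:
  fixes M :: "('ap::finite) opm"
  assumes "x \<in> X" "y \<in> X" shows "fdef M X (\<lambda>w v. good M w \<Pi> (v x) (v y))"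
proof (rule fd_weaken)
  show "fdef M {x, y} (\<lambda>w v. good M w \<Pi> (v x) (v y))" unfolding good_def by (intro fdi fd_rel fd_sc) simp_all
qed (use assms in simp)

lemma chi_le: "chi M w h k \<Longrightarrow> h < k \<and> h \<le> length w + 1 \<and> k \<le> length w + 1"
  using chi_bounds[of M w h k] by simp

lemma onp_iff: "onp M w \<Pi> i j k \<longleftrightarrow> (\<forall>a h. i \<le> a \<and> a < k \<and> h \<le> j \<and> chi M w a h \<and> rel M w \<Pi> a h \<longrightarrow> h \<le> k)"
  unfolding onp_def not_less[symmetric] using chi_le[of M w, unfolded not_less[symmetric]] by blast

lemma good_iff: "k < j \<Longrightarrow> j \<le> length w + 1 \<Longrightarrow>
    good M w \<Pi> j k \<longleftrightarrow> (\<exists>h\<le>j. chi M w k h \<and> rel M w \<Pi> k h) \<or> rel M w \<Pi> k (Suc k)"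
proof -
  assume a: "k < j" "j \<le> length w + 1"
  have "(\<exists>l\<le>length w + 1. sc w k l \<and> rel M w \<Pi> k l) \<longleftrightarrow> rel M w \<Pi> k (Suc k)"
  proof
    assume "\<exists>l\<le>length w + 1. sc w k l \<and> rel M w \<Pi> k l"
    then obtain l where "l \<le> length w + 1" "sc w k l" "rel M w \<Pi> k l" by blast
    then show "rel M w \<Pi> k (Suc k)" using sc_iff[of l w k] by simp
  next
    assume "rel M w \<Pi> k (Suc k)"
    then show "\<exists>l\<le>length w + 1. sc w k l \<and> rel M w \<Pi> k l" using a sc_iff[of "Suc k" w k] by (intro exI[of _ "Suc k"]) simp
  qed
  moreover have "(\<exists>h\<le>length w + 1. \<not> j < h \<and> chi M w k h \<and> rel M w \<Pi> k h) \<longleftrightarrow> (\<exists>h\<le>j. chi M w k h \<and> rel M w \<Pi> k h)"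
    unfolding not_less using chi_le[of M w k] by blast
  ultimately show ?thesis unfolding good_def by simp
qed

lemma sstep_fun: "sstep M w \<Pi> j a b \<Longrightarrow> sstep M w \<Pi> j a c \<Longrightarrow> b = c"
  unfolding sstep_def by (auto split: if_splits)

context opword begin

text \<open>By non-crossing of chains, the positions of the summary path are those not strictly inside a jump.\<close>

lemma summary_reach:
  assumes j: "j \<le> n + 1"
  shows "(\<lambda>a b. sstep M w \<Pi> j a b \<and> A a \<and> B b)\<^sup>*\<^sup>* i j \<longleftrightarrow> i \<le> j \<and>
    (\<forall>k. i \<le> k \<and> k < j \<and> onp M w \<Pi> i j k \<longrightarrow> A k \<and> good M w \<Pi> j k) \<and>
    (\<forall>k. i < k \<and> k \<le> j \<and> onp M w \<Pi> i j k \<longrightarrow> B k)"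
proof (induction "j - i" arbitrary: i rule: less_induct)
  case less
  let ?R = "\<lambda>a b. sstep M w \<Pi> j a b \<and> A a \<and> B b"
  let ?O = "\<lambda>i k. onp M w \<Pi> i j k"
  have le: "a \<le> b" if "?R\<^sup>*\<^sup>* a b" for a b
    using that by (induction rule: rtranclp_induct) (auto dest: sstep_less)
  consider (gt) "j < i" | (eq) "i = j" | (lt) "i < j" by linarith
  then show ?case
  proof cases
    case gt
    then show ?thesis using le[of i j] by auto
  next
    case eq
    then show ?thesis by auto
  next
    case lt
    have oi: "?O i i" unfolding onp_iff by simp
    have ne: "i \<noteq> j" using lt by simp
    have first: "?R\<^sup>*\<^sup>* i j \<longleftrightarrow> (\<exists>b. ?R i b \<and> ?R\<^sup>*\<^sup>* b j)"
    proof
      assume "?R\<^sup>*\<^sup>* i j"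
      then show "\<exists>b. ?R i b \<and> ?R\<^sup>*\<^sup>* b j"
      proof (cases rule: converse_rtranclpE)
        case base
        then show ?thesis using ne by simp
      next
        case (step b)
        show ?thesis by (rule exI[of _ b], rule conjI, rule step(1), rule step(2))
      qed
    next
      assume "\<exists>b. ?R i b \<and> ?R\<^sup>*\<^sup>* b j"
      then show "?R\<^sup>*\<^sup>* i j"
      proof (elim exE)
        fix b assume b: "?R i b \<and> ?R\<^sup>*\<^sup>* b j"
        show "?R\<^sup>*\<^sup>* i j" by (rule converse_rtranclp_into_rtranclp[of ?R, OF conjunct1[OF b] conjunct2[OF b]])
      qed
    qed
    show ?thesis
    proof (cases "good M w \<Pi> j i")
      case False
      then have ns: "\<not> sstep M w \<Pi> j i b" for b using sstep_cases[of M w \<Pi> j i b] good_iff[OF lt j] by auto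
      have "\<not> ?R\<^sup>*\<^sup>* i j" unfolding first by (simp add: ns)
      moreover have "\<not> (\<forall>k. i \<le> k \<and> k < j \<and> ?O i k \<longrightarrow> A k \<and> good M w \<Pi> j k)" using False oi lt by blast
      ultimately show ?thesis by simp
    next
      case True
      obtain b where b: "sstep M w \<Pi> j i b"
        using True[unfolded good_iff[OF lt j]] unfolding sstep_def by (cases "{h. h \<le> j \<and> chi M w i h \<and> rel M w \<Pi> i h} = {}") auto
      have ib: "i < b" using sstep_less[OF b] .
      have cs: "b \<le> j \<and> chi M w i b \<and> rel M w \<Pi> i b \<and> (\<forall>h. h \<le> j \<and> chi M w i h \<and> rel M w \<Pi> i h \<longrightarrow> h \<le> b) \<or>
        b = Suc i \<and> \<not> (\<exists>h. h \<le> j \<and> chi M w i h \<and> rel M w \<Pi> i h)" using sstep_cases[OF b] by auto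
      then have bj: "b \<le> j" using lt by auto
      have mx: "h \<le> b" if "h \<le> j" "chi M w i h" "rel M w \<Pi> i h" for h using cs that by blast
      have ib': "chi M w i b \<and> rel M w \<Pi> i b" if "Suc i < b" using cs that by auto
      \<comment> \<open>The first step leads from \<open>i\<close> to \<open>b\<close>. By
        non-crossing, no jump that starts strictly inside this step can leave it, so after
        \<open>i\<close> the path from \<open>i\<close> visits the same positions as the path from
        \<open>b\<close>.\<close>
      have O: "?O i k \<longleftrightarrow> b \<le> k \<and> ?O b k" if k: "i < k" for k
      proof
        assume o: "?O i k"
        have "\<not> k < b"
        proof
          assume kb: "k < b"
          then have "chi M w i b \<and> rel M w \<Pi> i b" using ib' k by simp
          then have "b \<le> k" using o k bj unfolding onp_iff by blast
          then show False using kb by simp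
        qed
        then have "b \<le> k" by simp
        moreover have "?O b k" unfolding onp_iff
        proof (intro allI impI)
          fix a h assume a: "b \<le> a \<and> a < k \<and> h \<le> j \<and> chi M w a h \<and> rel M w \<Pi> a h"
          then have "i \<le> a" using ib by simp
          then show "h \<le> k" using a o unfolding onp_iff by blast
        qed
        ultimately show "b \<le> k \<and> ?O b k" by blast
      next
        assume o: "b \<le> k \<and> ?O b k"
        show "?O i k" unfolding onp_iff
        proof (intro allI impI)
          fix a h assume a: "i \<le> a \<and> a < k \<and> h \<le> j \<and> chi M w a h \<and> rel M w \<Pi> a h"
          consider "b \<le> a" | "a = i" | "i < a" "a < b" using a by linarith
          then show "h \<le> k"
          proof cases
            case 1
            then show ?thesis using o a unfolding onp_iff by blast
          next
            case 2
            then have "h \<le> b" using mx a by blast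
            then show ?thesis using o by simp
          next
            case 3
            then have "Suc i < b" by simp
            then have "L i b" "L a h" using ib' a chi_iff_link by blast+
            then have "h \<le> b" using link_noncrossing[of i b a h] 3 by blast
            then show ?thesis using o by simp
          qed
        qed
      qed
      have ob: "?O b b" unfolding onp_iff by simp
      have IH: "?R\<^sup>*\<^sup>* b j \<longleftrightarrow> b \<le> j \<and> (\<forall>k. b \<le> k \<and> k < j \<and> ?O b k \<longrightarrow> A k \<and> good M w \<Pi> j k) \<and>
        (\<forall>k. b < k \<and> k \<le> j \<and> ?O b k \<longrightarrow> B k)" by (rule less.hyps) (use ib lt in simp)
      have "(\<exists>c. (sstep M w \<Pi> j i c \<and> A i \<and> B c) \<and> Z c) \<longleftrightarrow> A i \<and> B b \<and> Z b" for Z using b sstep_fun[OF b] by blast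
      then have "?R\<^sup>*\<^sup>* i j \<longleftrightarrow> A i \<and> B b \<and> ?R\<^sup>*\<^sup>* b j" unfolding first by (rule meta_spec)
      also have "\<dots> \<longleftrightarrow> (A i \<and> (\<forall>k. b \<le> k \<and> k < j \<and> ?O b k \<longrightarrow> A k \<and> good M w \<Pi> j k)) \<and>
        (B b \<and> (\<forall>k. b < k \<and> k \<le> j \<and> ?O b k \<longrightarrow> B k))" unfolding IH using bj by blast
      also have "(A i \<and> (\<forall>k. b \<le> k \<and> k < j \<and> ?O b k \<longrightarrow> A k \<and> good M w \<Pi> j k)) \<longleftrightarrow>
        (\<forall>k. i \<le> k \<and> k < j \<and> ?O i k \<longrightarrow> A k \<and> good M w \<Pi> j k)"
      proof (intro iffI conjI allI impI)
        fix k assume a: "A i \<and> (\<forall>k. b \<le> k \<and> k < j \<and> ?O b k \<longrightarrow> A k \<and> good M w \<Pi> j k)" and k: "i \<le> k \<and> k < j \<and> ?O i k"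
        have "A k \<and> good M w \<Pi> j k"
        proof (cases "k = i")
          case False
          then have "i < k" using k by simp
          then show ?thesis using O[of k] a k by blast
        qed (use a True in simp)
        then show "A k" "good M w \<Pi> j k" by blast+
      next
        assume a: "\<forall>k. i \<le> k \<and> k < j \<and> ?O i k \<longrightarrow> A k \<and> good M w \<Pi> j k"
        show "A i" using a lt oi by blast
        fix k assume k: "b \<le> k \<and> k < j \<and> ?O b k"
        then have ik: "i < k" using ib by simp
        then have "?O i k" using O[of k] k by blast
        then show "A k" "good M w \<Pi> j k" using a k ik less_imp_le[OF ik] by blast+
      qed
      also have "(B b \<and> (\<forall>k. b < k \<and> k \<le> j \<and> ?O b k \<longrightarrow> B k)) \<longleftrightarrow> (\<forall>k. i < k \<and> k \<le> j \<and> ?O i k \<longrightarrow> B k)"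
      proof (intro iffI conjI allI impI)
        fix k assume a: "B b \<and> (\<forall>k. b < k \<and> k \<le> j \<and> ?O b k \<longrightarrow> B k)" and k: "i < k \<and> k \<le> j \<and> ?O i k"
        then have "b \<le> k" "?O b k" using O[of k] by blast+
        then show "B k" using a k by (cases "k = b") auto
      next
        assume a: "\<forall>k. i < k \<and> k \<le> j \<and> ?O i k \<longrightarrow> B k"
        show "B b" using a ib bj ob O[OF ib] by blast
        fix k assume k: "b < k \<and> k \<le> j \<and> ?O b k"
        then have ik: "i < k" "b \<le> k" using ib by simp_all
        then have "?O i k" using O[of k] k by blast
        then show "B k" using a k ik by blast
      qed
      finally show ?thesis using lt by simp
    qed
  qed
qed

lemma until_summary_fo:
  assumes i: "i \<le> n + 1"
  shows "until_sat (summary_path M w \<Pi>) F G i \<longleftrightarrow> (\<exists>j\<le>n + 1. \<not> j < i \<and>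
    (\<forall>k\<le>n + 1. \<not> k < i \<and> k < j \<and> onp M w \<Pi> i j k \<longrightarrow> F k \<and> good M w \<Pi> j k) \<and> G j)"
proof -
  have r: "(\<lambda>a b. sstep M w \<Pi> j a b \<and> F a)\<^sup>*\<^sup>* i j \<longleftrightarrow> \<not> j < i \<and>
    (\<forall>k\<le>n + 1. \<not> k < i \<and> k < j \<and> onp M w \<Pi> i j k \<longrightarrow> F k \<and> good M w \<Pi> j k)" if "j \<le> n + 1" for j
  proof -
    have "k < j \<Longrightarrow> k \<le> n + 1" for k using that by simp
    then show ?thesis using summary_reach[OF that, of \<Pi> F "\<lambda>_. True" i] by (simp add: not_less) blast
  qed
  show ?thesis unfolding until_summary[of i w, unfolded positions_def atLeastAtMost_iff, OF conjI[OF le0 i]]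
    by (auto simp: r Bex_def)
qed

text \<open>A step has to be available at every source, while the guard of since concerns the
  targets; hence two separate quantifiers over the path.\<close>

lemma since_summary_fo:
  assumes i: "i \<le> n + 1"
  shows "since_sat (summary_path M w \<Pi>) F G i \<longleftrightarrow> (\<exists>j\<le>n + 1. \<not> i < j \<and>
    (\<forall>k\<le>n + 1. \<not> k < j \<and> k < i \<and> onp M w \<Pi> j i k \<longrightarrow> good M w \<Pi> i k) \<and>
    (\<forall>k\<le>n + 1. j < k \<and> \<not> i < k \<and> onp M w \<Pi> j i k \<longrightarrow> F k) \<and> G j)"
proof -
  have b: "k < i \<Longrightarrow> k \<le> n + 1" "k \<le> i \<Longrightarrow> k \<le> n + 1" for k using i by simp_all
  have r: "(\<lambda>a b. sstep M w \<Pi> i a b \<and> F b)\<^sup>*\<^sup>* j i \<longleftrightarrow> \<not> i < j \<and>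
    (\<forall>k\<le>n + 1. \<not> k < j \<and> k < i \<and> onp M w \<Pi> j i k \<longrightarrow> good M w \<Pi> i k) \<and>
    (\<forall>k\<le>n + 1. j < k \<and> \<not> i < k \<and> onp M w \<Pi> j i k \<longrightarrow> F k)" for j
  proof -
    have 1: "(\<forall>k\<le>n + 1. \<not> k < j \<and> k < i \<and> onp M w \<Pi> j i k \<longrightarrow> good M w \<Pi> i k) \<longleftrightarrow>
      (\<forall>k. j \<le> k \<and> k < i \<and> onp M w \<Pi> j i k \<longrightarrow> good M w \<Pi> i k)" unfolding not_less using b(1) by blast
    have 2: "(\<forall>k\<le>n + 1. j < k \<and> \<not> i < k \<and> onp M w \<Pi> j i k \<longrightarrow> F k) \<longleftrightarrow>
      (\<forall>k. j < k \<and> k \<le> i \<and> onp M w \<Pi> j i k \<longrightarrow> F k)" unfolding not_less using b(2) by blast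
    show ?thesis unfolding 1 2 unfolding not_less
      using summary_reach[OF i, of \<Pi> "\<lambda>_. True" F j] by (simp only: simp_thms)
  qed
  show ?thesis unfolding since_summary[of i w, unfolded positions_def atLeastAtMost_iff, OF conjI[OF le0 i]]
    by (auto simp: r Bex_def)
qed

end

section \<open>First-order forms of the remaining operators\<close>

lemma Min_fo:
  assumes bnd: "\<And>k. C k \<Longrightarrow> k \<le> B"
  shows "(let K = {k. k > i \<and> C k} in K \<noteq> {} \<and> F (Min K)) \<longleftrightarrow>
    (\<exists>k\<le>B. i < k \<and> C k \<and> \<not> (\<exists>l\<le>B. i < l \<and> l < k \<and> C l) \<and> F (k :: nat))"
proof -
  have fin: "finite {k. k > i \<and> C k}" by (rule finite_subset[of _ "{..B}"]) (use bnd in auto)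
  have "(\<forall>l\<in>{k. k > i \<and> C k}. k \<le> l) = (\<forall>l. i < l \<and> C l \<longrightarrow> \<not> l < k)" for k by (auto simp: not_less)
  then have e: "(\<forall>l\<in>{k. k > i \<and> C k}. k \<le> l) = (\<not> (\<exists>l\<le>B. i < l \<and> l < k \<and> C l))" for k using bnd by blast
  show ?thesis unfolding Let_def Min_iff_ex[OF fin] e using bnd by blast
qed

lemma Max_fo:
  assumes bnd: "\<And>k. C k \<Longrightarrow> k \<le> B"
  shows "(let K = {k. k < i \<and> C k} in K \<noteq> {} \<and> F (Max K)) \<longleftrightarrow>
    (\<exists>k\<le>B. k < i \<and> C k \<and> \<not> (\<exists>l\<le>B. l < i \<and> k < l \<and> C l) \<and> F (k :: nat))"
proof -
  have fin: "finite {k. k < i \<and> C k}" by (rule finite_subset[of _ "{..B}"]) (use bnd in auto)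
  have "(\<forall>l\<in>{k. k < i \<and> C k}. l \<le> k) = (\<forall>l. l < i \<and> C l \<longrightarrow> \<not> k < l)" for k by (auto simp: not_less)
  then have e: "(\<forall>l\<in>{k. k < i \<and> C k}. l \<le> k) = (\<not> (\<exists>l\<le>B. l < i \<and> k < l \<and> C l))" for k using bnd by blast
  show ?thesis unfolding Let_def Max_iff_ex[OF fin] e using bnd by blast
qed

lemma ex_shift:
  assumes "\<And>h. A h \<Longrightarrow> P h \<and> Q h" shows "(\<exists>h. P h \<and> A h \<and> Z h) \<longleftrightarrow> (\<exists>h. Q h \<and> A h \<and> Z h)"
  using assms by blast

lemma all_bound:
  fixes B :: nat
  assumes "\<And>k. C k \<Longrightarrow> k \<le> B" shows "(\<forall>k\<le>B. P k \<and> Q k \<and> C k \<longrightarrow> R k) \<longleftrightarrow> (\<forall>k. P k \<and> Q k \<and> C k \<longrightarrow> R k)"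
  using assms by blast

lemma ex_bound:
  fixes B :: nat
  assumes "\<And>h j. A h j \<Longrightarrow> A' h j \<Longrightarrow> h \<le> B \<and> j \<le> B"
  shows "(\<exists>h j. A h j \<and> A' h j \<and> Z h j) \<longleftrightarrow> (\<exists>h\<le>B. \<exists>j\<le>B. A h j \<and> A' h j \<and> Z h j)"
  using assms by blast

lemma hnext_yields_fo:
  "hnext_sat M w HYields F i \<longleftrightarrow> (\<exists>h\<le>length w + 1. chi M w h i \<and> rel M w {Yields} h i \<and> (\<exists>k\<le>length w + 1. i < k \<and> (chi M w h k \<and> rel M w {Yields} h k) \<and> \<not> (\<exists>l\<le>length w + 1. i < l \<and> l < k \<and> chi M w h l \<and> rel M w {Yields} h l) \<and> F k))"
proof -
  have y: "chi M w h k \<and> rel M w {Yields} h k \<Longrightarrow> k \<le> length w + 1" for h k using chi_le[of M w h k] by blast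
  have m: "(let K = {k. k > i \<and> chi M w h k \<and> rel M w {Yields} h k} in K \<noteq> {} \<and> F (Min K)) \<longleftrightarrow> (\<exists>k\<le>length w + 1. i < k \<and> (chi M w h k \<and> rel M w {Yields} h k) \<and> \<not> (\<exists>l\<le>length w + 1. i < l \<and> l < k \<and> chi M w h l \<and> rel M w {Yields} h l) \<and> F k)" for h
    by (rule Min_fo[where C = "\<lambda>k. chi M w h k \<and> rel M w {Yields} h k"]) (rule y)
  show ?thesis unfolding hnext_sat.simps m
    by (rule ex_shift[where A = "\<lambda>h. chi M w h i" and P = "\<lambda>h. h < i" and Q = "\<lambda>h. h \<le> length w + 1"]) (use chi_le[of M w] in blast)
qed

lemma hnext_takes_fo:
  "hnext_sat M w HTakes F i \<longleftrightarrow> (\<exists>h\<le>length w + 1. chi M w i h \<and> rel M w {Takes} i h \<and> (\<exists>k\<le>length w + 1. i < k \<and> (chi M w k h \<and> rel M w {Takes} k h) \<and> \<not> (\<exists>l\<le>length w + 1. i < l \<and> l < k \<and> chi M w l h \<and> rel M w {Takes} l h) \<and> F k))"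
proof -
  have y: "chi M w k h \<and> rel M w {Takes} k h \<Longrightarrow> k \<le> length w + 1" for h k using chi_le[of M w k h] by blast
  have m: "(let K = {k. k > i \<and> chi M w k h \<and> rel M w {Takes} k h} in K \<noteq> {} \<and> F (Min K)) \<longleftrightarrow> (\<exists>k\<le>length w + 1. i < k \<and> (chi M w k h \<and> rel M w {Takes} k h) \<and> \<not> (\<exists>l\<le>length w + 1. i < l \<and> l < k \<and> chi M w l h \<and> rel M w {Takes} l h) \<and> F k)" for h
    by (rule Min_fo[where C = "\<lambda>k. chi M w k h \<and> rel M w {Takes} k h"]) (rule y)
  show ?thesis unfolding hnext_sat.simps m
    by (rule ex_shift[where A = "\<lambda>h. chi M w i h" and P = "\<lambda>h. h > i" and Q = "\<lambda>h. h \<le> length w + 1"]) (use chi_le[of M w] in blast)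
qed

lemma hback_yields_fo:
  "hback_sat M w HYields F i \<longleftrightarrow> (\<exists>h\<le>length w + 1. chi M w h i \<and> rel M w {Yields} h i \<and> (\<exists>k\<le>length w + 1. k < i \<and> (chi M w h k \<and> rel M w {Yields} h k) \<and> \<not> (\<exists>l\<le>length w + 1. l < i \<and> k < l \<and> chi M w h l \<and> rel M w {Yields} h l) \<and> F k))"
proof -
  have y: "chi M w h k \<and> rel M w {Yields} h k \<Longrightarrow> k \<le> length w + 1" for h k using chi_le[of M w h k] by blast
  have m: "(let K = {k. k < i \<and> chi M w h k \<and> rel M w {Yields} h k} in K \<noteq> {} \<and> F (Max K)) \<longleftrightarrow> (\<exists>k\<le>length w + 1. k < i \<and> (chi M w h k \<and> rel M w {Yields} h k) \<and> \<not> (\<exists>l\<le>length w + 1. l < i \<and> k < l \<and> chi M w h l \<and> rel M w {Yields} h l) \<and> F k)" for h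
    by (rule Max_fo[where C = "\<lambda>k. chi M w h k \<and> rel M w {Yields} h k"]) (rule y)
  show ?thesis unfolding hback_sat.simps m
    by (rule ex_shift[where A = "\<lambda>h. chi M w h i" and P = "\<lambda>h. h < i" and Q = "\<lambda>h. h \<le> length w + 1"]) (use chi_le[of M w] in blast)
qed

lemma hback_takes_fo:
  "hback_sat M w HTakes F i \<longleftrightarrow> (\<exists>h\<le>length w + 1. chi M w i h \<and> rel M w {Takes} i h \<and> (\<exists>k\<le>length w + 1. k < i \<and> (chi M w k h \<and> rel M w {Takes} k h) \<and> \<not> (\<exists>l\<le>length w + 1. l < i \<and> k < l \<and> chi M w l h \<and> rel M w {Takes} l h) \<and> F k))"
proof -
  have y: "chi M w k h \<and> rel M w {Takes} k h \<Longrightarrow> k \<le> length w + 1" for h k using chi_le[of M w k h] by blast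
  have m: "(let K = {k. k < i \<and> chi M w k h \<and> rel M w {Takes} k h} in K \<noteq> {} \<and> F (Max K)) \<longleftrightarrow> (\<exists>k\<le>length w + 1. k < i \<and> (chi M w k h \<and> rel M w {Takes} k h) \<and> \<not> (\<exists>l\<le>length w + 1. l < i \<and> k < l \<and> chi M w l h \<and> rel M w {Takes} l h) \<and> F k)" for h
    by (rule Max_fo[where C = "\<lambda>k. chi M w k h \<and> rel M w {Takes} k h"]) (rule y)
  show ?thesis unfolding hback_sat.simps m
    by (rule ex_shift[where A = "\<lambda>h. chi M w i h" and P = "\<lambda>h. h > i" and Q = "\<lambda>h. h \<le> length w + 1"]) (use chi_le[of M w] in blast)
qed

lemma huntil_yields_fo:
  "until_sat (hier_path M w HYields) F G i \<longleftrightarrow> (\<exists>h\<le>length w + 1. \<exists>j\<le>length w + 1. chi M w h i \<and> chi M w h j \<and> \<not> j < i \<and>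
     (\<forall>k\<le>length w + 1. \<not> k < i \<and> \<not> j < k \<and> chi M w h k \<longrightarrow> rel M w {Yields} h k) \<and>
     (\<forall>k\<le>length w + 1. \<not> k < i \<and> k < j \<and> chi M w h k \<longrightarrow> F k) \<and> G j)"
proof -
  have a: "(\<forall>k\<le>length w + 1. P k \<and> Q k \<and> chi M w h k \<longrightarrow> R k) \<longleftrightarrow> (\<forall>k. P k \<and> Q k \<and> chi M w h k \<longrightarrow> R k)" for h P Q R
    by (rule all_bound) (use chi_le[of M w] in blast)
  show ?thesis unfolding until_hier_yields a unfolding not_less
    by (rule ex_bound[where A = "\<lambda>h j. chi M w h i" and A' = "\<lambda>h j. chi M w h j"]) (use chi_le[of M w] in blast)
qed

lemma huntil_takes_fo:
  "until_sat (hier_path M w HTakes) F G i \<longleftrightarrow> (\<exists>h\<le>length w + 1. \<exists>j\<le>length w + 1. chi M w i h \<and> chi M w j h \<and> \<not> j < i \<and>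
     (\<forall>k\<le>length w + 1. \<not> k < i \<and> \<not> j < k \<and> chi M w k h \<longrightarrow> rel M w {Takes} k h) \<and>
     (\<forall>k\<le>length w + 1. \<not> k < i \<and> k < j \<and> chi M w k h \<longrightarrow> F k) \<and> G j)"
proof -
  have a: "(\<forall>k\<le>length w + 1. P k \<and> Q k \<and> chi M w k h \<longrightarrow> R k) \<longleftrightarrow> (\<forall>k. P k \<and> Q k \<and> chi M w k h \<longrightarrow> R k)" for h P Q R
    by (rule all_bound) (use chi_le[of M w] in blast)
  show ?thesis unfolding until_hier_takes a unfolding not_less
    by (rule ex_bound[where A = "\<lambda>h j. chi M w i h" and A' = "\<lambda>h j. chi M w j h"]) (use chi_le[of M w] in blast)
qed

lemma hsince_yields_fo:
  "since_sat (hier_path M w HYields) F G i \<longleftrightarrow> (\<exists>h\<le>length w + 1. \<exists>j\<le>length w + 1. chi M w h i \<and> chi M w h j \<and> \<not> i < j \<and>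
     (\<forall>k\<le>length w + 1. \<not> k < j \<and> \<not> i < k \<and> chi M w h k \<longrightarrow> rel M w {Yields} h k) \<and>
     (\<forall>k\<le>length w + 1. j < k \<and> \<not> i < k \<and> chi M w h k \<longrightarrow> F k) \<and> G j)"
proof -
  have a: "(\<forall>k\<le>length w + 1. P k \<and> Q k \<and> chi M w h k \<longrightarrow> R k) \<longleftrightarrow> (\<forall>k. P k \<and> Q k \<and> chi M w h k \<longrightarrow> R k)" for h P Q R
    by (rule all_bound) (use chi_le[of M w] in blast)
  show ?thesis unfolding since_hier_yields a unfolding not_less
    by (rule ex_bound[where A = "\<lambda>h j. chi M w h i" and A' = "\<lambda>h j. chi M w h j"]) (use chi_le[of M w] in blast)
qed

lemma hsince_takes_fo:
  "since_sat (hier_path M w HTakes) F G i \<longleftrightarrow> (\<exists>h\<le>length w + 1. \<exists>j\<le>length w + 1. chi M w i h \<and> chi M w j h \<and> \<not> i < j \<and>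
     (\<forall>k\<le>length w + 1. \<not> k < j \<and> \<not> i < k \<and> chi M w k h \<longrightarrow> rel M w {Takes} k h) \<and>
     (\<forall>k\<le>length w + 1. j < k \<and> \<not> i < k \<and> chi M w k h \<longrightarrow> F k) \<and> G j)"
proof -
  have a: "(\<forall>k\<le>length w + 1. P k \<and> Q k \<and> chi M w k h \<longrightarrow> R k) \<longleftrightarrow> (\<forall>k. P k \<and> Q k \<and> chi M w k h \<longrightarrow> R k)" for h P Q R
    by (rule all_bound) (use chi_le[of M w] in blast)
  show ?thesis unfolding since_hier_takes a unfolding not_less
    by (rule ex_bound[where A = "\<lambda>h j. chi M w i h" and A' = "\<lambda>h j. chi M w j h"]) (use chi_le[of M w] in blast)
qed

lemma next_fo: "i + 1 \<in> positions w \<and> rel M w \<Pi> i (i + 1) \<and> F (i + 1) \<longleftrightarrow>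
    (\<exists>k\<le>length w + 1. sc w i k \<and> rel M w \<Pi> i k \<and> F k)"
  by (auto simp: positions_def sc_iff)

lemma back_fo: "i \<le> length w + 1 \<Longrightarrow> 1 \<le> i \<and> rel M w \<Pi> (i - 1) i \<and> F (i - 1) \<longleftrightarrow>
    (\<exists>k\<le>length w + 1. sc w k i \<and> rel M w \<Pi> k i \<and> F k)"
  by (cases i) (auto simp: sc_iff)

lemma chain_fo:
  "(\<exists>j>i. chi M w i j \<and> rel M w \<Pi> i j \<and> F j) \<longleftrightarrow> (\<exists>k\<le>length w + 1. chi M w i k \<and> rel M w \<Pi> i k \<and> F k)"
  "(\<exists>j<i. chi M w j i \<and> rel M w \<Pi> j i \<and> F j) \<longleftrightarrow> (\<exists>k\<le>length w + 1. chi M w k i \<and> rel M w \<Pi> k i \<and> F k)"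
  by (rule ex_shift[where A = "\<lambda>j. chi M w i j"], use chi_le[of M w] in blast,
      rule ex_shift[where A = "\<lambda>j. chi M w j i"], use chi_le[of M w] in blast)

text \<open>Structural induction with \<open>x\<close> and \<open>X\<close> general, because
  subformulas are evaluated at quantified positions, whose variables are added to
  \<open>X\<close>.\<close>

lemma potl_fdef:
  fixes M :: "('ap::finite) opm"
  assumes opm: "is_opm SL M"
  shows "x \<in> X \<Longrightarrow> fdef M X (\<lambda>w v. potl_sat M w \<phi> (v x))"
proof (induction \<phi> arbitrary: x X)
  case (Atom a)
  then show ?case unfolding potl_sat.simps by (rule fd_prop)
next
  case (Neg \<phi>)
  show ?case unfolding potl_sat.simps by (rule fd_not[OF Neg.IH[OF Neg.prems]])
next
  case (Or \<phi> \<psi>)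
  show ?case unfolding potl_sat.simps by (rule fd_or[OF Or.IH(1)[OF Or.prems] Or.IH(2)[OF Or.prems]])
next
  case (Next \<Pi> \<phi>)
  have "fdef M {x} (\<lambda>w v. \<exists>k\<le>length w + 1. sc w (v x) k \<and> rel M w \<Pi> (v x) k \<and> potl_sat M w \<phi> k)"
    by (intro fdi fd_rel fd_sc Next.IH) simp_all
  then have "fdef M {x} (\<lambda>w v. potl_sat M w (Next \<Pi> \<phi>) (v x))"
    by (rule fd_cong) (unfold potl_sat.simps, rule next_fo[where F = "potl_sat M w \<phi>" and w = w for w])
  then show ?case by (rule fd_weaken) (use Next.prems in simp)
next
  case (Back \<Pi> \<phi>)
  have "fdef M {x} (\<lambda>w v. \<exists>k\<le>length w + 1. sc w k (v x) \<and> rel M w \<Pi> k (v x) \<and> potl_sat M w \<phi> k)"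
    by (intro fdi fd_rel fd_sc Back.IH) simp_all
  then have "fdef M {x} (\<lambda>w v. potl_sat M w (Back \<Pi> \<phi>) (v x))"
    by (rule fd_cong) (unfold potl_sat.simps, rule back_fo[where F = "potl_sat M w \<phi>" and w = w for w], simp)
  then show ?case by (rule fd_weaken) (use Back.prems in simp)
next
  case (ChainNext \<Pi> \<phi>)
  have "fdef M {x} (\<lambda>w v. \<exists>k\<le>length w + 1. chi M w (v x) k \<and> rel M w \<Pi> (v x) k \<and> potl_sat M w \<phi> k)"
    by (intro fdi fd_rel fd_sc ChainNext.IH) simp_all
  then have "fdef M {x} (\<lambda>w v. potl_sat M w (ChainNext \<Pi> \<phi>) (v x))"
    by (rule fd_cong) (unfold potl_sat.simps, rule chain_fo(1)[where F = "potl_sat M w \<phi>" and w = w for w])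
  then show ?case by (rule fd_weaken) (use ChainNext.prems in simp)
next
  case (ChainBack \<Pi> \<phi>)
  have "fdef M {x} (\<lambda>w v. \<exists>k\<le>length w + 1. chi M w k (v x) \<and> rel M w \<Pi> k (v x) \<and> potl_sat M w \<phi> k)"
    by (intro fdi fd_rel fd_sc ChainBack.IH) simp_all
  then have "fdef M {x} (\<lambda>w v. potl_sat M w (ChainBack \<Pi> \<phi>) (v x))"
    by (rule fd_cong) (unfold potl_sat.simps, rule chain_fo(2)[where F = "potl_sat M w \<phi>" and w = w for w])
  then show ?case by (rule fd_weaken) (use ChainBack.prems in simp)
next
  case (ChainUntil \<Pi> \<phi> \<psi>)
  have "fdef M {x} (\<lambda>w v. \<exists>j\<le>length w + 1. \<not> j < v x \<and>
    (\<forall>k\<le>length w + 1. \<not> k < v x \<and> k < j \<and> onp M w \<Pi> (v x) j k \<longrightarrow> potl_sat M w \<phi> k \<and> good M w \<Pi> j k) \<and> potl_sat M w \<psi> j)"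
    by (intro fdi fd_onp fd_good ChainUntil.IH) simp_all
  then have "fdef M {x} (\<lambda>w v. potl_sat M w (ChainUntil \<Pi> \<phi> \<psi>) (v x))"
    by (rule fd_cong) (unfold potl_sat.simps, rule opword.until_summary_fo[OF opw[OF opm]], simp_all)
  then show ?case by (rule fd_weaken) (use ChainUntil.prems in simp)
next
  case (ChainSince \<Pi> \<phi> \<psi>)
  have "fdef M {x} (\<lambda>w v. \<exists>j\<le>length w + 1. \<not> v x < j \<and>
    (\<forall>k\<le>length w + 1. \<not> k < j \<and> k < v x \<and> onp M w \<Pi> j (v x) k \<longrightarrow> good M w \<Pi> (v x) k) \<and>
    (\<forall>k\<le>length w + 1. j < k \<and> \<not> v x < k \<and> onp M w \<Pi> j (v x) k \<longrightarrow> potl_sat M w \<phi> k) \<and> potl_sat M w \<psi> j)"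
    by (intro fdi fd_onp fd_good ChainSince.IH) simp_all
  then have "fdef M {x} (\<lambda>w v. potl_sat M w (ChainSince \<Pi> \<phi> \<psi>) (v x))"
    by (rule fd_cong) (unfold potl_sat.simps, rule opword.since_summary_fo[OF opw[OF opm]], simp_all)
  then show ?case by (rule fd_weaken) (use ChainSince.prems in simp)
next
  case (HNext \<mu> \<phi>)
  have "fdef M {x} (\<lambda>w v. potl_sat M w (HNext \<mu> \<phi>) (v x))"
  proof (cases \<mu>)
    case HYields
    show ?thesis unfolding HYields potl_sat.simps hnext_yields_fo by (intro fdi fd_rel HNext.IH) simp_all
  next
    case HTakes
    show ?thesis unfolding HTakes potl_sat.simps hnext_takes_fo by (intro fdi fd_rel HNext.IH) simp_all
  qed
  then show ?case by (rule fd_weaken) (use HNext.prems in simp)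
next
  case (HBack \<mu> \<phi>)
  have "fdef M {x} (\<lambda>w v. potl_sat M w (HBack \<mu> \<phi>) (v x))"
  proof (cases \<mu>)
    case HYields
    show ?thesis unfolding HYields potl_sat.simps hback_yields_fo by (intro fdi fd_rel HBack.IH) simp_all
  next
    case HTakes
    show ?thesis unfolding HTakes potl_sat.simps hback_takes_fo by (intro fdi fd_rel HBack.IH) simp_all
  qed
  then show ?case by (rule fd_weaken) (use HBack.prems in simp)
next
  case (HUntil \<mu> \<phi> \<psi>)
  have "fdef M {x} (\<lambda>w v. potl_sat M w (HUntil \<mu> \<phi> \<psi>) (v x))"
  proof (cases \<mu>)
    case HYields
    show ?thesis unfolding HYields potl_sat.simps huntil_yields_fo by (intro fdi fd_rel HUntil.IH) simp_all
  next
    case HTakes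
    show ?thesis unfolding HTakes potl_sat.simps huntil_takes_fo by (intro fdi fd_rel HUntil.IH) simp_all
  qed
  then show ?case by (rule fd_weaken) (use HUntil.prems in simp)
next
  case (HSince \<mu> \<phi> \<psi>)
  have "fdef M {x} (\<lambda>w v. potl_sat M w (HSince \<mu> \<phi> \<psi>) (v x))"
  proof (cases \<mu>)
    case HYields
    show ?thesis unfolding HYields potl_sat.simps hsince_yields_fo by (intro fdi fd_rel HSince.IH) simp_all
  next
    case HTakes
    show ?thesis unfolding HTakes potl_sat.simps hsince_takes_fo by (intro fdi fd_rel HSince.IH) simp_all
  qed
  then show ?case by (rule fd_weaken) (use HSince.prems in simp)
qed

lemma potl_fo_definable:
  fixes M :: "('ap::finite) opm"
  assumes opm: "is_opm SL M"
  shows "\<exists>\<nu>. fo_fv \<nu> = {x} \<and>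
    (\<forall>w i v. compatible M w \<longrightarrow> i \<le> length w + 1 \<longrightarrow> potl_sat M w \<phi> i = fo_sat M w \<nu> (v(x := i)))"
proof (rule fdefE[OF potl_fdef[OF opm, of x "{x}" \<phi>]])
  fix \<psi> assume p: "fo_fv \<psi> \<subseteq> {x}"
    "\<And>w v. compatible M w \<Longrightarrow> \<forall>y\<in>{x}. v y \<le> length w + 1 \<Longrightarrow> fo_sat M w \<psi> v = potl_sat M w \<phi> (v x)"
  \<comment> \<open>Conjunction with \<open>x = x\<close>, as the formula obtained may have no free
    variable at all.\<close>
  let ?\<nu> = "FNeg (FOr (FNeg \<psi>) (FNeg (FEq x x)))"
  show ?thesis
  proof (intro exI[of _ ?\<nu>] conjI allI impI)
    show "fo_fv ?\<nu> = {x}" using p(1) by auto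
    fix w i v assume "compatible M w" "i \<le> length w + 1"
    then show "potl_sat M w \<phi> i = fo_sat M w ?\<nu> (v(x := i))" using p(2)[of w "v(x := i)"] by simp
  qed
qed simp

section \<open>From first-order logic to POTL\<close>

definition placed :: "nat \<Rightarrow> nat set \<Rightarrow> (nat \<Rightarrow> nat) \<Rightarrow> 'ap set list \<Rightarrow> (nat \<Rightarrow> nat set) \<Rightarrow> (nat \<Rightarrow> nat) \<Rightarrow> bool" where
  "placed k X \<rho> w P v \<longleftrightarrow> (\<forall>x\<in>X. v x \<le> length w + 1 \<and> (\<forall>j\<le>length w + 1. \<rho> x \<in> P j \<longleftrightarrow> j = v x)) \<and>
     (\<forall>j\<le>length w + 1. \<forall>q<k. q \<notin> P j)"

definition sim :: "'ap opm \<Rightarrow> nat \<Rightarrow> nat \<Rightarrow> nat set \<Rightarrow> (nat \<Rightarrow> nat) \<Rightarrow> 'ap set list \<Rightarrow> (nat \<Rightarrow> nat set) \<Rightarrow> (nat \<Rightarrow> nat) \<Rightarrow>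
    'ap set list \<Rightarrow> (nat \<Rightarrow> nat set) \<Rightarrow> (nat \<Rightarrow> nat) \<Rightarrow> bool" where
  "sim M N k X \<rho> w P v w' P' v' \<longleftrightarrow> compatible M w \<and> compatible M w' \<and> k \<le> N \<and>
     eqv N k (wforest M w P 0 (length w + 2)) (wforest M w' P' 0 (length w' + 2)) \<and>
     (\<forall>x\<in>X. k \<le> \<rho> x \<and> \<rho> x < N) \<and> placed k X \<rho> w P v \<and> placed k X \<rho> w' P' v'"

lemma simD:
  assumes "sim M N k X \<rho> w P v w' P' v'"
  shows "compatible M w" "compatible M w'" "k \<le> N"
    "eqv N k (wforest M w P 0 (length w + 2)) (wforest M w' P' 0 (length w' + 2))"
    "\<And>x. x \<in> X \<Longrightarrow> k \<le> \<rho> x \<and> \<rho> x < N" "placed k X \<rho> w P v" "placed k X \<rho> w' P' v'"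
  using assms unfolding sim_def by blast+

lemma sim_sym: "sim M N k X \<rho> w P v w' P' v' \<Longrightarrow> sim M N k X \<rho> w' P' v' w P v"
  unfolding sim_def using eqv_sym by blast

lemma placed_bound: "placed k X \<rho> w P v \<Longrightarrow> \<forall>x\<in>X. v x \<le> length w + 1"
  unfolding placed_def by blast

lemma placed_step:
  assumes p: "placed (Suc k) X \<rho> w P v" and r: "\<And>x. x \<in> X \<Longrightarrow> Suc k \<le> \<rho> x" and j: "j \<le> length w + 1"
  shows "placed k (insert z X) (\<rho>(z := k)) w (P(j := insert k (P j))) (v(z := j))"
proof -
  have nk: "q \<notin> P i" if "i \<le> length w + 1" "q \<le> k" for i q using p that unfolding placed_def by auto
  have b: "v x \<le> length w + 1" "i \<le> length w + 1 \<Longrightarrow> \<rho> x \<in> P i \<longleftrightarrow> i = v x" if "x \<in> X" for x i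
    using p that unfolding placed_def by blast+
  have ne: "\<rho> x \<noteq> k" if "x \<in> X" for x using r[OF that] by simp
  show ?thesis unfolding placed_def
  proof (intro conjI ballI allI impI)
    fix x assume x: "x \<in> insert z X"
    show "(v(z := j)) x \<le> length w + 1" using x b(1) j by auto
    fix i assume i: "i \<le> length w + 1"
    show "((\<rho>(z := k)) x \<in> (P(j := insert k (P j))) i) = (i = (v(z := j)) x)"
    proof (cases "x = z")
      case True
      then show ?thesis using nk[OF i order_refl] by simp
    next
      case False
      then have "x \<in> X" using x by simp
      then show ?thesis using False b(2)[of x i] ne[of x] i by auto
    qed
  next
    fix i q assume "i \<le> length w + 1" "q < k"
    then show "q \<notin> (P(j := insert k (P j))) i" using nk[of i q] nk[of j q] j by (cases "i = j") simp_all
  qed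
qed

context
  fixes M :: "'ap opm" and SL :: "'ap set"
  assumes opm: "is_opm SL M"
begin

lemma closed_all:
  assumes "compatible M w"
  shows "itree.closed (sub_end M w) (length w + 2) 0 (length w + 2)"
proof -
  interpret opword M SL w using opw[OF opm assms] .
  show ?thesis unfolding closed_def using en_le by auto
qed

lemma placed_atoms:
  assumes c: "compatible M w" and p: "placed k X \<rho> w P v" and x: "x \<in> X" "\<rho> x < N" and y: "y \<in> X" "\<rho> y < N"
  shows "(\<rho> x, s) \<in> occ N (wforest M w P 0 (length w + 2)) \<longleftrightarrow> s = symb_at w (v x)"
    "(\<rho> x, \<rho> y) \<in> lts N (wforest M w P 0 (length w + 2)) \<longleftrightarrow> v x < v y"
    "(\<rho> x, \<rho> y) \<in> ancs N (wforest M w P 0 (length w + 2)) \<longleftrightarrow> v x < v y \<and> v y < sub_end M w (v x)"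
proof -
  interpret opword M SL w using opw[OF opm c] .
  note cl = closed_all[OF c]
  have q: "\<rho> x \<in> P j \<longleftrightarrow> j = v x" "\<rho> y \<in> P j \<longleftrightarrow> j = v y" if "j < length w + 2" for j
    using p x(1) y(1) that unfolding placed_def by auto
  have b: "v x < length w + 2" "v y < length w + 2" using placed_bound[OF p] x(1) y(1) by auto
  have qv: "\<rho> x \<in> P (v x)" "\<rho> y \<in> P (v y)" using q b by blast+
  show "(\<rho> x, s) \<in> occ N (wforest M w P 0 (length w + 2)) \<longleftrightarrow> s = symb_at w (v x)"
    unfolding wforest_def occ_ivf[OF cl le0] using q(1) b(1) x(2) by auto
  show "(\<rho> x, \<rho> y) \<in> lts N (wforest M w P 0 (length w + 2)) \<longleftrightarrow> v x < v y"
    unfolding wforest_def lts_ivf[OF cl le0] mem_Collect_eq prod.case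
  proof
    assume "\<exists>i j. (0 \<le> i \<and> i < j \<and> j < length w + 2) \<and> (\<rho> x \<in> P i \<and> \<rho> x < N) \<and> \<rho> y \<in> P j \<and> \<rho> y < N"
    then obtain i j where ij: "i < j" "j < length w + 2" "\<rho> x \<in> P i" "\<rho> y \<in> P j" by blast
    have "i < length w + 2" using ij by simp
    then show "v x < v y" using q(1)[of i] q(2)[OF ij(2)] ij by simp
  next
    assume "v x < v y"
    then show "\<exists>i j. (0 \<le> i \<and> i < j \<and> j < length w + 2) \<and> (\<rho> x \<in> P i \<and> \<rho> x < N) \<and> \<rho> y \<in> P j \<and> \<rho> y < N"
      using qv b x(2) y(2) by blast
  qed
  show "(\<rho> x, \<rho> y) \<in> ancs N (wforest M w P 0 (length w + 2)) \<longleftrightarrow> v x < v y \<and> v y < en (v x)"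
    unfolding wforest_def ancs_ivf[OF cl le0] mem_Collect_eq prod.case
  proof
    assume "\<exists>i j. (0 \<le> i \<and> i < length w + 2 \<and> i < j \<and> j < en i) \<and> (\<rho> x \<in> P i \<and> \<rho> x < N) \<and> \<rho> y \<in> P j \<and> \<rho> y < N"
    then obtain i j where ij: "i < length w + 2" "i < j" "j < en i" "\<rho> x \<in> P i" "\<rho> y \<in> P j" by blast
    have "j < length w + 2" using ij en_le[of i] by simp
    then have "j = v y" "i = v x" using q(1)[OF ij(1)] q(2)[of j] ij by simp_all
    then show "v x < v y \<and> v y < en (v x)" using ij by simp
  next
    assume "v x < v y \<and> v y < en (v x)"
    then show "\<exists>i j. (0 \<le> i \<and> i < length w + 2 \<and> i < j \<and> j < en i) \<and> (\<rho> x \<in> P i \<and> \<rho> x < N) \<and> \<rho> y \<in> P j \<and> \<rho> y < N"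
      using qv b x(2) y(2) by blast
  qed
qed

lemma sim_atoms:
  assumes s: "sim M N k X \<rho> w P v w' P' v'" and x: "x \<in> X" and y: "y \<in> X"
  shows "symb_at w (v x) = symb_at w' (v' x)" "v x < v y \<longleftrightarrow> v' x < v' y"
    "v x < v y \<and> v y < sub_end M w (v x) \<longleftrightarrow> v' x < v' y \<and> v' y < sub_end M w' (v' x)"
proof -
  let ?F = "wforest M w P 0 (length w + 2)" and ?G = "wforest M w' P' 0 (length w' + 2)"
  note D = simD[OF s]
  have "eqv N 0 ?F ?G" using eqv_mono[OF D(4)] by simp
  then have "atomic N ?F = atomic N ?G" by (simp only: eqv_0)
  then have e: "occ N ?F = occ N ?G" "lts N ?F = lts N ?G" "ancs N ?F = ancs N ?G" unfolding atomic_def by blast+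
  have r: "\<rho> x < N" "\<rho> y < N" using D(5) x y by blast+
  note A = placed_atoms[OF D(1,6) x r(1) y r(2)] and B = placed_atoms[OF D(2,7) x r(1) y r(2)]
  show "symb_at w (v x) = symb_at w' (v' x)" using A(1)[of "symb_at w (v x)"] B(1)[of "symb_at w (v x)"] e(1) by simp
  show "v x < v y \<longleftrightarrow> v' x < v' y" using A(2) B(2) e(2) by simp
  show "v x < v y \<and> v y < sub_end M w (v x) \<longleftrightarrow> v' x < v' y \<and> v' y < sub_end M w' (v' x)" using A(3) B(3) e(3) by simp
qed

text \<open>Choosing a value for \<open>z\<close> is a move with the fresh pebble \<open>k\<close>:
  the equivalence answers position \<open>j\<close> by some \<open>j'\<close>, and from then on
  \<open>z\<close> is carried by pebble \<open>k\<close>.\<close>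

lemma sim_step:
  assumes s: "sim M N (Suc k) X \<rho> w P v w' P' v'" and j: "j \<le> length w + 1"
  obtains j' where "j' \<le> length w' + 1" "sim M N k (insert z X) (\<rho>(z := k)) w (P(j := insert k (P j))) (v(z := j))
      w' (P'(j' := insert k (P' j'))) (v'(z := j'))"
proof -
  note D = simD[OF s]
  interpret A: opword M SL w using opw[OF opm D(1)] .
  interpret B: opword M SL w' using opw[OF opm D(2)] .
  let ?F = "\<lambda>P. wforest M w P 0 (length w + 2)" and ?G = "\<lambda>P. wforest M w' P 0 (length w' + 2)"
  have "?F (P(j := insert k (P j))) \<in> marks k (?F P)"
    unfolding wforest_def A.marks_ivf[OF closed_all[OF D(1)] le0] using j by auto
  then obtain G where G: "G \<in> marks k (?G P')" "eqv N k (?F (P(j := insert k (P j)))) G"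
    using D(4)[unfolded eqv_Suc] by blast
  obtain j' where j': "j' < length w' + 2" "G = ?G (P'(j' := insert k (P' j')))"
    using G(1) unfolding wforest_def B.marks_ivf[OF closed_all[OF D(2)] le0] by blast
  have r: "\<And>x. x \<in> X \<Longrightarrow> Suc k \<le> \<rho> x" using D(5) by blast
  have b: "j' \<le> length w' + 1" using j'(1) by simp
  have rr: "\<forall>x\<in>insert z X. k \<le> (\<rho>(z := k)) x \<and> (\<rho>(z := k)) x < N" using D(3,5) by fastforce
  have kN: "k \<le> N" using D(3) by simp
  show thesis
    by (rule that[OF b]) (unfold sim_def, intro conjI D(1,2) kN rr G(2)[unfolded j'(2)] placed_step D(6,7) r j b)
qed

text \<open>\<open>Q\<close> cannot distinguish two situations of the game with at least
  \<open>k\<close> rounds left. Being semantic, the notion also applies to auxiliary relations such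
  as \<open>par\<close>, which are no formulas of the logic.\<close>

definition inv :: "nat \<Rightarrow> nat set \<Rightarrow> ('ap set list \<Rightarrow> (nat \<Rightarrow> nat) \<Rightarrow> bool) \<Rightarrow> bool" where
  "inv k X Q \<longleftrightarrow> (\<forall>N l \<rho> w P v w' P' v'. k \<le> l \<longrightarrow> sim M N l X \<rho> w P v w' P' v' \<longrightarrow> Q w v = Q w' v')"

lemma invI: "(\<And>N l \<rho> w P v w' P' v'. k \<le> l \<Longrightarrow> sim M N l X \<rho> w P v w' P' v' \<Longrightarrow> Q w v = Q w' v') \<Longrightarrow> inv k X Q"
  unfolding inv_def by simp

lemma invD: "inv k X Q \<Longrightarrow> k \<le> l \<Longrightarrow> sim M N l X \<rho> w P v w' P' v' \<Longrightarrow> Q w v = Q w' v'"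
  unfolding inv_def by simp

lemma inv_not: "inv k X Q \<Longrightarrow> inv k X (\<lambda>w v. \<not> Q w v)"
  unfolding inv_def by simp

lemma inv_or: "inv k X Q \<Longrightarrow> inv k X R \<Longrightarrow> inv k X (\<lambda>w v. Q w v \<or> R w v)"
  unfolding inv_def by simp

lemma inv_and: "inv k X Q \<Longrightarrow> inv k X R \<Longrightarrow> inv k X (\<lambda>w v. Q w v \<and> R w v)"
  unfolding inv_def by simp

lemma inv_mono:
  assumes "inv k X Q" "k \<le> l" shows "inv l X Q"
proof (rule invI)
  fix N l' \<rho> w P v w' P' v' assume a: "l \<le> l'" "sim M N l' X \<rho> w P v w' P' v'"
  show "Q w v = Q w' v'" by (rule invD[OF assms(1) order_trans[OF assms(2) a(1)] a(2)])
qed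

lemma inv_cong:
  assumes "inv k X R" "\<And>w v. compatible M w \<Longrightarrow> \<forall>x\<in>X. v x \<le> length w + 1 \<Longrightarrow> Q w v = R w v"
  shows "inv k X Q"
proof (rule invI)
  fix N l \<rho> w P v w' P' v' assume a: "k \<le> l" "sim M N l X \<rho> w P v w' P' v'"
  note D = simD[OF a(2)]
  show "Q w v = Q w' v'"
    using assms(2)[OF D(1) placed_bound[OF D(6)]] assms(2)[OF D(2) placed_bound[OF D(7)]] invD[OF assms(1) a] by simp
qed

lemma inv_less: "x \<in> X \<Longrightarrow> y \<in> X \<Longrightarrow> inv k X (\<lambda>w v. v x < v y)"
  by (rule invI) (rule sim_atoms(2))

lemma inv_symb: "x \<in> X \<Longrightarrow> y \<in> X \<Longrightarrow> inv k X (\<lambda>w v. Z (symb_at w (v x)) (symb_at w (v y)))"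
  by (rule invI) (simp add: sim_atoms(1))

lemma inv_ex:
  assumes "inv k (insert z X) Q"
  shows "inv (Suc k) X (\<lambda>w v. \<exists>j\<le>length w + 1. Q w (v(z := j)))"
proof (rule invI)
  have main: "\<exists>j\<le>length w' + 1. Q w' (v'(z := j))"
    if a: "k \<le> l" "sim M N (Suc l) X \<rho> w P v w' P' v'" "\<exists>j\<le>length w + 1. Q w (v(z := j))" for N l \<rho> w P v w' P' v'
  proof -
    obtain j where j: "j \<le> length w + 1" "Q w (v(z := j))" using a(3) by blast
    obtain j' where j': "j' \<le> length w' + 1" "sim M N l (insert z X) (\<rho>(z := l)) w (P(j := insert l (P j))) (v(z := j))
      w' (P'(j' := insert l (P' j'))) (v'(z := j'))" by (rule sim_step[OF a(2) j(1)])
    show ?thesis using invD[OF assms a(1) j'(2)] j j'(1) by blast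
  qed
  fix N l \<rho> w P v w' P' v' assume a: "Suc k \<le> l" "sim M N l X \<rho> w P v w' P' v'"
  then obtain m where m: "l = Suc m" "k \<le> m" by (cases l) auto
  show "(\<exists>j\<le>length w + 1. Q w (v(z := j))) = (\<exists>j\<le>length w' + 1. Q w' (v'(z := j)))"
    using main[OF m(2) a(2)[unfolded m(1)]] main[OF m(2) sim_sym[OF a(2)[unfolded m(1)]]] by (rule iffI)
qed

lemma inv_exF:
  assumes "inv k (insert z X) (\<lambda>w v. R w v (v z))" "\<And>w v j a. R w (v(z := j)) a = R w v a"
  shows "inv (Suc k) X (\<lambda>w v. \<exists>j\<le>length w + 1. R w v j)"
  using inv_ex[OF assms(1)] unfolding assms(2) by simp

section \<open>The chain relation in terms of order and ancestors\<close>

definition anc :: "'ap set list \<Rightarrow> nat \<Rightarrow> nat \<Rightarrow> bool" where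
  "anc w i j \<longleftrightarrow> i < j \<and> j < sub_end M w i"

definition par :: "'ap set list \<Rightarrow> nat \<Rightarrow> nat \<Rightarrow> bool" where
  "par w i j \<longleftrightarrow> anc w i j \<and> \<not> (\<exists>c\<le>length w + 1. anc w i c \<and> anc w c j)"

lemma inv_anc: "x \<in> X \<Longrightarrow> y \<in> X \<Longrightarrow> inv k X (\<lambda>w v. anc w (v x) (v y))"
  unfolding anc_def by (rule invI) (rule sim_atoms(3))

lemma inv_par:
  assumes "x \<in> X" "y \<in> X" shows "inv (Suc k) X (\<lambda>w v. par w (v x) (v y))"
proof -
  have z: "Suc (x + y) \<noteq> x" "Suc (x + y) \<noteq> y" by simp_all
  have "inv (Suc k) X (\<lambda>w v. \<exists>c\<le>length w + 1. anc w (v x) c \<and> anc w c (v y))"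
    by (rule inv_exF[where z = "Suc (x + y)"], rule inv_and; (rule inv_anc)?) (use assms z in auto)
  then show ?thesis unfolding par_def by (intro inv_and inv_not inv_anc assms)
qed

text \<open>Combines \<open>link_iff\<close> with nonadjacency. The end of the subtree is the first
  position after \<open>i\<close> that is no descendant, and a child is a descendant with no node in
  between on the branch.\<close>

lemma chi_iff:
  assumes c: "compatible M w" and i: "i \<le> length w + 1" and j: "j \<le> length w + 1"
  shows "chi M w i j \<longleftrightarrow> (\<exists>c\<le>length w + 1. i < c \<and> c < j) \<and>
    (par w i j \<or> i < j \<and> \<not> anc w i j \<and> \<not> (\<exists>c\<le>length w + 1. (i < c \<and> c < j) \<and> \<not> anc w i c) \<and>
       \<not> (\<exists>c\<le>length w + 1. par w i c \<and> prel M w Equals i c))"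
proof -
  interpret opword M SL w using opw[OF opm c] .
  have pp: "pr i k \<longleftrightarrow> par w i k" for k
  proof
    assume "pr i k"
    then have a: "i < k" "k < en i" "\<forall>c. i < c \<and> c < k \<longrightarrow> en c \<le> k" unfolding parent_iff[OF i] by blast+
    then show "par w i k" unfolding par_def anc_def by fastforce
  next
    assume a: "par w i k"
    have k: "i < k" "k < en i" using a unfolding par_def anc_def by blast+
    have "en c \<le> k" if cc: "i < c" "c < k" for c
    proof -
      have "c \<le> n + 1" "c < en i" using k cc en_le[OF i] by auto
      then show ?thesis using a cc unfolding par_def anc_def by (auto simp: not_less)
    qed
    then show "pr i k" unfolding parent_iff[OF i] using k by blast
  qed
  have s: "(\<exists>c\<le>n + 1. i < c \<and> c < j) \<longleftrightarrow> Suc i < j" using j by (auto intro!: exI[of _ "Suc i"])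
  have ei: "i < en i" using en_not[OF i] by blast
  have e: "j = en i \<and> i \<le> n \<and> j \<le> n + 1 \<longleftrightarrow> i < j \<and> \<not> anc w i j \<and> \<not> (\<exists>c\<le>n + 1. (i < c \<and> c < j) \<and> \<not> anc w i c)"
  proof
    assume "j = en i \<and> i \<le> n \<and> j \<le> n + 1"
    then show "i < j \<and> \<not> anc w i j \<and> \<not> (\<exists>c\<le>n + 1. (i < c \<and> c < j) \<and> \<not> anc w i c)"
      unfolding anc_def using ei by simp
  next
    assume a: "i < j \<and> \<not> anc w i j \<and> \<not> (\<exists>c\<le>n + 1. (i < c \<and> c < j) \<and> \<not> anc w i c)"
    have "i < j" by (rule conjunct1[OF a])
    moreover have "\<not> anc w i j" by (rule conjunct1[OF conjunct2[OF a]])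
    ultimately have le: "en i \<le> j" unfolding anc_def by simp
    have "\<not> en i < j"
    proof
      assume l: "en i < j"
      then have "en i \<le> n + 1" using j by simp
      then have "anc w i (en i)" using a ei l by blast
      then show False unfolding anc_def by simp
    qed
    then show "j = en i \<and> i \<le> n \<and> j \<le> n + 1" using le a j by simp
  qed
  have x: "(\<exists>c. pr i c \<and> E i c) \<longleftrightarrow> (\<exists>c\<le>n + 1. par w i c \<and> E i c)" unfolding pp[symmetric] using parent_less[of M w i] by blast
  have e': "(j = en i \<and> i \<le> n \<and> j \<le> n + 1 \<and> Z) =
      (i < j \<and> \<not> anc w i j \<and> \<not> (\<exists>c\<le>n + 1. (i < c \<and> c < j) \<and> \<not> anc w i c) \<and> Z)" for Z
    using arg_cong[OF e, of "\<lambda>A. A \<and> Z"] unfolding conj_assoc .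
  show ?thesis unfolding chi_iff_link link_iff s unfolding x unfolding pp unfolding e' by (rule conj_commute)
qed

text \<open>Two rounds suffice: one for the quantified position \<open>c\<close> and one for the
  quantifier inside \<open>par\<close>. This is the value of \<open>depth\<close> on
  \<open>FChi\<close>.\<close>

lemma inv_chi:
  assumes xy: "x \<in> X" "y \<in> X" shows "inv (Suc (Suc k)) X (\<lambda>w v. chi M w (v x) (v y))"
proof (rule inv_cong)
  let ?z = "Suc (x + y)"
  have z: "?z \<noteq> x" "?z \<noteq> y" by simp_all
  have m: "x \<in> insert ?z X" "y \<in> insert ?z X" "?z \<in> insert ?z X" using xy by simp_all
  have 1: "inv (Suc (Suc k)) X (\<lambda>w v. \<exists>c\<le>length w + 1. v x < c \<and> c < v y)"
    by (rule inv_exF[where z = ?z]) (intro inv_and inv_less m, use z in simp)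
  have 2: "inv (Suc (Suc k)) X (\<lambda>w v. \<exists>c\<le>length w + 1. (v x < c \<and> c < v y) \<and> \<not> anc w (v x) c)"
    by (rule inv_exF[where z = ?z]) (intro inv_and inv_not inv_less inv_anc m, use z in simp)
  have 3: "inv (Suc (Suc k)) X (\<lambda>w v. \<exists>c\<le>length w + 1. par w (v x) c \<and> prel M w Equals (v x) c)"
    unfolding prel_def
    by (rule inv_exF[where z = ?z]) (intro inv_and inv_par inv_symb[where Z = "\<lambda>a b. M a b = Some Equals"] m, use z in simp)
  show "inv (Suc (Suc k)) X (\<lambda>w v. (\<exists>c\<le>length w + 1. v x < c \<and> c < v y) \<and>
    (par w (v x) (v y) \<or> v x < v y \<and> \<not> anc w (v x) (v y) \<and> \<not> (\<exists>c\<le>length w + 1. (v x < c \<and> c < v y) \<and> \<not> anc w (v x) c) \<and>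
       \<not> (\<exists>c\<le>length w + 1. par w (v x) c \<and> prel M w Equals (v x) c)))"
    by (intro inv_and[OF 1] inv_or[OF inv_par[OF xy]] inv_and[OF inv_less[OF xy]] inv_and[OF inv_not[OF inv_anc[OF xy]]]
        inv_and[OF inv_not[OF 2] inv_not[OF 3]])
qed (use xy in \<open>simp add: chi_iff\<close>)

primrec depth :: "'ap fo \<Rightarrow> nat" where
  "depth (FEq x y) = 0"
| "depth (FLess x y) = 0"
| "depth (FChi x y) = 2"
| "depth (FProp a x) = 0"
| "depth (FNeg \<psi>) = depth \<psi>"
| "depth (FOr \<psi> \<theta>) = max (depth \<psi>) (depth \<theta>)"
| "depth (FEx x \<psi>) = Suc (depth \<psi>)"

lemma fo_inv: "fo_fv \<psi> \<subseteq> X \<Longrightarrow> inv (depth \<psi>) X (\<lambda>w v. fo_sat M w \<psi> v)"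
proof (induction \<psi> arbitrary: X)
  case (FEq x y)
  then have h: "inv 0 X (\<lambda>w v. \<not> v x < v y \<and> \<not> v y < v x)" by (intro inv_and inv_not inv_less) simp_all
  have "inv 0 X (\<lambda>w v. v x = v y)" by (rule inv_cong[OF h]) auto
  then show ?case by simp
next
  case (FLess x y)
  then show ?case using inv_less[of x X y] by simp
next
  case (FChi x y)
  then show ?case using inv_chi[of x X y 0] by (simp add: numeral_2_eq_2)
next
  case (FProp a x)
  then show ?case using inv_symb[of x X x 0 "\<lambda>s t. \<exists>b. s = Letter b \<and> a \<in> b"] by (simp add: prop_at_def)
next
  case (FNeg \<psi>)
  then show ?case using inv_not[OF FNeg.IH[of X]] by simp
next
  case (FOr \<psi> \<theta>)
  have p: "fo_fv \<psi> \<subseteq> X" "fo_fv \<theta> \<subseteq> X" using FOr.prems by simp_all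
  have "inv (max (depth \<psi>) (depth \<theta>)) X (\<lambda>w v. fo_sat M w \<psi> v \<or> fo_sat M w \<theta> v)"
    by (rule inv_or[OF inv_mono[OF FOr.IH(1)[OF p(1)] max.cobounded1] inv_mono[OF FOr.IH(2)[OF p(2)] max.cobounded2]])
  then show ?case by simp
next
  case (FEx x \<psi>)
  then have "inv (depth \<psi>) (insert x X) (\<lambda>w v. fo_sat M w \<psi> v)" by (intro FEx.IH) auto
  from inv_ex[OF this] show ?case by (simp add: positions_def Bex_def)
qed

text \<open>The only variable is carried by pebble \<open>K\<close> and the pebbles below
  \<open>K\<close> serve the \<open>K\<close> rounds, hence \<open>Suc K\<close> pebbles in
  all.\<close>

lemma sim_single:
  assumes "compatible M w" "compatible M w'" "v x \<le> length w + 1" "v' x \<le> length w' + 1"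
    and "cls (Suc K) K (wforest M w ((\<lambda>_. {})(v x := {K})) 0 (length w + 2)) =
      cls (Suc K) K (wforest M w' ((\<lambda>_. {})(v' x := {K})) 0 (length w' + 2))"
  shows "sim M (Suc K) K {x} (\<lambda>_. K) w ((\<lambda>_. {})(v x := {K})) v w' ((\<lambda>_. {})(v' x := {K})) v'"
  using assms unfolding sim_def placed_def eqv_def by simp

lemma fo_marked_tree:
  assumes fv: "fo_fv \<psi> = {x}"
  shows "\<exists>K S. \<forall>w i v. compatible M w \<longrightarrow> i \<le> length w + 1 \<longrightarrow>
    fo_sat M w \<psi> (v(x := i)) = (cls (Suc K) K (wforest M w ((\<lambda>_. {})(i := {K})) 0 (length w + 2)) \<in> S)"
proof -
  let ?K = "depth \<psi>"
  let ?c = "\<lambda>w i. cls (Suc ?K) ?K (wforest M w ((\<lambda>_. {})(i := {?K})) 0 (length w + 2))"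
  \<comment> \<open>The classes of the marked words that satisfy the formula; the values of all
    variables other than \<open>x\<close> are irrelevant and set to 0.\<close>
  let ?S = "{?c w i | w i. compatible M w \<and> i \<le> length w + 1 \<and> fo_sat M w \<psi> ((\<lambda>_. 0)(x := i))}"
  have e: "fo_sat M w \<psi> (v(x := i)) = fo_sat M w' \<psi> (v'(x := i'))"
    if "compatible M w" "compatible M w'" "i \<le> length w + 1" "i' \<le> length w' + 1" "?c w i = ?c w' i'" for w i v w' i' v'
    by (rule invD[OF fo_inv[of \<psi> "{x}"] order_refl sim_single[of w w' "v(x := i)" x "v'(x := i')" ?K]])
      (use that fv in simp_all)
  show ?thesis
  proof (intro exI[of _ ?K] exI[of _ ?S] allI impI)
    fix w i and v :: "nat \<Rightarrow> nat" assume wi: "compatible M w" "i \<le> length w + 1"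
    show "fo_sat M w \<psi> (v(x := i)) \<longleftrightarrow> ?c w i \<in> ?S"
    proof
      assume "fo_sat M w \<psi> (v(x := i))"
      then have "fo_sat M w \<psi> ((\<lambda>_. 0)(x := i))" using e[OF wi(1) wi(1) wi(2) wi(2) HOL.refl, of v "\<lambda>_. 0"] by simp
      then show "?c w i \<in> ?S" using wi by blast
    next
      assume "?c w i \<in> ?S"
      then obtain w' i' where a: "?c w i = ?c w' i'" "compatible M w'" "i' \<le> length w' + 1" "fo_sat M w' \<psi> ((\<lambda>_. 0)(x := i'))"
        unfolding mem_Collect_eq by (elim exE conjE)
      show "fo_sat M w \<psi> (v(x := i))" using e[OF wi(1) a(2) wi(2) a(3) a(1), of v "\<lambda>_. 0"] a(4) by simp
    qed
  qed
qed

end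

lemma fo_potl_definable:
  fixes M :: "('ap::finite) opm"
  assumes opm: "is_opm SL M" and fv: "fo_fv \<psi> = {x}"
  shows "\<exists>\<phi>. potl_wf \<phi> \<and> (\<forall>w i v. compatible M w \<longrightarrow> i \<le> length w + 1 \<longrightarrow> fo_sat M w \<psi> (v(x := i)) = potl_sat M w \<phi> i)"
proof -
  obtain K S where S: "\<forall>w i v. compatible M w \<longrightarrow> i \<le> length w + 1 \<longrightarrow>
    fo_sat M w \<psi> (v(x := i)) = (cls (Suc K) K (wforest M w ((\<lambda>_. {})(i := {K})) 0 (length w + 2)) \<in> S)"
    using fo_marked_tree[OF opm fv] by (elim exE)
  note tree_logic.marked_tree_definable[OF PD_tree_logic[OF opm], of "\<lambda>\<tau>. \<tau> \<in> S" "Suc K" K K]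
  then obtain \<phi> where p: "potl_wf \<phi>" "\<And>w i. compatible M w \<Longrightarrow> i \<le> length w + 1 \<Longrightarrow> potl_sat M w \<phi> i =
      (cls (Suc K) K (wforest M w ((\<lambda>_. {})(i := {K})) 0 (length w + 2)) \<in> S)"
    by (rule PD_E) (simp only: fst_conv snd_conv)
  show ?thesis
  proof (intro exI[of _ \<phi>] conjI allI impI p(1))
    fix w i v assume a: "compatible M w" "i \<le> length w + 1"
    show "fo_sat M w \<psi> (v(x := i)) = potl_sat M w \<phi> i"
      by (rule trans[OF S[THEN spec, THEN spec, THEN spec, THEN mp, THEN mp, OF a] p(2)[OF a, symmetric]])
  qed
qed

theorem theorem2:
  fixes M :: "('ap::finite) opm" and SL :: "'ap set"
  assumes "is_opm SL M"
  shows "(\<forall>\<phi> :: 'ap potl. potl_wf \<phi> \<longrightarrow>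
            (\<exists>(\<nu> :: 'ap fo) x. fo_fv \<nu> = {x} \<and>
               (\<forall>w i v. op_word M w \<longrightarrow> i \<in> positions w \<longrightarrow>
                  (potl_sat M w \<phi> i \<longleftrightarrow> fo_sat M w \<nu> (v(x := i)))))) \<and>
         (\<forall>(\<psi> :: 'ap fo) x. fo_fv \<psi> = {x} \<longrightarrow>
            (\<exists>\<phi> :: 'ap potl. potl_wf \<phi> \<and>
               (\<forall>w i v. op_word M w \<longrightarrow> i \<in> positions w \<longrightarrow>
                  (fo_sat M w \<psi> (v(x := i)) \<longleftrightarrow> potl_sat M w \<phi> i))))"
proof (intro conjI allI impI)
  fix \<phi> :: "'ap potl"
  obtain \<nu> where n: "fo_fv \<nu> = {0}"
    "\<forall>w i v. compatible M w \<longrightarrow> i \<le> length w + 1 \<longrightarrow> potl_sat M w \<phi> i = fo_sat M w \<nu> (v(0 := i))"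
    using potl_fo_definable[OF assms, of 0 \<phi>] by (elim exE conjE)
  show "\<exists>(\<nu> :: 'ap fo) x. fo_fv \<nu> = {x} \<and> (\<forall>w i v. op_word M w \<longrightarrow> i \<in> positions w \<longrightarrow>
      (potl_sat M w \<phi> i \<longleftrightarrow> fo_sat M w \<nu> (v(x := i))))"
  proof (intro exI[of _ \<nu>] exI[of _ 0] conjI allI impI n(1))
    fix w i v assume a: "compatible M w" "i \<in> positions w"
    have "i \<le> length w + 1" using a(2) by (simp add: positions_def)
    then show "potl_sat M w \<phi> i = fo_sat M w \<nu> (v(0 := i))"
      by (rule n(2)[THEN spec, THEN spec, THEN spec, THEN mp, THEN mp, OF a(1)])
  qed
next
  fix \<psi> :: "'ap fo" and x assume fv: "fo_fv \<psi> = {x}"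
  obtain \<phi> where p: "potl_wf \<phi>"
    "\<forall>w i v. compatible M w \<longrightarrow> i \<le> length w + 1 \<longrightarrow> fo_sat M w \<psi> (v(x := i)) = potl_sat M w \<phi> i"
    using fo_potl_definable[OF assms fv] by (elim exE conjE)
  show "\<exists>\<phi> :: 'ap potl. potl_wf \<phi> \<and> (\<forall>w i v. op_word M w \<longrightarrow> i \<in> positions w \<longrightarrow>
      (fo_sat M w \<psi> (v(x := i)) \<longleftrightarrow> potl_sat M w \<phi> i))"
  proof (intro exI[of _ \<phi>] conjI allI impI p(1))
    fix w i v assume a: "compatible M w" "i \<in> positions w"
    have "i \<le> length w + 1" using a(2) by (simp add: positions_def)
    then show "fo_sat M w \<psi> (v(x := i)) = potl_sat M w \<phi> i"
      by (rule p(2)[THEN spec, THEN spec, THEN spec, THEN mp, THEN mp, OF a(1)])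
  qed
qed

end
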